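(* Let $k$ be a field of characteristic zero. Let $V$ be an affine normal toric $k$-variety, let $v$ be a toric divisorial valuation on $V$, and let $\mathcal{N}_v\subset \mathscr{L}_\infty(V)$ be the associated Nash set. Let $\eta_v$ be the generic point of $\mathcal{N}_v$ and let $\kappa_v$ be the residue field of $\eta_v$. Then for a general $k$-rational arc $\alpha\in\mathcal{N}_v$ (that is, for every $k$-rational point $\alpha$ of some nonempty open subset of $\mathcal{N}_v$) there exists an isomorphism of formal $\kappa_v$-schemes $$\widehat{\mathscr{L}_\infty(V)_{\eta_v}}\ \widehat{\otimes}_{\kappa_v}\ \kappa_v[[(T_i)_{i\in\mathbb{N}}]]\;\cong\;\widehat{\mathscr{L}_\infty(V)_{\alpha}}\ \widehat{\otimes}_k\ \kappa_v .$$
   Context: **Arc scheme.** For an affine $k$-variety $V$ (a $k$-scheme of finite type), $\mathscr{L}_\infty(V)$ is the affine $k$-scheme characterized by functorial bijections $\mathrm{Hom}_k(\mathrm{Spec}\,R,\mathscr{L}_\infty(V))\cong \mathrm{Hom}_k(\mathrm{Spec}\,R[[t]],V)$ for all $k$-algebras $R$. Its points are called arcs. An arc $\alpha$ with residue field $\kappa(\alpha)$ gives a $k$-algebra morphism $\alpha^*:\mathcal{O}(V)\to\kappa(\alpha)[[t]]$, and $\mathrm{ord}_\alpha:=\mathrm{ord}_t\circ\alpha^*:\mathcal{O}(V)\to\mathbb{N}\cup\{+\infty\}$. **Nash set.** For a divisorial valuation $v$ on $V$, the Nash set $\mathcal{N}_v$ is the closure in $\mathscr{L}_\infty(V)$ of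 $\{\alpha : \mathrm{ord}_\alpha=v\}$; it is irreducible. **Toric valuations.** An affine normal toric variety is of the form $V_\sigma=\mathrm{Spec}\,k[\sigma^\vee\cap M]$, with $N$ the cocharacter lattice of a split torus, $M=\mathrm{Hom}_{\mathbb{Z}}(N,\mathbb{Z})$ and $\sigma$ a strongly convex rational polyhedral cone of $N_{\mathbb{R}}$. The toric divisorial valuations are the $\mathrm{ord}_n$, $n\in\sigma\cap N$, where $\mathrm{ord}_n(f)$ is the minimum of $\langle m,n\rangle$ over the characters $\chi^m$ occurring in $f$ with nonzero coefficient. **Formal neighborhoods.** For a point $x$ of a scheme $X$, the formal neighborhood $\widehat{X_x}$ is the formal spectrum of the completion $\varprojlim_n \mathcal{O}_{X,x}/\mathfrak{m}_x^n$ of the local ring. $\widehat\otimes$ is the completed tensor product (a formal scheme $\mathrm{Spf}(R)$ and its ring of sections $R$ are notationally identified), and $\kappa[[(T_i)_{i\in\mathbb{N}}]]$ is the completion of $\kappa[(T_i)_{i\in\mathbb{N}}]$ along the ideal $\langle T_i;i\in\mathbb{N}\rangle$. The formal neighborhood of $\eta_v$ is regarded as a formal $\kappa_v$-scheme via a suitable coefficient field (containing $k$) of the completed local ring. *)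

theory Defs
  imports "HOL-Algebra.QuotRing" "HOL-Algebra.Ideal_Product" "HOL-Library.Poly_Mapping" "HOL-Analysis.Analysis"
begin

section \<open>Monoid algebras\<close>

text \<open>
  \<open>R[S]\<close> for a submonoid \<open>S\<close> of a commutative monoid written additively: finitely supported
  functions \<open>f\<close>, standing for the sum of the \<open>f m \<cdot> \<chi>\<^sup>m\<close>, with the convolution product.  Taking
  multisets of variables as monomials gives polynomial rings.
\<close>

definition monoid_algebra ::
    "('a, 'e) ring_scheme \<Rightarrow> 'm::comm_monoid_add set \<Rightarrow> ('m \<Rightarrow> 'a) ring" where
  "monoid_algebra R S =
    \<lparr> carrier = {f. (\<forall>m. f m \<in> carrier R) \<and> finite {m. f m \<noteq> \<zero>\<^bsub>R\<^esub>} \<and> {m. f m \<noteq> \<zero>\<^bsub>R\<^esub>} \<subseteq> S},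
      monoid.mult = (\<lambda>f g m. \<Oplus>\<^bsub>R\<^esub>p \<in> {(a, b). f a \<noteq> \<zero>\<^bsub>R\<^esub> \<and> g b \<noteq> \<zero>\<^bsub>R\<^esub> \<and> a + b = m}.
                       f (fst p) \<otimes>\<^bsub>R\<^esub> g (snd p)),
      monoid.one = (\<lambda>m. if m = 0 then \<one>\<^bsub>R\<^esub> else \<zero>\<^bsub>R\<^esub>),
      ring.zero = (\<lambda>m. \<zero>\<^bsub>R\<^esub>),
      ring.add = (\<lambda>f g m. f m \<oplus>\<^bsub>R\<^esub> g m) \<rparr>"

definition monoid_algebra_monom :: "('a, 'e) ring_scheme \<Rightarrow> 'a \<Rightarrow> 'm \<Rightarrow> ('m \<Rightarrow> 'a)" where
  "monoid_algebra_monom R c m = (\<lambda>m'. if m' = m then c else \<zero>\<^bsub>R\<^esub>)"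

definition monoid_algebra_const :: "('a, 'e) ring_scheme \<Rightarrow> 'a \<Rightarrow> ('m::zero \<Rightarrow> 'a)" where
  "monoid_algebra_const R c = monoid_algebra_monom R c 0"

definition mpoly_ring :: "('a, 'e) ring_scheme \<Rightarrow> 'x set \<Rightarrow> ('x multiset \<Rightarrow> 'a) ring" where
  "mpoly_ring R V = monoid_algebra R {m. set_mset m \<subseteq> V}"

definition poly_var :: "('a, 'e) ring_scheme \<Rightarrow> 'x \<Rightarrow> ('x multiset \<Rightarrow> 'a)" where
  "poly_var R x = monoid_algebra_monom R \<one>\<^bsub>R\<^esub> {#x#}"

lemma (in cring) monoid_algebra_mult_superset:
  fixes f g :: "'m::comm_monoid_add \<Rightarrow> 'a"
  assumes f: "\<And>m. f m \<in> carrier R" and g: "\<And>m. g m \<in> carrier R"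
    and A: "finite A" "{m. f m \<noteq> \<zero>} \<subseteq> A" and B: "finite B" "{m. g m \<noteq> \<zero>} \<subseteq> B"
  shows "(f \<otimes>\<^bsub>monoid_algebra R S\<^esub> g) m =
    (\<Oplus>p\<in>A \<times> B. if fst p + snd p = m then f (fst p) \<otimes> g (snd p) else \<zero>)"
  unfolding monoid_algebra_def
  apply simp
  apply (rule add.finprod_mono_neutral_cong_left)
  using assms by (auto)

lemma (in cring) monoid_algebra_mult_closed:
  fixes f g :: "'m::comm_monoid_add \<Rightarrow> 'a"
  assumes S: "\<And>a b. a \<in> S \<Longrightarrow> b \<in> S \<Longrightarrow> a + b \<in> S"
    and f: "f \<in> carrier (monoid_algebra R S)" and g: "g \<in> carrier (monoid_algebra R S)"
  shows "f \<otimes>\<^bsub>monoid_algebra R S\<^esub> g \<in> carrier (monoid_algebra R S)"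
proof -
  let ?A = "{m. f m \<noteq> \<zero>}" and ?B = "{m. g m \<noteq> \<zero>}"
  have fc: "\<And>m. f m \<in> carrier R" "finite ?A" "?A \<subseteq> S"
    and gc: "\<And>m. g m \<in> carrier R" "finite ?B" "?B \<subseteq> S"
    using f g by (auto simp: monoid_algebra_def)
  have eq: "(f \<otimes>\<^bsub>monoid_algebra R S\<^esub> g) m =
    (\<Oplus>p\<in>?A \<times> ?B. if fst p + snd p = m then f (fst p) \<otimes> g (snd p) else \<zero>)" for m
    by (rule monoid_algebra_mult_superset) (use fc gc in auto)
  have sub: "{m. (f \<otimes>\<^bsub>monoid_algebra R S\<^esub> g) m \<noteq> \<zero>} \<subseteq> (\<lambda>p. fst p + snd p) ` (?A \<times> ?B)"
  proof
    fix m assume "m \<in> {m. (f \<otimes>\<^bsub>monoid_algebra R S\<^esub> g) m \<noteq> \<zero>}"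
    moreover have "(f \<otimes>\<^bsub>monoid_algebra R S\<^esub> g) m = \<zero>" if "m \<notin> (\<lambda>p. fst p + snd p) ` (?A \<times> ?B)"
      unfolding eq by (rule add.finprod_one_eqI) (use that in force)
    ultimately show "m \<in> (\<lambda>p. fst p + snd p) ` (?A \<times> ?B)" by blast
  qed
  have "(\<lambda>p. fst p + snd p) ` (?A \<times> ?B) \<subseteq> S"
    using fc(3) gc(3) by (intro image_subsetI) (simp add: S mem_Times_iff subset_iff)
  moreover have "(f \<otimes>\<^bsub>monoid_algebra R S\<^esub> g) m \<in> carrier R" for m
    unfolding eq by (rule finsum_closed) (use fc gc in auto)
  moreover have "finite {m. (f \<otimes>\<^bsub>monoid_algebra R S\<^esub> g) m \<noteq> \<zero>}"
    by (rule finite_subset[OF sub]) (use fc gc in auto)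
  ultimately show ?thesis
    using sub by (subst (2) monoid_algebra_def) auto
qed

lemma (in cring) monoid_algebra_monom_mult:
  fixes a b :: "'m::comm_monoid_add"
  assumes "c \<in> carrier R" "d \<in> carrier R"
  shows "monoid_algebra_monom R c a \<otimes>\<^bsub>monoid_algebra R S\<^esub> monoid_algebra_monom R d b =
    monoid_algebra_monom R (c \<otimes> d) (a + b)"
proof
  fix m
  show "(monoid_algebra_monom R c a \<otimes>\<^bsub>monoid_algebra R S\<^esub> monoid_algebra_monom R d b) m =
    monoid_algebra_monom R (c \<otimes> d) (a + b) m"
    using assms
    by (subst monoid_algebra_mult_superset[where A = "{a}" and B = "{b}"])
       (auto simp: monoid_algebra_monom_def finsum_insert)
qed

lemma (in cring) monoid_algebra_induct [consumes 1, case_names zero add]: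
  fixes f :: "'m::comm_monoid_add \<Rightarrow> 'a"
  assumes f: "f \<in> carrier (monoid_algebra R S)"
    and zero: "Q \<zero>\<^bsub>monoid_algebra R S\<^esub>"
    and add: "\<And>c m g. c \<in> carrier R \<Longrightarrow> m \<in> S \<Longrightarrow> g \<in> carrier (monoid_algebra R S) \<Longrightarrow> Q g \<Longrightarrow>
      Q (monoid_algebra_monom R c m \<oplus>\<^bsub>monoid_algebra R S\<^esub> g)"
  shows "Q f"
  using f
proof (induction "card {m. f m \<noteq> \<zero>}" arbitrary: f)
  case 0
  then have "f = \<zero>\<^bsub>monoid_algebra R S\<^esub>" by (auto simp: monoid_algebra_def)
  then show ?case using zero by simp
next
  case (Suc n)
  then obtain m where m: "f m \<noteq> \<zero>" by fastforce
  define g where "g = f(m := \<zero>)"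
  have fc: "\<And>m. f m \<in> carrier R" "finite {m. f m \<noteq> \<zero>}" "{m. f m \<noteq> \<zero>} \<subseteq> S"
    using Suc.prems by (auto simp: monoid_algebra_def)
  have *: "{m. g m \<noteq> \<zero>} = {m. f m \<noteq> \<zero>} - {m}" by (auto simp: g_def)
  have gc: "g \<in> carrier (monoid_algebra R S)"
    using fc by (auto simp: monoid_algebra_def * ) (auto simp: g_def)
  have "n = card {m. g m \<noteq> \<zero>}" using Suc.hyps(2) m fc(2) unfolding * by simp
  then have "Q g" using Suc.hyps(1) gc by blast
  moreover have "f = monoid_algebra_monom R (f m) m \<oplus>\<^bsub>monoid_algebra R S\<^esub> g"
    using fc by (auto simp: monoid_algebra_def g_def monoid_algebra_monom_def)
  ultimately show ?case using add[of "f m" m g] fc m gc by auto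
qed

lemma (in cring) monoid_algebra_monom_closed:
  "c \<in> carrier R \<Longrightarrow> m \<in> S \<Longrightarrow> monoid_algebra_monom R c m \<in> carrier (monoid_algebra R S)"
  by (auto simp: monoid_algebra_def monoid_algebra_monom_def)

lemma (in cring) monoid_algebra_add_group:
  "abelian_group (monoid_algebra R S)"
proof (rule abelian_groupI)
  fix x y z
  assume xyz: "x \<in> carrier (monoid_algebra R S)" 
  have x: "\<And>m. x m \<in> carrier R" "finite {m. x m \<noteq> \<zero>}" "{m. x m \<noteq> \<zero>} \<subseteq> S"
    using xyz by (auto simp: monoid_algebra_def)
  show "\<exists>y\<in>carrier (monoid_algebra R S). y \<oplus>\<^bsub>monoid_algebra R S\<^esub> x = \<zero>\<^bsub>monoid_algebra R S\<^esub>"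
    by (rule bexI[of _ "\<lambda>m. \<ominus> x m"]) (use x in \<open>auto simp: monoid_algebra_def l_neg a_inv_def[symmetric] elim!: rev_finite_subset\<close>)
  assume "y \<in> carrier (monoid_algebra R S)" 
  then have y: "\<And>m. y m \<in> carrier R" "finite {m. y m \<noteq> \<zero>}" "{m. y m \<noteq> \<zero>} \<subseteq> S"
    by (auto simp: monoid_algebra_def)
  have sub: "{m. x m \<oplus> y m \<noteq> \<zero>} \<subseteq> {m. x m \<noteq> \<zero>} \<union> {m. y m \<noteq> \<zero>}" by auto
  have "finite {m. x m \<oplus> y m \<noteq> \<zero>}" by (rule finite_subset[OF sub]) (use x y in auto)
  then show "x \<oplus>\<^bsub>monoid_algebra R S\<^esub> y \<in> carrier (monoid_algebra R S)"
    using x y sub by (auto simp: monoid_algebra_def)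
  show "x \<oplus>\<^bsub>monoid_algebra R S\<^esub> y = y \<oplus>\<^bsub>monoid_algebra R S\<^esub> x"
    using x y by (auto simp: monoid_algebra_def a_comm)
  assume "z \<in> carrier (monoid_algebra R S)"
  then show "x \<oplus>\<^bsub>monoid_algebra R S\<^esub> y \<oplus>\<^bsub>monoid_algebra R S\<^esub> z = x \<oplus>\<^bsub>monoid_algebra R S\<^esub> (y \<oplus>\<^bsub>monoid_algebra R S\<^esub> z)"
    using x y by (auto simp: monoid_algebra_def a_assoc)
qed (auto simp: monoid_algebra_def)

lemma (in cring) monoid_algebra_mult_comm:
  fixes f g :: "'m::comm_monoid_add \<Rightarrow> 'a"
  assumes f: "f \<in> carrier (monoid_algebra R S)" and g: "g \<in> carrier (monoid_algebra R S)"
  shows "f \<otimes>\<^bsub>monoid_algebra R S\<^esub> g = g \<otimes>\<^bsub>monoid_algebra R S\<^esub> f"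
proof
  fix m
  let ?A = "{m. f m \<noteq> \<zero>}" and ?B = "{m. g m \<noteq> \<zero>}"
  have fc: "\<And>m. f m \<in> carrier R" "finite ?A" "?A \<subseteq> S"
    and gc: "\<And>m. g m \<in> carrier R" "finite ?B" "?B \<subseteq> S"
    using f g by (auto simp: monoid_algebra_def)
  have "(f \<otimes>\<^bsub>monoid_algebra R S\<^esub> g) m =
    (\<Oplus>p\<in>?A \<times> ?B. if fst p + snd p = m then f (fst p) \<otimes> g (snd p) else \<zero>)"
    by (rule monoid_algebra_mult_superset) (use fc gc in auto)
  also have "\<dots> = (\<Oplus>p\<in>prod.swap ` (?B \<times> ?A). if fst p + snd p = m then f (fst p) \<otimes> g (snd p) else \<zero>)"
    by (simp add: product_swap)
  also have "\<dots> = (\<Oplus>p\<in>?B \<times> ?A. if fst p + snd p = m then g (fst p) \<otimes> f (snd p) else \<zero>)"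
    by (subst finsum_reindex) (use fc gc in \<open>auto simp: m_comm add.commute intro!: finsum_cong'\<close>)
  also have "\<dots> = (g \<otimes>\<^bsub>monoid_algebra R S\<^esub> f) m"
    by (rule monoid_algebra_mult_superset[symmetric]) (use fc gc in auto)
  finally show "(f \<otimes>\<^bsub>monoid_algebra R S\<^esub> g) m = (g \<otimes>\<^bsub>monoid_algebra R S\<^esub> f) m" .
qed

lemma (in cring) monoid_algebra_l_distr:
  fixes f g h :: "'m::comm_monoid_add \<Rightarrow> 'a"
  assumes f: "f \<in> carrier (monoid_algebra R S)" and g: "g \<in> carrier (monoid_algebra R S)"
    and h: "h \<in> carrier (monoid_algebra R S)"
  shows "(f \<oplus>\<^bsub>monoid_algebra R S\<^esub> g) \<otimes>\<^bsub>monoid_algebra R S\<^esub> h =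
    f \<otimes>\<^bsub>monoid_algebra R S\<^esub> h \<oplus>\<^bsub>monoid_algebra R S\<^esub> g \<otimes>\<^bsub>monoid_algebra R S\<^esub> h"
proof
  fix m
  let ?A = "{m. f m \<noteq> \<zero>} \<union> {m. g m \<noteq> \<zero>}" and ?B = "{m. h m \<noteq> \<zero>}"
  have c: "\<And>m. f m \<in> carrier R" "\<And>m. g m \<in> carrier R" "\<And>m. h m \<in> carrier R"
    "finite ?A" "finite ?B"
    using f g h by (auto simp: monoid_algebra_def)
  have addm: "(u \<oplus>\<^bsub>monoid_algebra R S\<^esub> v) m = u m \<oplus> v m" for u v :: "'m \<Rightarrow> 'a" and m
    by (simp add: monoid_algebra_def)
  have "((f \<oplus>\<^bsub>monoid_algebra R S\<^esub> g) \<otimes>\<^bsub>monoid_algebra R S\<^esub> h) m =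
    (\<Oplus>p\<in>?A \<times> ?B. if fst p + snd p = m then (f (fst p) \<oplus> g (fst p)) \<otimes> h (snd p) else \<zero>)"
    by (subst monoid_algebra_mult_superset[where A = ?A and B = ?B]) (use c in \<open>auto simp: addm cong: if_cong\<close>)
  also have "\<dots> = (\<Oplus>p\<in>?A \<times> ?B. (if fst p + snd p = m then f (fst p) \<otimes> h (snd p) else \<zero>) \<oplus>
      (if fst p + snd p = m then g (fst p) \<otimes> h (snd p) else \<zero>))"
    by (rule finsum_cong') (use c in \<open>auto simp: l_distr\<close>)
  also have "\<dots> = (\<Oplus>p\<in>?A \<times> ?B. if fst p + snd p = m then f (fst p) \<otimes> h (snd p) else \<zero>) \<oplus>
      (\<Oplus>p\<in>?A \<times> ?B. if fst p + snd p = m then g (fst p) \<otimes> h (snd p) else \<zero>)"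
    by (rule finsum_addf) (use c in auto)
  also have "\<dots> = (f \<otimes>\<^bsub>monoid_algebra R S\<^esub> h) m \<oplus> (g \<otimes>\<^bsub>monoid_algebra R S\<^esub> h) m"
    by (subst (1 2) monoid_algebra_mult_superset[where A = ?A and B = ?B]) (use c in auto)
  finally show "((f \<oplus>\<^bsub>monoid_algebra R S\<^esub> g) \<otimes>\<^bsub>monoid_algebra R S\<^esub> h) m =
    (f \<otimes>\<^bsub>monoid_algebra R S\<^esub> h \<oplus>\<^bsub>monoid_algebra R S\<^esub> g \<otimes>\<^bsub>monoid_algebra R S\<^esub> h) m"
    by (simp add: addm)
qed

lemma (in cring) monoid_algebra_cring:
  fixes S :: "'m::comm_monoid_add set"
  assumes S0: "0 \<in> S" and S: "\<And>a b. a \<in> S \<Longrightarrow> b \<in> S \<Longrightarrow> a + b \<in> S"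
  shows "cring (monoid_algebra R S)"
proof -
  let ?P = "monoid_algebra R S"
  interpret P: abelian_group ?P by (rule monoid_algebra_add_group)
  have cl: "f \<otimes>\<^bsub>?P\<^esub> g \<in> carrier ?P" if "f \<in> carrier ?P" "g \<in> carrier ?P" for f g
    by (rule monoid_algebra_mult_closed) (use S that in auto)
  have comm: "f \<otimes>\<^bsub>?P\<^esub> g = g \<otimes>\<^bsub>?P\<^esub> f" if "f \<in> carrier ?P" "g \<in> carrier ?P" for f g
    by (rule monoid_algebra_mult_comm) (use that in auto)
  note ld = monoid_algebra_l_distr
  have rd: "h \<otimes>\<^bsub>?P\<^esub> (f \<oplus>\<^bsub>?P\<^esub> g) = h \<otimes>\<^bsub>?P\<^esub> f \<oplus>\<^bsub>?P\<^esub> h \<otimes>\<^bsub>?P\<^esub> g"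
    if "f \<in> carrier ?P" "g \<in> carrier ?P" "h \<in> carrier ?P" for f g h
    using that by (metis comm ld P.a_closed)
  have z: "\<zero>\<^bsub>?P\<^esub> \<otimes>\<^bsub>?P\<^esub> f = \<zero>\<^bsub>?P\<^esub>" if "f \<in> carrier ?P" for f
  proof -
    have "\<zero>\<^bsub>?P\<^esub> \<otimes>\<^bsub>?P\<^esub> f \<oplus>\<^bsub>?P\<^esub> \<zero>\<^bsub>?P\<^esub> \<otimes>\<^bsub>?P\<^esub> f = \<zero>\<^bsub>?P\<^esub> \<otimes>\<^bsub>?P\<^esub> f"
      using that by (simp add: ld[symmetric] cl)
    then show ?thesis using that cl by (meson P.add.l_cancel_one P.zero_closed)
  qed
  have z': "f \<otimes>\<^bsub>?P\<^esub> \<zero>\<^bsub>?P\<^esub> = \<zero>\<^bsub>?P\<^esub>" if "f \<in> carrier ?P" for f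
    using that comm z by simp
  note mc = monoid_algebra_monom_closed
  have a1: "monoid_algebra_monom R c a \<otimes>\<^bsub>?P\<^esub> monoid_algebra_monom R d b \<otimes>\<^bsub>?P\<^esub> h =
     monoid_algebra_monom R c a \<otimes>\<^bsub>?P\<^esub> (monoid_algebra_monom R d b \<otimes>\<^bsub>?P\<^esub> h)"
    if "c \<in> carrier R" "a \<in> S" "d \<in> carrier R" "b \<in> S" "h \<in> carrier ?P" for c a d b h
    using that(5)
  proof (induction h rule: monoid_algebra_induct)
    case zero
    then show ?case using that by (simp add: z' cl mc)
  next
    case (add e m g)
    then show ?case using that S
      by (simp add: rd cl mc monoid_algebra_monom_mult m_assoc add.assoc)
  qed
  have a2: "monoid_algebra_monom R c a \<otimes>\<^bsub>?P\<^esub> g \<otimes>\<^bsub>?P\<^esub> h =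
     monoid_algebra_monom R c a \<otimes>\<^bsub>?P\<^esub> (g \<otimes>\<^bsub>?P\<^esub> h)"
    if "c \<in> carrier R" "a \<in> S" "g \<in> carrier ?P" "h \<in> carrier ?P" for c a g h
    using that(3)
  proof (induction g rule: monoid_algebra_induct)
    case zero
    then show ?case using that by (simp add: z z' cl mc)
  next
    case (add e m g)
    then show ?case using that by (simp add: rd ld cl mc a1)
  qed
  have assoc: "f \<otimes>\<^bsub>?P\<^esub> g \<otimes>\<^bsub>?P\<^esub> h = f \<otimes>\<^bsub>?P\<^esub> (g \<otimes>\<^bsub>?P\<^esub> h)"
    if "f \<in> carrier ?P" "g \<in> carrier ?P" "h \<in> carrier ?P" for f g h
    using that(1)
  proof (induction f rule: monoid_algebra_induct)
    case zero
    then show ?case using that by (simp add: z cl)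
  next
    case (add e m f)
    then show ?case using that by (simp add: ld cl mc a2)
  qed
  have one: "\<one>\<^bsub>?P\<^esub> = monoid_algebra_monom R \<one> 0"
    by (auto simp: monoid_algebra_def monoid_algebra_monom_def)
  have l1: "\<one>\<^bsub>?P\<^esub> \<otimes>\<^bsub>?P\<^esub> f = f" if "f \<in> carrier ?P" for f
    using that
  proof (induction f rule: monoid_algebra_induct)
    case zero
    then show ?case using S0 by (simp add: one z' mc)
  next
    case (add e m f)
    then show ?case using S0
      by (simp add: one rd mc monoid_algebra_monom_mult)
  qed
  have oc: "\<one>\<^bsub>?P\<^esub> \<in> carrier ?P" using S0 by (simp add: one mc)
  show ?thesis
  proof (rule cringI[OF P.abelian_group_axioms comm_monoidI])
    show "x \<otimes>\<^bsub>?P\<^esub> y = y \<otimes>\<^bsub>?P\<^esub> x" if "x \<in> carrier ?P" "y \<in> carrier ?P" for x y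
      using that by (rule comm)
  qed (use oc in \<open>auto simp: cl assoc l1 ld\<close>)
qed

lemma (in cring) monoid_algebra_eval:
  fixes S :: "'m::comm_monoid_add set" and h :: "'a \<Rightarrow> 't" and e :: "'m \<Rightarrow> 't"
  assumes S0: "0 \<in> S" and S: "\<And>a b. a \<in> S \<Longrightarrow> b \<in> S \<Longrightarrow> a + b \<in> S"
    and T: "cring T" and h: "h \<in> ring_hom R T"
    and e: "\<And>a. a \<in> S \<Longrightarrow> e a \<in> carrier T" "e 0 = \<one>\<^bsub>T\<^esub>"
      "\<And>a b. a \<in> S \<Longrightarrow> b \<in> S \<Longrightarrow> e (a + b) = e a \<otimes>\<^bsub>T\<^esub> e b"
  obtains E where "E \<in> ring_hom (monoid_algebra R S) T"
    "\<And>c m. c \<in> carrier R \<Longrightarrow> m \<in> S \<Longrightarrow> E (monoid_algebra_monom R c m) = h c \<otimes>\<^bsub>T\<^esub> e m"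
proof -
  let ?P = "monoid_algebra R S"
  interpret P: cring ?P by (rule monoid_algebra_cring) (use S0 S in auto)
  interpret T: cring T by fact
  interpret h: ring_hom_cring R T h by unfold_locales (use h in auto)
  define E where "E f = (\<Oplus>\<^bsub>T\<^esub>m\<in>{m. f m \<noteq> \<zero>}. h (f m) \<otimes>\<^bsub>T\<^esub> e m)" for f
  have sup: "E f = (\<Oplus>\<^bsub>T\<^esub>m\<in>A. h (f m) \<otimes>\<^bsub>T\<^esub> e m)"
    if "f \<in> carrier ?P" "finite A" "{m. f m \<noteq> \<zero>} \<subseteq> A" "A \<subseteq> S" for f A
    unfolding E_def
    apply (rule T.add.finprod_mono_neutral_cong_left)
    using that e(1) by (auto simp: monoid_algebra_def)
  have mc: "monoid_algebra_monom R c m \<in> carrier ?P" if "c \<in> carrier R" "m \<in> S" for c m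
    using that by (rule monoid_algebra_monom_closed)
  have Em: "E (monoid_algebra_monom R c m) = h c \<otimes>\<^bsub>T\<^esub> e m" if "c \<in> carrier R" "m \<in> S" for c m
    using that e(1) by (subst sup[of _ "{m}"]) (auto simp: mc, auto simp: monoid_algebra_monom_def T.finsum_insert split: if_splits)
  have Ec: "E f \<in> carrier T" if "f \<in> carrier ?P" for f
    unfolding E_def by (rule T.finsum_closed) (use that e(1) in \<open>auto simp: monoid_algebra_def\<close>)
  have Ea: "E (f \<oplus>\<^bsub>?P\<^esub> g) = E f \<oplus>\<^bsub>T\<^esub> E g" if f: "f \<in> carrier ?P" and g: "g \<in> carrier ?P" for f g
  proof -
    let ?A = "{m. f m \<noteq> \<zero>} \<union> {m. g m \<noteq> \<zero>}"
    have c: "\<And>m. f m \<in> carrier R" "\<And>m. g m \<in> carrier R" "finite ?A" "?A \<subseteq> S"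
      using f g by (auto simp: monoid_algebra_def)
    have "{m. (f \<oplus>\<^bsub>?P\<^esub> g) m \<noteq> \<zero>} \<subseteq> ?A" by (auto simp: monoid_algebra_def)
    then have "E (f \<oplus>\<^bsub>?P\<^esub> g) = (\<Oplus>\<^bsub>T\<^esub>m\<in>?A. h ((f \<oplus>\<^bsub>?P\<^esub> g) m) \<otimes>\<^bsub>T\<^esub> e m)"
      using c f g by (intro sup) auto
    also have "\<dots> = (\<Oplus>\<^bsub>T\<^esub>m\<in>?A. h (f m) \<otimes>\<^bsub>T\<^esub> e m \<oplus>\<^bsub>T\<^esub> h (g m) \<otimes>\<^bsub>T\<^esub> e m)"
    proof (rule T.finsum_cong')
      fix m assume "m \<in> ?A"
      then have "m \<in> S" using c by blast
      then show "h ((f \<oplus>\<^bsub>?P\<^esub> g) m) \<otimes>\<^bsub>T\<^esub> e m = h (f m) \<otimes>\<^bsub>T\<^esub> e m \<oplus>\<^bsub>T\<^esub> h (g m) \<otimes>\<^bsub>T\<^esub> e m"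
        using c e(1) by (simp add: monoid_algebra_def T.l_distr)
    qed (use c e(1) in auto)
    also have "\<dots> = (\<Oplus>\<^bsub>T\<^esub>m\<in>?A. h (f m) \<otimes>\<^bsub>T\<^esub> e m) \<oplus>\<^bsub>T\<^esub> (\<Oplus>\<^bsub>T\<^esub>m\<in>?A. h (g m) \<otimes>\<^bsub>T\<^esub> e m)"
      by (rule T.finsum_addf) (use c e(1) in auto)
    also have "\<dots> = E f \<oplus>\<^bsub>T\<^esub> E g"
      using c f g by (subst (1 2) sup[of _ ?A]) auto
    finally show ?thesis .
  qed
  have E0: "E \<zero>\<^bsub>?P\<^esub> = \<zero>\<^bsub>T\<^esub>"
    unfolding E_def by (simp add: monoid_algebra_def)
  have Emm1: "E (monoid_algebra_monom R c m \<otimes>\<^bsub>?P\<^esub> g) = E (monoid_algebra_monom R c m) \<otimes>\<^bsub>T\<^esub> E g"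
    if "c \<in> carrier R" "m \<in> S" "g \<in> carrier ?P" for c m g
    using that(3)
  proof (induction g rule: monoid_algebra_induct)
    case zero
    then show ?case using that by (simp add: E0 mc Ec)
  next
    case (add d n g)
    then have "E (monoid_algebra_monom R c m \<otimes>\<^bsub>?P\<^esub> monoid_algebra_monom R d n) =
        E (monoid_algebra_monom R c m) \<otimes>\<^bsub>T\<^esub> E (monoid_algebra_monom R d n)"
      using that S e by (simp add: monoid_algebra_monom_mult Em T.m_ac)
    then show ?case using that add by (simp add: P.r_distr T.r_distr mc Ea Ec)
  qed
  have Emm: "E (f \<otimes>\<^bsub>?P\<^esub> g) = E f \<otimes>\<^bsub>T\<^esub> E g"
    if "f \<in> carrier ?P" "g \<in> carrier ?P" for f g
    using that(1)
  proof (induction f rule: monoid_algebra_induct)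
    case zero
    then show ?case using that by (simp add: E0 mc Ec)
  next
    case (add d n f)
    then show ?case using that by (simp add: P.l_distr T.l_distr mc Ea Ec Emm1)
  qed
  have one: "\<one>\<^bsub>?P\<^esub> = monoid_algebra_monom R \<one> 0"
    by (auto simp: monoid_algebra_def monoid_algebra_monom_def)
  have "E \<one>\<^bsub>?P\<^esub> = \<one>\<^bsub>T\<^esub>" using S0 e by (simp add: one Em)
  then have "E \<in> ring_hom ?P T" by (intro ring_hom_memI Ec Emm Ea) auto
  then show thesis using that Em by blast
qed

lemma (in cring) mpoly_ring_cring: "cring (mpoly_ring R V)"
  unfolding mpoly_ring_def by (rule monoid_algebra_cring) auto

lemma (in cring) poly_var_closed: "x \<in> V \<Longrightarrow> poly_var R x \<in> carrier (mpoly_ring R V)"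
  unfolding mpoly_ring_def poly_var_def by (rule monoid_algebra_monom_closed) auto

lemma (in cring) mpoly_const_closed:
  "c \<in> carrier R \<Longrightarrow> monoid_algebra_const R c \<in> carrier (mpoly_ring R V)"
  unfolding mpoly_ring_def monoid_algebra_const_def by (rule monoid_algebra_monom_closed) auto

lemma (in cring) mpoly_ring_eval:
  assumes T: "cring T" and h: "h \<in> ring_hom R T" and u: "\<And>x. x \<in> V \<Longrightarrow> u x \<in> carrier T"
  obtains E where "E \<in> ring_hom (mpoly_ring R V) T"
    "\<And>c. c \<in> carrier R \<Longrightarrow> E (monoid_algebra_const R c) = h c"
    "\<And>x. x \<in> V \<Longrightarrow> E (poly_var R x) = u x"
proof -
  interpret T: cring T by fact
  define e where "e m = (\<Otimes>\<^bsub>T\<^esub>x\<in>set_mset m. u x [^]\<^bsub>T\<^esub> count m x)" for m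
  have sup: "e m = (\<Otimes>\<^bsub>T\<^esub>x\<in>A. u x [^]\<^bsub>T\<^esub> count m x)"
    if "finite A" "set_mset m \<subseteq> A" "A \<subseteq> V" for m A
    unfolding e_def
    apply (rule T.finprod_mono_neutral_cong_left)
    using that u by (auto simp: not_in_iff)
  have e1: "e m \<in> carrier T" if "set_mset m \<subseteq> V" for m
    unfolding e_def by (rule T.finprod_closed) (use that u in auto)
  have e2: "e 0 = \<one>\<^bsub>T\<^esub>" by (simp add: e_def)
  have e3: "e (a + b) = e a \<otimes>\<^bsub>T\<^esub> e b" if "set_mset a \<subseteq> V" "set_mset b \<subseteq> V" for a b
  proof -
    let ?A = "set_mset a \<union> set_mset b"
    have "e (a + b) = (\<Otimes>\<^bsub>T\<^esub>x\<in>?A. u x [^]\<^bsub>T\<^esub> count a x \<otimes>\<^bsub>T\<^esub> u x [^]\<^bsub>T\<^esub> count b x)"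
      using that u by (subst sup[of ?A]) (auto intro!: T.finprod_cong' simp: T.nat_pow_mult)
    also have "\<dots> = (\<Otimes>\<^bsub>T\<^esub>x\<in>?A. u x [^]\<^bsub>T\<^esub> count a x) \<otimes>\<^bsub>T\<^esub> (\<Otimes>\<^bsub>T\<^esub>x\<in>?A. u x [^]\<^bsub>T\<^esub> count b x)"
      by (rule T.finprod_multf) (use that u in auto)
    also have "\<dots> = e a \<otimes>\<^bsub>T\<^esub> e b"
      using that by (subst (1 2) sup[of ?A]) auto
    finally show ?thesis .
  qed
  obtain E where E: "E \<in> ring_hom (mpoly_ring R V) T"
    "\<And>c m. c \<in> carrier R \<Longrightarrow> m \<in> {m. set_mset m \<subseteq> V} \<Longrightarrow>
       E (monoid_algebra_monom R c m) = h c \<otimes>\<^bsub>T\<^esub> e m"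
    unfolding mpoly_ring_def
    by (rule monoid_algebra_eval[OF _ _ T h, of "{m. set_mset m \<subseteq> V}" e]) (use e1 e2 e3 in auto)
  show thesis
  proof
    show "E \<in> ring_hom (mpoly_ring R V) T" by fact
    show "E (monoid_algebra_const R c) = h c" if "c \<in> carrier R" for c
      using that E(2)[of c 0] e2 ring_hom_closed[OF h that] by (simp add: monoid_algebra_const_def)
    show "E (poly_var R x) = u x" if "x \<in> V" for x
    proof -
      have "e {#x#} = u x" using u that by (simp add: e_def)
      then show ?thesis
        using that u E(2)[of "\<one>" "{#x#}"] ring_hom_one[OF h] by (simp add: poly_var_def)
    qed
  qed
qed

lemma (in cring) mpoly_ring_hom_ext:
  assumes T: "cring T" and E: "E \<in> ring_hom (mpoly_ring R V) T" and F: "F \<in> ring_hom (mpoly_ring R V) T"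
    and c: "\<And>c. c \<in> carrier R \<Longrightarrow> E (monoid_algebra_const R c) = F (monoid_algebra_const R c)"
    and x: "\<And>x. x \<in> V \<Longrightarrow> E (poly_var R x) = F (poly_var R x)"
    and f: "f \<in> carrier (mpoly_ring R V)"
  shows "E f = F f"
proof -
  interpret P: cring "mpoly_ring R V" by (rule mpoly_ring_cring)
  interpret T: cring T by fact
  interpret E: ring_hom_cring "mpoly_ring R V" T E by unfold_locales (use E in auto)
  interpret F: ring_hom_cring "mpoly_ring R V" T F by unfold_locales (use F in auto)
  have mc: "monoid_algebra_monom R d m \<in> carrier (mpoly_ring R V)"
    if "d \<in> carrier R" "set_mset m \<subseteq> V" for d m
    unfolding mpoly_ring_def by (rule monoid_algebra_monom_closed) (use that in auto)
  have m: "E (monoid_algebra_monom R d m) = F (monoid_algebra_monom R d m)"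
    if "d \<in> carrier R" "set_mset m \<subseteq> V" for d m
    using that(2)
  proof (induction m)
    case empty
    then show ?case using c[of d] that by (simp add: monoid_algebra_const_def)
  next
    case (add y m)
    have "monoid_algebra_monom R d (add_mset y m) =
        monoid_algebra_monom R d m \<otimes>\<^bsub>mpoly_ring R V\<^esub> poly_var R y"
      using that(1) by (simp add: mpoly_ring_def poly_var_def monoid_algebra_monom_mult)
    then show ?case using add that(1) x[of y] by (simp add: mc poly_var_closed)
  qed
  show ?thesis
    using f[unfolded mpoly_ring_def]
  proof (induction f rule: monoid_algebra_induct)
    case zero
    then show ?case using E.hom_zero F.hom_zero by (simp add: mpoly_ring_def)
  next
    case (add d n g)
    then have *: "set_mset n \<subseteq> V" "g \<in> carrier (mpoly_ring R V)" by (auto simp: mpoly_ring_def)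
    show ?case unfolding mpoly_ring_def[symmetric] using add * by (simp add: mc m)
  qed
qed


section \<open>Affine normal toric varieties\<close>

text \<open>
  A basis of the cocharacter lattice is chosen, so that \<open>N = int ^ 'n\<close> sits in
  \<open>N\<^sub>\<real> = real ^ 'n\<close>, and \<open>M = Hom(N, \<int>)\<close> is \<open>int ^ 'n\<close> with the dual basis.
\<close>

definition lattice_vec :: "int ^ 'n \<Rightarrow> real ^ 'n" where
  "lattice_vec u = (\<chi> i. real_of_int (u $ i))"

definition lattice_pairing :: "int ^ 'n \<Rightarrow> int ^ 'n \<Rightarrow> int" where
  "lattice_pairing m u = (\<Sum>i\<in>UNIV. m $ i * u $ i)"

definition strongly_convex_rational_cone :: "(real ^ 'n) set \<Rightarrow> bool" where
  "strongly_convex_rational_cone \<sigma> \<longleftrightarrow>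
     (\<exists>F :: (int ^ 'n) set. finite F \<and> \<sigma> = convex_cone hull (lattice_vec ` F)) \<and>
     (\<forall>x. x \<in> \<sigma> \<and> - x \<in> \<sigma> \<longrightarrow> x = 0)"

definition dual_cone_lattice :: "(real ^ 'n) set \<Rightarrow> (int ^ 'n) set" where
  "dual_cone_lattice \<sigma> = {m. \<forall>u\<in>\<sigma>. 0 \<le> lattice_vec m \<bullet> u}"

definition toric_ring :: "('k, 'e) ring_scheme \<Rightarrow> (real ^ 'n) set \<Rightarrow> (int ^ 'n \<Rightarrow> 'k) ring" where
  "toric_ring K \<sigma> = monoid_algebra K (dual_cone_lattice \<sigma>)"

text \<open>
  For \<open>n \<in> \<sigma>\<close> and \<open>f\<close> in \<^term>\<open>toric_ring K \<sigma>\<close> the pairings below are nonnegative, so \<^term>\<open>nat\<close>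
  does not truncate.  The value at \<open>0\<close> is the infimum of the empty set, \<^term>\<open>\<infinity> :: enat\<close>.
\<close>

definition toric_ord :: "('k, 'e) ring_scheme \<Rightarrow> int ^ 'n \<Rightarrow> (int ^ 'n \<Rightarrow> 'k) \<Rightarrow> enat" where
  "toric_ord K n f = (INF m \<in> {m. f m \<noteq> \<zero>\<^bsub>K\<^esub>}. enat (nat (lattice_pairing m n)))"


section \<open>Spectra, local rings, residue fields\<close>

definition Spec :: "('a, 'e) ring_scheme \<Rightarrow> 'a set set" where
  "Spec R = {p. primeideal p R}"

definition zariski :: "('a, 'e) ring_scheme \<Rightarrow> 'a set topology" where
  "zariski R = topology_generated_by {{p \<in> Spec R. f \<notin> p} |f. f \<in> carrier R}"

definition generic_point :: "('a, 'e) ring_scheme \<Rightarrow> 'a set set \<Rightarrow> 'a set \<Rightarrow> bool" where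
  "generic_point R Z p \<longleftrightarrow> p \<in> Spec R \<and> zariski R closure_of {p} = Z"

text \<open>\<open>frac R S a s\<close> is the fraction \<open>a/s\<close>, as the set of all pairs equivalent to \<open>(a, s)\<close>.\<close>

definition frac :: "('a, 'e) ring_scheme \<Rightarrow> 'a set \<Rightarrow> 'a \<Rightarrow> 'a \<Rightarrow> ('a \<times> 'a) set" where
  "frac R S a s = {(b, t). b \<in> carrier R \<and> t \<in> S \<and>
     (\<exists>u\<in>S. u \<otimes>\<^bsub>R\<^esub> (t \<otimes>\<^bsub>R\<^esub> a) = u \<otimes>\<^bsub>R\<^esub> (s \<otimes>\<^bsub>R\<^esub> b))}"

definition localization :: "('a, 'e) ring_scheme \<Rightarrow> 'a set \<Rightarrow> ('a \<times> 'a) set ring" where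
  "localization R S =
    \<lparr> carrier = {frac R S a s |a s. a \<in> carrier R \<and> s \<in> S},
      monoid.mult = (\<lambda>x y. \<Union>(a, s)\<in>x. \<Union>(b, t)\<in>y. frac R S (a \<otimes>\<^bsub>R\<^esub> b) (s \<otimes>\<^bsub>R\<^esub> t)),
      monoid.one = frac R S \<one>\<^bsub>R\<^esub> \<one>\<^bsub>R\<^esub>,
      ring.zero = frac R S \<zero>\<^bsub>R\<^esub> \<one>\<^bsub>R\<^esub>,
      ring.add = (\<lambda>x y. \<Union>(a, s)\<in>x. \<Union>(b, t)\<in>y.
               frac R S (t \<otimes>\<^bsub>R\<^esub> a \<oplus>\<^bsub>R\<^esub> s \<otimes>\<^bsub>R\<^esub> b) (s \<otimes>\<^bsub>R\<^esub> t)) \<rparr>"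

definition local_ring_at :: "('a, 'e) ring_scheme \<Rightarrow> 'a set \<Rightarrow> ('a \<times> 'a) set ring" where
  "local_ring_at R p = localization R (carrier R - p)"

definition local_ring_map :: "('a, 'e) ring_scheme \<Rightarrow> 'a set \<Rightarrow> 'a \<Rightarrow> ('a \<times> 'a) set" where
  "local_ring_map R p a = frac R (carrier R - p) a \<one>\<^bsub>R\<^esub>"

definition local_max_ideal :: "('a, 'e) ring_scheme \<Rightarrow> 'a set \<Rightarrow> ('a \<times> 'a) set set" where
  "local_max_ideal R p = {frac R (carrier R - p) a s |a s. a \<in> p \<and> s \<in> carrier R - p}"

definition residue_field :: "('a, 'e) ring_scheme \<Rightarrow> 'a set \<Rightarrow> ('a \<times> 'a) set set ring" where
  "residue_field R p = local_ring_at R p Quot local_max_ideal R p"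

definition residue_map :: "('a, 'e) ring_scheme \<Rightarrow> 'a set \<Rightarrow> 'a \<Rightarrow> ('a \<times> 'a) set set" where
  "residue_map R p a = local_max_ideal R p +>\<^bsub>local_ring_at R p\<^esub> local_ring_map R p a"


section \<open>The arc scheme of an affine scheme\<close>

text \<open>
  Let \<open>B\<close> be a \<open>K\<close>-algebra with structure map \<open>\<iota>\<close>.  A \<open>K\<close>-algebra morphism \<open>B \<rightarrow> R[[t]]\<close> is a
  family of maps \<open>D\<^sub>i : B \<rightarrow> R\<close> (the coefficients of \<open>t\<^sup>i\<close>) which are additive, satisfy the Leibniz
  rule and send \<open>\<iota> c\<close> to \<open>c\<close> for \<open>i = 0\<close> and to \<open>0\<close> for \<open>i > 0\<close>.  The ring of the arc
  scheme is therefore the quotient by these relations of the polynomial ring over \<open>K\<close> in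
  variables \<open>(f, i)\<close>, the variable \<open>(f, i)\<close> becoming \<open>D\<^sub>i f\<close>.
\<close>

definition arc_poly_ring :: "('k, 'e) ring_scheme \<Rightarrow> ('b, 'f) ring_scheme \<Rightarrow>
    (('b \<times> nat) multiset \<Rightarrow> 'k) ring" where
  "arc_poly_ring K B = mpoly_ring K (carrier B \<times> (UNIV :: nat set))"

definition arc_relations :: "('k, 'e) ring_scheme \<Rightarrow> ('b, 'f) ring_scheme \<Rightarrow> ('k \<Rightarrow> 'b) \<Rightarrow>
    (('b \<times> nat) multiset \<Rightarrow> 'k) set" where
  "arc_relations K B \<iota> = (let P = arc_poly_ring K B; x = (\<lambda>f i. poly_var K (f, i)) in
     {x (f \<oplus>\<^bsub>B\<^esub> g) i \<ominus>\<^bsub>P\<^esub> (x f i \<oplus>\<^bsub>P\<^esub> x g i) |f g i. f \<in> carrier B \<and> g \<in> carrier B} \<union>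
     {x (f \<otimes>\<^bsub>B\<^esub> g) i \<ominus>\<^bsub>P\<^esub> (\<Oplus>\<^bsub>P\<^esub>j\<in>{..i}. x f j \<otimes>\<^bsub>P\<^esub> x g (i - j)) |f g i.
        f \<in> carrier B \<and> g \<in> carrier B} \<union>
     {x (\<iota> c) 0 \<ominus>\<^bsub>P\<^esub> monoid_algebra_const K c |c. c \<in> carrier K} \<union>
     {x (\<iota> c) i |c i. c \<in> carrier K \<and> 0 < i})"

definition arc_ideal :: "('k, 'e) ring_scheme \<Rightarrow> ('b, 'f) ring_scheme \<Rightarrow> ('k \<Rightarrow> 'b) \<Rightarrow>
    (('b \<times> nat) multiset \<Rightarrow> 'k) set" where
  "arc_ideal K B \<iota> = Idl\<^bsub>arc_poly_ring K B\<^esub> (arc_relations K B \<iota>)"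

definition arc_ring :: "('k, 'e) ring_scheme \<Rightarrow> ('b, 'f) ring_scheme \<Rightarrow> ('k \<Rightarrow> 'b) \<Rightarrow>
    (('b \<times> nat) multiset \<Rightarrow> 'k) set ring" where
  "arc_ring K B \<iota> = arc_poly_ring K B Quot arc_ideal K B \<iota>"

definition arc_scalar :: "('k, 'e) ring_scheme \<Rightarrow> ('b, 'f) ring_scheme \<Rightarrow> ('k \<Rightarrow> 'b) \<Rightarrow>
    'k \<Rightarrow> (('b \<times> nat) multiset \<Rightarrow> 'k) set" where
  "arc_scalar K B \<iota> c = arc_ideal K B \<iota> +>\<^bsub>arc_poly_ring K B\<^esub> monoid_algebra_const K c"

definition universal_arc :: "('k, 'e) ring_scheme \<Rightarrow> ('b, 'f) ring_scheme \<Rightarrow> ('k \<Rightarrow> 'b) \<Rightarrow>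
    'b \<Rightarrow> nat \<Rightarrow> (('b \<times> nat) multiset \<Rightarrow> 'k) set" where
  "universal_arc K B \<iota> f i = arc_ideal K B \<iota> +>\<^bsub>arc_poly_ring K B\<^esub> poly_var K (f, i)"

text \<open>\<open>R[[t]]\<close>, with power series given by their coefficient sequences.\<close>

definition power_series_ring :: "('r, 'e) ring_scheme \<Rightarrow> (nat \<Rightarrow> 'r) ring" where
  "power_series_ring R =
    \<lparr> carrier = {a. \<forall>i. a i \<in> carrier R},
      monoid.mult = (\<lambda>a b i. \<Oplus>\<^bsub>R\<^esub>j\<in>{..i}. a j \<otimes>\<^bsub>R\<^esub> b (i - j)),
      monoid.one = (\<lambda>i. if i = 0 then \<one>\<^bsub>R\<^esub> else \<zero>\<^bsub>R\<^esub>),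
      ring.zero = (\<lambda>i. \<zero>\<^bsub>R\<^esub>),
      ring.add = (\<lambda>a b i. a i \<oplus>\<^bsub>R\<^esub> b i) \<rparr>"

definition power_series_ord :: "('r, 'e) ring_scheme \<Rightarrow> (nat \<Rightarrow> 'r) \<Rightarrow> enat" where
  "power_series_ord R a = (INF i \<in> {i. a i \<noteq> \<zero>\<^bsub>R\<^esub>}. enat i)"

text \<open>
  The bijections characterizing the arc scheme, for an arbitrary \<open>K\<close>-algebra \<open>T\<close> with structure
  map \<open>\<tau>\<close>; naturality in \<open>T\<close> is immediate from the formula.
\<close>

lemma arc_ring_represents_arcs:
  fixes K :: "('k, 'e) ring_scheme" and B :: "('b, 'f) ring_scheme" and T :: "('t, 'g) ring_scheme"
  assumes K: "cring K" and B: "cring B" and T: "cring T"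
    and i: "\<iota> \<in> ring_hom K B" and j: "\<tau> \<in> ring_hom K T"
  shows "cring (arc_ring K B \<iota>)" "arc_scalar K B \<iota> \<in> ring_hom K (arc_ring K B \<iota>)"
    "bij_betw (\<lambda>h. \<lambda>f\<in>carrier B. \<lambda>i. h (universal_arc K B \<iota> f i))
      {h \<in> ring_hom (arc_ring K B \<iota>) T \<inter> extensional (carrier (arc_ring K B \<iota>)).
         \<forall>c\<in>carrier K. h (arc_scalar K B \<iota> c) = \<tau> c}
      {\<phi> \<in> ring_hom B (power_series_ring T) \<inter> extensional (carrier B).
         \<forall>c\<in>carrier K. \<phi> (\<iota> c) = (\<lambda>i. if i = 0 then \<tau> c else \<zero>\<^bsub>T\<^esub>)}"
proof -
  interpret K: cring K by fact
  interpret B: cring B by fact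
  interpret T: cring T by fact
  let ?P = "arc_poly_ring K B" and ?x = "\<lambda>f i. poly_var K (f, i)"
  let ?I = "arc_ideal K B \<iota>" and ?A = "arc_ring K B \<iota>"
  let ?s = "arc_scalar K B \<iota>" and ?D = "universal_arc K B \<iota>"
  interpret P: cring ?P unfolding arc_poly_ring_def by (rule K.mpoly_ring_cring)
  have xc [simp]: "?x f i \<in> carrier ?P" if "f \<in> carrier B" for f i
    unfolding arc_poly_ring_def by (rule K.poly_var_closed) (use that in auto)
  have cc [simp]: "monoid_algebra_const K c \<in> carrier ?P" if "c \<in> carrier K" for c
    unfolding arc_poly_ring_def by (rule K.mpoly_const_closed) (use that in auto)
  have ic [simp]: "\<iota> c \<in> carrier B" if "c \<in> carrier K" for c
    using ring_hom_closed[OF i that] .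
  have sumc [simp]: "(\<Oplus>\<^bsub>?P\<^esub>j\<in>{..n}. ?x f j \<otimes>\<^bsub>?P\<^esub> ?x g (n - j)) \<in> carrier ?P"
    if "f \<in> carrier B" "g \<in> carrier B" for f g n
    by (rule P.finsum_closed) (use that in auto)
  have relc: "arc_relations K B \<iota> \<subseteq> carrier ?P"
    unfolding arc_relations_def Let_def by auto
  have rel:
    "f \<in> carrier B \<Longrightarrow> g \<in> carrier B \<Longrightarrow>
       ?x (f \<oplus>\<^bsub>B\<^esub> g) n \<ominus>\<^bsub>?P\<^esub> (?x f n \<oplus>\<^bsub>?P\<^esub> ?x g n) \<in> arc_relations K B \<iota>"
    "f \<in> carrier B \<Longrightarrow> g \<in> carrier B \<Longrightarrow>
       ?x (f \<otimes>\<^bsub>B\<^esub> g) n \<ominus>\<^bsub>?P\<^esub> (\<Oplus>\<^bsub>?P\<^esub>j\<in>{..n}. ?x f j \<otimes>\<^bsub>?P\<^esub> ?x g (n - j)) \<in> arc_relations K B \<iota>"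
    "c \<in> carrier K \<Longrightarrow> ?x (\<iota> c) 0 \<ominus>\<^bsub>?P\<^esub> monoid_algebra_const K c \<in> arc_relations K B \<iota>"
    "c \<in> carrier K \<Longrightarrow> 0 < n \<Longrightarrow> ?x (\<iota> c) n \<in> arc_relations K B \<iota>" for f g n c
    unfolding arc_relations_def Let_def by blast+
  interpret I: ideal ?I ?P unfolding arc_ideal_def by (rule P.genideal_ideal[OF relc])
  have relI: "arc_relations K B \<iota> \<subseteq> ?I"
    unfolding arc_ideal_def by (rule P.genideal_self[OF relc])
  show A: "cring ?A" unfolding arc_ring_def by (rule I.quotient_is_cring) (rule P.cring_axioms)
  interpret A: cring ?A by fact
  let ?q = "\<lambda>p. ?I +>\<^bsub>?P\<^esub> p"
  have q: "?q \<in> ring_hom ?P ?A" unfolding arc_ring_def by (rule I.rcos_ring_hom)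
  interpret q: ring_hom_cring ?P ?A ?q by unfold_locales (use q in auto)
  have qsurj: "\<exists>p\<in>carrier ?P. a = ?q p" if "a \<in> carrier ?A" for a
    using that unfolding arc_ring_def FactRing_def A_RCOSETS_def' by auto
  have qI: "?q r = \<zero>\<^bsub>?A\<^esub>" if "r \<in> ?I" for r
  proof -
    have "?q r = ?I" by (rule I.a_rcos_const[OF that])
    moreover have "\<zero>\<^bsub>?A\<^esub> = ?I" unfolding arc_ring_def FactRing_def by simp
    ultimately show ?thesis by (rule trans[OF _ sym])
  qed
  have qdiff: "?q a = ?q b" if "a \<ominus>\<^bsub>?P\<^esub> b \<in> arc_relations K B \<iota>" "a \<in> carrier ?P" "b \<in> carrier ?P" for a b
  proof -
    have "?q (a \<ominus>\<^bsub>?P\<^esub> b) = \<zero>\<^bsub>?A\<^esub>" using that relI by (intro qI) auto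
    then have "?q a \<oplus>\<^bsub>?A\<^esub> (\<ominus>\<^bsub>?A\<^esub> ?q b) = \<zero>\<^bsub>?A\<^esub>" using that by (simp add: a_minus_def)
    then have "\<ominus>\<^bsub>?A\<^esub> (\<ominus>\<^bsub>?A\<^esub> ?q b) = ?q a" using that by (intro A.minus_equality) auto
    then show ?thesis using that by simp
  qed
  have s_def: "?s c = ?q (monoid_algebra_const K c)" for c by (simp add: arc_scalar_def)
  have D_def: "?D f n = ?q (?x f n)" for f n by (simp add: universal_arc_def)
  have D_add: "?D (f \<oplus>\<^bsub>B\<^esub> g) n = ?D f n \<oplus>\<^bsub>?A\<^esub> ?D g n"
    if "f \<in> carrier B" "g \<in> carrier B" for f g n
  proof -
    have "?q (?x (f \<oplus>\<^bsub>B\<^esub> g) n) = ?q (?x f n \<oplus>\<^bsub>?P\<^esub> ?x g n)"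
      by (rule qdiff) (use that rel in auto)
    then show ?thesis using that by (simp add: D_def)
  qed
  have D_mult: "?D (f \<otimes>\<^bsub>B\<^esub> g) n = (\<Oplus>\<^bsub>?A\<^esub>j\<in>{..n}. ?D f j \<otimes>\<^bsub>?A\<^esub> ?D g (n - j))"
    if "f \<in> carrier B" "g \<in> carrier B" for f g n
  proof -
    have "?q (?x (f \<otimes>\<^bsub>B\<^esub> g) n) = ?q (\<Oplus>\<^bsub>?P\<^esub>j\<in>{..n}. ?x f j \<otimes>\<^bsub>?P\<^esub> ?x g (n - j))"
      by (rule qdiff) (use that rel in auto)
    also have "\<dots> = (\<Oplus>\<^bsub>?A\<^esub>j\<in>{..n}. ?q (?x f j \<otimes>\<^bsub>?P\<^esub> ?x g (n - j)))"
      using that by (subst q.hom_finsum) (auto simp: comp_def)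
    finally show ?thesis using that by (simp add: D_def)
  qed
  have D_scal: "?D (\<iota> c) n = (if n = 0 then ?s c else \<zero>\<^bsub>?A\<^esub>)" if "c \<in> carrier K" for c n
  proof (cases "n = 0")
    case True
    have "?q (?x (\<iota> c) 0) = ?q (monoid_algebra_const K c)"
      by (rule qdiff) (use that rel in auto)
    then show ?thesis using True by (simp add: D_def s_def)
  next
    case False
    have "?x (\<iota> c) n \<in> arc_relations K B \<iota>"
      using that False by (intro rel) auto
    then show ?thesis using False relI qI by (auto simp: D_def)
  qed
  have Dc [simp]: "?D f n \<in> carrier ?A" if "f \<in> carrier B" for f n
    using that by (simp add: D_def)
  have const: "monoid_algebra_const K \<in> ring_hom K ?P"
  proof (rule ring_hom_memI)
    show "monoid_algebra_const K (x \<otimes>\<^bsub>K\<^esub> y) = monoid_algebra_const K x \<otimes>\<^bsub>?P\<^esub> monoid_algebra_const K y"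
      if "x \<in> carrier K" "y \<in> carrier K" for x y
      using that by (simp add: arc_poly_ring_def mpoly_ring_def monoid_algebra_const_def K.monoid_algebra_monom_mult)
    show "monoid_algebra_const K (x \<oplus>\<^bsub>K\<^esub> y) = monoid_algebra_const K x \<oplus>\<^bsub>?P\<^esub> monoid_algebra_const K y"
      if "x \<in> carrier K" "y \<in> carrier K" for x y
      using that by (auto simp: arc_poly_ring_def mpoly_ring_def monoid_algebra_def monoid_algebra_const_def monoid_algebra_monom_def)
    show "monoid_algebra_const K \<one>\<^bsub>K\<^esub> = \<one>\<^bsub>?P\<^esub>"
      by (auto simp: arc_poly_ring_def mpoly_ring_def monoid_algebra_def monoid_algebra_const_def monoid_algebra_monom_def)
  qed auto
  have "?s = ?q \<circ> monoid_algebra_const K" by (auto simp: s_def)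
  then show s: "?s \<in> ring_hom K ?A" using ring_hom_trans[OF const q] by simp
  show "bij_betw (\<lambda>h. \<lambda>f\<in>carrier B. \<lambda>i. h (?D f i))
      {h \<in> ring_hom ?A T \<inter> extensional (carrier ?A). \<forall>c\<in>carrier K. h (?s c) = \<tau> c}
      {\<phi> \<in> ring_hom B (power_series_ring T) \<inter> extensional (carrier B).
         \<forall>c\<in>carrier K. \<phi> (\<iota> c) = (\<lambda>i. if i = 0 then \<tau> c else \<zero>\<^bsub>T\<^esub>)}"
    (is "bij_betw ?F ?L ?R")
  proof (rule bij_betw_imageI)
    show "inj_on ?F ?L"
    proof (rule inj_onI)
      fix h h' assume h: "h \<in> ?L" and h': "h' \<in> ?L" and eq: "?F h = ?F h'"
      have hq: "h \<circ> ?q \<in> ring_hom ?P T" "h' \<circ> ?q \<in> ring_hom ?P T"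
        using h h' ring_hom_trans[OF q] by auto
      have "h (?q p) = h' (?q p)" if p: "p \<in> carrier ?P" for p
      proof -
        have "(h \<circ> ?q) p = (h' \<circ> ?q) p"
        proof (rule K.mpoly_ring_hom_ext[where V = "carrier B \<times> (UNIV :: nat set)", folded arc_poly_ring_def, OF T hq])
          show "p \<in> carrier ?P" by fact
          show "(h \<circ> ?q) (monoid_algebra_const K c) = (h' \<circ> ?q) (monoid_algebra_const K c)"
            if "c \<in> carrier K" for c
            using h h' that by (auto simp: s_def)
          show "(h \<circ> ?q) (poly_var K y) = (h' \<circ> ?q) (poly_var K y)"
            if "y \<in> carrier B \<times> UNIV" for y
          proof -
            obtain f n where y: "y = (f, n)" "f \<in> carrier B" using \<open>y \<in> carrier B \<times> UNIV\<close> by auto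
            have "?F h f n = ?F h' f n" using eq by simp
            then show ?thesis using y by (simp add: D_def)
          qed
        qed
        then show ?thesis by simp
      qed
      then have "h a = h' a" if "a \<in> carrier ?A" for a using qsurj[OF that] by auto
      then show "h = h'" using h h' by (intro extensionalityI[of _ "carrier ?A"]) auto
    qed
    show "?F ` ?L = ?R"
    proof
      show "?F ` ?L \<subseteq> ?R"
      proof (rule image_subsetI)
        fix h assume h: "h \<in> ?L"
        interpret h: ring_hom_cring ?A T h by unfold_locales (use h in auto)
        have D1: "?D \<one>\<^bsub>B\<^esub> n = (if n = 0 then \<one>\<^bsub>?A\<^esub> else \<zero>\<^bsub>?A\<^esub>)" for n
          using D_scal[of "\<one>\<^bsub>K\<^esub>" n] ring_hom_one[OF i] ring_hom_one[OF s] by simp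
        have "?F h \<in> ring_hom B (power_series_ring T)"
        proof (rule ring_hom_memI)
          show "?F h x \<in> carrier (power_series_ring T)" if "x \<in> carrier B" for x
            using that by (auto simp: power_series_ring_def)
          show "?F h (x \<otimes>\<^bsub>B\<^esub> y) = ?F h x \<otimes>\<^bsub>power_series_ring T\<^esub> ?F h y"
            if "x \<in> carrier B" "y \<in> carrier B" for x y
            using that by (auto simp: power_series_ring_def D_mult comp_def intro!: T.finsum_cong')
          show "?F h (x \<oplus>\<^bsub>B\<^esub> y) = ?F h x \<oplus>\<^bsub>power_series_ring T\<^esub> ?F h y"
            if "x \<in> carrier B" "y \<in> carrier B" for x y
            using that by (auto simp: power_series_ring_def D_add)
          show "?F h \<one>\<^bsub>B\<^esub> = \<one>\<^bsub>power_series_ring T\<^esub>"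
            by (auto simp: power_series_ring_def D1)
        qed
        then show "?F h \<in> ?R" using h by (auto simp: D_scal)
      qed
      show "?R \<subseteq> ?F ` ?L"
      proof
        fix \<phi> assume phi: "\<phi> \<in> ?R"
        then have ph: "\<phi> \<in> ring_hom B (power_series_ring T)" by auto
        have pc: "\<phi> f n \<in> carrier T" if "f \<in> carrier B" for f n
          using ring_hom_closed[OF ph that] by (simp add: power_series_ring_def)
        have p_add: "\<phi> (f \<oplus>\<^bsub>B\<^esub> g) n = \<phi> f n \<oplus>\<^bsub>T\<^esub> \<phi> g n"
          and p_mult: "\<phi> (f \<otimes>\<^bsub>B\<^esub> g) n = (\<Oplus>\<^bsub>T\<^esub>j\<in>{..n}. \<phi> f j \<otimes>\<^bsub>T\<^esub> \<phi> g (n - j))"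
          if "f \<in> carrier B" "g \<in> carrier B" for f g n
          using ring_hom_add[OF ph that] ring_hom_mult[OF ph that] by (simp_all add: power_series_ring_def)
        have p_scal: "\<phi> (\<iota> c) n = (if n = 0 then \<tau> c else \<zero>\<^bsub>T\<^esub>)" if "c \<in> carrier K" for c n
          using phi that by simp
        obtain E where E: "E \<in> ring_hom ?P T"
          "\<And>c. c \<in> carrier K \<Longrightarrow> E (monoid_algebra_const K c) = \<tau> c"
          "\<And>y. y \<in> carrier B \<times> UNIV \<Longrightarrow> E (poly_var K y) = \<phi> (fst y) (snd y)"
          unfolding arc_poly_ring_def
          by (rule K.mpoly_ring_eval[OF T j, of "carrier B \<times> UNIV" "\<lambda>y. \<phi> (fst y) (snd y)"])
             (use pc in auto)
        interpret E: ring_hom_cring ?P T E by unfold_locales (use E in auto)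
        let ?N = "a_kernel ?P T E"
        have N: "x \<in> ?N \<longleftrightarrow> x \<in> carrier ?P \<and> E x = \<zero>\<^bsub>T\<^esub>" for x
          unfolding a_kernel_def' by (rule mem_Collect_eq)
        have Ex: "E (?x f n) = \<phi> f n" if "f \<in> carrier B" for f n using E(3)[of "(f, n)"] that by simp
        have Ed: "a \<ominus>\<^bsub>?P\<^esub> b \<in> ?N" if "a \<in> carrier ?P" "b \<in> carrier ?P" "E a = E b" for a b
        proof -
          have "E (a \<ominus>\<^bsub>?P\<^esub> b) = E a \<oplus>\<^bsub>T\<^esub> (\<ominus>\<^bsub>T\<^esub> E b)"
            unfolding a_minus_def using that(1,2) by simp
          also have "\<dots> = \<zero>\<^bsub>T\<^esub>" unfolding that(3) using that(2) by (simp add: T.r_neg)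
          finally show ?thesis unfolding N using that(1,2) by blast
        qed
        have "arc_relations K B \<iota> \<subseteq> ?N"
        proof -
          have r1: "?x (f \<oplus>\<^bsub>B\<^esub> g) n \<ominus>\<^bsub>?P\<^esub> (?x f n \<oplus>\<^bsub>?P\<^esub> ?x g n) \<in> ?N"
            if "f \<in> carrier B" "g \<in> carrier B" for f g n
            by (rule Ed) (use that in \<open>simp_all add: Ex p_add\<close>)
          have r2: "?x (f \<otimes>\<^bsub>B\<^esub> g) n \<ominus>\<^bsub>?P\<^esub> (\<Oplus>\<^bsub>?P\<^esub>j\<in>{..n}. ?x f j \<otimes>\<^bsub>?P\<^esub> ?x g (n - j)) \<in> ?N"
            if fg: "f \<in> carrier B" "g \<in> carrier B" for f g n
          proof (rule Ed)
            have "E (\<Oplus>\<^bsub>?P\<^esub>j\<in>{..n}. ?x f j \<otimes>\<^bsub>?P\<^esub> ?x g (n - j)) =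
                (\<Oplus>\<^bsub>T\<^esub>j\<in>{..n}. (E \<circ> (\<lambda>j. ?x f j \<otimes>\<^bsub>?P\<^esub> ?x g (n - j))) j)"
              using fg by (subst E.hom_finsum) (auto simp: comp_def)
            also have "\<dots> = (\<Oplus>\<^bsub>T\<^esub>j\<in>{..n}. \<phi> f j \<otimes>\<^bsub>T\<^esub> \<phi> g (n - j))"
              by (rule T.finsum_cong') (use fg pc in \<open>auto simp: Ex\<close>)
            also have "\<dots> = E (?x (f \<otimes>\<^bsub>B\<^esub> g) n)" using fg by (simp add: Ex p_mult)
            finally show "E (?x (f \<otimes>\<^bsub>B\<^esub> g) n) = E (\<Oplus>\<^bsub>?P\<^esub>j\<in>{..n}. ?x f j \<otimes>\<^bsub>?P\<^esub> ?x g (n - j))"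
              by (rule sym)
          qed (use fg in auto)
          have r3: "?x (\<iota> c) 0 \<ominus>\<^bsub>?P\<^esub> monoid_algebra_const K c \<in> ?N" if "c \<in> carrier K" for c
            using that p_scal[OF that] by (intro Ed) (simp_all add: Ex E(2))
          have r4: "?x (\<iota> c) n \<in> ?N" if "c \<in> carrier K" "0 < n" for c n
            unfolding N using that p_scal[OF that(1)] by (simp add: Ex)
          show ?thesis unfolding arc_relations_def Let_def
            by (intro Un_least subsetI; elim CollectE exE conjE; hypsubst)
               (rule r1 r2 r3 r4; assumption)+
        qed
        then have IN: "?I \<subseteq> ?N"
          unfolding arc_ideal_def by (rule P.genideal_minimal[OF ring_hom_ring.kernel_is_ideal[OF ring_hom_ringI2[OF P.ring_axioms T.ring_axioms E(1)]]])
        define h where "h = (\<lambda>a\<in>carrier ?A. E (SOME p. p \<in> a))"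
        have hq: "h (?q p) = E p" if p: "p \<in> carrier ?P" for p
        proof -
          have "p \<in> ?q p" using p I.a_rcos_self by blast
          then have "(SOME p'. p' \<in> ?q p) \<in> ?q p" by (rule someI[where P = "\<lambda>p'. p' \<in> ?q p"])
          then obtain r where r: "r \<in> ?I" "(SOME p'. p' \<in> ?q p) = r \<oplus>\<^bsub>?P\<^esub> p"
            unfolding a_r_coset_def' by blast
          then have "r \<in> ?N" using IN by blast
          then have "E r = \<zero>\<^bsub>T\<^esub>" "r \<in> carrier ?P" unfolding N by blast+
          then show ?thesis using p r by (simp add: h_def)
        qed
        have h: "h \<in> ring_hom ?A T"
        proof (rule ring_hom_memI)
          show "h a \<in> carrier T" if "a \<in> carrier ?A" for a using qsurj[OF that] hq by auto
          show "h (a \<otimes>\<^bsub>?A\<^esub> b) = h a \<otimes>\<^bsub>T\<^esub> h b" if ab: "a \<in> carrier ?A" "b \<in> carrier ?A" for a b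
          proof -
            obtain p p' where p: "p \<in> carrier ?P" "a = ?q p" and p': "p' \<in> carrier ?P" "b = ?q p'"
              using qsurj[OF ab(1)] qsurj[OF ab(2)] by blast
            have "h (?q (p \<otimes>\<^bsub>?P\<^esub> p')) = E p \<otimes>\<^bsub>T\<^esub> E p'"
              using p(1) p'(1) by (subst hq) auto
            moreover have "?q (p \<otimes>\<^bsub>?P\<^esub> p') = a \<otimes>\<^bsub>?A\<^esub> b"
              unfolding p(2) p'(2) by (rule q.hom_mult[OF p(1) p'(1)])
            moreover have "h a = E p" "h b = E p'" unfolding p(2) p'(2) by (rule hq, fact)+
            ultimately show ?thesis by simp
          qed
          show "h (a \<oplus>\<^bsub>?A\<^esub> b) = h a \<oplus>\<^bsub>T\<^esub> h b" if ab: "a \<in> carrier ?A" "b \<in> carrier ?A" for a b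
          proof -
            obtain p p' where p: "p \<in> carrier ?P" "a = ?q p" and p': "p' \<in> carrier ?P" "b = ?q p'"
              using qsurj[OF ab(1)] qsurj[OF ab(2)] by blast
            have "h (?q (p \<oplus>\<^bsub>?P\<^esub> p')) = E p \<oplus>\<^bsub>T\<^esub> E p'"
              using p(1) p'(1) by (subst hq) auto
            moreover have "?q (p \<oplus>\<^bsub>?P\<^esub> p') = a \<oplus>\<^bsub>?A\<^esub> b"
              unfolding p(2) p'(2) by (rule q.hom_add[OF p(1) p'(1)])
            moreover have "h a = E p" "h b = E p'" unfolding p(2) p'(2) by (rule hq, fact)+
            ultimately show ?thesis by simp
          qed
          show "h \<one>\<^bsub>?A\<^esub> = \<one>\<^bsub>T\<^esub>" using hq[of "\<one>\<^bsub>?P\<^esub>"] by simp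
        qed
        have "h \<in> extensional (carrier ?A)" by (simp add: h_def)
        moreover have "\<forall>c\<in>carrier K. h (?s c) = \<tau> c" by (simp add: s_def hq E(2))
        ultimately have "h \<in> ?L" using h by blast
        moreover have "?F h = \<phi>"
        proof (rule extensionalityI[of _ "carrier B"])
          show "?F h f = \<phi> f" if "f \<in> carrier B" for f
            using that by (auto simp: D_def hq Ex)
        qed (use phi in auto)
        ultimately show "\<phi> \<in> ?F ` ?L" by blast
      qed
    qed
  qed
qed

definition arc_morphism :: "('k, 'e) ring_scheme \<Rightarrow> ('b, 'f) ring_scheme \<Rightarrow> ('k \<Rightarrow> 'b) \<Rightarrow>
    (('b \<times> nat) multiset \<Rightarrow> 'k) set set \<Rightarrow> 'b \<Rightarrow> nat \<Rightarrow>
    ((('b \<times> nat) multiset \<Rightarrow> 'k) set \<times> (('b \<times> nat) multiset \<Rightarrow> 'k) set) set set" where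
  "arc_morphism K B \<iota> \<alpha> f = (\<lambda>i. residue_map (arc_ring K B \<iota>) \<alpha> (universal_arc K B \<iota> f i))"

definition arc_ord :: "('k, 'e) ring_scheme \<Rightarrow> ('b, 'f) ring_scheme \<Rightarrow> ('k \<Rightarrow> 'b) \<Rightarrow>
    (('b \<times> nat) multiset \<Rightarrow> 'k) set set \<Rightarrow> 'b \<Rightarrow> enat" where
  "arc_ord K B \<iota> \<alpha> f =
     power_series_ord (residue_field (arc_ring K B \<iota>) \<alpha>) (arc_morphism K B \<iota> \<alpha> f)"

definition nash_set :: "('k, 'e) ring_scheme \<Rightarrow> ('b, 'f) ring_scheme \<Rightarrow> ('k \<Rightarrow> 'b) \<Rightarrow>
    ('b \<Rightarrow> enat) \<Rightarrow> (('b \<times> nat) multiset \<Rightarrow> 'k) set set set" where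
  "nash_set K B \<iota> v = zariski (arc_ring K B \<iota>) closure_of
     {\<alpha> \<in> Spec (arc_ring K B \<iota>). \<forall>f\<in>carrier B. arc_ord K B \<iota> \<alpha> f = v f}"

text \<open>A point of \<open>Spec A\<close>, for a \<open>K\<close>-algebra \<open>A\<close> with structure map \<open>\<iota>\<close>, is \<open>K\<close>-rational if its
  residue field is \<open>K\<close>.\<close>

definition rational_point :: "('k, 'e) ring_scheme \<Rightarrow> ('a, 'f) ring_scheme \<Rightarrow> ('k \<Rightarrow> 'a) \<Rightarrow>
    'a set \<Rightarrow> bool" where
  "rational_point K A \<iota> p \<longleftrightarrow> p \<in> Spec A \<and>
     bij_betw (\<lambda>c. residue_map A p (\<iota> c)) (carrier K) (carrier (residue_field A p))"


section \<open>Completions and completed tensor products\<close>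

text \<open>
  A linearly topologized ring with a countable fundamental system of neighbourhoods of \<open>0\<close>
  consisting of ideals \<open>nbhd 0 \<supseteq> nbhd 1 \<supseteq> \<dots>\<close>.
\<close>

record 'a top_ring = "'a ring" +
  nbhd :: "nat \<Rightarrow> 'a set"

definition top_ring_topology :: "('a, 'e) top_ring_scheme \<Rightarrow> 'a topology" where
  "top_ring_topology R = topology_generated_by {nbhd R n +>\<^bsub>R\<^esub> a |n a. a \<in> carrier R}"

definition discrete_top_ring :: "('a, 'e) ring_scheme \<Rightarrow> 'a top_ring" where
  "discrete_top_ring R = \<lparr> carrier = carrier R, monoid.mult = (\<otimes>\<^bsub>R\<^esub>),
     monoid.one = \<one>\<^bsub>R\<^esub>, ring.zero = \<zero>\<^bsub>R\<^esub>, ring.add = (\<oplus>\<^bsub>R\<^esub>), nbhd = (\<lambda>n. {\<zero>\<^bsub>R\<^esub>}) \<rparr>"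

text \<open>
  The completion of \<open>R\<close> along a decreasing sequence of ideals \<open>F\<close>, i.e. the inverse limit of the
  \<open>R / F n\<close>, with the inverse limit topology.  The transition maps send a coset of \<open>F (Suc n)\<close> to
  the coset of \<open>F n\<close> containing it.
\<close>

definition completion :: "('a, 'e) ring_scheme \<Rightarrow> (nat \<Rightarrow> 'a set) \<Rightarrow> (nat \<Rightarrow> 'a set) top_ring" where
  "completion R F = (let C = {x. (\<forall>n. x n \<in> carrier (R Quot F n)) \<and> (\<forall>n. x (Suc n) \<subseteq> x n)} in
    \<lparr> carrier = C,
      monoid.mult = (\<lambda>x y n. x n \<otimes>\<^bsub>R Quot F n\<^esub> y n),
      monoid.one = (\<lambda>n. \<one>\<^bsub>R Quot F n\<^esub>),
      ring.zero = (\<lambda>n. \<zero>\<^bsub>R Quot F n\<^esub>),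
      ring.add = (\<lambda>x y n. x n \<oplus>\<^bsub>R Quot F n\<^esub> y n),
      nbhd = (\<lambda>n. {x \<in> C. x n = \<zero>\<^bsub>R Quot F n\<^esub>}) \<rparr>)"

definition completion_map :: "('a, 'e) ring_scheme \<Rightarrow> (nat \<Rightarrow> 'a set) \<Rightarrow> 'a \<Rightarrow> nat \<Rightarrow> 'a set" where
  "completion_map R F a = (\<lambda>n. F n +>\<^bsub>R\<^esub> a)"

primrec ideal_power :: "('a, 'e) ring_scheme \<Rightarrow> 'a set \<Rightarrow> nat \<Rightarrow> 'a set" where
  "ideal_power R I 0 = carrier R"
| "ideal_power R I (Suc n) = I \<cdot>\<^bsub>R\<^esub> ideal_power R I n"

definition formal_nbhd :: "('a, 'e) ring_scheme \<Rightarrow> 'a set \<Rightarrow> (nat \<Rightarrow> ('a \<times> 'a) set set) top_ring" where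
  "formal_nbhd R p =
     completion (local_ring_at R p) (ideal_power (local_ring_at R p) (local_max_ideal R p))"

definition formal_nbhd_map :: "('a, 'e) ring_scheme \<Rightarrow> 'a set \<Rightarrow> 'a \<Rightarrow> nat \<Rightarrow> ('a \<times> 'a) set set" where
  "formal_nbhd_map R p a =
     completion_map (local_ring_at R p) (ideal_power (local_ring_at R p) (local_max_ideal R p))
       (local_ring_map R p a)"

text \<open>
  A coefficient field containing \<open>K\<close> of the completed local ring at a point of \<open>Spec A\<close>, where
  \<open>A\<close> is a \<open>K\<close>-algebra with structure map \<open>\<iota>\<close>: a \<open>K\<close>-algebra section \<open>s\<close> of the map to the
  residue field, which is the projection \<open>x \<mapsto> x 1\<close> since \<open>\<mm>\<^sup>1 = \<mm>\<close>.
\<close>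

definition coefficient_field :: "('k, 'e) ring_scheme \<Rightarrow> ('a, 'f) ring_scheme \<Rightarrow> ('k \<Rightarrow> 'a) \<Rightarrow>
    'a set \<Rightarrow> (('a \<times> 'a) set set \<Rightarrow> nat \<Rightarrow> ('a \<times> 'a) set set) \<Rightarrow> bool" where
  "coefficient_field K A \<iota> p s \<longleftrightarrow>
     s \<in> ring_hom (residue_field A p) (formal_nbhd A p) \<and>
     (\<forall>x\<in>carrier (residue_field A p). s x 1 = x) \<and>
     (\<forall>c\<in>carrier K. s (residue_map A p (\<iota> c)) = formal_nbhd_map A p (\<iota> c))"

definition countable_var_ideal :: "('a, 'e) ring_scheme \<Rightarrow> (nat multiset \<Rightarrow> 'a) set" where
  "countable_var_ideal R = Idl\<^bsub>mpoly_ring R (UNIV :: nat set)\<^esub> (range (poly_var R))"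

definition countable_power_series ::
    "('a, 'e) ring_scheme \<Rightarrow> (nat \<Rightarrow> (nat multiset \<Rightarrow> 'a) set) top_ring" where
  "countable_power_series R = completion (mpoly_ring R (UNIV :: nat set))
     (ideal_power (mpoly_ring R (UNIV :: nat set)) (countable_var_ideal R))"

definition countable_power_series_const ::
    "('a, 'e) ring_scheme \<Rightarrow> 'a \<Rightarrow> nat \<Rightarrow> (nat multiset \<Rightarrow> 'a) set" where
  "countable_power_series_const R c = completion_map (mpoly_ring R (UNIV :: nat set))
     (ideal_power (mpoly_ring R (UNIV :: nat set)) (countable_var_ideal R))
     (monoid_algebra_const R c)"

text \<open>
  The tensor product over \<open>K\<close> of two commutative \<open>K\<close>-algebras with structure maps \<open>\<phi> : K \<rightarrow> R\<close> and
  \<open>\<psi> : K \<rightarrow> S\<close>: the free abelian group on \<open>R \<times> S\<close> modulo the bilinearity relations.  The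
  multiplication of the free abelian group extends \<open>(a, b) (c, d) = (a c, b d)\<close> bilinearly, and
  the subgroup generated by the relations is then an ideal.
\<close>

definition free_tensor_ring :: "('a, 'e) ring_scheme \<Rightarrow> ('b, 'f) ring_scheme \<Rightarrow>
    ('a \<times> 'b, int) poly_mapping ring" where
  "free_tensor_ring R S =
    \<lparr> carrier = {x. Poly_Mapping.keys x \<subseteq> carrier R \<times> carrier S},
      monoid.mult = (\<lambda>x y. frag_extend (\<lambda>(a, b).
         frag_extend (\<lambda>(c, d). frag_of (a \<otimes>\<^bsub>R\<^esub> c, b \<otimes>\<^bsub>S\<^esub> d)) y) x),
      monoid.one = frag_of (\<one>\<^bsub>R\<^esub>, \<one>\<^bsub>S\<^esub>),
      ring.zero = 0,
      ring.add = (+) \<rparr>"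

definition tensor_ideal :: "('k, 'g) ring_scheme \<Rightarrow> ('a, 'e) ring_scheme \<Rightarrow> ('k \<Rightarrow> 'a) \<Rightarrow>
    ('b, 'f) ring_scheme \<Rightarrow> ('k \<Rightarrow> 'b) \<Rightarrow> ('a \<times> 'b, int) poly_mapping set" where
  "tensor_ideal K R \<phi> S \<psi> = Idl\<^bsub>free_tensor_ring R S\<^esub> (
     {frag_of (a \<oplus>\<^bsub>R\<^esub> a', b) - frag_of (a, b) - frag_of (a', b) |a a' b.
        a \<in> carrier R \<and> a' \<in> carrier R \<and> b \<in> carrier S} \<union>
     {frag_of (a, b \<oplus>\<^bsub>S\<^esub> b') - frag_of (a, b) - frag_of (a, b') |a b b'.
        a \<in> carrier R \<and> b \<in> carrier S \<and> b' \<in> carrier S} \<union>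
     {frag_of (\<phi> c \<otimes>\<^bsub>R\<^esub> a, b) - frag_of (a, \<psi> c \<otimes>\<^bsub>S\<^esub> b) |c a b.
        c \<in> carrier K \<and> a \<in> carrier R \<and> b \<in> carrier S})"

definition tensor_ring :: "('k, 'g) ring_scheme \<Rightarrow> ('a, 'e) ring_scheme \<Rightarrow> ('k \<Rightarrow> 'a) \<Rightarrow>
    ('b, 'f) ring_scheme \<Rightarrow> ('k \<Rightarrow> 'b) \<Rightarrow> ('a \<times> 'b, int) poly_mapping set ring" where
  "tensor_ring K R \<phi> S \<psi> = free_tensor_ring R S Quot tensor_ideal K R \<phi> S \<psi>"

definition pure_tensor :: "('k, 'g) ring_scheme \<Rightarrow> ('a, 'e) ring_scheme \<Rightarrow> ('k \<Rightarrow> 'a) \<Rightarrow>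
    ('b, 'f) ring_scheme \<Rightarrow> ('k \<Rightarrow> 'b) \<Rightarrow> 'a \<Rightarrow> 'b \<Rightarrow> ('a \<times> 'b, int) poly_mapping set" where
  "pure_tensor K R \<phi> S \<psi> a b = tensor_ideal K R \<phi> S \<psi> +>\<^bsub>free_tensor_ring R S\<^esub> frag_of (a, b)"

text \<open>
  The completed tensor product (over a discrete ring \<open>K\<close>) is the completion of \<open>R \<otimes>\<^sub>K S\<close> along the
  images of \<open>nbhd R n \<otimes> S + R \<otimes> nbhd S n\<close>, i.e. the inverse limit of the
  \<open>R / nbhd R n \<otimes>\<^sub>K S / nbhd S n\<close>.
\<close>

definition tensor_nbhd :: "('k, 'g) ring_scheme \<Rightarrow> ('a, 'e) top_ring_scheme \<Rightarrow> ('k \<Rightarrow> 'a) \<Rightarrow>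
    ('b, 'f) top_ring_scheme \<Rightarrow> ('k \<Rightarrow> 'b) \<Rightarrow> nat \<Rightarrow> ('a \<times> 'b, int) poly_mapping set set" where
  "tensor_nbhd K R \<phi> S \<psi> n = Idl\<^bsub>tensor_ring K R \<phi> S \<psi>\<^esub> (
     {pure_tensor K R \<phi> S \<psi> a b |a b. a \<in> nbhd R n \<and> b \<in> carrier S} \<union>
     {pure_tensor K R \<phi> S \<psi> a b |a b. a \<in> carrier R \<and> b \<in> nbhd S n})"

definition completed_tensor :: "('k, 'g) ring_scheme \<Rightarrow> ('a, 'e) top_ring_scheme \<Rightarrow> ('k \<Rightarrow> 'a) \<Rightarrow>
    ('b, 'f) top_ring_scheme \<Rightarrow> ('k \<Rightarrow> 'b) \<Rightarrow> (nat \<Rightarrow> ('a \<times> 'b, int) poly_mapping set set) top_ring" where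
  "completed_tensor K R \<phi> S \<psi> =
     completion (tensor_ring K R \<phi> S \<psi>) (tensor_nbhd K R \<phi> S \<psi>)"

definition completed_tensor_inr :: "('k, 'g) ring_scheme \<Rightarrow> ('a, 'e) top_ring_scheme \<Rightarrow>
    ('k \<Rightarrow> 'a) \<Rightarrow> ('b, 'f) top_ring_scheme \<Rightarrow> ('k \<Rightarrow> 'b) \<Rightarrow>
    'b \<Rightarrow> nat \<Rightarrow> ('a \<times> 'b, int) poly_mapping set set" where
  "completed_tensor_inr K R \<phi> S \<psi> b =
     completion_map (tensor_ring K R \<phi> S \<psi>) (tensor_nbhd K R \<phi> S \<psi>)
       (pure_tensor K R \<phi> S \<psi> \<one>\<^bsub>R\<^esub> b)"

text \<open>
  Isomorphism of the formal spectra of two topological \<open>L\<close>-algebras, with structure maps \<open>\<phi>\<close> and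
  \<open>\<psi>\<close>, as formal \<open>L\<close>-schemes.
\<close>

definition formal_iso :: "('l, 'g) ring_scheme \<Rightarrow> ('a, 'e) top_ring_scheme \<Rightarrow> ('l \<Rightarrow> 'a) \<Rightarrow>
    ('b, 'f) top_ring_scheme \<Rightarrow> ('l \<Rightarrow> 'b) \<Rightarrow> bool" where
  "formal_iso L R \<phi> S \<psi> \<longleftrightarrow>
     (\<exists>h. h \<in> ring_iso R S \<and>
          homeomorphic_map (top_ring_topology R) (top_ring_topology S) h \<and>
          (\<forall>c\<in>carrier L. h (\<phi> c) = \<psi> c))"


section \<open>Arcs on affine toric varieties\<close>

definition toric_arc_ring :: "('k, 'e) ring_scheme \<Rightarrow> (real ^ 'n) set \<Rightarrow>
    (((int ^ 'n \<Rightarrow> 'k) \<times> nat) multiset \<Rightarrow> 'k) set ring" where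
  "toric_arc_ring K \<sigma> = arc_ring K (toric_ring K \<sigma>) (monoid_algebra_const K)"

definition toric_arc_scalar :: "('k, 'e) ring_scheme \<Rightarrow> (real ^ 'n) set \<Rightarrow> 'k \<Rightarrow>
    (((int ^ 'n \<Rightarrow> 'k) \<times> nat) multiset \<Rightarrow> 'k) set" where
  "toric_arc_scalar K \<sigma> = arc_scalar K (toric_ring K \<sigma>) (monoid_algebra_const K)"

definition toric_nash_set :: "('k, 'e) ring_scheme \<Rightarrow> (real ^ 'n) set \<Rightarrow> int ^ 'n \<Rightarrow>
    (((int ^ 'n \<Rightarrow> 'k) \<times> nat) multiset \<Rightarrow> 'k) set set set" where
  "toric_nash_set K \<sigma> n = nash_set K (toric_ring K \<sigma>) (monoid_algebra_const K) (toric_ord K n)"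

end

theory Submission
  imports Defs "HOL-Algebra.UnivPoly" "HOL-Algebra.Free_Abelian_Groups" "HOL-Library.Multiset_Order"
begin

text \<open>
  Let \<open>S\<close> be the monoid of characters that are regular on \<open>V\<close>, and let \<open>d m = \<langle>m, n\<rangle>\<close>. An arc on
  \<open>V\<close> with coefficients in a ring \<open>C\<close> is a monoid homomorphism \<open>\<phi>\<close> from \<open>S\<close> to \<open>C[[t]]\<close>.

  Suppose that \<open>C\<close> is complete for a topology in which the ideal \<open>N\<close> is topologically nilpotent,
  and that modulo \<open>N\<close> the series \<open>\<phi> m\<close> has order exactly \<open>d m\<close>, with invertible leading
  coefficient. Weierstrass preparation then gives unique factorizations \<open>\<phi> m = p m \<cdot> u m\<close>, where
  \<open>p m\<close> is a monic polynomial of degree \<open>d m\<close> with lower coefficients in \<open>N\<close>, and \<open>u m\<close> is a unit.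
  Uniqueness makes \<open>p\<close> and \<open>u\<close> multiplicative in \<open>m\<close> (\<open>weierstrass_arc_family\<close>), and since \<open>S\<close>
  generates the character lattice, \<open>u\<close> is an arc on the torus, that is, a choice of finitely many
  units \<open>c i\<close> of \<open>C[[t]]\<close> (\<open>torus_arc_param\<close>).

  Consequently the formal neighborhood of a point \<open>\<alpha>\<close> of the Nash set at which all characters have
  their generic order represents pairs \<open>(p, c)\<close>: a multiplicative family \<open>p\<close> of distinguished
  polynomials, and torus coordinates \<open>c\<close> that lift those of the residue field
  (\<open>coordinates_extend\<close>, \<open>coordinates_ext\<close>). The choice of \<open>p\<close> does not involve \<open>\<alpha>\<close>. If the torus
  coordinates in the residue field are lifted to constants, the deviations of the coefficients of
  \<open>c\<close> from these constants are countably many free variables. At a rational \<open>\<alpha>\<close> the residual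
  coordinates come from the ground field, so they are already constants.

  At the generic point \<open>\<eta>\<close> one needs a coefficient field that contains the torus coordinates. The
  universal arc \<open>t\<^sup>d \<cdot> u\<close> with \<open>u\<close> on the torus has coefficients in a domain, so its kernel is a
  point of the arc scheme. That point induces the valuation \<open>ord\<^sub>n\<close> (\<open>univ_pt_ord\<close>), hence it lies
  in the Nash set and contains \<open>\<eta>\<close>. Therefore every arc of the form \<open>t\<^sup>d \<cdot> u\<close>, over any ring, kills
  \<open>\<eta>\<close> (\<open>eta_killed\<close>). Applied to the torus part of the canonical arc on the formal neighborhood of
  \<open>\<eta>\<close>, this yields a section \<open>s\<close> of the residue map that carries the residual torus coordinates to
  the torus coordinates (\<open>section_exists\<close>). Over this coefficient field the formal neighborhood of
  \<open>\<eta>\<close> represents the families \<open>p\<close> alone, and adjoining countably many variables supplies the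
  deviations of the torus coordinates that are present at \<open>\<alpha>\<close> (\<open>formal_nbhds_iso\<close>).

  The points with generic orders contain an open subset of the Nash set around \<open>\<eta>\<close>, because it
  suffices to test one lattice point in the interior of the dual cone
  (\<open>generic_orders_if_interior\<close>).
\<close>

section \<open>Congruences modulo ideals\<close>

lemma (in abelian_group) minus_eq_zero_iff:
  assumes "x \<in> carrier G" "y \<in> carrier G"
  shows "x \<ominus> y = \<zero> \<longleftrightarrow> x = y"
proof
  assume "x \<ominus> y = \<zero>"
  then have "\<ominus> (\<ominus> y) = x" using assms by (intro minus_equality) (auto simp: a_minus_def)
  then show "x = y" using assms by simp
qed (use assms in \<open>simp add: a_minus_def r_neg\<close>)

lemma (in ring) coset_mem_iff:
  assumes "ideal I R" "a \<in> carrier R"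
  shows "a \<in> I \<longleftrightarrow> I +> a = I +> \<zero>"
  using quotient_eq_iff_same_a_r_cos[OF assms zero_closed] assms(2) by (simp add: a_minus_def)

lemma (in ring) coset_mem_cong:
  assumes "ideal I R" "a \<in> carrier R" "b \<in> carrier R" "I +> a = I +> b"
  shows "a \<in> I \<longleftrightarrow> b \<in> I"
  unfolding coset_mem_iff[OF assms(1,2)] coset_mem_iff[OF assms(1,3)] assms(4) by (rule refl)

lemma (in ring) coset_zero: "ideal I R \<Longrightarrow> I +> \<zero> = I"
  using a_coset_add_zero ideal.Icarr by (metis subsetI)

lemma (in cring) coset_cong:
  assumes I: "ideal I R" and c: "a \<in> carrier R" "b \<in> carrier R" "a' \<in> carrier R" "b' \<in> carrier R"
    and e: "I +> a = I +> a'" "I +> b = I +> b'"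
  shows "I +> (a \<oplus> b) = I +> (a' \<oplus> b')" "I +> (a \<otimes> b) = I +> (a' \<otimes> b')"
    "I +> (\<ominus> a) = I +> (\<ominus> a')" "I +> (a \<ominus> b) = I +> (a' \<ominus> b')"
proof -
  interpret I: ideal I R by fact
  interpret h: ring_hom_ring R "R Quot I" "(+>) I" by (rule I.rcos_ring_hom_ring)
  have 1: "I +> (a \<oplus> b) = I +> (a' \<oplus> b')" if "b \<in> carrier R" "b' \<in> carrier R" "I +> b = I +> b'" for b b'
    using h.hom_add[of a b] h.hom_add[of a' b'] that c e by simp
  show "I +> (a \<oplus> b) = I +> (a' \<oplus> b')" using 1 c e by blast
  show "I +> (a \<otimes> b) = I +> (a' \<otimes> b')"
    using h.hom_mult[of a b] h.hom_mult[of a' b'] c e by simp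
  show "I +> (\<ominus> a) = I +> (\<ominus> a')"
    using h.hom_a_inv[of a] h.hom_a_inv[of a'] c e by simp
  have "I +> (\<ominus> b) = I +> (\<ominus> b')"
    using h.hom_a_inv[of b] h.hom_a_inv[of b'] c e by simp
  then show "I +> (a \<ominus> b) = I +> (a' \<ominus> b')"
    unfolding a_minus_def using c by (intro 1) auto
qed

lemma (in ring) coset_mono:
  assumes "ideal I R" "ideal J R" "I \<subseteq> J" "a \<in> carrier R" "b \<in> carrier R" "I +> a = I +> b"
  shows "J +> a = J +> b"
  using assms quotient_eq_iff_same_a_r_cos by blast

lemma (in ring) coset_subset_iff:
  assumes "ideal I R" "ideal J R" "I \<subseteq> J" "a \<in> carrier R" "b \<in> carrier R"
  shows "I +> a \<subseteq> J +> b \<longleftrightarrow> J +> a = J +> b"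
proof -
  interpret I: ideal I R by fact
  interpret J: ideal J R by fact
  have 1: "I +> a \<subseteq> J +> a" using assms(3) unfolding a_r_coset_def' by blast
  have 2: "a \<in> I +> a" using assms by (intro I.a_rcos_self)
  show ?thesis
    using 1 2 assms J.a_repr_independence' by (metis subset_iff)
qed

lemma (in ring) ideal_power_ideal: "ideal I R \<Longrightarrow> ideal (ideal_power R I n) R"
  by (induction n) (auto simp: oneideal ideal_prod_is_ideal)

lemma (in ring) ideal_power_1: "ideal I R \<Longrightarrow> ideal_power R I (Suc 0) = I"
proof -
  assume I: "ideal I R"
  interpret I: ideal I R by fact
  have "x \<in> ideal_prod R I (carrier R)" if "x \<in> I" for x
    using ideal_prod.prod[of x I \<one> "carrier R" R] that by simp
  then show ?thesis using ideal_prod_inter[OF I oneideal] by auto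
qed

lemma (in ring) ideal_prod_subset:
  assumes "ideal Q R" "\<And>i j. i \<in> I \<Longrightarrow> j \<in> J \<Longrightarrow> i \<otimes> j \<in> Q"
  shows "I \<cdot> J \<subseteq> Q"
proof
  interpret Q: ideal Q R by fact
  fix x assume "x \<in> I \<cdot> J"
  then show "x \<in> Q" by induction (use assms(2) in auto)
qed

lemma (in ring) ideal_power_Suc_subset: "ideal I R \<Longrightarrow> ideal_power R I (Suc n) \<subseteq> ideal_power R I n"
  using ideal_prod_inter[OF _ ideal_power_ideal] by fastforce

lemma (in ring) ideal_power_mono: "ideal I R \<Longrightarrow> m \<le> n \<Longrightarrow> ideal_power R I n \<subseteq> ideal_power R I m"
  using lift_Suc_antimono_le[of "ideal_power R I"] ideal_power_Suc_subset by blast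

lemma (in ring) ideal_power_Suc_mem:
  "a \<in> I \<Longrightarrow> b \<in> ideal_power R I n \<Longrightarrow> a \<otimes> b \<in> ideal_power R I (Suc n)"
  by (simp add: ideal_prod.prod)

lemma ideal_power_hom:
  assumes R: "ring R" and S: "ring S" and h: "h \<in> ring_hom R S" and I: "ideal I R" and J: "ideal J S"
    and hI: "h ` I \<subseteq> J"
  shows "h ` ideal_power R I n \<subseteq> ideal_power S J n"
proof -
  interpret R: ring R by fact
  interpret S: ring S by fact
  interpret h: ring_hom_ring R S h by (rule ring_hom_ringI2) (use assms in auto)
  show ?thesis
  proof (induction n)
    case (Suc n)
    interpret Q: ideal "ideal_power S J (Suc n)" S by (rule S.ideal_power_ideal[OF J])
    interpret I: ideal I R by fact
    interpret In: ideal "ideal_power R I n" R by (rule R.ideal_power_ideal[OF I])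
    show ?case
    proof (rule image_subsetI)
      fix x assume "x \<in> ideal_power R I (Suc n)"
      then have x: "x \<in> ideal_prod R I (ideal_power R I n)" by simp
      have c: "y \<in> carrier R" if "y \<in> ideal_prod R I (ideal_power R I n)" for y
        using that R.ideal_prod_in_carrier[OF I R.ideal_power_ideal[OF I]] by blast
      show "h x \<in> ideal_power S J (Suc n)" using x
      proof induction
        case (prod i j)
        then have "h (i \<otimes>\<^bsub>R\<^esub> j) = h i \<otimes>\<^bsub>S\<^esub> h j" using I.Icarr In.Icarr by simp
        moreover have "h i \<in> J" "h j \<in> ideal_power S J n" using prod Suc hI by auto
        ultimately show ?case using S.ideal_power_Suc_mem by simp
      next
        case (sum s1 s2)
        then have "h (s1 \<oplus>\<^bsub>R\<^esub> s2) = h s1 \<oplus>\<^bsub>S\<^esub> h s2" using c by simp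
        then show ?case using sum Q.a_closed by simp
      qed
    qed
  qed auto
qed


section \<open>Complete topological rings\<close>

text \<open>
  The completed local rings and completed tensor products below are all of this kind. The last
  axiom says that \<open>nbhd R 1\<close> is topologically nilpotent; it is what makes the approximations in
  Weierstrass division converge.
\<close>

locale complete_top_ring = cring R for R :: "('a, 'b) top_ring_scheme" (structure) +
  assumes nbhd_ideal: "\<And>n. ideal (nbhd R n) R"
    and nbhd_decr: "\<And>n. nbhd R (Suc n) \<subseteq> nbhd R n"
    and nbhd_Inter: "\<And>x. x \<in> carrier R \<Longrightarrow> (\<And>n. x \<in> nbhd R n) \<Longrightarrow> x = \<zero>"
    and nbhd_complete: "\<And>x. (\<And>n. x n \<in> carrier R) \<Longrightarrow>
        (\<And>n. nbhd R n +> x (Suc n) = nbhd R n +> x n) \<Longrightarrow>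
        \<exists>y\<in>carrier R. \<forall>n. nbhd R n +> y = nbhd R n +> x n"
    and nilpotent: "\<And>n. \<exists>k. ideal_power R (nbhd R 1) k \<subseteq> nbhd R n"
begin

lemma nbhd_mono: "m \<le> n \<Longrightarrow> nbhd R n \<subseteq> nbhd R m"
  using lift_Suc_antimono_le[of "nbhd R"] nbhd_decr by blast

lemma eq_if_cong:
  assumes "x \<in> carrier R" "y \<in> carrier R" "\<And>n. nbhd R n +> x = nbhd R n +> y"
  shows "x = y"
proof -
  have "x \<ominus> y \<in> nbhd R n" for n
    using quotient_eq_iff_same_a_r_cos[OF nbhd_ideal assms(1,2)] assms(3) by blast
  then have "x \<ominus> y = \<zero>" using assms by (intro nbhd_Inter) auto
  then show ?thesis using assms by (metis minus_eq_zero_iff)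
qed

definition tends :: "(nat \<Rightarrow> 'a) \<Rightarrow> 'a \<Rightarrow> bool" where
  "tends x y \<longleftrightarrow> y \<in> carrier R \<and> (\<forall>n. \<exists>k. \<forall>j\<ge>k. nbhd R n +> y = nbhd R n +> x j)"

lemma tends_closed: "tends x y \<Longrightarrow> y \<in> carrier R"
  by (simp add: tends_def)

lemma tends_unique:
  assumes "tends x y" "tends x z" shows "y = z"
proof (rule eq_if_cong)
  fix n
  obtain k l where "\<forall>j\<ge>k. nbhd R n +> y = nbhd R n +> x j" "\<forall>j\<ge>l. nbhd R n +> z = nbhd R n +> x j"
    using assms unfolding tends_def by blast
  then have "nbhd R n +> y = nbhd R n +> x (max k l)" "nbhd R n +> z = nbhd R n +> x (max k l)" by auto
  then show "nbhd R n +> y = nbhd R n +> z" by simp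
qed (use assms tends_closed in auto)

lemma tends_cong:
  assumes "tends x y" "\<And>n. \<exists>k. \<forall>j\<ge>k. nbhd R n +> x j = nbhd R n +> x' j"
  shows "tends x' y"
  unfolding tends_def
proof (intro conjI allI)
  fix n
  obtain k where k: "\<forall>j\<ge>k. nbhd R n +> y = nbhd R n +> x j" using assms(1) unfolding tends_def by blast
  obtain l where l: "\<forall>j\<ge>l. nbhd R n +> x j = nbhd R n +> x' j" using assms(2)[of n] by blast
  show "\<exists>k. \<forall>j\<ge>k. nbhd R n +> y = nbhd R n +> x' j"
    using k l by (intro exI[of _ "max k l"] allI impI) (metis max.boundedE)
qed (rule tends_closed[OF assms(1)])

lemma tends_const: "y \<in> carrier R \<Longrightarrow> tends (\<lambda>_. y) y"
  by (simp add: tends_def)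

lemma tends_binop:
  assumes "\<And>j. x j \<in> carrier R" "\<And>j. x' j \<in> carrier R" "tends x y" "tends x' y'"
  shows "tends (\<lambda>j. x j \<oplus> x' j) (y \<oplus> y')" "tends (\<lambda>j. x j \<otimes> x' j) (y \<otimes> y')"
proof -
  have y: "y \<in> carrier R" "y' \<in> carrier R" using assms tends_closed by auto
  have *: "\<exists>k. \<forall>j\<ge>k. nbhd R n +> y = nbhd R n +> x j \<and> nbhd R n +> y' = nbhd R n +> x' j" for n
  proof -
    obtain k l where "\<forall>j\<ge>k. nbhd R n +> y = nbhd R n +> x j" "\<forall>j\<ge>l. nbhd R n +> y' = nbhd R n +> x' j"
      using assms(3,4) unfolding tends_def by blast
    then show ?thesis by (intro exI[of _ "max k l"]) auto
  qed
  show "tends (\<lambda>j. x j \<oplus> x' j) (y \<oplus> y')"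
    unfolding tends_def
  proof (intro conjI allI)
    fix n
    obtain k where "\<forall>j\<ge>k. nbhd R n +> y = nbhd R n +> x j \<and> nbhd R n +> y' = nbhd R n +> x' j"
      using *[of n] by blast
    then show "\<exists>k. \<forall>j\<ge>k. nbhd R n +> (y \<oplus> y') = nbhd R n +> (x j \<oplus> x' j)"
      using coset_cong(1)[OF nbhd_ideal y assms(1,2)] by (intro exI[of _ k] allI impI) simp
  qed (use y in simp)
  show "tends (\<lambda>j. x j \<otimes> x' j) (y \<otimes> y')"
    unfolding tends_def
  proof (intro conjI allI)
    fix n
    obtain k where "\<forall>j\<ge>k. nbhd R n +> y = nbhd R n +> x j \<and> nbhd R n +> y' = nbhd R n +> x' j"
      using *[of n] by blast
    then show "\<exists>k. \<forall>j\<ge>k. nbhd R n +> (y \<otimes> y') = nbhd R n +> (x j \<otimes> x' j)"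
      using coset_cong(2)[OF nbhd_ideal y assms(1,2)] by (intro exI[of _ k] allI impI) simp
  qed (use y in simp)
qed

lemma tends_in_nbhd:
  assumes "\<And>j. x j \<in> carrier R" "tends x y" "\<And>j. j \<ge> k \<Longrightarrow> x j \<in> nbhd R n"
  shows "y \<in> nbhd R n"
proof -
  obtain l where l: "\<forall>j\<ge>l. nbhd R n +> y = nbhd R n +> x j" using assms(2) unfolding tends_def by blast
  have "nbhd R n +> y = nbhd R n +> x (max k l)" using l by auto
  also have "\<dots> = nbhd R n +> \<zero>" using assms coset_mem_iff[OF nbhd_ideal] by auto
  finally show ?thesis using coset_mem_iff[OF nbhd_ideal] tends_closed[OF assms(2)] by blast
qed

lemma tends_exists:
  assumes x: "\<And>j. x j \<in> carrier R"
    and c: "\<And>n. \<exists>k. \<forall>j\<ge>k. nbhd R n +> x (Suc j) = nbhd R n +> x j"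
  shows "\<exists>y. tends x y"
proof -
  obtain k where k: "\<And>n j. j \<ge> k n \<Longrightarrow> nbhd R n +> x (Suc j) = nbhd R n +> x j"
    using c by metis
  define l where "l n = (\<Sum>i\<le>n. k i)" for n
  have kl: "k n \<le> l n" for n unfolding l_def by (rule member_le_sum) auto
  have lS: "l n \<le> l (Suc n)" for n by (simp add: l_def)
  have st: "nbhd R n +> x j = nbhd R n +> x (l n)" if "j \<ge> l n" for n j
    using that
  proof (induction j rule: dec_induct)
    case (step j)
    then show ?case using k[of n j] kl[of n] by simp
  qed simp
  obtain y where y: "y \<in> carrier R" "\<forall>n. nbhd R n +> y = nbhd R n +> x (l n)"
    using nbhd_complete[of "\<lambda>n. x (l n)"] x st[OF lS] by blast
  then have "tends x y" unfolding tends_def using st by metis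
  then show ?thesis ..
qed

lemma in_powers_zero:
  assumes "x \<in> carrier R" "\<And>k. x \<in> ideal_power R (nbhd R 1) k"
  shows "x = \<zero>"
  using assms nilpotent by (intro nbhd_Inter) blast+

end

text \<open>
  Besides continuity, \<open>nbhd R 1\<close> has to be respected: that ideal determines which polynomials are
  distinguished, so these homomorphisms preserve Weierstrass factorizations.
\<close>

definition adic_hom :: "('a, 'e) top_ring_scheme \<Rightarrow> ('b, 'f) top_ring_scheme \<Rightarrow> ('a \<Rightarrow> 'b) set" where
  "adic_hom R S = {h \<in> ring_hom R S. h ` nbhd R 1 \<subseteq> nbhd S 1 \<and> (\<forall>n. \<exists>k. h ` nbhd R k \<subseteq> nbhd S n)}"

lemma adic_hom_hom: "h \<in> adic_hom R S \<Longrightarrow> h \<in> ring_hom R S"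
  by (simp add: adic_hom_def)

lemma adic_hom_1: "h \<in> adic_hom R S \<Longrightarrow> x \<in> nbhd R 1 \<Longrightarrow> h x \<in> nbhd S 1"
  unfolding adic_hom_def by blast

lemma adic_hom_cont: "h \<in> adic_hom R S \<Longrightarrow> \<exists>k. h ` nbhd R k \<subseteq> nbhd S n"
  unfolding adic_hom_def by blast

lemma adic_hom_id: "id \<in> adic_hom R R"
  by (auto simp: adic_hom_def ring_hom_def)

lemma adic_hom_trans:
  assumes "f \<in> adic_hom R S" "g \<in> adic_hom S T"
  shows "g \<circ> f \<in> adic_hom R T"
proof -
  have "\<exists>k. (g \<circ> f) ` nbhd R k \<subseteq> nbhd T n" for n
  proof -
    obtain l where l: "g ` nbhd S l \<subseteq> nbhd T n" using assms(2) unfolding adic_hom_def by blast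
    obtain k where "f ` nbhd R k \<subseteq> nbhd S l" using assms(1) unfolding adic_hom_def by blast
    then show ?thesis using l by (intro exI[of _ k]) (auto simp: image_subset_iff)
  qed
  then show ?thesis using assms ring_hom_trans[of f R S g T] by (auto simp: adic_hom_def image_subset_iff)
qed


section \<open>Completions\<close>

locale filtered_ring = cring R for R :: "('a, 'b) ring_scheme" (structure) +
  fixes F :: "nat \<Rightarrow> 'a set"
  assumes F_ideal: "\<And>n. ideal (F n) R"
    and F_decr: "\<And>n. F (Suc n) \<subseteq> F n"
    and F_nilpotent: "\<And>n. \<exists>k. ideal_power R (F 1) k \<subseteq> F n"
begin

abbreviation "Compl \<equiv> completion R F"

text \<open>
  Elements of the completion are handled through coherent sequences of representatives in \<open>R\<close>, on
  which the ring operations are pointwise and continuous maps can be applied before passing to the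
  limit.
\<close>

definition coherent :: "(nat \<Rightarrow> 'a) \<Rightarrow> bool" where
  "coherent r \<longleftrightarrow> (\<forall>n. r n \<in> carrier R \<and> F n +> r (Suc n) = F n +> r n)"

definition pt :: "(nat \<Rightarrow> 'a) \<Rightarrow> nat \<Rightarrow> 'a set" where
  "pt r = (\<lambda>n. F n +> r n)"

lemma F_mono: "m \<le> n \<Longrightarrow> F n \<subseteq> F m"
  using lift_Suc_antimono_le[of F] F_decr by blast

lemma quot_carrier: "X \<in> carrier (R Quot F n) \<longleftrightarrow> (\<exists>a\<in>carrier R. X = F n +> a)"
  by (auto simp: FactRing_def A_RCOSETS_def')

lemma coherent_stable:
  assumes "coherent r" "n \<le> j" shows "F n +> r j = F n +> r n"
  using assms(2)
proof (induction j rule: dec_induct)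
  case (step j)
  have "F n +> r (Suc j) = F n +> r j"
    by (rule coset_mono[OF F_ideal F_ideal F_mono]) (use assms step in \<open>auto simp: coherent_def\<close>)
  then show ?case using step by simp
qed simp

lemma carrier_Compl: "x \<in> carrier Compl \<longleftrightarrow> (\<exists>r. coherent r \<and> x = pt r)"
proof
  assume "x \<in> carrier Compl"
  then have x: "\<And>n. x n \<in> carrier (R Quot F n)" "\<And>n. x (Suc n) \<subseteq> x n"
    by (auto simp: completion_def Let_def)
  obtain r where r: "\<And>n. r n \<in> carrier R" "\<And>n. x n = F n +> r n"
    using x(1) unfolding quot_carrier by metis
  then have "coherent r" using x(2) coset_subset_iff[OF F_ideal F_ideal F_decr] by (auto simp: coherent_def)
  moreover have "x = pt r" using r by (auto simp: pt_def)
  ultimately show "\<exists>r. coherent r \<and> x = pt r" by blast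
next
  assume "\<exists>r. coherent r \<and> x = pt r"
  then obtain r where r: "coherent r" "x = pt r" by blast
  have "F (Suc n) +> r (Suc n) \<subseteq> F n +> r n" for n
    using coset_subset_iff[OF F_ideal F_ideal F_decr] r(1) unfolding coherent_def by blast
  moreover have "F n +> r n \<in> carrier (R Quot F n)" for n
    unfolding quot_carrier using r(1) unfolding coherent_def by blast
  ultimately show "x \<in> carrier Compl" by (simp add: r(2) completion_def Let_def pt_def)
qed

lemma pt_eq_iff: "pt r = pt s \<longleftrightarrow> (\<forall>n. F n +> r n = F n +> s n)"
  by (auto simp: pt_def fun_eq_iff)

lemma pt_closed [simp]: "coherent r \<Longrightarrow> pt r \<in> carrier Compl"
  using carrier_Compl by blast

lemma coherent_closed: "coherent r \<Longrightarrow> r n \<in> carrier R"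
  by (simp add: coherent_def)

lemma quot_hom: "ring_hom_ring R (R Quot F n) ((+>) (F n))"
  using ideal.rcos_ring_hom_ring[OF F_ideal] .

lemma
  assumes "coherent r" "coherent s"
  shows pt_add: "pt r \<oplus>\<^bsub>Compl\<^esub> pt s = pt (\<lambda>n. r n \<oplus> s n)"
    and pt_mult: "pt r \<otimes>\<^bsub>Compl\<^esub> pt s = pt (\<lambda>n. r n \<otimes> s n)"
proof -
  have "(F n +> r n) \<oplus>\<^bsub>R Quot F n\<^esub> (F n +> s n) = F n +> (r n \<oplus> s n)"
    "(F n +> r n) \<otimes>\<^bsub>R Quot F n\<^esub> (F n +> s n) = F n +> (r n \<otimes> s n)" for n
  proof -
    interpret h: ring_hom_ring R "R Quot F n" "(+>) (F n)" by (rule quot_hom)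
    show "(F n +> r n) \<oplus>\<^bsub>R Quot F n\<^esub> (F n +> s n) = F n +> (r n \<oplus> s n)"
      "(F n +> r n) \<otimes>\<^bsub>R Quot F n\<^esub> (F n +> s n) = F n +> (r n \<otimes> s n)"
      using assms coherent_closed by auto
  qed
  then show "pt r \<oplus>\<^bsub>Compl\<^esub> pt s = pt (\<lambda>n. r n \<oplus> s n)" "pt r \<otimes>\<^bsub>Compl\<^esub> pt s = pt (\<lambda>n. r n \<otimes> s n)"
    by (auto simp: completion_def Let_def pt_def)
qed

lemma
  shows pt_one: "\<one>\<^bsub>Compl\<^esub> = pt (\<lambda>n. \<one>)" and pt_zero: "\<zero>\<^bsub>Compl\<^esub> = pt (\<lambda>n. \<zero>)"
proof -
  have "\<one>\<^bsub>R Quot F n\<^esub> = F n +> \<one>" "\<zero>\<^bsub>R Quot F n\<^esub> = F n +> \<zero>" for n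
  proof -
    interpret h: ring_hom_ring R "R Quot F n" "(+>) (F n)" by (rule quot_hom)
    show "\<one>\<^bsub>R Quot F n\<^esub> = F n +> \<one>" "\<zero>\<^bsub>R Quot F n\<^esub> = F n +> \<zero>" by simp_all
  qed
  then show "\<one>\<^bsub>Compl\<^esub> = pt (\<lambda>n. \<one>)" "\<zero>\<^bsub>Compl\<^esub> = pt (\<lambda>n. \<zero>)"
    by (auto simp: completion_def Let_def pt_def)
qed

lemma coherent_ops:
  assumes "coherent r" "coherent s"
  shows "coherent (\<lambda>n. r n \<oplus> s n)" "coherent (\<lambda>n. r n \<otimes> s n)" "coherent (\<lambda>n. \<ominus> r n)"
  using assms coset_cong(1-3)[OF F_ideal, of "r (Suc _)" "s (Suc _)" "r _" "s _"] unfolding coherent_def by simp_all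

lemma coherent_const: "a \<in> carrier R \<Longrightarrow> coherent (\<lambda>n. a)"
  by (simp add: coherent_def)

lemma Compl_cring: "cring Compl"
proof (rule cringI)
  show "abelian_group Compl"
  proof (rule abelian_groupI)
    show "\<zero>\<^bsub>Compl\<^esub> \<in> carrier Compl" by (simp add: pt_zero coherent_const)
    fix x y z assume "x \<in> carrier Compl"
    then obtain r where r: "coherent r" "x = pt r" using carrier_Compl by blast
    have "pt (\<lambda>n. \<ominus> r n) \<oplus>\<^bsub>Compl\<^esub> x = \<zero>\<^bsub>Compl\<^esub>"
      unfolding r(2) using r(1) by (simp add: pt_add coherent_ops pt_zero coherent_closed l_neg)
    then show "\<exists>y\<in>carrier Compl. y \<oplus>\<^bsub>Compl\<^esub> x = \<zero>\<^bsub>Compl\<^esub>"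
      using r coherent_ops by (meson pt_closed)
    show "\<zero>\<^bsub>Compl\<^esub> \<oplus>\<^bsub>Compl\<^esub> x = x"
      unfolding r(2) using r(1) by (simp add: pt_add pt_zero coherent_const coherent_closed)
    assume "y \<in> carrier Compl"
    then obtain s where s: "coherent s" "y = pt s" using carrier_Compl by blast
    show "x \<oplus>\<^bsub>Compl\<^esub> y \<in> carrier Compl" unfolding r s using r s by (simp add: pt_add coherent_ops)
    show "x \<oplus>\<^bsub>Compl\<^esub> y = y \<oplus>\<^bsub>Compl\<^esub> x" unfolding r s using r s by (simp add: pt_add coherent_closed a_comm)
    assume "z \<in> carrier Compl"
    then obtain t where t: "coherent t" "z = pt t" using carrier_Compl by blast
    show "x \<oplus>\<^bsub>Compl\<^esub> y \<oplus>\<^bsub>Compl\<^esub> z = x \<oplus>\<^bsub>Compl\<^esub> (y \<oplus>\<^bsub>Compl\<^esub> z)"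
      unfolding r s t using r s t by (simp add: pt_add coherent_ops coherent_closed a_assoc)
  qed
  show "comm_monoid Compl"
  proof (rule comm_monoidI)
    show "\<one>\<^bsub>Compl\<^esub> \<in> carrier Compl" by (simp add: pt_one coherent_const)
    fix x y z assume "x \<in> carrier Compl"
    then obtain r where r: "coherent r" "x = pt r" using carrier_Compl by blast
    show "\<one>\<^bsub>Compl\<^esub> \<otimes>\<^bsub>Compl\<^esub> x = x"
      unfolding r(2) using r(1) by (simp add: pt_mult pt_one coherent_const coherent_closed)
    assume "y \<in> carrier Compl"
    then obtain s where s: "coherent s" "y = pt s" using carrier_Compl by blast
    show "x \<otimes>\<^bsub>Compl\<^esub> y \<in> carrier Compl" unfolding r s using r s by (simp add: pt_mult coherent_ops)
    show "x \<otimes>\<^bsub>Compl\<^esub> y = y \<otimes>\<^bsub>Compl\<^esub> x" unfolding r s using r s by (simp add: pt_mult coherent_closed m_comm)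
    assume "z \<in> carrier Compl"
    then obtain t where t: "coherent t" "z = pt t" using carrier_Compl by blast
    show "x \<otimes>\<^bsub>Compl\<^esub> y \<otimes>\<^bsub>Compl\<^esub> z = x \<otimes>\<^bsub>Compl\<^esub> (y \<otimes>\<^bsub>Compl\<^esub> z)"
      unfolding r s t using r s t by (simp add: pt_mult coherent_ops coherent_closed m_assoc)
  qed
  fix x y z assume "x \<in> carrier Compl" "y \<in> carrier Compl" "z \<in> carrier Compl"
  then obtain r s t where r: "coherent r" "x = pt r" and s: "coherent s" "y = pt s"
    and t: "coherent t" "z = pt t" using carrier_Compl by blast
  show "(x \<oplus>\<^bsub>Compl\<^esub> y) \<otimes>\<^bsub>Compl\<^esub> z = x \<otimes>\<^bsub>Compl\<^esub> z \<oplus>\<^bsub>Compl\<^esub> y \<otimes>\<^bsub>Compl\<^esub> z"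
    unfolding r s t using r s t by (simp add: pt_add pt_mult coherent_ops coherent_closed l_distr)
qed

sublocale Compl: cring Compl by (rule Compl_cring)

lemma nbhd_Compl: "nbhd Compl n = {x \<in> carrier Compl. x n = F n}"
  by (auto simp: completion_def Let_def FactRing_def)

lemma proj_hom: "(\<lambda>x. x n) \<in> ring_hom Compl (R Quot F n)"
  by (rule ring_hom_memI) (auto simp: completion_def Let_def)

lemma proj_hom_ring: "ring_hom_ring Compl (R Quot F n) (\<lambda>x. x n)"
  by (rule ring_hom_ringI2) (use Compl.ring_axioms ideal.quotient_is_ring[OF F_ideal] proj_hom in auto)

lemma pt_in_nbhd:
  assumes r: "coherent r"
  shows "pt r \<in> nbhd Compl n \<longleftrightarrow> r n \<in> F n"
proof -
  have "pt r \<in> nbhd Compl n \<longleftrightarrow> F n +> r n = F n"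
    unfolding nbhd_Compl mem_Collect_eq using pt_closed[OF r] by (simp add: pt_def)
  then show ?thesis
    unfolding coset_mem_iff[OF F_ideal coherent_closed[OF r]] coset_zero[OF F_ideal] .
qed

lemma nbhd_Compl_ideal: "ideal (nbhd Compl n) Compl"
proof -
  interpret h: ring_hom_ring Compl "R Quot F n" "\<lambda>x. x n" by (rule proj_hom_ring)
  have "nbhd Compl n = a_kernel Compl (R Quot F n) (\<lambda>x. x n)"
    unfolding nbhd_Compl a_kernel_def' by (simp add: FactRing_def)
  then show ?thesis using h.kernel_is_ideal by simp
qed

lemma coset_Compl_iff:
  assumes "x \<in> carrier Compl" "y \<in> carrier Compl"
  shows "nbhd Compl n +>\<^bsub>Compl\<^esub> x = nbhd Compl n +>\<^bsub>Compl\<^esub> y \<longleftrightarrow> x n = y n"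
proof -
  interpret h: ring_hom_ring Compl "R Quot F n" "\<lambda>x. x n" by (rule proj_hom_ring)
  have "nbhd Compl n +>\<^bsub>Compl\<^esub> x = nbhd Compl n +>\<^bsub>Compl\<^esub> y \<longleftrightarrow> x \<ominus>\<^bsub>Compl\<^esub> y \<in> nbhd Compl n"
    by (rule Compl.quotient_eq_iff_same_a_r_cos[OF nbhd_Compl_ideal assms, symmetric])
  also have "\<dots> \<longleftrightarrow> (x \<ominus>\<^bsub>Compl\<^esub> y) n = \<zero>\<^bsub>R Quot F n\<^esub>"
    using assms by (simp add: nbhd_Compl FactRing_def)
  also have "(x \<ominus>\<^bsub>Compl\<^esub> y) n = x n \<ominus>\<^bsub>R Quot F n\<^esub> y n"
    using assms unfolding a_minus_def by simp
  also have "\<dots> = \<zero>\<^bsub>R Quot F n\<^esub> \<longleftrightarrow> x n = y n"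
    using assms by (intro h.S.minus_eq_zero_iff) (auto simp: h.hom_closed)
  finally show ?thesis .
qed

text \<open>
  Topological nilpotency passes to the completion. The index \<open>Suc n\<close> occurs because an element of
  \<open>nbhd Compl 1\<close> has representatives in \<open>F 1\<close> only at positive indices.
\<close>

lemma ideal_power_Compl:
  assumes "x \<in> ideal_power Compl (nbhd Compl 1) k"
  shows "\<exists>a\<in>ideal_power R (F 1) k. x (Suc n) = F (Suc n) +> a"
  using assms
proof (induction k arbitrary: x)
  case 0
  then have "x \<in> carrier Compl" by simp
  then obtain r where "coherent r" "x = pt r" using carrier_Compl by blast
  then show ?case by (auto simp: pt_def coherent_def)
next
  case (Suc k)
  let ?Q = "R Quot F (Suc n)"
  interpret h: ring_hom_ring R ?Q "(+>) (F (Suc n))" by (rule quot_hom)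
  interpret J: ideal "ideal_power R (F 1) (Suc k)" R by (rule ideal_power_ideal[OF F_ideal])
  interpret Jk: ideal "ideal_power R (F 1) k" R by (rule ideal_power_ideal[OF F_ideal])
  interpret I: ideal "F 1" R by (rule F_ideal)
  have "x \<in> ideal_prod Compl (nbhd Compl 1) (ideal_power Compl (nbhd Compl 1) k)" using Suc.prems by simp
  then show ?case
  proof induction
    case (prod i j)
    obtain r where r: "coherent r" "i = pt r" using prod(1) carrier_Compl by (auto simp: nbhd_Compl)
    have "r 1 \<in> F 1" using pt_in_nbhd r prod(1) by blast
    have rF: "F 1 +> r (Suc n) = F 1 +> r 1" using coherent_stable[OF r(1), of 1 "Suc n"] by simp
    then have rn: "r (Suc n) \<in> F 1"
      using coset_mem_cong[OF F_ideal _ _ rF] \<open>r 1 \<in> F 1\<close> coherent_closed[OF r(1)] by blast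
    obtain b where b: "b \<in> ideal_power R (F 1) k" "j (Suc n) = F (Suc n) +> b" using Suc.IH[OF prod(2)] by blast
    have "(i \<otimes>\<^bsub>Compl\<^esub> j) (Suc n) = i (Suc n) \<otimes>\<^bsub>?Q\<^esub> j (Suc n)" by (simp add: completion_def Let_def)
    also have "\<dots> = F (Suc n) +> (r (Suc n) \<otimes> b)"
      using b rn I.Icarr Jk.Icarr by (simp add: r pt_def)
    finally show ?case using ideal_power_Suc_mem[OF rn b(1)] by blast
  next
    case (sum s1 s2)
    then obtain a b where ab: "a\<in>ideal_power R (F 1) (Suc k)" "s1 (Suc n) = F (Suc n) +> a"
      "b\<in>ideal_power R (F 1) (Suc k)" "s2 (Suc n) = F (Suc n) +> b" by blast
    have "(s1 \<oplus>\<^bsub>Compl\<^esub> s2) (Suc n) = s1 (Suc n) \<oplus>\<^bsub>?Q\<^esub> s2 (Suc n)" by (simp add: completion_def Let_def)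
    also have "\<dots> = F (Suc n) +> (a \<oplus> b)"
      using ab J.Icarr by simp
    finally show ?case using J.a_closed ab by blast
  qed
qed

lemma complete_top_ring_Compl: "complete_top_ring Compl"
proof (intro complete_top_ring.intro complete_top_ring_axioms.intro Compl_cring)
  show "ideal (nbhd Compl n) Compl" for n by (rule nbhd_Compl_ideal)
  show decr: "nbhd Compl (Suc n) \<subseteq> nbhd Compl n" for n
  proof
    fix x assume x: "x \<in> nbhd Compl (Suc n)"
    then obtain r where r: "coherent r" "x = pt r" using carrier_Compl by (auto simp: nbhd_Compl)
    have "r (Suc n) \<in> F n" using x r pt_in_nbhd F_decr by blast
    moreover have "F n +> r (Suc n) = F n +> r n" using r(1) by (simp add: coherent_def)
    ultimately have "r n \<in> F n" using coset_mem_cong[OF F_ideal] coherent_closed[OF r(1)] by blast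
    then show "x \<in> nbhd Compl n" using r pt_in_nbhd by blast
  qed
  show "x = \<zero>\<^bsub>Compl\<^esub>" if "x \<in> carrier Compl" "\<And>n. x \<in> nbhd Compl n" for x
    using that by (auto simp: nbhd_Compl completion_def Let_def FactRing_def)
  show "\<exists>k. ideal_power Compl (nbhd Compl 1) k \<subseteq> nbhd Compl n" for n
  proof -
    obtain k where k: "ideal_power R (F 1) k \<subseteq> F (Suc n)" using F_nilpotent by blast
    have "x \<in> nbhd Compl (Suc n)" if x: "x \<in> ideal_power Compl (nbhd Compl 1) k" for x
    proof -
      have c: "x \<in> carrier Compl"
        by (rule ideal.Icarr[OF Compl.ideal_power_ideal[OF nbhd_Compl_ideal] x])
      obtain a where a: "a\<in>ideal_power R (F 1) k" "x (Suc n) = F (Suc n) +> a"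
        using ideal_power_Compl[OF x, of n] by blast
      then have "a \<in> F (Suc n)" using k by blast
      then have "x (Suc n) = F (Suc n)"
        unfolding a(2) coset_mem_iff[OF F_ideal ideal.Icarr[OF F_ideal \<open>a \<in> F (Suc n)\<close>]]
        by (simp add: coset_zero[OF F_ideal])
      then show ?thesis using c by (simp add: nbhd_Compl)
    qed
    then show ?thesis using decr[of n] by (intro exI[of _ k] subsetI) (rule subsetD)
  qed
  fix x assume x: "\<And>n. x n \<in> carrier Compl"
    "\<And>n. nbhd Compl n +>\<^bsub>Compl\<^esub> x (Suc n) = nbhd Compl n +>\<^bsub>Compl\<^esub> x n"
  have x2: "x (Suc n) n = x n n" for n using coset_Compl_iff[OF x(1) x(1)] x(2) by simp
  have xc: "x n m \<in> carrier (R Quot F m)" "x n (Suc m) \<subseteq> x n m" for n m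
    using x(1)[of n] by (auto simp: completion_def Let_def)
  have "x (Suc n) (Suc n) \<subseteq> x n n" for n using xc(2)[of "Suc n" n] unfolding x2 .
  then have "(\<lambda>n. x n n) \<in> carrier Compl"
    using xc(1) by (simp add: completion_def Let_def)
  then show "\<exists>y\<in>carrier Compl. \<forall>n. nbhd Compl n +>\<^bsub>Compl\<^esub> y = nbhd Compl n +>\<^bsub>Compl\<^esub> x n"
    using coset_Compl_iff[OF _ x(1)] by (intro bexI[of _ "\<lambda>n. x n n"] allI) simp_all
qed

lemma completion_map_pt: "completion_map R F a = pt (\<lambda>n. a)"
  by (auto simp: completion_map_def pt_def)

lemma completion_map_hom: "completion_map R F \<in> ring_hom R Compl"
  by (rule ring_hom_memI)
     (simp_all add: completion_map_pt coherent_const pt_add pt_mult pt_one)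

lemma completion_map_nbhd: "a \<in> F n \<Longrightarrow> completion_map R F a \<in> nbhd Compl n"
  using ideal.Icarr[OF F_ideal] by (simp add: completion_map_pt pt_in_nbhd coherent_const)

text \<open>
  A continuous homomorphism sends coherent sequences to Cauchy sequences; the extension is the
  limit.
\<close>

lemma completion_extend:
  assumes C: "complete_top_ring C" and f: "f \<in> ring_hom R C"
    and f1: "f ` F 1 \<subseteq> nbhd C 1" and fn: "\<And>n. \<exists>k. f ` F k \<subseteq> nbhd C n"
  shows "\<exists>h\<in>adic_hom Compl C. \<forall>a\<in>carrier R. h (completion_map R F a) = f a"
proof -
  interpret C: complete_top_ring C by fact
  interpret f: ring_hom_ring R C f by (rule ring_hom_ringI2) (use f ring_axioms C.ring_axioms in auto)
  have fcong: "nbhd C n +>\<^bsub>C\<^esub> f a = nbhd C n +>\<^bsub>C\<^esub> f b"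
    if "f ` F k \<subseteq> nbhd C n" "a \<in> carrier R" "b \<in> carrier R" "F k +> a = F k +> b" for k n a b
  proof -
    have "a \<ominus> b \<in> F k" by (rule iffD2[OF quotient_eq_iff_same_a_r_cos[OF F_ideal that(2,3)] that(4)])
    then have "f (a \<ominus> b) \<in> nbhd C n" using that(1) by (simp add: image_subset_iff)
    moreover have "f (a \<ominus> b) = f a \<ominus>\<^bsub>C\<^esub> f b" using that(2,3) by (simp add: a_minus_def)
    ultimately have "f a \<ominus>\<^bsub>C\<^esub> f b \<in> nbhd C n" by simp
    then show ?thesis
      using C.quotient_eq_iff_same_a_r_cos[OF C.nbhd_ideal, of "f a" "f b" n] that(2,3) by simp
  qed
  have ex: "\<exists>y. C.tends (\<lambda>j. f (r j)) y" if r: "coherent r" for r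
  proof (rule C.tends_exists)
    show "f (r j) \<in> carrier C" for j using r coherent_closed by simp
    fix n
    obtain k where k: "f ` F k \<subseteq> nbhd C n" using fn by blast
    have "nbhd C n +>\<^bsub>C\<^esub> f (r (Suc j)) = nbhd C n +>\<^bsub>C\<^esub> f (r j)" if "j \<ge> k" for j
    proof (rule fcong[OF k])
      show "F k +> r (Suc j) = F k +> r j"
        using coherent_stable[OF r, of k j] coherent_stable[OF r, of k "Suc j"] that by simp
    qed (use r coherent_closed in auto)
    then show "\<exists>k. \<forall>j\<ge>k. nbhd C n +>\<^bsub>C\<^esub> f (r (Suc j)) = nbhd C n +>\<^bsub>C\<^esub> f (r j)"
      by (intro exI[of _ k] allI impI)
  qed
  have cong: "C.tends (\<lambda>j. f (s j)) y"
    if r: "coherent r" and s: "coherent s" and rs: "pt r = pt s" and y: "C.tends (\<lambda>j. f (r j)) y" for r s y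
  proof (rule C.tends_cong[OF y])
    fix n
    obtain k where k: "f ` F k \<subseteq> nbhd C n" using fn by blast
    have "nbhd C n +>\<^bsub>C\<^esub> f (r j) = nbhd C n +>\<^bsub>C\<^esub> f (s j)" if "j \<ge> k" for j
    proof (rule fcong[OF k])
      show "F k +> r j = F k +> s j"
        using coherent_stable[OF r that] coherent_stable[OF s that] rs by (simp add: pt_eq_iff)
    qed (use r s coherent_closed in auto)
    then show "\<exists>k. \<forall>j\<ge>k. nbhd C n +>\<^bsub>C\<^esub> f (r j) = nbhd C n +>\<^bsub>C\<^esub> f (s j)"
      by (intro exI[of _ k] allI impI)
  qed
  define h where "h x = (THE y. \<exists>r. coherent r \<and> x = pt r \<and> C.tends (\<lambda>j. f (r j)) y)" for x
  have h: "h (pt r) = y" if "coherent r" "C.tends (\<lambda>j. f (r j)) y" for r y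
    unfolding h_def
  proof (rule the_equality)
    show "\<exists>s. coherent s \<and> pt r = pt s \<and> C.tends (\<lambda>j. f (s j)) y" using that by blast
    fix z assume "\<exists>s. coherent s \<and> pt r = pt s \<and> C.tends (\<lambda>j. f (s j)) z"
    then obtain s where s: "coherent s" "pt r = pt s" "C.tends (\<lambda>j. f (s j)) z" by blast
    have "C.tends (\<lambda>j. f (r j)) z" using s by (intro cong[OF s(1) that(1)]) auto
    then show "z = y" using C.tends_unique that(2) by blast
  qed
  have ht: "C.tends (\<lambda>j. f (r j)) (h (pt r))" if "coherent r" for r
    using ex[OF that] h[OF that] by auto
  have hm: "h (completion_map R F a) = f a" if "a \<in> carrier R" for a
    unfolding completion_map_pt using that by (intro h) (auto simp: coherent_const C.tends_const)
  have "h \<in> ring_hom Compl C"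
  proof (rule ring_hom_memI)
    fix x assume "x \<in> carrier Compl"
    then obtain r where r: "coherent r" "x = pt r" using carrier_Compl by blast
    show "h x \<in> carrier C" using ht r C.tends_closed by blast
    fix y assume "y \<in> carrier Compl"
    then obtain s where s: "coherent s" "y = pt s" using carrier_Compl by blast
    have c: "\<And>j. f (r j) \<in> carrier C" "\<And>j. f (s j) \<in> carrier C" using r s coherent_closed by auto
    note b = C.tends_binop[OF c ht[OF r(1)] ht[OF s(1)]]
    show "h (x \<otimes>\<^bsub>Compl\<^esub> y) = h x \<otimes>\<^bsub>C\<^esub> h y"
      unfolding r(2) s(2) pt_mult[OF r(1) s(1)]
      by (rule h[OF coherent_ops(2)[OF r(1) s(1)]]) (use b(2) r s coherent_closed in simp)
    show "h (x \<oplus>\<^bsub>Compl\<^esub> y) = h x \<oplus>\<^bsub>C\<^esub> h y"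
      unfolding r(2) s(2) pt_add[OF r(1) s(1)]
      by (rule h[OF coherent_ops(1)[OF r(1) s(1)]]) (use b(1) r s coherent_closed in simp)
  next
    show "h \<one>\<^bsub>Compl\<^esub> = \<one>\<^bsub>C\<^esub>" using hm[of \<one>] by (simp add: ring_hom_one[OF completion_map_hom])
  qed
  moreover have hn: "h ` nbhd Compl k \<subseteq> nbhd C n" if k: "f ` F k \<subseteq> nbhd C n" for n k
  proof (rule image_subsetI)
    fix x assume x: "x \<in> nbhd Compl k"
    then obtain r where r: "coherent r" "x = pt r" using carrier_Compl by (auto simp: nbhd_Compl)
    have rk: "r k \<in> F k" using x r pt_in_nbhd by blast
    have "r j \<in> F k" if "j \<ge> k" for j
      using coset_mem_cong[OF F_ideal _ _ coherent_stable[OF r(1) that]] rk coherent_closed[OF r(1)] by blast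
    then have fr: "f (r j) \<in> nbhd C n" if "j \<ge> k" for j using k that by blast
    show "h x \<in> nbhd C n"
      unfolding r(2)
    proof (rule C.tends_in_nbhd[OF _ ht[OF r(1)]])
      show "f (r j) \<in> carrier C" for j using coherent_closed[OF r(1)] by simp
    qed (rule fr)
  qed
  moreover have "\<exists>k. h ` nbhd Compl k \<subseteq> nbhd C n" for n using fn[of n] hn[of _ n] by metis
  moreover have "h ` nbhd Compl 1 \<subseteq> nbhd C 1" using hn[OF f1] .
  ultimately have "h \<in> adic_hom Compl C" unfolding adic_hom_def by simp
  then show ?thesis using hm by (intro bexI[of _ h] ballI)
qed

text \<open>
  The image of \<open>R\<close> is dense in the completion.
\<close>

lemma completion_hom_ext:
  assumes C: "complete_top_ring C" and h: "h \<in> adic_hom Compl C" and h': "h' \<in> adic_hom Compl C"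
    and eq: "\<And>a. a \<in> carrier R \<Longrightarrow> h (completion_map R F a) = h' (completion_map R F a)"
    and x: "x \<in> carrier Compl"
  shows "h x = h' x"
proof -
  interpret C: complete_top_ring C by fact
  interpret h: ring_hom_ring Compl C h
    by (rule ring_hom_ringI2) (use h Compl.ring_axioms C.ring_axioms in \<open>auto simp: adic_hom_def\<close>)
  interpret h': ring_hom_ring Compl C h'
    by (rule ring_hom_ringI2) (use h' Compl.ring_axioms C.ring_axioms in \<open>auto simp: adic_hom_def\<close>)
  interpret Co: complete_top_ring Compl by (rule complete_top_ring_Compl)
  obtain r where r: "coherent r" "x = pt r" using carrier_Compl x by blast
  have hc: "nbhd C n +>\<^bsub>C\<^esub> g x = nbhd C n +>\<^bsub>C\<^esub> g (completion_map R F (r k))"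
    if g: "ring_hom_ring Compl C g" and k: "g ` nbhd Compl k \<subseteq> nbhd C n" for g n k
  proof -
    interpret g: ring_hom_ring Compl C g by fact
    have rc: "completion_map R F (r k) \<in> carrier Compl"
      using ring_hom_closed[OF completion_map_hom] coherent_closed[OF r(1)] .
    have "x k = completion_map R F (r k) k" by (simp add: r completion_map_def pt_def)
    then have "x \<ominus>\<^bsub>Compl\<^esub> completion_map R F (r k) \<in> nbhd Compl k"
      unfolding Compl.quotient_eq_iff_same_a_r_cos[OF nbhd_Compl_ideal x rc] coset_Compl_iff[OF x rc] .
    then have "g (x \<ominus>\<^bsub>Compl\<^esub> completion_map R F (r k)) \<in> nbhd C n" using k by blast
    then have "g x \<ominus>\<^bsub>C\<^esub> g (completion_map R F (r k)) \<in> nbhd C n"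
      using x rc by (simp add: a_minus_def)
    then show ?thesis using C.quotient_eq_iff_same_a_r_cos[OF C.nbhd_ideal] x rc by simp
  qed
  show ?thesis
  proof (rule C.eq_if_cong)
    fix n
    obtain k where k: "h ` nbhd Compl k \<subseteq> nbhd C n" using adic_hom_cont[OF h] by blast
    obtain l where l: "h' ` nbhd Compl l \<subseteq> nbhd C n" using adic_hom_cont[OF h'] by blast
    let ?k = "max k l"
    have "nbhd Compl ?k \<subseteq> nbhd Compl k" "nbhd Compl ?k \<subseteq> nbhd Compl l" by (rule Co.nbhd_mono, simp)+
    from subset_trans[OF image_mono[OF this(1)] k] subset_trans[OF image_mono[OF this(2)] l]
    have "h ` nbhd Compl ?k \<subseteq> nbhd C n" "h' ` nbhd Compl ?k \<subseteq> nbhd C n" .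
    from hc[OF h.ring_hom_ring_axioms this(1)] hc[OF h'.ring_hom_ring_axioms this(2)]
    show "nbhd C n +>\<^bsub>C\<^esub> h x = nbhd C n +>\<^bsub>C\<^esub> h' x"
      using eq[OF coherent_closed[OF r(1)]] by simp
  qed (use x in auto)
qed

end


section \<open>Power series\<close>

lemma (in ring) finsum_in_ideal:
  assumes "ideal I R" "\<And>x. x \<in> A \<Longrightarrow> f x \<in> I"
  shows "finsum R f A \<in> I"
proof -
  interpret I: ideal I R by fact
  show ?thesis
    using assms(2)
  proof (induction A rule: infinite_finite_induct)
    case (insert x A)
    then have "f \<in> A \<rightarrow> carrier R" "f x \<in> carrier R" using I.Icarr by auto
    then show ?case using insert by (simp add: finsum_insert I.a_closed)
  qed (simp_all add: finsum_infinite)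
qed

lemma (in comm_monoid) Units_rightI: "x \<in> carrier G \<Longrightarrow> y \<in> carrier G \<Longrightarrow> x \<otimes> y = \<one> \<Longrightarrow> x \<in> Units G"
  unfolding Units_def using m_comm[of x y] by auto

lemma (in cring) coset_finsum_cong:
  assumes I: "ideal I R" and f: "\<And>x. x \<in> A \<Longrightarrow> f x \<in> carrier R" and g: "\<And>x. x \<in> A \<Longrightarrow> g x \<in> carrier R"
    and e: "\<And>x. x \<in> A \<Longrightarrow> I +> f x = I +> g x"
  shows "I +> finsum R f A = I +> finsum R g A"
  using f g e
proof (induction A rule: infinite_finite_induct)
  case (insert x A)
  then have "f \<in> A \<rightarrow> carrier R" "f x \<in> carrier R" "g \<in> A \<rightarrow> carrier R" "g x \<in> carrier R" by auto
  then show ?case using insert by (simp add: finsum_insert) (rule coset_cong(1)[OF I], auto)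
qed (simp_all add: finsum_infinite)

lemma ps_carrier: "f \<in> carrier (power_series_ring R) \<longleftrightarrow> (\<forall>i. f i \<in> carrier R)"
  by (simp add: power_series_ring_def)

lemma ps_coeff_closed: "f \<in> carrier (power_series_ring R) \<Longrightarrow> f i \<in> carrier R"
  by (simp add: power_series_ring_def)

lemma ps_add: "(f \<oplus>\<^bsub>power_series_ring R\<^esub> g) i = f i \<oplus>\<^bsub>R\<^esub> g i"
  by (simp add: power_series_ring_def)

lemma ps_mult: "(f \<otimes>\<^bsub>power_series_ring R\<^esub> g) i = (\<Oplus>\<^bsub>R\<^esub>j\<in>{..i}. f j \<otimes>\<^bsub>R\<^esub> g (i - j))"
  by (simp add: power_series_ring_def)

lemma ps_one: "\<one>\<^bsub>power_series_ring R\<^esub> i = (if i = 0 then \<one>\<^bsub>R\<^esub> else \<zero>\<^bsub>R\<^esub>)"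
  by (simp add: power_series_ring_def)

lemma ps_zero: "\<zero>\<^bsub>power_series_ring R\<^esub> i = \<zero>\<^bsub>R\<^esub>"
  by (simp add: power_series_ring_def)

text \<open>
  Each coefficient of a product depends only on truncations of the factors, so the ring laws can
  be read off from univariate polynomials.
\<close>

lemma (in cring) power_series_cring: "cring (power_series_ring R)"
proof -
  let ?P = "power_series_ring R"
  interpret U: UP_cring R "UP R" by unfold_locales simp
  define tr where "tr N a = (\<lambda>i::nat. if i \<le> N then a i else \<zero>)" for N and a :: "nat \<Rightarrow> 'a"
  have tr: "tr N a \<in> carrier (UP R)" if "a \<in> carrier ?P" for a N
  proof -
    have "tr N a \<in> up R"
    proof (rule mem_upI)
      show "tr N a i \<in> carrier R" for i using that by (simp add: tr_def ps_carrier)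
      show "\<exists>n. bound \<zero> n (tr N a)" by (rule exI[of _ N]) (simp add: tr_def bound_def)
    qed
    then show ?thesis by (simp add: UP_def)
  qed
  have trs: "tr N a i = a i" if "i \<le> N" for a i N using that by (simp add: tr_def)
  have trm: "(f \<otimes>\<^bsub>UP R\<^esub> g) n = (\<Oplus>j\<in>{..n}. f j \<otimes> g (n - j))"
    if "f \<in> carrier (UP R)" "g \<in> carrier (UP R)" for f g n
    using that by (simp add: UP_def)
  have mt: "(a \<otimes>\<^bsub>?P\<^esub> b) n = (tr N a \<otimes>\<^bsub>UP R\<^esub> tr N b) n"
    if "a \<in> carrier ?P" "b \<in> carrier ?P" "n \<le> N" for a b n N
    unfolding trm[OF tr[OF that(1)] tr[OF that(2)]] ps_mult
    using that by (intro finsum_cong') (auto simp: trs ps_carrier)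
  have mc: "a \<otimes>\<^bsub>?P\<^esub> b \<in> carrier ?P" if "a \<in> carrier ?P" "b \<in> carrier ?P" for a b
    using that by (auto simp: ps_carrier ps_mult)
  show ?thesis
  proof (rule cringI)
    show "abelian_group ?P"
    proof (rule abelian_groupI)
      fix x assume x: "x \<in> carrier ?P"
      show "\<exists>y\<in>carrier ?P. y \<oplus>\<^bsub>?P\<^esub> x = \<zero>\<^bsub>?P\<^esub>"
        using x by (intro bexI[of _ "\<lambda>i. \<ominus> x i"]) (auto simp: ps_carrier fun_eq_iff ps_add ps_zero l_neg)
    qed (auto simp: ps_carrier fun_eq_iff ps_add ps_zero a_assoc intro: a_comm)
    show "Group.comm_monoid ?P"
    proof (rule comm_monoidI)
      show "x \<otimes>\<^bsub>?P\<^esub> y \<in> carrier ?P" if "x \<in> carrier ?P" "y \<in> carrier ?P" for x y using mc that .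
      show "\<one>\<^bsub>?P\<^esub> \<in> carrier ?P" by (simp add: ps_carrier ps_one)
      show "x \<otimes>\<^bsub>?P\<^esub> y = y \<otimes>\<^bsub>?P\<^esub> x" if xy: "x \<in> carrier ?P" "y \<in> carrier ?P" for x y
      proof
        fix n show "(x \<otimes>\<^bsub>?P\<^esub> y) n = (y \<otimes>\<^bsub>?P\<^esub> x) n"
          using mt[OF xy order.refl] mt[OF xy(2,1) order.refl] U.UP_m_comm[OF tr[OF xy(1)] tr[OF xy(2)]] by simp
      qed
      show "\<one>\<^bsub>?P\<^esub> \<otimes>\<^bsub>?P\<^esub> x = x" if x: "x \<in> carrier ?P" for x
      proof
        fix n
        have "(\<one>\<^bsub>?P\<^esub> \<otimes>\<^bsub>?P\<^esub> x) n = (\<Oplus>j\<in>{..n}. if 0 = j then x (n - j) else \<zero>)"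
          unfolding ps_mult using x by (intro finsum_cong') (auto simp: ps_one ps_carrier)
        also have "\<dots> = x n" using x finsum_singleton[of 0 "{..n}" "\<lambda>j. x (n - j)"] by (auto simp: ps_carrier)
        finally show "(\<one>\<^bsub>?P\<^esub> \<otimes>\<^bsub>?P\<^esub> x) n = x n" .
      qed
      show "x \<otimes>\<^bsub>?P\<^esub> y \<otimes>\<^bsub>?P\<^esub> z = x \<otimes>\<^bsub>?P\<^esub> (y \<otimes>\<^bsub>?P\<^esub> z)"
        if xyz: "x \<in> carrier ?P" "y \<in> carrier ?P" "z \<in> carrier ?P" for x y z
      proof
        fix n
        note t = tr[OF xyz(1), of n] tr[OF xyz(2), of n] tr[OF xyz(3), of n]
        have "(x \<otimes>\<^bsub>?P\<^esub> y \<otimes>\<^bsub>?P\<^esub> z) n = (\<Oplus>j\<in>{..n}. (tr n x \<otimes>\<^bsub>UP R\<^esub> tr n y) j \<otimes> tr n z (n - j))"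
          unfolding ps_mult[where f = "x \<otimes>\<^bsub>?P\<^esub> y"]
          by (intro finsum_cong')
            (use mc[OF xyz(1,2)] xyz in \<open>simp_all add: mt[OF xyz(1,2), of _ n, symmetric] trs ps_coeff_closed\<close>)
        also have "\<dots> = (tr n x \<otimes>\<^bsub>UP R\<^esub> tr n y \<otimes>\<^bsub>UP R\<^esub> tr n z) n"
          using t by (simp add: trm)
        also have "\<dots> = (tr n x \<otimes>\<^bsub>UP R\<^esub> (tr n y \<otimes>\<^bsub>UP R\<^esub> tr n z)) n"
          using U.UP_m_assoc[OF t] by simp
        also have "\<dots> = (\<Oplus>j\<in>{..n}. tr n x j \<otimes> (tr n y \<otimes>\<^bsub>UP R\<^esub> tr n z) (n - j))"
          using t by (simp add: trm)
        also have "\<dots> = (x \<otimes>\<^bsub>?P\<^esub> (y \<otimes>\<^bsub>?P\<^esub> z)) n"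
          unfolding ps_mult[where f = x]
          by (intro finsum_cong')
            (use mc[OF xyz(2,3)] xyz in \<open>simp_all add: mt[OF xyz(2,3), of _ n, symmetric] trs ps_coeff_closed\<close>)
        finally show "(x \<otimes>\<^bsub>?P\<^esub> y \<otimes>\<^bsub>?P\<^esub> z) n = (x \<otimes>\<^bsub>?P\<^esub> (y \<otimes>\<^bsub>?P\<^esub> z)) n" .
      qed
    qed
    show "(x \<oplus>\<^bsub>?P\<^esub> y) \<otimes>\<^bsub>?P\<^esub> z = x \<otimes>\<^bsub>?P\<^esub> z \<oplus>\<^bsub>?P\<^esub> y \<otimes>\<^bsub>?P\<^esub> z"
      if xyz: "x \<in> carrier ?P" "y \<in> carrier ?P" "z \<in> carrier ?P" for x y z
    proof
      fix n
      have "((x \<oplus>\<^bsub>?P\<^esub> y) \<otimes>\<^bsub>?P\<^esub> z) n = (\<Oplus>j\<in>{..n}. x j \<otimes> z (n - j) \<oplus> y j \<otimes> z (n - j))"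
        unfolding ps_mult ps_add using xyz by (intro finsum_cong') (auto simp: ps_carrier l_distr)
      also have "\<dots> = (x \<otimes>\<^bsub>?P\<^esub> z \<oplus>\<^bsub>?P\<^esub> y \<otimes>\<^bsub>?P\<^esub> z) n"
        unfolding ps_mult ps_add using xyz by (intro finsum_addf) (auto simp: ps_carrier)
      finally show "((x \<oplus>\<^bsub>?P\<^esub> y) \<otimes>\<^bsub>?P\<^esub> z) n = (x \<otimes>\<^bsub>?P\<^esub> z \<oplus>\<^bsub>?P\<^esub> y \<otimes>\<^bsub>?P\<^esub> z) n" .
    qed
  qed
qed

lemma ps_hom:
  assumes R: "cring R" and S: "cring S" and h: "h \<in> ring_hom R S"
  shows "(\<lambda>f. h \<circ> f) \<in> ring_hom (power_series_ring R) (power_series_ring S)"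
proof -
  interpret R: cring R by fact
  interpret S: cring S by fact
  interpret h: ring_hom_cring R S h by (intro ring_hom_cring.intro ring_hom_cring_axioms.intro R S h)
  show ?thesis
  proof (rule ring_hom_memI)
    show "h \<circ> x \<in> carrier (power_series_ring S)" if "x \<in> carrier (power_series_ring R)" for x
      using that by (simp add: ps_carrier)
    fix x y assume xy: "x \<in> carrier (power_series_ring R)" "y \<in> carrier (power_series_ring R)"
    show "h \<circ> (x \<otimes>\<^bsub>power_series_ring R\<^esub> y) = (h \<circ> x) \<otimes>\<^bsub>power_series_ring S\<^esub> (h \<circ> y)"
    proof
      fix n
      have "h (\<Oplus>\<^bsub>R\<^esub>j\<in>{..n}. x j \<otimes>\<^bsub>R\<^esub> y (n - j)) = (\<Oplus>\<^bsub>S\<^esub>j\<in>{..n}. h (x j \<otimes>\<^bsub>R\<^esub> y (n - j)))"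
        using xy by (subst h.hom_finsum) (auto simp: ps_carrier comp_def)
      also have "\<dots> = (\<Oplus>\<^bsub>S\<^esub>j\<in>{..n}. h (x j) \<otimes>\<^bsub>S\<^esub> h (y (n - j)))"
        using xy by (intro S.finsum_cong') (auto simp: ps_carrier)
      finally show "(h \<circ> (x \<otimes>\<^bsub>power_series_ring R\<^esub> y)) n = ((h \<circ> x) \<otimes>\<^bsub>power_series_ring S\<^esub> (h \<circ> y)) n"
        by (simp add: ps_mult)
    qed
    show "h \<circ> (x \<oplus>\<^bsub>power_series_ring R\<^esub> y) = (h \<circ> x) \<oplus>\<^bsub>power_series_ring S\<^esub> (h \<circ> y)"
      using xy by (auto simp: fun_eq_iff ps_add ps_carrier)
  qed (auto simp: fun_eq_iff ps_one)
qed

definition tpow :: "('a, 'e) ring_scheme \<Rightarrow> nat \<Rightarrow> nat \<Rightarrow> 'a" where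
  "tpow R d = (\<lambda>i. if i = d then \<one>\<^bsub>R\<^esub> else \<zero>\<^bsub>R\<^esub>)"

context cring
begin

abbreviation "PS \<equiv> power_series_ring R"

interpretation PS: cring PS by (rule power_series_cring)

lemma ps_uminus: "f \<in> carrier PS \<Longrightarrow> (\<ominus>\<^bsub>PS\<^esub> f) i = \<ominus> f i"
proof -
  assume f: "f \<in> carrier PS"
  have "f i \<oplus> (\<ominus>\<^bsub>PS\<^esub> f) i = \<zero>" using PS.r_neg[OF f] by (metis ps_add ps_zero)
  then show ?thesis using f PS.a_inv_closed[OF f] by (metis a_comm minus_equality ps_carrier)
qed

lemma ps_minus: "f \<in> carrier PS \<Longrightarrow> g \<in> carrier PS \<Longrightarrow> (f \<ominus>\<^bsub>PS\<^esub> g) i = f i \<ominus> g i"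
  by (simp add: a_minus_def ps_add ps_uminus)

lemma tpow_closed [simp]: "tpow R d \<in> carrier PS"
  by (simp add: ps_carrier tpow_def)

lemma tpow_mult:
  assumes f: "f \<in> carrier PS"
  shows "(tpow R d \<otimes>\<^bsub>PS\<^esub> f) i = (if i < d then \<zero> else f (i - d))"
proof -
  have "(tpow R d \<otimes>\<^bsub>PS\<^esub> f) i = (\<Oplus>j\<in>{..i}. if d = j then f (i - j) else \<zero>)"
    unfolding ps_mult using f by (intro finsum_cong') (auto simp: tpow_def ps_carrier)
  also have "\<dots> = (if i < d then \<zero> else f (i - d))"
  proof (cases "i < d")
    case True
    then show ?thesis by (auto intro!: add.finprod_one_eqI)
  next
    case False
    then show ?thesis using f finsum_singleton[of d "{..i}" "\<lambda>j. f (i - j)"] by (auto simp: ps_carrier)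
  qed
  finally show ?thesis .
qed

lemma tpow_0: "tpow R 0 = \<one>\<^bsub>PS\<^esub>"
  by (auto simp: fun_eq_iff tpow_def ps_one)

lemma tpow_add: "tpow R (d + e) = tpow R d \<otimes>\<^bsub>PS\<^esub> tpow R e"
  by (auto simp: fun_eq_iff tpow_mult) (auto simp: tpow_def)

lemma ps_mult_0: "f \<in> carrier PS \<Longrightarrow> g \<in> carrier PS \<Longrightarrow> (f \<otimes>\<^bsub>PS\<^esub> g) 0 = f 0 \<otimes> g 0"
  by (simp add: ps_mult ps_carrier)

lemma ps_mult_in_ideal:
  assumes "ideal I R" "\<And>j. j \<le> i \<Longrightarrow> f j \<otimes> g (i - j) \<in> I"
  shows "(f \<otimes>\<^bsub>PS\<^esub> g) i \<in> I"
  unfolding ps_mult by (rule finsum_in_ideal) (use assms in auto)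

lemma ps_UnitsI:
  assumes f: "f \<in> carrier PS" and f0: "f 0 \<in> Units R"
  shows "f \<in> Units PS"
proof -
  \<comment> \<open>the recursion for the coefficients of the inverse, with the values already found as argument\<close>
  define G where "G g n = (if n = 0 then inv (f 0)
     else \<ominus> (inv (f 0) \<otimes> finsum R (restrict (\<lambda>j. f j \<otimes> g (n - j)) {1..n}) {1..n}))" for g and n :: nat
  define g where "g = wfrec less_than G"
  have "adm_wf less_than G"
    unfolding adm_wf_def
  proof (intro allI impI)
    fix u v :: "nat \<Rightarrow> 'a" and n assume e: "\<forall>z. (z, n) \<in> less_than \<longrightarrow> u z = v z"
    have "restrict (\<lambda>j. f j \<otimes> u (n - j)) {1..n} = restrict (\<lambda>j. f j \<otimes> v (n - j)) {1..n}"
      using e by (intro restrict_ext) auto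
    then show "G u n = G v n" by (simp add: G_def)
  qed
  then have g: "g n = G g n" for n unfolding g_def using wfrec_fixpoint[OF wf_less_than] by metis
  have gc: "g n \<in> carrier R" for n
  proof (induction n rule: less_induct)
    case (less n)
    have "restrict (\<lambda>j. f j \<otimes> g (n - j)) {1..n} \<in> {1..n} \<rightarrow> carrier R"
      using less f by (auto simp: ps_carrier)
    then show ?case unfolding g[of n] using f0 by (auto simp: G_def)
  qed
  then have gP: "g \<in> carrier PS" by (simp add: ps_carrier)
  have "f \<otimes>\<^bsub>PS\<^esub> g = \<one>\<^bsub>PS\<^esub>"
  proof
    fix n
    show "(f \<otimes>\<^bsub>PS\<^esub> g) n = \<one>\<^bsub>PS\<^esub> n"
    proof (cases "n = 0")
      case True
      then show ?thesis using f0 g[of 0] f gP by (simp add: ps_mult_0 ps_one G_def)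
    next
      case False
      let ?s = "\<Oplus>j\<in>{1..n}. f j \<otimes> g (n - j)"
      have s: "?s \<in> carrier R" using f gc by (auto simp: ps_carrier)
      have "{..n} = insert 0 {1..n}" by auto
      then have "(f \<otimes>\<^bsub>PS\<^esub> g) n = f 0 \<otimes> g n \<oplus> ?s"
        unfolding ps_mult using f gc by (simp add: ps_carrier finsum_insert Pi_iff)
      also have "finsum R (restrict (\<lambda>j. f j \<otimes> g (n - j)) {1..n}) {1..n} = ?s"
        using f gc by (intro finsum_cong') (auto simp: ps_carrier)
      then have "g n = \<ominus> (inv (f 0) \<otimes> ?s)" using False g[of n] by (simp add: G_def)
      also have "f 0 \<otimes> \<ominus> (inv (f 0) \<otimes> ?s) = \<ominus> ((f 0 \<otimes> inv (f 0)) \<otimes> ?s)"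
        using Units_closed[OF f0] Units_inv_closed[OF f0] s by (simp add: r_minus m_assoc del: Units_r_inv)
      also have "\<dots> = \<ominus> ?s" unfolding Units_r_inv[OF f0] l_one[OF s] ..
      also have "\<ominus> ?s \<oplus> ?s = \<zero>" by (rule l_neg[OF s])
      finally show ?thesis using False by (simp add: ps_one)
    qed
  qed
  then show ?thesis by (rule PS.Units_rightI[OF f gP])
qed

lemma ps_Units_coeff:
  assumes "f \<in> Units PS" shows "f 0 \<in> Units R"
proof -
  obtain g where g: "g \<in> carrier PS" "f \<otimes>\<^bsub>PS\<^esub> g = \<one>\<^bsub>PS\<^esub>"
    using assms PS.Units_inv_closed PS.Units_r_inv by blast
  have f: "f \<in> carrier PS" using assms by auto
  have "f 0 \<otimes> g 0 = \<one>" using g f by (metis ps_mult_0 ps_one)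
  then show ?thesis by (rule Units_rightI[rotated 2]) (use f g in \<open>auto simp: ps_carrier\<close>)
qed

end

lemma ring_hom_Units:
  assumes "cring R" "cring S" "h \<in> ring_hom R S" "x \<in> Units R"
  shows "h x \<in> Units S"
proof -
  obtain y where "y \<in> carrier R" "x \<otimes>\<^bsub>R\<^esub> y = \<one>\<^bsub>R\<^esub>" "y \<otimes>\<^bsub>R\<^esub> x = \<one>\<^bsub>R\<^esub>" "x \<in> carrier R"
    using assms(4) by (auto simp: Units_def)
  then have "h x \<otimes>\<^bsub>S\<^esub> h y = \<one>\<^bsub>S\<^esub>" "h y \<otimes>\<^bsub>S\<^esub> h x = \<one>\<^bsub>S\<^esub>" "h x \<in> carrier S" "h y \<in> carrier S"
    using assms(3) by (metis ring_hom_mult ring_hom_one ring_hom_closed)+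
  then show ?thesis by (auto simp: Units_def)
qed


section \<open>Weierstrass preparation\<close>

lemma (in cring) diff_diff: "a \<in> carrier R \<Longrightarrow> b \<in> carrier R \<Longrightarrow> (a \<ominus> b) \<ominus> a = \<ominus> b"
  by algebra

context complete_top_ring
begin

interpretation PS: cring PS by (rule power_series_cring)

lemma tends_Suc:
  assumes "tends x y" shows "tends (\<lambda>j. x (Suc j)) y"
  unfolding tends_def
proof (intro conjI allI)
  fix n
  obtain k where k: "\<forall>j\<ge>k. nbhd R n +> y = nbhd R n +> x j" using assms unfolding tends_def by blast
  show "\<exists>k. \<forall>j\<ge>k. nbhd R n +> y = nbhd R n +> x (Suc j)"
    by (intro exI[of _ k] allI impI) (rule k[rule_format], simp)
qed (rule tends_closed[OF assms])

lemma tends_finsum: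
  assumes "finite A" "\<And>a j. a \<in> A \<Longrightarrow> x a j \<in> carrier R" "\<And>a. a \<in> A \<Longrightarrow> tends (x a) (y a)"
  shows "tends (\<lambda>j. \<Oplus>a\<in>A. x a j) (\<Oplus>a\<in>A. y a)"
  using assms
proof (induction A rule: finite_induct)
  case empty
  then show ?case by (simp add: tends_const)
next
  case (insert a A)
  have c: "(\<lambda>a. x a j) \<in> A \<rightarrow> carrier R" "x a j \<in> carrier R" for j using insert by auto
  have yc: "y b \<in> carrier R" if "b \<in> insert a A" for b by (rule tends_closed[OF insert(5)[OF that]])
  have c': "y \<in> A \<rightarrow> carrier R" "y a \<in> carrier R" by (auto intro: yc)
  have "tends (\<lambda>j. x a j \<oplus> (\<Oplus>a\<in>A. x a j)) (y a \<oplus> (\<Oplus>a\<in>A. y a))"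
    by (rule tends_binop(1)) (use insert c in \<open>auto intro!: finsum_closed\<close>)
  then show ?case using insert c c' by (simp add: finsum_insert)
qed

lemma tends_minus:
  assumes "\<And>j. x j \<in> carrier R" "\<And>j. x' j \<in> carrier R" "tends x y" "tends x' y'"
  shows "tends (\<lambda>j. x j \<ominus> x' j) (y \<ominus> y')"
proof -
  have y: "y' \<in> carrier R" "y \<in> carrier R" using assms tends_closed by auto
  have "tends (\<lambda>j. \<ominus> \<one> \<otimes> x' j) (\<ominus> \<one> \<otimes> y')"
    by (rule tends_binop(2)) (use assms in \<open>auto intro: tends_const\<close>)
  then have "tends (\<lambda>j. \<ominus> x' j) (\<ominus> y')" using assms y by (simp add: l_minus)
  then have "tends (\<lambda>j. x j \<oplus> \<ominus> x' j) (y \<oplus> \<ominus> y')"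
    by (intro tends_binop(1)) (use assms in auto)
  then show ?thesis by (simp add: a_minus_def)
qed

abbreviation "N \<equiv> nbhd R 1"

lemma monic_mult_coeff:
  assumes h: "h \<in> carrier PS" and q: "q \<in> carrier PS"
  shows "((tpow R d \<oplus>\<^bsub>PS\<^esub> h) \<otimes>\<^bsub>PS\<^esub> q) (i + d) = q i \<oplus> (h \<otimes>\<^bsub>PS\<^esub> q) (i + d)"
proof -
  have "(tpow R d \<oplus>\<^bsub>PS\<^esub> h) \<otimes>\<^bsub>PS\<^esub> q = tpow R d \<otimes>\<^bsub>PS\<^esub> q \<oplus>\<^bsub>PS\<^esub> h \<otimes>\<^bsub>PS\<^esub> q"
    using h q by (simp add: PS.l_distr)
  then show ?thesis using q by (simp add: ps_add tpow_mult)
qed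

lemma coset_power_mult:
  assumes "a \<in> N" "b \<in> carrier R" "b' \<in> carrier R"
    "ideal_power R N j +> b = ideal_power R N j +> b'"
  shows "ideal_power R N (Suc j) +> (a \<otimes> b) = ideal_power R N (Suc j) +> (a \<otimes> b')"
proof -
  have a: "a \<in> carrier R" using ideal.Icarr[OF nbhd_ideal assms(1)] .
  note I = ideal_power_ideal[OF nbhd_ideal[of 1]]
  have "b \<ominus> b' \<in> ideal_power R N j"
    using quotient_eq_iff_same_a_r_cos[OF I assms(2,3)] assms(4) by simp
  then have "a \<otimes> (b \<ominus> b') \<in> ideal_power R N (Suc j)" by (rule ideal_power_Suc_mem[OF assms(1)])
  moreover have "a \<otimes> (b \<ominus> b') = a \<otimes> b \<ominus> a \<otimes> b'"
    using a assms by (simp add: a_minus_def r_distr r_minus)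
  ultimately show ?thesis
    using quotient_eq_iff_same_a_r_cos[OF I, of "a \<otimes> b" "a \<otimes> b'" "Suc j"] a assms by simp
qed

text \<open>
  The quotient of \<open>t\<^sup>d\<close> by \<open>t\<^sup>d + h\<close>: only the coefficients in degrees \<open>\<ge> d\<close> are prescribed, the
  others form the remainder. The condition on \<open>q\<close> is the fixed point equation \<open>q i = 1 i - (h q)
  (i + d)\<close>, whose right-hand side is contracting for the powers of \<open>N\<close> because the coefficients of
  \<open>h\<close> lie in \<open>N\<close>.
\<close>

lemma weierstrass_division:
  assumes h: "h \<in> carrier PS" and hN: "\<And>i. h i \<in> N"
  shows "\<exists>q\<in>carrier PS. \<forall>i. q i \<ominus> \<one>\<^bsub>PS\<^esub> i \<in> N \<and>
    ((tpow R d \<oplus>\<^bsub>PS\<^esub> h) \<otimes>\<^bsub>PS\<^esub> q) (i + d) = \<one>\<^bsub>PS\<^esub> i"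
proof -
  define T where "T q = (\<lambda>i. \<one>\<^bsub>PS\<^esub> i \<ominus> (h \<otimes>\<^bsub>PS\<^esub> q) (i + d))" for q
  define q where "q j = (T ^^ j) \<one>\<^bsub>PS\<^esub>" for j
  have one: "\<one>\<^bsub>PS\<^esub> i \<in> carrier R" for i by (simp add: ps_one)
  have Tc: "T q \<in> carrier PS" if "q \<in> carrier PS" for q
    using ps_coeff_closed[OF PS.m_closed[OF h that]] one by (simp add: ps_carrier T_def)
  have qP: "q j \<in> carrier PS" for j by (induction j) (use Tc in \<open>auto simp: q_def\<close>)
  then have qc: "q j i \<in> carrier R" for i j by (simp add: ps_carrier)
  have qS: "q (Suc j) = T (q j)" for j by (simp add: q_def)
  have hc: "h i \<in> carrier R" for i using h by (simp add: ps_carrier)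
  have hq: "(h \<otimes>\<^bsub>PS\<^esub> q j) i \<in> carrier R" for i j using ps_coeff_closed[OF PS.m_closed[OF h qP]] .
  note I = ideal_power_ideal[OF nbhd_ideal[of 1]]
  have step: "ideal_power R N j +> q (Suc j) i = ideal_power R N j +> q j i" for i j
  proof (induction j arbitrary: i)
    case 0
    then show ?case using quotient_eq_iff_same_a_r_cos[OF oneideal qc qc] qc by simp
  next
    case (Suc j)
    have hqj: "ideal_power R N (Suc j) +> (h \<otimes>\<^bsub>PS\<^esub> q (Suc j)) k = ideal_power R N (Suc j) +> (h \<otimes>\<^bsub>PS\<^esub> q j) k" for k
      unfolding ps_mult
    proof (rule coset_finsum_cong[OF I])
      fix i show "ideal_power R N (Suc j) +> h i \<otimes> q (Suc j) (k - i) = ideal_power R N (Suc j) +> h i \<otimes> q j (k - i)"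
        by (rule coset_power_mult[OF hN qc qc Suc])
    qed (use hc qc in simp_all)
    show ?case
    proof -
      have e: "q (Suc l) i = \<one>\<^bsub>PS\<^esub> i \<ominus> (h \<otimes>\<^bsub>PS\<^esub> q l) (i + d)" for l by (simp add: qS T_def)
      show ?thesis unfolding e[of "Suc j"] e[of j]
        by (rule coset_cong(4)[OF I one hq one hq refl hqj])
    qed
  qed
  have "\<exists>y. tends (\<lambda>j. q j i) y" for i
  proof (rule tends_exists)
    fix n
    obtain k where k: "ideal_power R N k \<subseteq> nbhd R n" using nilpotent by blast
    have "nbhd R n +> q (Suc j) i = nbhd R n +> q j i" if "j \<ge> k" for j
      using ideal_power_mono[OF nbhd_ideal that] k
      by (intro coset_mono[OF I nbhd_ideal _ qc qc step]) (rule subset_trans)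
    then show "\<exists>k. \<forall>j\<ge>k. nbhd R n +> q (Suc j) i = nbhd R n +> q j i" by (intro exI[of _ k] allI impI)
  qed (rule qc)
  then obtain r where r: "\<And>i. tends (\<lambda>j. q j i) (r i)" by metis
  have rP: "r \<in> carrier PS" using r tends_closed by (auto simp: ps_carrier)
  have eq: "r i = \<one>\<^bsub>PS\<^esub> i \<ominus> (h \<otimes>\<^bsub>PS\<^esub> r) (i + d)" for i
  proof (rule tends_unique)
    show "tends (\<lambda>j. q (Suc j) i) (r i)" by (rule tends_Suc[OF r])
    have "tends (\<lambda>j. (h \<otimes>\<^bsub>PS\<^esub> q j) k) ((h \<otimes>\<^bsub>PS\<^esub> r) k)" for k
      unfolding ps_mult
      by (rule tends_finsum) (use hc qc r in \<open>auto intro!: tends_binop(2) tends_const\<close>)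
    then show "tends (\<lambda>j. q (Suc j) i) (\<one>\<^bsub>PS\<^esub> i \<ominus> (h \<otimes>\<^bsub>PS\<^esub> r) (i + d))"
      unfolding qS T_def by (intro tends_minus tends_const one hq)
  qed
  have hrN: "(h \<otimes>\<^bsub>PS\<^esub> r) i \<in> N" for i
    by (rule ps_mult_in_ideal[OF nbhd_ideal]) (use hN rP in \<open>auto simp: ps_carrier intro!: ideal.I_r_closed[OF nbhd_ideal]\<close>)
  have hr: "(h \<otimes>\<^bsub>PS\<^esub> r) i \<in> carrier R" for i using ps_coeff_closed[OF PS.m_closed[OF h rP]] .
  have rc: "r i \<in> carrier R" for i using rP by (simp add: ps_carrier)
  show ?thesis
  proof (intro bexI[OF _ rP] allI conjI)
    fix i
    have "r i \<ominus> \<one>\<^bsub>PS\<^esub> i = \<ominus> (h \<otimes>\<^bsub>PS\<^esub> r) (i + d)"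
      unfolding eq[of i] by (rule diff_diff[OF one hr])
    then show "r i \<ominus> \<one>\<^bsub>PS\<^esub> i \<in> N"
      using hrN additive_subgroup.a_inv_closed[OF ideal.axioms(1)[OF nbhd_ideal]] by simp
    have "r i \<oplus> (h \<otimes>\<^bsub>PS\<^esub> r) (i + d) = \<one>\<^bsub>PS\<^esub> i"
      unfolding eq[of i] using one[of i] hr[of "i + d"] by (simp add: a_minus_def a_assoc l_neg)
    then show "((tpow R d \<oplus>\<^bsub>PS\<^esub> h) \<otimes>\<^bsub>PS\<^esub> r) (i + d) = \<one>\<^bsub>PS\<^esub> i"
      by (simp add: monic_mult_coeff[OF h rP])
  qed
qed

text \<open>
  By the same contraction, the coefficients of \<open>g\<close> lie in all powers of \<open>N\<close>.
\<close>

lemma weierstrass_division_unique: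
  assumes h: "h \<in> carrier PS" and hN: "\<And>i. h i \<in> N" and g: "g \<in> carrier PS"
    and z: "\<And>i. ((tpow R d \<oplus>\<^bsub>PS\<^esub> h) \<otimes>\<^bsub>PS\<^esub> g) (i + d) = \<zero>"
  shows "g = \<zero>\<^bsub>PS\<^esub>"
proof -
  have gc: "g i \<in> carrier R" for i using g by (simp add: ps_carrier)
  have hg: "(h \<otimes>\<^bsub>PS\<^esub> g) i \<in> carrier R" for i using ps_coeff_closed[OF PS.m_closed[OF h g]] .
  note I = ideal_power_ideal[OF nbhd_ideal[of 1]]
  have eq: "g i = \<ominus> (h \<otimes>\<^bsub>PS\<^esub> g) (i + d)" for i
    using z[of i] unfolding monic_mult_coeff[OF h g] using minus_equality[OF _ hg gc] by simp
  have "g i \<in> ideal_power R N j" for i j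
  proof (induction j arbitrary: i)
    case (Suc j)
    have "(h \<otimes>\<^bsub>PS\<^esub> g) k \<in> ideal_power R N (Suc j)" for k
      by (rule ps_mult_in_ideal[OF I]) (rule ideal_power_Suc_mem[OF hN Suc])
    then show ?case unfolding eq[of i]
      using additive_subgroup.a_inv_closed[OF ideal.axioms(1)[OF I]] by blast
  qed (simp add: gc)
  then show ?thesis using in_powers_zero[OF gc] by (auto simp: fun_eq_iff ps_zero)
qed

text \<open>
  Division by \<open>1 + z\<close>, the case \<open>d = 0\<close>, is the geometric series.
\<close>

lemma one_plus_N_Units:
  assumes "z \<in> N" shows "\<one> \<oplus> z \<in> Units R"
proof -
  have zc: "z \<in> carrier R" using ideal.Icarr[OF nbhd_ideal assms] .
  define h where "h i = (if i = 0 then z else \<zero>)" for i :: nat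
  have z0: "\<zero> \<in> N" using additive_subgroup.zero_closed[OF ideal.axioms(1)[OF nbhd_ideal]] .
  have h: "h \<in> carrier PS" "\<And>i. h i \<in> N" using assms zc z0 by (auto simp: h_def ps_carrier)
  obtain q where q: "q \<in> carrier PS" "\<forall>i. q i \<ominus> \<one>\<^bsub>PS\<^esub> i \<in> N \<and>
    ((tpow R 0 \<oplus>\<^bsub>PS\<^esub> h) \<otimes>\<^bsub>PS\<^esub> q) (i + 0) = \<one>\<^bsub>PS\<^esub> i"
    using weierstrass_division[OF h, of 0] ..
  have "((tpow R 0 \<oplus>\<^bsub>PS\<^esub> h) \<otimes>\<^bsub>PS\<^esub> q) 0 = \<one>" using q(2)[rule_format, of 0] by (simp add: ps_one)
  then have "(\<one> \<oplus> z) \<otimes> q 0 = \<one>"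
    using q(1) h(1) by (simp add: ps_mult_0 ps_add) (simp add: tpow_def h_def)
  then show ?thesis using q(1) zc by (intro Units_rightI[of _ "q 0"]) (auto simp: ps_carrier)
qed

lemma Units_mod_N:
  assumes x: "x \<in> carrier R" and y: "y \<in> carrier R" and e: "x \<otimes> y \<ominus> \<one> \<in> N"
  shows "x \<in> Units R"
proof -
  have "\<one> \<oplus> (x \<otimes> y \<ominus> \<one>) \<in> Units R" by (rule one_plus_N_Units[OF e])
  moreover have "\<one> \<oplus> (x \<otimes> y \<ominus> \<one>) = x \<otimes> y" using x y by algebra
  ultimately have u: "x \<otimes> y \<in> Units R" by simp
  then have "x \<otimes> (y \<otimes> inv (x \<otimes> y)) = \<one>" using x y by (simp add: m_assoc[symmetric])
  then show ?thesis using x y u by (intro Units_rightI[of x "y \<otimes> inv (x \<otimes> y)"]) auto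
qed

lemma Units_if_cong_Units: "x \<in> Units R \<Longrightarrow> y \<in> carrier R \<Longrightarrow> N +> x = N +> y \<Longrightarrow> y \<in> Units R"
proof (rule Units_mod_N[of y "inv x"])
  assume a: "x \<in> Units R" "y \<in> carrier R" "N +> x = N +> y"
  have "N +> (y \<otimes> inv x) = N +> (x \<otimes> inv x)" using a by (intro coset_cong(2)[OF nbhd_ideal]) auto
  then show "y \<otimes> inv x \<ominus> \<one> \<in> N"
    using a quotient_eq_iff_same_a_r_cos[OF nbhd_ideal, of "y \<otimes> inv x" \<one>] by simp
qed auto

text \<open>The distinguished polynomials of Weierstrass preparation, represented as power series.\<close>

definition distinguished :: "nat \<Rightarrow> (nat \<Rightarrow> 'a) \<Rightarrow> bool" where
  "distinguished d p \<longleftrightarrow> p \<in> carrier PS \<and> (\<forall>i<d. p i \<in> N) \<and> p d = \<one> \<and> (\<forall>i>d. p i = \<zero>)"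

lemma distinguished_closed: "distinguished d p \<Longrightarrow> p \<in> carrier PS"
  by (simp add: distinguished_def)

lemma distinguished_split:
  assumes p: "distinguished d p"
  obtains h where "h \<in> carrier PS" "\<And>i. h i \<in> N" "p = tpow R d \<oplus>\<^bsub>PS\<^esub> h"
proof -
  define h where "h i = (if i < d then p i else \<zero>)" for i
  have z0: "\<zero> \<in> N" using additive_subgroup.zero_closed[OF ideal.axioms(1)[OF nbhd_ideal]] .
  have pc: "p i \<in> carrier R" for i using p by (simp add: distinguished_def ps_carrier)
  show thesis
  proof
    show "h \<in> carrier PS" using pc by (simp add: h_def ps_carrier)
    show "h i \<in> N" for i using z0 p by (simp add: h_def distinguished_def)
    show "p = tpow R d \<oplus>\<^bsub>PS\<^esub> h"
    proof
      fix i show "p i = (tpow R d \<oplus>\<^bsub>PS\<^esub> h) i"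
        using p pc[of i] by (cases i d rule: linorder_cases) (auto simp: ps_add tpow_def h_def distinguished_def)
    qed
  qed
qed

text \<open>
  The quotient \<open>w\<close> of the two units satisfies \<open>p' (w - 1) = p - p'\<close>, which has no coefficients in
  degrees \<open>\<ge> d\<close>; uniqueness of division forces \<open>w = 1\<close>.
\<close>

lemma weierstrass_unique:
  assumes p: "distinguished d p" and p': "distinguished d p'" and u: "u \<in> Units PS" and u': "u' \<in> Units PS"
    and eq: "p \<otimes>\<^bsub>PS\<^esub> u = p' \<otimes>\<^bsub>PS\<^esub> u'"
  shows "p = p'" "u = u'"
proof -
  note c = distinguished_closed[OF p] distinguished_closed[OF p'] PS.Units_closed[OF u] PS.Units_closed[OF u'] PS.Units_inv_closed[OF u]
  define w where "w = u' \<otimes>\<^bsub>PS\<^esub> inv\<^bsub>PS\<^esub> u"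
  have wc: "w \<in> carrier PS" using c by (simp add: w_def)
  have "p = p \<otimes>\<^bsub>PS\<^esub> u \<otimes>\<^bsub>PS\<^esub> inv\<^bsub>PS\<^esub> u" using c u by (simp add: PS.m_assoc)
  also have "\<dots> = p' \<otimes>\<^bsub>PS\<^esub> w" unfolding eq w_def using c by (simp add: PS.m_assoc)
  finally have pw: "p = p' \<otimes>\<^bsub>PS\<^esub> w" .
  obtain h where h: "h \<in> carrier PS" "\<And>i. h i \<in> N" "p' = tpow R d \<oplus>\<^bsub>PS\<^esub> h"
    using distinguished_split[OF p'] by blast
  have g: "w \<ominus>\<^bsub>PS\<^esub> \<one>\<^bsub>PS\<^esub> \<in> carrier PS" using wc by simp
  have e: "p' \<otimes>\<^bsub>PS\<^esub> (w \<ominus>\<^bsub>PS\<^esub> \<one>\<^bsub>PS\<^esub>) = p \<ominus>\<^bsub>PS\<^esub> p'"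
    unfolding pw using wc c by (simp add: a_minus_def PS.r_distr PS.r_minus)
  have "w \<ominus>\<^bsub>PS\<^esub> \<one>\<^bsub>PS\<^esub> = \<zero>\<^bsub>PS\<^esub>"
  proof (rule weierstrass_division_unique[OF h(1,2) g])
    fix i
    have pe: "p (i + d) = p' (i + d)" using p p' by (cases "i = 0") (auto simp: distinguished_def)
    have "((tpow R d \<oplus>\<^bsub>PS\<^esub> h) \<otimes>\<^bsub>PS\<^esub> (w \<ominus>\<^bsub>PS\<^esub> \<one>\<^bsub>PS\<^esub>)) (i + d) = p (i + d) \<ominus> p' (i + d)"
      unfolding h(3)[symmetric] e by (rule ps_minus[OF c(1,2)])
    also have "\<dots> = \<zero>" unfolding pe using ps_coeff_closed[OF c(2)] by (simp add: a_minus_def r_neg)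
    finally show "((tpow R d \<oplus>\<^bsub>PS\<^esub> h) \<otimes>\<^bsub>PS\<^esub> (w \<ominus>\<^bsub>PS\<^esub> \<one>\<^bsub>PS\<^esub>)) (i + d) = \<zero>" .
  qed
  then have w1: "w = \<one>\<^bsub>PS\<^esub>" using PS.minus_eq_zero_iff[OF wc PS.one_closed] by simp
  then show "p = p'" using pw c by simp
  have "u' = w \<otimes>\<^bsub>PS\<^esub> u" using c u by (simp add: w_def PS.m_assoc)
  then show "u = u'" using w1 c by simp
qed

text \<open>
  Split \<open>f = t\<^sup>d b + a\<close> with \<open>a\<close> of degree less than \<open>d\<close>. Then \<open>b\<close> is a unit and \<open>f / b = t\<^sup>d + h\<close>
  with all coefficients of \<open>h\<close> in \<open>N\<close>. Multiplying by the quotient \<open>q\<close> of \<open>t\<^sup>d\<close> by \<open>t\<^sup>d + h\<close>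
  produces the distinguished polynomial, and \<open>q\<close> is a unit because it is congruent to \<open>1\<close>.
\<close>

lemma weierstrass_preparation:
  assumes f: "f \<in> carrier PS" and fN: "\<And>i. i < d \<Longrightarrow> f i \<in> N" and fd: "f d \<in> Units R"
  obtains p u where "distinguished d p" "u \<in> Units PS" "f = p \<otimes>\<^bsub>PS\<^esub> u"
proof -
  define b where "b i = f (i + d)" for i
  define a where "a i = (if i < d then f i else \<zero>)" for i
  have fc: "f i \<in> carrier R" for i using f by (simp add: ps_carrier)
  have z0: "\<zero> \<in> N" using additive_subgroup.zero_closed[OF ideal.axioms(1)[OF nbhd_ideal]] .
  have aP: "a \<in> carrier PS" and bP: "b \<in> carrier PS" using fc by (auto simp: a_def b_def ps_carrier)
  have aN: "a i \<in> N" for i using fN z0 by (simp add: a_def)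
  have bU: "b \<in> Units PS" by (rule ps_UnitsI[OF bP]) (simp add: b_def fd)
  note bi = PS.Units_inv_closed[OF bU]
  have fab: "f = tpow R d \<otimes>\<^bsub>PS\<^esub> b \<oplus>\<^bsub>PS\<^esub> a"
  proof
    fix i show "f i = (tpow R d \<otimes>\<^bsub>PS\<^esub> b \<oplus>\<^bsub>PS\<^esub> a) i"
      using fc by (simp add: ps_add tpow_mult[OF bP]) (simp add: a_def b_def)
  qed
  define h where "h = a \<otimes>\<^bsub>PS\<^esub> inv\<^bsub>PS\<^esub> b"
  have hP: "h \<in> carrier PS" using aP bi by (simp add: h_def)
  have hN: "h i \<in> N" for i
    unfolding h_def by (rule ps_mult_in_ideal[OF nbhd_ideal])
      (use aN bi in \<open>auto simp: ps_carrier intro!: ideal.I_r_closed[OF nbhd_ideal]\<close>)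
  have fb: "f = (tpow R d \<oplus>\<^bsub>PS\<^esub> h) \<otimes>\<^bsub>PS\<^esub> b"
    unfolding fab h_def using aP bP bi bU by (simp add: PS.l_distr PS.m_assoc)
  obtain q where qq: "q \<in> carrier PS" "\<forall>i. q i \<ominus> \<one>\<^bsub>PS\<^esub> i \<in> N \<and>
    ((tpow R d \<oplus>\<^bsub>PS\<^esub> h) \<otimes>\<^bsub>PS\<^esub> q) (i + d) = \<one>\<^bsub>PS\<^esub> i"
    using weierstrass_division[OF hP hN, of d] ..
  note q = qq(1) qq(2)[rule_format, THEN conjunct1] qq(2)[rule_format, THEN conjunct2]
  have qc: "q i \<in> carrier R" for i using q by (simp add: ps_carrier)
  have "q 0 \<in> Units R"
    using q(2)[of 0] qc[of 0] by (intro Units_mod_N[of "q 0" \<one>]) (auto simp: ps_one)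
  then have qU: "q \<in> Units PS" by (intro ps_UnitsI q)
  note qi = PS.Units_inv_closed[OF qU]
  define p where "p = (tpow R d \<oplus>\<^bsub>PS\<^esub> h) \<otimes>\<^bsub>PS\<^esub> q"
  have "distinguished d p"
    unfolding distinguished_def
  proof (intro conjI allI impI)
    show "p \<in> carrier PS" using hP q by (simp add: p_def)
    show "p d = \<one>" using q(3)[of 0] by (simp add: p_def ps_one)
    show "p i = \<zero>" if "i > d" for i using q(3)[of "i - d"] that by (simp add: p_def ps_one)
    fix i assume "i < d"
    then have "p i = \<zero> \<oplus> (h \<otimes>\<^bsub>PS\<^esub> q) i"
      unfolding p_def using hP q by (simp add: PS.l_distr ps_add tpow_mult)
    also have "\<dots> = (h \<otimes>\<^bsub>PS\<^esub> q) i" using ps_coeff_closed[OF PS.m_closed[OF hP q(1)]] by simp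
    also have "\<dots> \<in> N"
      by (rule ps_mult_in_ideal[OF nbhd_ideal])
        (use hN qc in \<open>auto simp: ps_carrier intro!: ideal.I_r_closed[OF nbhd_ideal]\<close>)
    finally show "p i \<in> N" .
  qed
  moreover have "inv\<^bsub>PS\<^esub> q \<otimes>\<^bsub>PS\<^esub> b \<in> Units PS" using qU bU by simp
  moreover have "f = p \<otimes>\<^bsub>PS\<^esub> (inv\<^bsub>PS\<^esub> q \<otimes>\<^bsub>PS\<^esub> b)"
  proof -
    have "p \<otimes>\<^bsub>PS\<^esub> (inv\<^bsub>PS\<^esub> q \<otimes>\<^bsub>PS\<^esub> b) = (tpow R d \<oplus>\<^bsub>PS\<^esub> h) \<otimes>\<^bsub>PS\<^esub> ((q \<otimes>\<^bsub>PS\<^esub> inv\<^bsub>PS\<^esub> q) \<otimes>\<^bsub>PS\<^esub> b)"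
      unfolding p_def using hP q qi bP by (simp add: PS.m_assoc del: PS.Units_r_inv)
    then show ?thesis using fb bP qU by simp
  qed
  ultimately show thesis by (rule that)
qed

lemma distinguished_mult:
  assumes p: "distinguished d p" and q: "distinguished e q"
  shows "distinguished (d + e) (p \<otimes>\<^bsub>PS\<^esub> q)"
  unfolding distinguished_def
proof (intro conjI allI impI)
  have pc: "p i \<in> carrier R" and qc: "q i \<in> carrier R" for i using p q by (auto simp: distinguished_def ps_carrier)
  show "p \<otimes>\<^bsub>PS\<^esub> q \<in> carrier PS" using distinguished_closed[OF p] distinguished_closed[OF q] by simp
  show "(p \<otimes>\<^bsub>PS\<^esub> q) i = \<zero>" if i: "d + e < i" for i
    unfolding ps_mult
  proof (rule add.finprod_one_eqI)
    fix j assume "j \<in> {..i}"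
    show "p j \<otimes> q (i - j) = \<zero>"
    proof (cases "j > d")
      case True
      then show ?thesis using p qc by (simp add: distinguished_def)
    next
      case False
      then have "i - j > e" using i by simp
      then show ?thesis using q pc by (simp add: distinguished_def)
    qed
  qed
  have "(p \<otimes>\<^bsub>PS\<^esub> q) (d + e) = (\<Oplus>j\<in>{..d + e}. if d = j then \<one> else \<zero>)"
    unfolding ps_mult
  proof (rule finsum_cong')
    fix j assume "j \<in> {..d + e}"
    show "p j \<otimes> q (d + e - j) = (if d = j then \<one> else \<zero>)"
    proof (cases j d rule: linorder_cases)
      case less
      then have "d + e - j > e" by simp
      then show ?thesis using q pc less by (simp add: distinguished_def)
    next
      case equal
      then show ?thesis using p q by (simp add: distinguished_def)
    next
      case greater
      then show ?thesis using p qc by (simp add: distinguished_def)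
    qed
  qed auto
  also have "\<dots> = \<one>" using finsum_singleton[of d "{..d + e}" "\<lambda>_. \<one>"] by simp
  finally show "(p \<otimes>\<^bsub>PS\<^esub> q) (d + e) = \<one>" .
  fix i assume i: "i < d + e"
  show "(p \<otimes>\<^bsub>PS\<^esub> q) i \<in> N"
  proof (rule ps_mult_in_ideal[OF nbhd_ideal])
    fix j assume "j \<le> i"
    show "p j \<otimes> q (i - j) \<in> N"
    proof (cases "j < d")
      case True
      then show ?thesis using p qc by (auto simp: distinguished_def intro!: ideal.I_r_closed[OF nbhd_ideal])
    next
      case False
      then have "i - j < e" using i \<open>j \<le> i\<close> by simp
      then show ?thesis using q pc by (auto simp: distinguished_def intro!: ideal.I_l_closed[OF nbhd_ideal])
    qed
  qed
qed

lemma distinguished_0: "distinguished 0 p \<longleftrightarrow> p = \<one>\<^bsub>PS\<^esub>"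
proof
  assume "distinguished 0 p"
  then show "p = \<one>\<^bsub>PS\<^esub>" by (auto simp: distinguished_def fun_eq_iff ps_one)
qed (auto simp: distinguished_def ps_one)

end

text \<open>
  Since \<open>S\<close> is a basis of its monoid algebra, arcs on the spectrum of that algebra amount to
  monoid homomorphisms from \<open>S\<close> to the power series.
\<close>

definition arc_family :: "'m::comm_monoid_add set \<Rightarrow> ('a, 'e) ring_scheme \<Rightarrow> ('m \<Rightarrow> nat \<Rightarrow> 'a) \<Rightarrow> bool" where
  "arc_family S R \<phi> \<longleftrightarrow> (\<forall>m\<in>S. \<phi> m \<in> carrier (power_series_ring R)) \<and> \<phi> 0 = \<one>\<^bsub>power_series_ring R\<^esub> \<and>
     (\<forall>a\<in>S. \<forall>b\<in>S. \<phi> (a + b) = \<phi> a \<otimes>\<^bsub>power_series_ring R\<^esub> \<phi> b)"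

lemma arc_familyD:
  assumes "arc_family S R \<phi>"
  shows "m \<in> S \<Longrightarrow> \<phi> m \<in> carrier (power_series_ring R)" "\<phi> 0 = \<one>\<^bsub>power_series_ring R\<^esub>"
    "a \<in> S \<Longrightarrow> b \<in> S \<Longrightarrow> \<phi> (a + b) = \<phi> a \<otimes>\<^bsub>power_series_ring R\<^esub> \<phi> b"
    "m \<in> S \<Longrightarrow> \<phi> m i \<in> carrier R"
  using assms by (auto simp: arc_family_def ps_carrier)

lemma arc_family_hom:
  assumes "cring R" "cring S'" "h \<in> ring_hom R S'" "arc_family S R \<phi>"
  shows "arc_family S S' (\<lambda>m. h \<circ> \<phi> m)"
  using ps_hom[OF assms(1-3)] assms(4)
  by (simp add: arc_family_def ring_hom_mult ring_hom_one ring_hom_closed)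

lemma arc_family_mult:
  assumes R: "cring R" and \<phi>: "arc_family S R \<phi>" and \<psi>: "arc_family S R \<psi>"
  shows "arc_family S R (\<lambda>m. \<phi> m \<otimes>\<^bsub>power_series_ring R\<^esub> \<psi> m)"
proof -
  interpret R: cring R by fact
  interpret P: cring "power_series_ring R" by (rule R.power_series_cring)
  show ?thesis using \<phi> \<psi> by (simp add: arc_family_def P.m_ac)
qed

text \<open>
  Products of distinguished polynomials are distinguished, so uniqueness of the factorization
  makes both factors multiplicative.
\<close>

lemma (in complete_top_ring) weierstrass_arc_family:
  assumes S: "(0::'m::comm_monoid_add) \<in> S" "\<And>a b. a \<in> S \<Longrightarrow> b \<in> S \<Longrightarrow> a + b \<in> S"
    and d: "d 0 = (0::nat)" "\<And>a b. a \<in> S \<Longrightarrow> b \<in> S \<Longrightarrow> d (a + b) = d a + d b"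
    and \<phi>: "arc_family S R \<phi>"
    and \<phi>N: "\<And>m i. m \<in> S \<Longrightarrow> i < d m \<Longrightarrow> \<phi> m i \<in> N" and \<phi>U: "\<And>m. m \<in> S \<Longrightarrow> \<phi> m (d m) \<in> Units R"
  obtains p u where "arc_family S R p" "arc_family S R u"
    "\<And>m. m \<in> S \<Longrightarrow> distinguished (d m) (p m)" "\<And>m. m \<in> S \<Longrightarrow> u m \<in> Units PS"
    "\<And>m. m \<in> S \<Longrightarrow> \<phi> m = p m \<otimes>\<^bsub>PS\<^esub> u m"
proof -
  interpret PS: cring PS by (rule power_series_cring)
  have "\<forall>m\<in>S. \<exists>p u. distinguished (d m) p \<and> u \<in> Units PS \<and> \<phi> m = p \<otimes>\<^bsub>PS\<^esub> u"
  proof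
    fix m assume m: "m \<in> S"
    obtain p u where "distinguished (d m) p" "u \<in> Units PS" "\<phi> m = p \<otimes>\<^bsub>PS\<^esub> u"
      using weierstrass_preparation[OF arc_familyD(1)[OF \<phi> m] \<phi>N[OF m] \<phi>U[OF m]] by blast
    then show "\<exists>p u. distinguished (d m) p \<and> u \<in> Units PS \<and> \<phi> m = p \<otimes>\<^bsub>PS\<^esub> u" by blast
  qed
  then obtain p u where pu: "\<And>m. m \<in> S \<Longrightarrow> distinguished (d m) (p m)" "\<And>m. m \<in> S \<Longrightarrow> u m \<in> Units PS"
    "\<And>m. m \<in> S \<Longrightarrow> \<phi> m = p m \<otimes>\<^bsub>PS\<^esub> u m" by metis
  have uc: "u m \<in> carrier PS" and pc: "p m \<in> carrier PS" if "m \<in> S" for m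
    using PS.Units_closed[OF pu(2)[OF that]] distinguished_closed[OF pu(1)[OF that]] by auto
  have add: "p (a + b) = p a \<otimes>\<^bsub>PS\<^esub> p b" "u (a + b) = u a \<otimes>\<^bsub>PS\<^esub> u b" if ab: "a \<in> S" "b \<in> S" for a b
  proof -
    have s: "a + b \<in> S" using S ab by blast
    have 1: "distinguished (d (a + b)) (p a \<otimes>\<^bsub>PS\<^esub> p b)"
      unfolding d(2)[OF ab] by (rule distinguished_mult[OF pu(1)[OF ab(1)] pu(1)[OF ab(2)]])
    have 2: "u a \<otimes>\<^bsub>PS\<^esub> u b \<in> Units PS" using pu(2) ab by simp
    have 3: "p (a + b) \<otimes>\<^bsub>PS\<^esub> u (a + b) = (p a \<otimes>\<^bsub>PS\<^esub> p b) \<otimes>\<^bsub>PS\<^esub> (u a \<otimes>\<^bsub>PS\<^esub> u b)"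
      unfolding pu(3)[OF s, symmetric] arc_familyD(3)[OF \<phi> ab] pu(3)[OF ab(1)] pu(3)[OF ab(2)]
      using uc ab pc by (simp add: PS.m_ac)
    show "p (a + b) = p a \<otimes>\<^bsub>PS\<^esub> p b" "u (a + b) = u a \<otimes>\<^bsub>PS\<^esub> u b"
      using weierstrass_unique[OF pu(1)[OF s] 1 pu(2)[OF s] 2 3] by auto
  qed
  have p0: "p 0 = \<one>\<^bsub>PS\<^esub>" using pu(1)[OF S(1)] unfolding d(1) distinguished_0 .
  have u0: "u 0 = \<one>\<^bsub>PS\<^esub>" using pu(3)[OF S(1)] uc[OF S(1)] p0 arc_familyD(2)[OF \<phi>] by simp
  show thesis
    by (rule that[OF _ _ pu]) (use p0 u0 add pc uc in \<open>auto simp: arc_family_def\<close>)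
qed

text \<open>
  Together with uniqueness, this transports Weierstrass factorizations along adic homomorphisms.
\<close>

lemma distinguished_hom:
  assumes C: "complete_top_ring C" and D: "complete_top_ring D" and h: "h \<in> adic_hom C D"
    and p: "complete_top_ring.distinguished C d p"
  shows "complete_top_ring.distinguished D d (h \<circ> p)"
proof -
  interpret C: complete_top_ring C by fact
  interpret D: complete_top_ring D by fact
  interpret h: ring_hom_cring C D h
    by (intro ring_hom_cring.intro ring_hom_cring_axioms.intro C.cring_axioms D.cring_axioms adic_hom_hom[OF h])
  show ?thesis using p adic_hom_1[OF h] unfolding C.distinguished_def D.distinguished_def
    by (auto simp: ps_carrier)
qed


section \<open>Homomorphisms from the character lattice\<close>

text \<open>
  The basis vectors generate the lattice as a group.
\<close>

lemma lattice_vector_induct: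
  fixes m :: "int ^ 'n"
  assumes z: "P 0" and ax: "\<And>i. P (axis i 1)"
    and add: "\<And>a b. P a \<Longrightarrow> P b \<Longrightarrow> P (a + b)" and mi: "\<And>a. P a \<Longrightarrow> P (- a)"
  shows "P m"
proof -
  have n: "P (axis i (int k))" for i k
  proof (induction k)
    case 0
    then show ?case using z by (simp add: axis_def zero_vec_def cong: if_cong)
  next
    case (Suc k)
    have "axis i (int (Suc k)) = axis i 1 + axis i (int k)" by (auto simp: axis_def vec_eq_iff)
    then show ?case using add[OF ax Suc] by metis
  qed
  have k: "P (axis i k)" for i k
  proof (cases "k \<ge> 0")
    case True
    then show ?thesis using n[of i "nat k"] by simp
  next
    case False
    have "axis i k = - axis i (int (nat (- k)))" using False by (auto simp: axis_def vec_eq_iff)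
    then show ?thesis using mi[OF n] by metis
  qed
  have "P (\<Sum>i\<in>A. axis i (m $ i))" if "finite A" for A
    using that by induction (auto intro: z add k)
  moreover have "m = (\<Sum>i\<in>UNIV. axis i (m $ i))"
    by (auto simp: vec_eq_iff axis_def)
  ultimately show ?thesis by (metis finite)
qed

definition lattice_char :: "('g, 'e) monoid_scheme \<Rightarrow> ('n::finite \<Rightarrow> 'g) \<Rightarrow> int ^ 'n \<Rightarrow> 'g" where
  "lattice_char G c m = (\<Otimes>\<^bsub>G\<^esub>i\<in>UNIV. c i [^]\<^bsub>G\<^esub> (m $ i))"

context comm_group
begin

lemma lattice_char_closed: "(\<And>i. c i \<in> carrier G) \<Longrightarrow> lattice_char G c m \<in> carrier G"
  unfolding lattice_char_def by (rule finprod_closed) auto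

lemma lattice_char_0: "lattice_char G c 0 = \<one>"
  unfolding lattice_char_def by (simp add: finprod_one_eqI)

lemma lattice_char_add:
  assumes "\<And>i. c i \<in> carrier G"
  shows "lattice_char G c (a + b) = lattice_char G c a \<otimes> lattice_char G c b"
proof -
  have "lattice_char G c (a + b) = (\<Otimes>i\<in>UNIV. c i [^] (a $ i) \<otimes> c i [^] (b $ i))"
    unfolding lattice_char_def using assms by (intro finprod_cong') (auto simp: int_pow_mult)
  also have "\<dots> = lattice_char G c a \<otimes> lattice_char G c b"
    unfolding lattice_char_def using assms by (intro finprod_multf) auto
  finally show ?thesis .
qed

lemma lattice_char_axis:
  assumes "\<And>i. c i \<in> carrier G"
  shows "lattice_char G c (axis i 1) = c i"
proof -
  have "lattice_char G c (axis i 1) = (\<Otimes>j\<in>UNIV. if j = i then c j else \<one>)"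
    unfolding lattice_char_def using assms by (intro finprod_cong') (auto simp: axis_def)
  also have "\<dots> = c i" using assms by (intro finprod_singleton_swap) auto
  finally show ?thesis .
qed

lemma lattice_hom_zero:
  fixes f :: "int ^ 'n \<Rightarrow> 'a"
  assumes "\<And>a. f a \<in> carrier G" "\<And>a b. f (a + b) = f a \<otimes> f b"
  shows "f 0 = \<one>" "f (- a) = inv f a"
proof -
  have "f 0 \<otimes> f 0 = f 0" using assms(2)[of 0 0] by simp
  then show 1: "f 0 = \<one>" using assms(1) l_cancel_one by metis
  have "f (- a) \<otimes> f a = \<one>" using assms(2)[of "- a" a] 1 by simp
  then show "f (- a) = inv f a" using assms(1) inv_equality by metis
qed

lemma lattice_hom_ext:
  fixes f g :: "int ^ 'n \<Rightarrow> 'a"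
  assumes f: "\<And>a. f a \<in> carrier G" "\<And>a b. f (a + b) = f a \<otimes> f b"
    and g: "\<And>a. g a \<in> carrier G" "\<And>a b. g (a + b) = g a \<otimes> g b"
    and e: "\<And>i. f (axis i 1) = g (axis i 1)"
  shows "f m = g m"
proof (induction m rule: lattice_vector_induct)
  case 1
  show ?case using lattice_hom_zero(1)[of f, OF f] lattice_hom_zero(1)[of g, OF g] by simp
next
  case (4 a)
  then show ?case using lattice_hom_zero(2)[of f, OF f] lattice_hom_zero(2)[of g, OF g] by simp
qed (simp_all add: e f(2) g(2))

text \<open>Write \<open>m\<close> as a difference of two elements of \<open>S\<close> to extend the homomorphism to the lattice.\<close>

lemma lattice_char_param:
  fixes S :: "(int ^ 'n) set"
  assumes S0: "0 \<in> S" and S: "\<And>a b. a \<in> S \<Longrightarrow> b \<in> S \<Longrightarrow> a + b \<in> S"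
    and gen: "\<And>m. \<exists>a\<in>S. m + a \<in> S"
    and u: "\<And>m. m \<in> S \<Longrightarrow> u m \<in> carrier G" "\<And>a b. a \<in> S \<Longrightarrow> b \<in> S \<Longrightarrow> u (a + b) = u a \<otimes> u b"
  obtains c where "\<And>i. c i \<in> carrier G" "\<And>m. m \<in> S \<Longrightarrow> u m = lattice_char G c m"
proof -
  obtain t where t: "\<And>m. t m \<in> S" "\<And>m. m + t m \<in> S" using gen by metis
  define v where "v m = u (m + t m) \<otimes> inv (u (t m))" for m
  have v: "v m = u (m + a) \<otimes> inv (u a)" if a: "a \<in> S" "m + a \<in> S" for m a
  proof -
    have "u (m + t m) \<otimes> u a = u (m + t m + a)" using a t by (simp add: u)
    also have "m + t m + a = (m + a) + t m" by simp
    also have "u \<dots> = u (m + a) \<otimes> u (t m)" by (rule u(2)[OF a(2) t(1)])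
    finally have e: "u (m + t m) \<otimes> u a = u (m + a) \<otimes> u (t m)" .
    have c: "u (m + t m) \<in> carrier G" "u a \<in> carrier G" "u (m + a) \<in> carrier G" "u (t m) \<in> carrier G"
      using a t u(1) by auto
    have "u (m + t m) \<otimes> inv (u (t m)) = u (m + t m) \<otimes> u a \<otimes> inv (u a) \<otimes> inv (u (t m))"
      using c by (simp add: m_assoc)
    also have "\<dots> = u (m + a) \<otimes> u (t m) \<otimes> inv (u (t m)) \<otimes> inv (u a)"
      unfolding e using c by (simp add: m_ac)
    also have "\<dots> = u (m + a) \<otimes> inv (u a)" using c by (simp add: m_assoc)
    finally show ?thesis by (simp add: v_def)
  qed
  have vc: "v m \<in> carrier G" for m using t u(1) by (simp add: v_def)
  have va: "v (a + b) = v a \<otimes> v b" for a b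
  proof -
    have s: "t a + t b \<in> S" "(a + t a) + (b + t b) \<in> S" using t S by auto
    have c: "u (a + t a) \<in> carrier G" "u (b + t b) \<in> carrier G" "u (t a) \<in> carrier G" "u (t b) \<in> carrier G"
      using t u(1) by auto
    have "v (a + b) = u ((a + b) + (t a + t b)) \<otimes> inv (u (t a + t b))"
      using s by (intro v) (simp_all add: ac_simps)
    also have "(a + b) + (t a + t b) = (a + t a) + (b + t b)" by (simp add: ac_simps)
    also have "u \<dots> \<otimes> inv (u (t a + t b)) = u (a + t a) \<otimes> u (b + t b) \<otimes> inv (u (t a) \<otimes> u (t b))"
      using t by (simp add: u(2))
    also have "\<dots> = v a \<otimes> v b" unfolding v_def using c by (simp add: inv_mult m_ac)
    finally show ?thesis .
  qed
  have u0: "u 0 = \<one>"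
    using u(2)[OF S0 S0] u(1)[OF S0] l_cancel_one[of "u 0" "u 0"] by simp
  define c where "c i = v (axis i 1)" for i
  have cc: "c i \<in> carrier G" for i using vc by (simp add: c_def)
  have "v m = lattice_char G c m" for m
    by (rule lattice_hom_ext[of v]) (simp_all add: vc va cc lattice_char_closed lattice_char_add lattice_char_axis, simp add: c_def)
  moreover have "v m = u m" if "m \<in> S" for m using v[OF S0, of m] u0 u(1) that by simp
  ultimately show thesis using that[of c] cc by metis
qed

lemma lattice_char_unique:
  fixes S :: "(int ^ 'n) set"
  assumes gen: "\<And>m. \<exists>a\<in>S. m + a \<in> S"
    and c: "\<And>i. c i \<in> carrier G" and c': "\<And>i. c' i \<in> carrier G"
    and e: "\<And>m. m \<in> S \<Longrightarrow> lattice_char G c m = lattice_char G c' m"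
  shows "c = c'"
proof
  fix i
  obtain a where a: "a \<in> S" "axis i 1 + a \<in> S" using gen by blast
  have "c i \<otimes> lattice_char G c a = c' i \<otimes> lattice_char G c a"
    using e[OF a(2)] e[OF a(1)] c c' by (simp add: lattice_char_add lattice_char_axis)
  then show "c i = c' i" using right_cancel[OF lattice_char_closed[of c a] c[of i] c'[of i]] c by simp
qed

end

lemma lattice_char_hom:
  assumes G: "comm_group G" and H: "comm_group H" and h: "h \<in> hom G H" and c: "\<And>i. c i \<in> carrier G"
  shows "h (lattice_char G c m) = lattice_char H (\<lambda>i. h (c i)) m"
proof -
  interpret G: comm_group G by fact
  interpret H: comm_group H by fact
  have hc: "h x \<in> carrier H" if "x \<in> carrier G" for x using hom_in_carrier[OF h that] .
  show ?thesis
    by (rule H.lattice_hom_ext[of "\<lambda>m. h (lattice_char G c m)"])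
      (simp_all add: hc c G.lattice_char_closed G.lattice_char_add hom_mult[OF h] H.lattice_char_closed
        H.lattice_char_add G.lattice_char_axis H.lattice_char_axis)
qed

abbreviation ps_units :: "('a, 'e) ring_scheme \<Rightarrow> (nat \<Rightarrow> 'a) monoid" where
  "ps_units R \<equiv> units_of (power_series_ring R)"

text \<open>
  The arc on the torus with coordinates \<open>c\<close>, as a family of units indexed by the characters.
\<close>

definition torus_arc :: "('a, 'e) ring_scheme \<Rightarrow> ('n::finite \<Rightarrow> nat \<Rightarrow> 'a) \<Rightarrow> int ^ 'n \<Rightarrow> nat \<Rightarrow> 'a" where
  "torus_arc R c = lattice_char (ps_units R) c"

context cring
begin

interpretation PS: cring PS by (rule power_series_cring)
interpretation U: comm_group "ps_units R" by (rule PS.units_comm_group)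

lemma torus_arc_Units: "(\<And>i. c i \<in> Units PS) \<Longrightarrow> torus_arc R c m \<in> Units PS"
  using U.lattice_char_closed[of c m] by (simp add: torus_arc_def units_of_carrier)

lemma torus_arc_add:
  "(\<And>i. c i \<in> Units PS) \<Longrightarrow> torus_arc R c (a + b) = torus_arc R c a \<otimes>\<^bsub>PS\<^esub> torus_arc R c b"
  using U.lattice_char_add[of c a b] by (simp add: torus_arc_def units_of_carrier units_of_mult)

lemma torus_arc_0: "torus_arc R c 0 = \<one>\<^bsub>PS\<^esub>"
  using U.lattice_char_0[of c] by (simp add: torus_arc_def units_of_one)

lemma torus_arc_family: "(\<And>i. c i \<in> Units PS) \<Longrightarrow> arc_family S R (torus_arc R c)"
  using torus_arc_Units[of c] by (simp add: arc_family_def torus_arc_add torus_arc_0 PS.Units_closed)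

lemma torus_arc_param:
  fixes S :: "(int ^ 'n) set"
  assumes "0 \<in> S" "\<And>a b. a \<in> S \<Longrightarrow> b \<in> S \<Longrightarrow> a + b \<in> S" "\<And>m. \<exists>a\<in>S. m + a \<in> S"
    and u: "arc_family S R u" "\<And>m. m \<in> S \<Longrightarrow> u m \<in> Units PS"
  obtains c where "\<And>i. c i \<in> Units PS" "\<And>m. m \<in> S \<Longrightarrow> u m = torus_arc R c m"
proof -
  note result = that
  show thesis
  proof (rule U.lattice_char_param[OF assms(1-3), of u])
    show thesis if "\<And>i. c i \<in> carrier (ps_units R)" "\<And>m. m \<in> S \<Longrightarrow> u m = lattice_char (ps_units R) c m" for c
      using that(1)[unfolded units_of_carrier] that(2)
      by (intro result[of c]) (simp_all add: torus_arc_def)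
    show "u m \<in> carrier (ps_units R)" if "m \<in> S" for m using u(2)[OF that] by (simp add: units_of_carrier)
    show "u (a + b) = u a \<otimes>\<^bsub>ps_units R\<^esub> u b" if "a \<in> S" "b \<in> S" for a b
      using arc_familyD(3)[OF u(1) that] by (simp add: units_of_mult)
  qed
qed

lemma torus_arc_unique:
  fixes S :: "(int ^ 'n) set"
  assumes "\<And>m. \<exists>a\<in>S. m + a \<in> S" "\<And>i. c i \<in> Units PS" "\<And>i. c' i \<in> Units PS"
    and "\<And>m. m \<in> S \<Longrightarrow> torus_arc R c m = torus_arc R c' m"
  shows "c = c'"
  by (rule U.lattice_char_unique[OF assms(1)]) (use assms in \<open>auto simp: torus_arc_def units_of_carrier\<close>)

end

lemma ps_hom_Units:
  assumes "cring R" "cring S'" "h \<in> ring_hom R S'" "f \<in> Units (power_series_ring R)"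
  shows "h \<circ> f \<in> Units (power_series_ring S')"
  using ring_hom_Units[OF cring.power_series_cring[OF assms(1)] cring.power_series_cring[OF assms(2)]
      ps_hom[OF assms(1-3)] assms(4)] .

lemma torus_arc_hom:
  assumes R: "cring R" and S: "cring S'" and h: "h \<in> ring_hom R S'"
    and c: "\<And>i. c i \<in> Units (power_series_ring R)"
  shows "h \<circ> torus_arc R c m = torus_arc S' (\<lambda>i. h \<circ> c i) m"
proof -
  interpret P: cring "power_series_ring R" by (rule cring.power_series_cring[OF R])
  interpret Q: cring "power_series_ring S'" by (rule cring.power_series_cring[OF S])
  have "(\<lambda>f. h \<circ> f) \<in> hom (ps_units R) (ps_units S')"
    by (rule homI) (simp_all add: units_of_carrier units_of_mult ps_hom_Units[OF R S h]
        ring_hom_mult[OF ps_hom[OF R S h]] P.Units_closed)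
  then show ?thesis
    unfolding torus_arc_def
    using lattice_char_hom[OF P.units_comm_group Q.units_comm_group, of "\<lambda>f. h \<circ> f" c m] c
    by (simp add: units_of_carrier)
qed


section \<open>The dual cone\<close>

lemma lattice_pairing_inner: "real_of_int (lattice_pairing m u) = lattice_vec m \<bullet> lattice_vec u"
  by (simp add: lattice_pairing_def lattice_vec_def inner_vec_def)

lemma lattice_pairing_add: "lattice_pairing (a + b) u = lattice_pairing a u + lattice_pairing b u"
  by (simp add: lattice_pairing_def algebra_simps sum.distrib)

lemma lattice_pairing_0: "lattice_pairing 0 u = 0"
  by (simp add: lattice_pairing_def)

lemma lattice_pairing_mult: "lattice_pairing (k *s m) u = k * lattice_pairing m u"
  by (simp add: lattice_pairing_def sum_distrib_left algebra_simps)

lemma dual_cone_zero: "0 \<in> dual_cone_lattice \<sigma>"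
  by (simp add: dual_cone_lattice_def lattice_vec_def inner_vec_def)

lemma dual_cone_add: "a \<in> dual_cone_lattice \<sigma> \<Longrightarrow> b \<in> dual_cone_lattice \<sigma> \<Longrightarrow> a + b \<in> dual_cone_lattice \<sigma>"
proof -
  have "lattice_vec (a + b) = lattice_vec a + lattice_vec b" by (simp add: lattice_vec_def vec_eq_iff)
  then show "a \<in> dual_cone_lattice \<sigma> \<Longrightarrow> b \<in> dual_cone_lattice \<sigma> \<Longrightarrow> a + b \<in> dual_cone_lattice \<sigma>"
    by (simp add: dual_cone_lattice_def inner_add_left)
qed

lemma dual_cone_pairing:
  "m \<in> dual_cone_lattice \<sigma> \<Longrightarrow> lattice_vec n \<in> \<sigma> \<Longrightarrow> 0 \<le> lattice_pairing m n"
  using lattice_pairing_inner[of m n] by (auto simp: dual_cone_lattice_def)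

lemma dual_cone_hull:
  "m \<in> dual_cone_lattice (convex_cone hull (lattice_vec ` F)) \<longleftrightarrow> (\<forall>u\<in>F. 0 \<le> lattice_pairing m u)"
proof
  assume "\<forall>u\<in>F. 0 \<le> lattice_pairing m u"
  then have "lattice_vec ` F \<subseteq> {x. lattice_vec m \<bullet> x \<ge> 0}"
    using lattice_pairing_inner[of m] by (auto simp del: of_int_0_le_iff simp: of_int_0_le_iff[symmetric, where 'a = real])
  then have "convex_cone hull (lattice_vec ` F) \<subseteq> {x. lattice_vec m \<bullet> x \<ge> 0}"
    by (rule hull_minimal) (rule convex_cone_halfspace_ge)
  then show "m \<in> dual_cone_lattice (convex_cone hull (lattice_vec ` F))"
    by (auto simp: dual_cone_lattice_def)
next
  assume m: "m \<in> dual_cone_lattice (convex_cone hull (lattice_vec ` F))"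
  show "\<forall>u\<in>F. 0 \<le> lattice_pairing m u"
    using dual_cone_pairing[OF m] hull_inc[of _ "lattice_vec ` F"] by blast
qed

text \<open>
  By strong convexity, \<open>0\<close> is not in the convex hull of the nonzero generators, so a linear
  functional is positive on all of them. Rounding a large multiple of it gives the lattice point
  \<open>m0\<close>.
\<close>

lemma dual_cone_interior:
  fixes \<sigma> :: "(real ^ 'n) set"
  assumes "strongly_convex_rational_cone \<sigma>"
  obtains m0 where "m0 \<in> dual_cone_lattice \<sigma>" "\<And>m. \<exists>k::nat. m + int k *s m0 \<in> dual_cone_lattice \<sigma>"
proof -
  obtain F :: "(int ^ 'n) set" where F: "finite F" "\<sigma> = convex_cone hull (lattice_vec ` F)"
    and sc: "\<And>x. x \<in> \<sigma> \<Longrightarrow> - x \<in> \<sigma> \<Longrightarrow> x = 0"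
    using assms unfolding strongly_convex_rational_cone_def by blast
  define V where "V = lattice_vec ` F - {0}"
  have cone: "convex_cone \<sigma>" unfolding F(2) by (rule convex_cone_convex_cone_hull)
  have V\<sigma>: "V \<subseteq> \<sigma>" unfolding V_def F(2) using hull_subset[of "lattice_vec ` F" convex_cone] by blast
  have Vf: "finite V" using F(1) by (simp add: V_def)
  have "0 \<notin> convex hull V"
  proof
    assume "0 \<in> convex hull V"
    then obtain w where w: "\<And>x. x \<in> V \<Longrightarrow> 0 \<le> w x" "sum w V = 1" "(\<Sum>x\<in>V. w x *\<^sub>R x) = 0"
      using convex_hull_finite[OF Vf] by auto
    then obtain v where v: "v \<in> V" "w v > 0"
      using sum_nonneg_eq_0_iff[OF Vf, of w] by (metis less_eq_real_def zero_neq_one)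
    have "w v *\<^sub>R v + (\<Sum>x\<in>V - {v}. w x *\<^sub>R x) = 0" using w(3) v Vf by (simp add: sum.remove)
    then have e: "- (w v *\<^sub>R v) = (\<Sum>x\<in>V - {v}. w x *\<^sub>R x)" by (simp add: add_eq_0_iff)
    have "(\<Sum>x\<in>A. w x *\<^sub>R x) \<in> \<sigma>" if "finite A" "A \<subseteq> V" for A
      using that
      by (induction A) (use w(1) V\<sigma> in \<open>auto intro!: convex_cone_add[OF cone] convex_cone_scaleR[OF cone] convex_cone_contains_0[OF cone]\<close>)
    then have "- (w v *\<^sub>R v) \<in> \<sigma>" unfolding e using Vf by simp
    moreover have "w v *\<^sub>R v \<in> \<sigma>" using convex_cone_scaleR[OF cone] v V\<sigma> by auto
    ultimately have "w v *\<^sub>R v = 0" using sc by blast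
    then show False using v by (auto simp: V_def)
  qed
  then obtain a b where ab: "0 < b" "\<And>x. x \<in> convex hull V \<Longrightarrow> a \<bullet> x > b"
    using separating_hyperplane_closed_0[of "convex hull V"] compact_imp_closed[OF finite_imp_compact_convex_hull[OF Vf]]
    by auto
  have abV: "a \<bullet> x > b" if "x \<in> V" for x using ab(2) hull_inc[OF that] by blast
  define B where "B = (\<Sum>x\<in>V. \<Sum>i\<in>UNIV. \<bar>x $ i\<bar>)"
  obtain K :: nat where K: "B < real K * b" using reals_Archimedean3[OF ab(1)] by blast
  \<comment> \<open>A multiple of the separating functional \<open>a\<close> is rounded to a lattice point.  The factor \<open>K\<close> is so large that
    the rounding error, at most \<open>B\<close> on \<open>V\<close>, does not affect positivity.\<close>
  define m0 :: "int ^ 'n" where "m0 = (\<chi> i. \<lfloor>real K * a $ i\<rfloor>)"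
  have pos: "lattice_vec m0 \<bullet> x > 0" if x: "x \<in> V" for x
  proof -
    have "real K * (a \<bullet> x) - lattice_vec m0 \<bullet> x = (\<Sum>i\<in>UNIV. (real K * a $ i - of_int \<lfloor>real K * a $ i\<rfloor>) * x $ i)"
      by (simp add: m0_def lattice_vec_def inner_vec_def sum_distrib_left algebra_simps sum_subtractf)
    also have "\<dots> \<le> (\<Sum>i\<in>UNIV. \<bar>x $ i\<bar>)"
    proof (rule sum_mono)
      fix i
      have f: "0 \<le> real K * a $ i - of_int \<lfloor>real K * a $ i\<rfloor>" "real K * a $ i - of_int \<lfloor>real K * a $ i\<rfloor> \<le> 1"
        by linarith+
      have "(real K * a $ i - of_int \<lfloor>real K * a $ i\<rfloor>) * x $ i \<le> (real K * a $ i - of_int \<lfloor>real K * a $ i\<rfloor>) * \<bar>x $ i\<bar>"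
        by (rule mult_left_mono) (use f in auto)
      also have "\<dots> \<le> 1 * \<bar>x $ i\<bar>" by (rule mult_right_mono) (use f in auto)
      finally show "(real K * a $ i - of_int \<lfloor>real K * a $ i\<rfloor>) * x $ i \<le> \<bar>x $ i\<bar>" by simp
    qed
    also have "\<dots> \<le> B" unfolding B_def
      using member_le_sum[of x V "\<lambda>x. \<Sum>i\<in>UNIV. \<bar>x $ i\<bar>"] x Vf by (simp add: sum_nonneg)
    finally have "real K * (a \<bullet> x) - B \<le> lattice_vec m0 \<bullet> x" by simp
    moreover have "real K * b \<le> real K * (a \<bullet> x)" using abV[OF x] by (intro mult_left_mono) auto
    ultimately show ?thesis using K by simp
  qed
  have pp: "lattice_pairing m0 u \<ge> 1" if "u \<in> F" "lattice_vec u \<noteq> 0" for u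
  proof -
    have "lattice_vec u \<in> V" using that by (simp add: V_def)
    then have "real_of_int (lattice_pairing m0 u) > 0" unfolding lattice_pairing_inner by (rule pos)
    then show ?thesis by simp
  qed
  have p0: "lattice_pairing m u = 0" if "lattice_vec u = 0" for m u
    using lattice_pairing_inner[of m u] that by simp
  show thesis
  proof
    show "m0 \<in> dual_cone_lattice \<sigma>" unfolding F(2) dual_cone_hull using pp p0 by (metis order.refl zero_le_one order.trans)
    fix m
    define k where "k = nat (\<Sum>u\<in>F. \<bar>lattice_pairing m u\<bar>)"
    have "0 \<le> lattice_pairing (m + int k *s m0) u" if u: "u \<in> F" for u
    proof (cases "lattice_vec u = 0")
      case False
      have "\<bar>lattice_pairing m u\<bar> \<le> (\<Sum>u\<in>F. \<bar>lattice_pairing m u\<bar>)" by (rule member_le_sum) (use u F in auto)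
      also have "\<dots> = int k" by (simp add: k_def sum_nonneg)
      also have "\<dots> \<le> int k * lattice_pairing m0 u" using pp[OF u False] by (simp add: mult_le_cancel_left1)
      finally show ?thesis by (simp add: lattice_pairing_add lattice_pairing_mult)
    qed (simp add: p0)
    then show "\<exists>k::nat. m + int k *s m0 \<in> dual_cone_lattice \<sigma>" unfolding F(2) dual_cone_hull by blast
  qed
qed


section \<open>Quotients and localizations\<close>

lemma quotient_carrier: "x \<in> carrier (R Quot I) \<longleftrightarrow> (\<exists>a\<in>carrier R. x = I +>\<^bsub>R\<^esub> a)"
  by (auto simp: FactRing_def A_RCOSETS_def')

lemma (in ring) quotient_extend:
  assumes I: "ideal I R" and T: "ring T" and f: "f \<in> ring_hom R T" and z: "\<And>a. a \<in> I \<Longrightarrow> f a = \<zero>\<^bsub>T\<^esub>"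
  shows "\<exists>g\<in>ring_hom (R Quot I) T. \<forall>a\<in>carrier R. g (I +> a) = f a"
proof -
  interpret I: ideal I R by fact
  interpret T: ring T by fact
  interpret f: ring_hom_ring R T f by (rule ring_hom_ringI2[OF ring_axioms T f])
  interpret q: ring_hom_ring R "R Quot I" "(+>) I" by (rule I.rcos_ring_hom_ring)
  define g where "g x = f (SOME a. a \<in> x)" for x
  have g: "g (I +> a) = f a" if a: "a \<in> carrier R" for a
  proof -
    have "a \<in> I +> a" using a by (rule I.a_rcos_self)
    then have "(SOME b. b \<in> I +> a) \<in> I +> a" by (rule someI[where P = "\<lambda>b. b \<in> I +> a"])
    moreover define b where "b = (SOME b. b \<in> I +> a)"
    ultimately have "b \<in> I +> a" by simp
    then have "\<exists>i\<in>I. b = i \<oplus> a" by (simp add: a_r_coset_def')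
    then obtain i where i: "i \<in> I" "b = i \<oplus> a" ..
    have "g (I +> a) = f b" by (simp add: g_def b_def)
    then show ?thesis unfolding i(2) using a z[OF i(1)] I.Icarr[OF i(1)] by simp
  qed
  have s: "\<exists>a\<in>carrier R. x = I +> a" if "x \<in> carrier (R Quot I)" for x
    using that unfolding quotient_carrier .
  have "g \<in> ring_hom (R Quot I) T"
  proof (rule ring_hom_memI)
    fix x assume "x \<in> carrier (R Quot I)"
    then obtain a where a: "a \<in> carrier R" "x = I +> a" using s by blast
    show "g x \<in> carrier T" using a g by simp
    fix y assume "y \<in> carrier (R Quot I)"
    then obtain b where b: "b \<in> carrier R" "y = I +> b" using s by blast
    show "g (x \<otimes>\<^bsub>R Quot I\<^esub> y) = g x \<otimes>\<^bsub>T\<^esub> g y"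
      unfolding a(2) b(2) q.hom_mult[OF a(1) b(1), symmetric] g[OF a(1)] g[OF b(1)] g[OF m_closed[OF a(1) b(1)]]
      by (rule f.hom_mult[OF a(1) b(1)])
    show "g (x \<oplus>\<^bsub>R Quot I\<^esub> y) = g x \<oplus>\<^bsub>T\<^esub> g y"
      unfolding a(2) b(2) q.hom_add[OF a(1) b(1), symmetric] g[OF a(1)] g[OF b(1)] g[OF a_closed[OF a(1) b(1)]]
      by (rule f.hom_add[OF a(1) b(1)])
  next
    show "g \<one>\<^bsub>R Quot I\<^esub> = \<one>\<^bsub>T\<^esub>" unfolding q.hom_one[symmetric] g[OF one_closed] by (rule f.hom_one)
  qed
  then show ?thesis using g by (intro bexI[of _ g] ballI)
qed

locale localized = cring R for R (structure) +
  fixes S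
  assumes S_sub: "S \<subseteq> carrier R" and S_one: "\<one> \<in> S" and S_mult: "\<And>a b. a \<in> S \<Longrightarrow> b \<in> S \<Longrightarrow> a \<otimes> b \<in> S"
begin

abbreviation "L \<equiv> localization R S"

lemma S_carr: "s \<in> S \<Longrightarrow> s \<in> carrier R"
  using S_sub by blast

text \<open>
  The extra factor \<open>u\<close> is needed for the relation to be transitive when \<open>S\<close> contains zero
  divisors.
\<close>

lemma frac_eq_iff:
  assumes c: "a \<in> carrier R" "b \<in> carrier R" "s \<in> S" "t \<in> S"
  shows "frac R S a s = frac R S b t \<longleftrightarrow> (\<exists>u\<in>S. u \<otimes> (t \<otimes> a) = u \<otimes> (s \<otimes> b))"
proof -
  define rel where "rel a s b t \<longleftrightarrow> (\<exists>u\<in>S. u \<otimes> (t \<otimes> a) = u \<otimes> (s \<otimes> b))" for a s b t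
  have sym: "rel a s b t \<Longrightarrow> rel b t a s" for a s b t unfolding rel_def by metis
  have trans: "rel a s c r" if r1: "rel a s b t" and r2: "rel b t c r"
    and cc: "a \<in> carrier R" "b \<in> carrier R" "c \<in> carrier R" "s \<in> S" "t \<in> S" "r \<in> S" for a b c s t r
  proof -
    obtain u where u: "u \<in> S" "u \<otimes> (t \<otimes> a) = u \<otimes> (s \<otimes> b)" using r1 rel_def by blast
    obtain v where v: "v \<in> S" "v \<otimes> (r \<otimes> b) = v \<otimes> (t \<otimes> c)" using r2 rel_def by blast
    note k = cc(1-3) S_carr[OF cc(4)] S_carr[OF cc(5)] S_carr[OF cc(6)] S_carr[OF u(1)] S_carr[OF v(1)]
    have "(u \<otimes> v \<otimes> t) \<otimes> (r \<otimes> a) = v \<otimes> r \<otimes> (u \<otimes> (t \<otimes> a))" using k by (simp add: m_ac)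
    also have "\<dots> = u \<otimes> s \<otimes> (v \<otimes> (r \<otimes> b))" unfolding u(2) using k by (simp add: m_ac)
    also have "\<dots> = (u \<otimes> v \<otimes> t) \<otimes> (s \<otimes> c)" unfolding v(2) using k by (simp add: m_ac)
    finally show ?thesis unfolding rel_def using u v cc S_mult by (intro bexI[of _ "u \<otimes> v \<otimes> t"]) auto
  qed
  have mem: "(b, t) \<in> frac R S a s \<longleftrightarrow> b \<in> carrier R \<and> t \<in> S \<and> rel a s b t" for a s b t
    by (auto simp: frac_def rel_def)
  have self: "rel b t b t" if "b \<in> carrier R" for b t unfolding rel_def using S_one by blast
  have "frac R S a s = frac R S b t \<longleftrightarrow> rel a s b t"
  proof
    assume "frac R S a s = frac R S b t"
    moreover have "(b, t) \<in> frac R S b t" using mem self c by blast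
    ultimately show "rel a s b t" using mem by blast
  next
    assume r: "rel a s b t"
    have "(x, y) \<in> frac R S a s \<longleftrightarrow> (x, y) \<in> frac R S b t" for x y
      unfolding mem using trans[OF r] trans[OF sym[OF r]] c by blast
    then show "frac R S a s = frac R S b t" by auto
  qed
  then show ?thesis by (simp add: rel_def)
qed

lemma frac_memD:
  assumes "(b, t) \<in> frac R S a s" "a \<in> carrier R" "s \<in> S"
  shows "b \<in> carrier R" "t \<in> S" "frac R S a s = frac R S b t"
proof -
  show c: "b \<in> carrier R" "t \<in> S" using assms by (auto simp: frac_def)
  show "frac R S a s = frac R S b t" unfolding frac_eq_iff[OF assms(2) c(1) assms(3) c(2)]
    using assms by (auto simp: frac_def)
qed

lemma frac_self: "a \<in> carrier R \<Longrightarrow> s \<in> S \<Longrightarrow> (a, s) \<in> frac R S a s"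
  unfolding frac_def using S_one by blast

lemma carrier_L: "x \<in> carrier L \<longleftrightarrow> (\<exists>a\<in>carrier R. \<exists>s\<in>S. x = frac R S a s)"
  by (auto simp: localization_def)

lemma frac_closed [simp]: "a \<in> carrier R \<Longrightarrow> s \<in> S \<Longrightarrow> frac R S a s \<in> carrier L"
  using carrier_L by blast

lemma frac_mult:
  assumes c: "a \<in> carrier R" "b \<in> carrier R" "s \<in> S" "t \<in> S"
  shows "frac R S a s \<otimes>\<^bsub>L\<^esub> frac R S b t = frac R S (a \<otimes> b) (s \<otimes> t)"
proof -
  have e: "frac R S (a' \<otimes> b') (s' \<otimes> t') = frac R S (a \<otimes> b) (s \<otimes> t)"
    if m: "(a', s') \<in> frac R S a s" "(b', t') \<in> frac R S b t" for a' s' b' t'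
  proof -
    note A = frac_memD[OF m(1) c(1,3)] and B = frac_memD[OF m(2) c(2,4)]
    obtain u where u: "u \<in> S" "u \<otimes> (s' \<otimes> a) = u \<otimes> (s \<otimes> a')" using A(3) frac_eq_iff[OF c(1) A(1) c(3) A(2)] by blast
    obtain v where v: "v \<in> S" "v \<otimes> (t' \<otimes> b) = v \<otimes> (t \<otimes> b')" using B(3) frac_eq_iff[OF c(2) B(1) c(4) B(2)] by blast
    note k = c(1,2) A(1) B(1) S_carr[OF c(3)] S_carr[OF c(4)] S_carr[OF A(2)] S_carr[OF B(2)] S_carr[OF u(1)] S_carr[OF v(1)]
    have "(u \<otimes> v) \<otimes> ((s \<otimes> t) \<otimes> (a' \<otimes> b')) = (u \<otimes> (s \<otimes> a')) \<otimes> (v \<otimes> (t \<otimes> b'))" using k by (simp add: m_ac)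
    also have "\<dots> = (u \<otimes> v) \<otimes> ((s' \<otimes> t') \<otimes> (a \<otimes> b))" unfolding u(2)[symmetric] v(2)[symmetric] using k by (simp add: m_ac)
    finally show ?thesis
      using c A B u v S_mult by (subst frac_eq_iff) (auto intro!: bexI[of _ "u \<otimes> v"])
  qed
  have "frac R S a s \<otimes>\<^bsub>L\<^esub> frac R S b t =
      (\<Union>(a', s')\<in>frac R S a s. \<Union>(b', t')\<in>frac R S b t. frac R S (a' \<otimes> b') (s' \<otimes> t'))"
    by (simp add: localization_def)
  also have "\<dots> = (\<Union>p\<in>frac R S a s. \<Union>p'\<in>frac R S b t. frac R S (a \<otimes> b) (s \<otimes> t))"
    by (intro SUP_cong refl) (auto simp: e split: prod.splits)
  also have "\<dots> = frac R S (a \<otimes> b) (s \<otimes> t)" using frac_self[OF c(1,3)] frac_self[OF c(2,4)] by blast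
  finally show ?thesis .
qed

lemma frac_add:
  assumes c: "a \<in> carrier R" "b \<in> carrier R" "s \<in> S" "t \<in> S"
  shows "frac R S a s \<oplus>\<^bsub>L\<^esub> frac R S b t = frac R S (t \<otimes> a \<oplus> s \<otimes> b) (s \<otimes> t)"
proof -
  have e: "frac R S (t' \<otimes> a' \<oplus> s' \<otimes> b') (s' \<otimes> t') = frac R S (t \<otimes> a \<oplus> s \<otimes> b) (s \<otimes> t)"
    if m: "(a', s') \<in> frac R S a s" "(b', t') \<in> frac R S b t" for a' s' b' t'
  proof -
    note A = frac_memD[OF m(1) c(1,3)] and B = frac_memD[OF m(2) c(2,4)]
    obtain u where u: "u \<in> S" "u \<otimes> (s' \<otimes> a) = u \<otimes> (s \<otimes> a')" using A(3) frac_eq_iff[OF c(1) A(1) c(3) A(2)] by blast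
    obtain v where v: "v \<in> S" "v \<otimes> (t' \<otimes> b) = v \<otimes> (t \<otimes> b')" using B(3) frac_eq_iff[OF c(2) B(1) c(4) B(2)] by blast
    note k = c(1,2) A(1) B(1) S_carr[OF c(3)] S_carr[OF c(4)] S_carr[OF A(2)] S_carr[OF B(2)] S_carr[OF u(1)] S_carr[OF v(1)]
    have "(u \<otimes> v) \<otimes> ((s \<otimes> t) \<otimes> (t' \<otimes> a' \<oplus> s' \<otimes> b')) =
        v \<otimes> t \<otimes> t' \<otimes> (u \<otimes> (s \<otimes> a')) \<oplus> u \<otimes> s \<otimes> s' \<otimes> (v \<otimes> (t \<otimes> b'))" using k by (simp add: m_ac r_distr)
    also have "\<dots> = (u \<otimes> v) \<otimes> ((s' \<otimes> t') \<otimes> (t \<otimes> a \<oplus> s \<otimes> b))"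
      unfolding u(2)[symmetric] v(2)[symmetric] using k by (simp add: m_ac r_distr)
    finally have eq: "(u \<otimes> v) \<otimes> ((s \<otimes> t) \<otimes> (t' \<otimes> a' \<oplus> s' \<otimes> b')) = (u \<otimes> v) \<otimes> ((s' \<otimes> t') \<otimes> (t \<otimes> a \<oplus> s \<otimes> b))" .
    show ?thesis
      using k c A(2) B(2) u(1) v(1) S_mult eq
      by (subst frac_eq_iff) (simp_all, rule bexI[of _ "u \<otimes> v"], simp_all)
  qed
  have "frac R S a s \<oplus>\<^bsub>L\<^esub> frac R S b t =
      (\<Union>(a', s')\<in>frac R S a s. \<Union>(b', t')\<in>frac R S b t. frac R S (t' \<otimes> a' \<oplus> s' \<otimes> b') (s' \<otimes> t'))"
    by (simp add: localization_def)
  also have "\<dots> = (\<Union>p\<in>frac R S a s. \<Union>p'\<in>frac R S b t. frac R S (t \<otimes> a \<oplus> s \<otimes> b) (s \<otimes> t))"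
    by (intro SUP_cong refl) (auto simp: e split: prod.splits)
  also have "\<dots> = frac R S (t \<otimes> a \<oplus> s \<otimes> b) (s \<otimes> t)" using frac_self[OF c(1,3)] frac_self[OF c(2,4)] by blast
  finally show ?thesis .
qed

lemma frac_one: "\<one>\<^bsub>L\<^esub> = frac R S \<one> \<one>" and frac_zero: "\<zero>\<^bsub>L\<^esub> = frac R S \<zero> \<one>"
  by (simp_all add: localization_def)

lemma frac_eqI:
  "a \<in> carrier R \<Longrightarrow> b \<in> carrier R \<Longrightarrow> s \<in> S \<Longrightarrow> t \<in> S \<Longrightarrow> t \<otimes> a = s \<otimes> b \<Longrightarrow> frac R S a s = frac R S b t"
  using S_one by (subst frac_eq_iff) auto

lemma L_cring: "cring L"
proof (rule cringI)
  show "abelian_group L"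
  proof (rule abelian_groupI)
    show "\<zero>\<^bsub>L\<^esub> \<in> carrier L" by (simp add: frac_zero S_one)
    fix x y z assume "x \<in> carrier L"
    then obtain a s where x: "x = frac R S a s" "a \<in> carrier R" "s \<in> S" using carrier_L by blast
    note k = x(2) S_carr[OF x(3)]
    show "\<zero>\<^bsub>L\<^esub> \<oplus>\<^bsub>L\<^esub> x = x"
      unfolding frac_zero x(1) using k x(3) S_one by (simp add: frac_add)
    have "frac R S (\<ominus> a) s \<oplus>\<^bsub>L\<^esub> x = \<zero>\<^bsub>L\<^esub>"
      unfolding frac_zero x(1) using k x(3) S_one S_mult
      by (simp add: frac_add) (rule frac_eqI, auto simp: r_minus l_neg)
    then show "\<exists>y\<in>carrier L. y \<oplus>\<^bsub>L\<^esub> x = \<zero>\<^bsub>L\<^esub>" using k x(3) frac_closed[of "\<ominus> a" s] by blast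
    assume "y \<in> carrier L"
    then obtain b t where y: "y = frac R S b t" "b \<in> carrier R" "t \<in> S" using carrier_L by blast
    note k = k y(2) S_carr[OF y(3)]
    show "x \<oplus>\<^bsub>L\<^esub> y \<in> carrier L" unfolding x(1) y(1) using k x(3) y(3) S_mult by (simp add: frac_add)
    show "x \<oplus>\<^bsub>L\<^esub> y = y \<oplus>\<^bsub>L\<^esub> x" unfolding x(1) y(1) using k x(3) y(3) by (simp add: frac_add a_comm m_comm)
    assume "z \<in> carrier L"
    then obtain c r where z: "z = frac R S c r" "c \<in> carrier R" "r \<in> S" using carrier_L by blast
    note k = k z(2) S_carr[OF z(3)]
    show "x \<oplus>\<^bsub>L\<^esub> y \<oplus>\<^bsub>L\<^esub> z = x \<oplus>\<^bsub>L\<^esub> (y \<oplus>\<^bsub>L\<^esub> z)"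
      unfolding x(1) y(1) z(1) using k x(3) y(3) z(3) S_mult
      by (simp add: frac_add r_distr m_ac a_ac)
  qed
  show "Group.comm_monoid L"
  proof (rule comm_monoidI)
    show "\<one>\<^bsub>L\<^esub> \<in> carrier L" by (simp add: frac_one S_one)
    fix x y z assume "x \<in> carrier L"
    then obtain a s where x: "x = frac R S a s" "a \<in> carrier R" "s \<in> S" using carrier_L by blast
    note k = x(2) S_carr[OF x(3)]
    show "\<one>\<^bsub>L\<^esub> \<otimes>\<^bsub>L\<^esub> x = x" unfolding frac_one x(1) using k x(3) S_one by (simp add: frac_mult)
    assume "y \<in> carrier L"
    then obtain b t where y: "y = frac R S b t" "b \<in> carrier R" "t \<in> S" using carrier_L by blast
    note k = k y(2) S_carr[OF y(3)]
    show "x \<otimes>\<^bsub>L\<^esub> y \<in> carrier L" unfolding x(1) y(1) using k x(3) y(3) S_mult by (simp add: frac_mult)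
    show "x \<otimes>\<^bsub>L\<^esub> y = y \<otimes>\<^bsub>L\<^esub> x" unfolding x(1) y(1) using k x(3) y(3) by (simp add: frac_mult m_comm)
    assume "z \<in> carrier L"
    then obtain c r where z: "z = frac R S c r" "c \<in> carrier R" "r \<in> S" using carrier_L by blast
    note k = k z(2) S_carr[OF z(3)]
    show "x \<otimes>\<^bsub>L\<^esub> y \<otimes>\<^bsub>L\<^esub> z = x \<otimes>\<^bsub>L\<^esub> (y \<otimes>\<^bsub>L\<^esub> z)"
      unfolding x(1) y(1) z(1) using k x(3) y(3) z(3) S_mult by (simp add: frac_mult m_ac)
  qed
  fix x y z assume "x \<in> carrier L" "y \<in> carrier L" "z \<in> carrier L"
  then obtain a s b t c r where x: "x = frac R S a s" "a \<in> carrier R" "s \<in> S"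
    and y: "y = frac R S b t" "b \<in> carrier R" "t \<in> S" and z: "z = frac R S c r" "c \<in> carrier R" "r \<in> S"
    unfolding carrier_L by blast
  note k = x(2) S_carr[OF x(3)] y(2) S_carr[OF y(3)] z(2) S_carr[OF z(3)]
  show "(x \<oplus>\<^bsub>L\<^esub> y) \<otimes>\<^bsub>L\<^esub> z = x \<otimes>\<^bsub>L\<^esub> z \<oplus>\<^bsub>L\<^esub> y \<otimes>\<^bsub>L\<^esub> z"
    unfolding x(1) y(1) z(1) using k x(3) y(3) z(3) S_mult
    by (simp add: frac_add frac_mult) (rule frac_eqI, auto simp: r_distr l_distr m_ac)
qed

lemma frac_map_hom: "(\<lambda>a. frac R S a \<one>) \<in> ring_hom R L"
  by (rule ring_hom_memI) (simp_all add: S_one frac_mult frac_add frac_one)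

lemma frac_inverse: "s \<in> S \<Longrightarrow> t \<in> S \<Longrightarrow> frac R S s t \<otimes>\<^bsub>L\<^esub> frac R S t s = \<one>\<^bsub>L\<^esub>"
  using S_one S_mult by (simp add: frac_mult frac_one S_carr) (rule frac_eqI, auto simp: S_carr m_comm)

lemma frac_Units: "s \<in> S \<Longrightarrow> t \<in> S \<Longrightarrow> frac R S s t \<in> Units L"
proof -
  interpret L: cring L by (rule L_cring)
  show "s \<in> S \<Longrightarrow> t \<in> S \<Longrightarrow> frac R S s t \<in> Units L"
    using frac_inverse[of s t] by (intro L.Units_rightI[of _ "frac R S t s"]) (auto simp: S_carr)
qed

lemma localization_extend:
  assumes T: "cring T" and f: "f \<in> ring_hom R T" and U: "\<And>s. s \<in> S \<Longrightarrow> f s \<in> Units T"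
  shows "\<exists>g\<in>ring_hom L T. \<forall>a\<in>carrier R. \<forall>s\<in>S. g (frac R S a s) = f a \<otimes>\<^bsub>T\<^esub> inv\<^bsub>T\<^esub> (f s)"
proof -
  interpret T: cring T by fact
  interpret f: ring_hom_cring R T f by (intro ring_hom_cring.intro ring_hom_cring_axioms.intro cring_axioms T f)
  define g where "g x = (let p = SOME p. p \<in> x in f (fst p) \<otimes>\<^bsub>T\<^esub> inv\<^bsub>T\<^esub> (f (snd p)))" for x
  have eqI: "x \<otimes>\<^bsub>T\<^esub> inv\<^bsub>T\<^esub> u = y \<otimes>\<^bsub>T\<^esub> inv\<^bsub>T\<^esub> v"
    if "x \<in> carrier T" "y \<in> carrier T" "u \<in> Units T" "v \<in> Units T" "v \<otimes>\<^bsub>T\<^esub> x = u \<otimes>\<^bsub>T\<^esub> y" for x y u v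
  proof -
    note k = that(1,2) T.Units_closed[OF that(3)] T.Units_closed[OF that(4)] T.Units_inv_closed[OF that(3)] T.Units_inv_closed[OF that(4)]
    have "x \<otimes>\<^bsub>T\<^esub> inv\<^bsub>T\<^esub> u = inv\<^bsub>T\<^esub> v \<otimes>\<^bsub>T\<^esub> v \<otimes>\<^bsub>T\<^esub> x \<otimes>\<^bsub>T\<^esub> inv\<^bsub>T\<^esub> u" using k that by simp
    also have "\<dots> = inv\<^bsub>T\<^esub> v \<otimes>\<^bsub>T\<^esub> (v \<otimes>\<^bsub>T\<^esub> x) \<otimes>\<^bsub>T\<^esub> inv\<^bsub>T\<^esub> u" using k by (simp add: T.m_assoc)
    also have "\<dots> = inv\<^bsub>T\<^esub> v \<otimes>\<^bsub>T\<^esub> y \<otimes>\<^bsub>T\<^esub> (u \<otimes>\<^bsub>T\<^esub> inv\<^bsub>T\<^esub> u)" unfolding that(5) using k by (simp add: T.m_ac del: T.Units_r_inv)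
    also have "\<dots> = y \<otimes>\<^bsub>T\<^esub> inv\<^bsub>T\<^esub> v" using k that by (simp add: T.m_comm)
    finally show ?thesis .
  qed
  have g: "g (frac R S a s) = f a \<otimes>\<^bsub>T\<^esub> inv\<^bsub>T\<^esub> (f s)" if as: "a \<in> carrier R" "s \<in> S" for a s
  proof -
    obtain b t where bt: "(SOME p. p \<in> frac R S a s) = (b, t)" by (meson surj_pair)
    have "(SOME p. p \<in> frac R S a s) \<in> frac R S a s"
      using frac_self[OF as] by (rule someI[where P = "\<lambda>p. p \<in> frac R S a s"])
    then have m: "(b, t) \<in> frac R S a s" by (simp add: bt)
    note B = frac_memD[OF m as]
    obtain u where u: "u \<in> S" "u \<otimes> (t \<otimes> a) = u \<otimes> (s \<otimes> b)" using B(3) frac_eq_iff[OF as(1) B(1) as(2) B(2)] by blast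
    have "f (u \<otimes> (t \<otimes> a)) = f (u \<otimes> (s \<otimes> b))" unfolding u(2) ..
    then have "f u \<otimes>\<^bsub>T\<^esub> (f t \<otimes>\<^bsub>T\<^esub> f a) = f u \<otimes>\<^bsub>T\<^esub> (f s \<otimes>\<^bsub>T\<^esub> f b)"
      using u(1) as B S_carr by simp
    then have "f t \<otimes>\<^bsub>T\<^esub> f a = f s \<otimes>\<^bsub>T\<^esub> f b"
      using T.Units_l_cancel[OF U[OF u(1)], of "f t \<otimes>\<^bsub>T\<^esub> f a" "f s \<otimes>\<^bsub>T\<^esub> f b"] as B S_carr by simp
    then have "f b \<otimes>\<^bsub>T\<^esub> inv\<^bsub>T\<^esub> (f t) = f a \<otimes>\<^bsub>T\<^esub> inv\<^bsub>T\<^esub> (f s)"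
      by (intro eqI[symmetric]) (use as B U in auto)
    then show ?thesis by (simp add: g_def bt)
  qed
  have "g \<in> ring_hom L T"
  proof (rule ring_hom_memI)
    fix x assume "x \<in> carrier L"
    then obtain a s where x: "x = frac R S a s" "a \<in> carrier R" "s \<in> S" using carrier_L by blast
    note k = f.hom_closed[OF x(2)] T.Units_inv_closed[OF U[OF x(3)]] f.hom_closed[OF S_carr[OF x(3)]] U[OF x(3)]
    show "g x \<in> carrier T" unfolding x(1) g[OF x(2,3)] using k by simp
    fix y assume "y \<in> carrier L"
    then obtain b t where y: "y = frac R S b t" "b \<in> carrier R" "t \<in> S" using carrier_L by blast
    note k = k f.hom_closed[OF y(2)] T.Units_inv_closed[OF U[OF y(3)]] f.hom_closed[OF S_carr[OF y(3)]] U[OF y(3)]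
    have st: "s \<otimes> t \<in> S" using x y S_mult by simp
    have i: "inv\<^bsub>T\<^esub> (f (s \<otimes> t)) = inv\<^bsub>T\<^esub> (f s) \<otimes>\<^bsub>T\<^esub> inv\<^bsub>T\<^esub> (f t)"
    proof (rule T.comm_inv_char)
      show "f (s \<otimes> t) \<otimes>\<^bsub>T\<^esub> (inv\<^bsub>T\<^esub> (f s) \<otimes>\<^bsub>T\<^esub> inv\<^bsub>T\<^esub> (f t)) = \<one>\<^bsub>T\<^esub>"
      proof -
        have "f (s \<otimes> t) \<otimes>\<^bsub>T\<^esub> (inv\<^bsub>T\<^esub> (f s) \<otimes>\<^bsub>T\<^esub> inv\<^bsub>T\<^esub> (f t)) = (f s \<otimes>\<^bsub>T\<^esub> inv\<^bsub>T\<^esub> (f s)) \<otimes>\<^bsub>T\<^esub> (f t \<otimes>\<^bsub>T\<^esub> inv\<^bsub>T\<^esub> (f t))"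
          using k S_carr[OF x(3)] S_carr[OF y(3)] by (simp add: T.m_ac del: T.Units_r_inv)
        then show ?thesis using k by simp
      qed
    qed (use k st S_carr in auto)
    have i': "inv\<^bsub>T\<^esub> (f s \<otimes>\<^bsub>T\<^esub> f t) = inv\<^bsub>T\<^esub> (f s) \<otimes>\<^bsub>T\<^esub> inv\<^bsub>T\<^esub> (f t)"
      using i f.hom_mult[OF S_carr[OF x(3)] S_carr[OF y(3)]] by simp
    show "g (x \<otimes>\<^bsub>L\<^esub> y) = g x \<otimes>\<^bsub>T\<^esub> g y"
      unfolding x(1) y(1) frac_mult[OF x(2) y(2) x(3) y(3)] using x y st k
      by (simp add: g i' T.m_ac S_carr)
    have "g (x \<oplus>\<^bsub>L\<^esub> y) = (f t \<otimes>\<^bsub>T\<^esub> f a \<oplus>\<^bsub>T\<^esub> f s \<otimes>\<^bsub>T\<^esub> f b) \<otimes>\<^bsub>T\<^esub> (inv\<^bsub>T\<^esub> (f s) \<otimes>\<^bsub>T\<^esub> inv\<^bsub>T\<^esub> (f t))"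
      unfolding x(1) y(1) frac_add[OF x(2) y(2) x(3) y(3)] using x y st S_carr by (simp add: g i')
    also have "\<dots> = f a \<otimes>\<^bsub>T\<^esub> inv\<^bsub>T\<^esub> (f s) \<otimes>\<^bsub>T\<^esub> (f t \<otimes>\<^bsub>T\<^esub> inv\<^bsub>T\<^esub> (f t)) \<oplus>\<^bsub>T\<^esub> f b \<otimes>\<^bsub>T\<^esub> inv\<^bsub>T\<^esub> (f t) \<otimes>\<^bsub>T\<^esub> (f s \<otimes>\<^bsub>T\<^esub> inv\<^bsub>T\<^esub> (f s))"
      using k by (simp add: T.l_distr T.r_distr T.m_ac del: T.Units_r_inv)
    also have "\<dots> = g x \<oplus>\<^bsub>T\<^esub> g y" unfolding x(1) y(1) using x y k by (simp add: g)
    finally show "g (x \<oplus>\<^bsub>L\<^esub> y) = g x \<oplus>\<^bsub>T\<^esub> g y" .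
  next
    show "g \<one>\<^bsub>L\<^esub> = \<one>\<^bsub>T\<^esub>" unfolding frac_one using S_one by (simp add: g)
  qed
  then show ?thesis using g by (intro bexI[of _ g] ballI)
qed

lemma localization_hom_ext:
  assumes T: "cring T" and g: "g \<in> ring_hom L T" and h: "h \<in> ring_hom L T"
    and e: "\<And>a. a \<in> carrier R \<Longrightarrow> g (frac R S a \<one>) = h (frac R S a \<one>)" and x: "x \<in> carrier L"
  shows "g x = h x"
proof -
  interpret T: cring T by fact
  interpret L: cring L by (rule L_cring)
  obtain a s where as: "x = frac R S a s" "a \<in> carrier R" "s \<in> S" using x carrier_L by blast
  have xs: "frac R S s \<one> \<otimes>\<^bsub>L\<^esub> x = frac R S a \<one>"
    unfolding as(1) using as(2,3) S_one S_mult by (simp add: frac_mult S_carr) (rule frac_eqI, auto simp: S_carr)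
  have u: "g (frac R S s \<one>) \<in> Units T" by (rule ring_hom_Units[OF L_cring T g frac_Units[OF as(3) S_one]])
  have c: "frac R S s \<one> \<in> carrier L" using as(3) S_one by (simp add: S_carr)
  have "g (frac R S s \<one>) \<otimes>\<^bsub>T\<^esub> g x = g (frac R S s \<one>) \<otimes>\<^bsub>T\<^esub> h x"
    using ring_hom_mult[OF g c x] ring_hom_mult[OF h c x] e[OF as(2)] e[OF S_carr[OF as(3)]] xs by simp
  then show ?thesis
    using T.Units_l_cancel[OF u ring_hom_closed[OF g x] ring_hom_closed[OF h x]] by simp
qed

end


section \<open>Local rings and formal neighborhoods\<close>

locale prime_point = cring R for R (structure) +
  fixes p
  assumes p_prime: "p \<in> Spec R"
begin

lemma p_primeideal: "primeideal p R"
  using p_prime by (simp add: Spec_def)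

lemma p_ideal: "ideal p R"
  by (rule primeideal.axioms(1)[OF p_primeideal])

lemma p_carr: "a \<in> p \<Longrightarrow> a \<in> carrier R"
  by (rule ideal.Icarr[OF p_ideal])

lemma localized_p: "localized R (carrier R - p)"
proof (intro localized.intro localized_axioms.intro cring_axioms)
  show "carrier R - p \<subseteq> carrier R" by blast
  show "\<one> \<in> carrier R - p"
    using primeideal.I_notcarr[OF p_primeideal] ideal.one_imp_carrier[OF p_ideal] by auto
  show "a \<otimes> b \<in> carrier R - p" if "a \<in> carrier R - p" "b \<in> carrier R - p" for a b
    using that primeideal.I_prime[OF p_primeideal, of a b] by auto
qed

sublocale loc: localized R "carrier R - p" by (rule localized_p)

abbreviation "LR \<equiv> local_ring_at R p"
abbreviation "\<mm> \<equiv> local_max_ideal R p"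

lemma LR_eq: "LR = localization R (carrier R - p)"
  by (simp add: local_ring_at_def)

lemma LR_cring: "cring LR"
  unfolding LR_eq by (rule loc.L_cring)

sublocale LR: cring LR by (rule LR_cring)

lemma frac_in_max:
  assumes "a \<in> carrier R" "s \<in> carrier R - p"
  shows "frac R (carrier R - p) a s \<in> \<mm> \<longleftrightarrow> a \<in> p"
proof
  assume "frac R (carrier R - p) a s \<in> \<mm>"
  then obtain b t where b: "b \<in> p" "t \<in> carrier R - p" "frac R (carrier R - p) a s = frac R (carrier R - p) b t"
    unfolding local_max_ideal_def by blast
  then obtain u where u: "u \<in> carrier R - p" "u \<otimes> (t \<otimes> a) = u \<otimes> (s \<otimes> b)"
    using loc.frac_eq_iff[OF assms(1) p_carr[OF b(1)] assms(2) b(2)] by blast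
  have "u \<otimes> (s \<otimes> b) \<in> p" using b(1) u(1) assms by (intro ideal.I_l_closed[OF p_ideal]) auto
  then have "u \<otimes> (t \<otimes> a) \<in> p" unfolding u(2) .
  then show "a \<in> p"
    using u(1) b(2) assms(1) primeideal.I_prime[OF p_primeideal, of u "t \<otimes> a"]
      primeideal.I_prime[OF p_primeideal, of t a] by auto
qed (use assms in \<open>auto simp: local_max_ideal_def\<close>)

lemma max_ideal: "ideal \<mm> LR"
proof (rule idealI)
  show "ring LR" by (rule LR.ring_axioms)
  have el: "\<exists>a s. x = frac R (carrier R - p) a s \<and> a \<in> p \<and> s \<in> carrier R - p" if "x \<in> \<mm>" for x
    using that unfolding local_max_ideal_def by blast
  have ab: "x \<otimes>\<^bsub>LR\<^esub> a \<in> \<mm>" if am: "a \<in> \<mm>" and xc: "x \<in> carrier LR" for a x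
  proof -
    obtain b s where b: "a = frac R (carrier R - p) b s" "b \<in> p" "s \<in> carrier R - p" using el[OF am] by blast
    obtain c t where c: "x = frac R (carrier R - p) c t" "c \<in> carrier R" "t \<in> carrier R - p"
      using xc unfolding LR_eq loc.carrier_L by blast
    have "x \<otimes>\<^bsub>LR\<^esub> a = frac R (carrier R - p) (c \<otimes> b) (t \<otimes> s)"
      unfolding b(1) c(1) LR_eq by (rule loc.frac_mult[OF c(2) p_carr[OF b(2)] c(3) b(3)])
    moreover have "c \<otimes> b \<in> p" using b c by (intro ideal.I_l_closed[OF p_ideal])
    ultimately show ?thesis using loc.S_mult[OF c(3) b(3)] unfolding local_max_ideal_def by blast
  qed
  have sub: "\<mm> \<subseteq> carrier LR"
    using el loc.frac_closed p_carr unfolding LR_eq by blast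
  show "subgroup \<mm> (add_monoid LR)"
  proof (rule LR.add.subgroupI)
    show "\<mm> \<subseteq> carrier LR" by (rule sub)
    show "\<mm> \<noteq> {}"
      using additive_subgroup.zero_closed[OF ideal.axioms(1)[OF p_ideal]] loc.S_one unfolding local_max_ideal_def by blast
    show "\<ominus>\<^bsub>LR\<^esub> a \<in> \<mm>" if "a \<in> \<mm>" for a
      using ab[OF that, of "\<ominus>\<^bsub>LR\<^esub> \<one>\<^bsub>LR\<^esub>"] that sub by (simp add: LR.l_minus subset_iff)
    show "a \<oplus>\<^bsub>LR\<^esub> b \<in> \<mm>" if ab': "a \<in> \<mm>" "b \<in> \<mm>" for a b
    proof -
      obtain c s where c: "a = frac R (carrier R - p) c s" "c \<in> p" "s \<in> carrier R - p" using el[OF ab'(1)] by blast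
      obtain d t where d: "b = frac R (carrier R - p) d t" "d \<in> p" "t \<in> carrier R - p" using el[OF ab'(2)] by blast
      have "a \<oplus>\<^bsub>LR\<^esub> b = frac R (carrier R - p) (t \<otimes> c \<oplus> s \<otimes> d) (s \<otimes> t)"
        unfolding c(1) d(1) LR_eq by (rule loc.frac_add[OF p_carr[OF c(2)] p_carr[OF d(2)] c(3) d(3)])
      moreover have "t \<otimes> c \<oplus> s \<otimes> d \<in> p"
        using c d by (intro additive_subgroup.a_closed[OF ideal.axioms(1)[OF p_ideal]] ideal.I_l_closed[OF p_ideal]) auto
      ultimately show ?thesis using loc.S_mult[OF c(3) d(3)] unfolding local_max_ideal_def by blast
    qed
  qed
  show "x \<otimes>\<^bsub>LR\<^esub> a \<in> \<mm>" if "a \<in> \<mm>" "x \<in> carrier LR" for a x by (rule ab[OF that])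
  show "a \<otimes>\<^bsub>LR\<^esub> x \<in> \<mm>" if "a \<in> \<mm>" "x \<in> carrier LR" for a x
    using ab[OF that] that sub LR.m_comm[of a x] by auto
qed

lemma local_ring_map_hom: "local_ring_map R p \<in> ring_hom R LR"
proof -
  have "local_ring_map R p = (\<lambda>a. frac R (carrier R - p) a \<one>)" by (simp add: local_ring_map_def fun_eq_iff)
  then show ?thesis unfolding LR_eq using loc.frac_map_hom by simp
qed

lemma local_ring_map_max: "a \<in> carrier R \<Longrightarrow> local_ring_map R p a \<in> \<mm> \<longleftrightarrow> a \<in> p"
  unfolding local_ring_map_def by (rule frac_in_max[OF _ loc.S_one])

lemma local_ring_map_Units: "s \<in> carrier R - p \<Longrightarrow> local_ring_map R p s \<in> Units LR"
  unfolding local_ring_map_def LR_eq by (rule loc.frac_Units[OF _ loc.S_one])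

lemma residue_map_hom: "residue_map R p \<in> ring_hom R (residue_field R p)"
proof -
  have "residue_map R p = (+>\<^bsub>LR\<^esub>) \<mm> \<circ> local_ring_map R p" by (simp add: residue_map_def fun_eq_iff)
  then show ?thesis unfolding residue_field_def
    using ring_hom_trans[OF local_ring_map_hom ideal.rcos_ring_hom[OF max_ideal]] by simp
qed

lemma residue_cring: "cring (residue_field R p)"
  unfolding residue_field_def by (rule ideal.quotient_is_cring[OF max_ideal LR.cring_axioms])

sublocale res: cring "residue_field R p" by (rule residue_cring)

lemma residue_zero_iff:
  assumes "a \<in> carrier R"
  shows "residue_map R p a = \<zero>\<^bsub>residue_field R p\<^esub> \<longleftrightarrow> a \<in> p"
proof -
  have c: "local_ring_map R p a \<in> carrier LR" using ring_hom_closed[OF local_ring_map_hom assms] .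
  have "residue_map R p a = \<zero>\<^bsub>residue_field R p\<^esub> \<longleftrightarrow> \<mm> +>\<^bsub>LR\<^esub> local_ring_map R p a = \<mm> +>\<^bsub>LR\<^esub> \<zero>\<^bsub>LR\<^esub>"
    by (simp add: residue_map_def residue_field_def FactRing_def LR.coset_zero[OF max_ideal])
  then show ?thesis unfolding LR.coset_mem_iff[OF max_ideal c, symmetric] local_ring_map_max[OF assms] .
qed

lemma residue_Units: "s \<in> carrier R - p \<Longrightarrow> residue_map R p s \<in> Units (residue_field R p)"
  unfolding residue_map_def residue_field_def
  by (rule ring_hom_Units[OF LR_cring _ ideal.rcos_ring_hom[OF max_ideal] local_ring_map_Units])
     (rule residue_cring[unfolded residue_field_def])

lemma residue_extend:
  assumes T: "cring T" and f: "f \<in> ring_hom R T" and z: "\<And>a. a \<in> p \<Longrightarrow> f a = \<zero>\<^bsub>T\<^esub>"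
    and U: "\<And>s. s \<in> carrier R - p \<Longrightarrow> f s \<in> Units T"
  shows "\<exists>g\<in>ring_hom (residue_field R p) T. \<forall>a\<in>carrier R. g (residue_map R p a) = f a"
proof -
  interpret T: cring T by fact
  obtain g where g: "g \<in> ring_hom LR T"
    "\<forall>a\<in>carrier R. \<forall>s\<in>carrier R - p. g (frac R (carrier R - p) a s) = f a \<otimes>\<^bsub>T\<^esub> inv\<^bsub>T\<^esub> (f s)"
    using loc.localization_extend[OF T f U] unfolding LR_eq by blast
  have g1: "g (local_ring_map R p a) = f a" if "a \<in> carrier R" for a
    using g(2) that loc.S_one ring_hom_one[OF f] ring_hom_closed[OF f that] by (simp add: local_ring_map_def)
  have "g x = \<zero>\<^bsub>T\<^esub>" if xm: "x \<in> \<mm>" for x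
  proof -
    obtain a s where a: "x = frac R (carrier R - p) a s" "a \<in> p" "s \<in> carrier R - p"
      using xm unfolding local_max_ideal_def by blast
    have "g x = f a \<otimes>\<^bsub>T\<^esub> inv\<^bsub>T\<^esub> (f s)" using g(2) a p_carr by simp
    then show ?thesis using z[OF a(2)] T.Units_inv_closed[OF U[OF a(3)]] by simp
  qed
  then obtain h where h: "h \<in> ring_hom (residue_field R p) T" "\<forall>x\<in>carrier LR. h (\<mm> +>\<^bsub>LR\<^esub> x) = g x"
    using LR.quotient_extend[OF max_ideal T.ring_axioms g(1)] unfolding residue_field_def by blast
  have "h (residue_map R p a) = f a" if "a \<in> carrier R" for a
    unfolding residue_map_def using h(2) ring_hom_closed[OF local_ring_map_hom that] g1[OF that] by simp
  then show ?thesis using h(1) by (intro bexI[of _ h] ballI)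
qed

lemma residue_hom_ext:
  assumes T: "cring T" and g: "g \<in> ring_hom (residue_field R p) T" and h: "h \<in> ring_hom (residue_field R p) T"
    and e: "\<And>a. a \<in> carrier R \<Longrightarrow> g (residue_map R p a) = h (residue_map R p a)"
    and x: "x \<in> carrier (residue_field R p)"
  shows "g x = h x"
proof -
  note q = ideal.rcos_ring_hom[OF max_ideal, folded residue_field_def]
  obtain y where y: "y \<in> carrier LR" "x = \<mm> +>\<^bsub>LR\<^esub> y" using x unfolding residue_field_def quotient_carrier by blast
  have "(g \<circ> (+>\<^bsub>LR\<^esub>) \<mm>) y = (h \<circ> (+>\<^bsub>LR\<^esub>) \<mm>) y"
  proof (rule loc.localization_hom_ext[OF T, folded LR_eq, OF ring_hom_trans[OF q g] ring_hom_trans[OF q h] _ y(1)])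
    show "(g \<circ> (+>\<^bsub>LR\<^esub>) \<mm>) (frac R (carrier R - p) a \<one>) = (h \<circ> (+>\<^bsub>LR\<^esub>) \<mm>) (frac R (carrier R - p) a \<one>)"
      if "a \<in> carrier R" for a
      using e[OF that] by (simp add: residue_map_def local_ring_map_def)
  qed
  then show ?thesis by (simp add: y(2))
qed

lemma filtered_LR: "filtered_ring LR (ideal_power LR \<mm>)"
proof (intro filtered_ring.intro filtered_ring_axioms.intro LR.cring_axioms)
  show "ideal (ideal_power LR \<mm> n) LR" for n by (rule LR.ideal_power_ideal[OF max_ideal])
  show "ideal_power LR \<mm> (Suc n) \<subseteq> ideal_power LR \<mm> n" for n by (rule LR.ideal_power_Suc_subset[OF max_ideal])
  show "\<exists>k. ideal_power LR (ideal_power LR \<mm> 1) k \<subseteq> ideal_power LR \<mm> n" for n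
    using LR.ideal_power_1[OF max_ideal] by (intro exI[of _ n]) simp
qed

sublocale fil: filtered_ring LR "ideal_power LR \<mm>" by (rule filtered_LR)

abbreviation "FN \<equiv> formal_nbhd R p"

lemma FN_complete: "complete_top_ring FN"
  unfolding formal_nbhd_def by (rule fil.complete_top_ring_Compl)

lemma FN_map_eq: "formal_nbhd_map R p = completion_map LR (ideal_power LR \<mm>) \<circ> local_ring_map R p"
  by (simp add: formal_nbhd_map_def fun_eq_iff)

lemma FN_map_hom: "formal_nbhd_map R p \<in> ring_hom R FN"
  unfolding FN_map_eq formal_nbhd_def by (rule ring_hom_trans[OF local_ring_map_hom fil.completion_map_hom])

lemma FN_map_nbhd: "a \<in> p \<Longrightarrow> formal_nbhd_map R p a \<in> nbhd FN 1"
  unfolding FN_map_eq formal_nbhd_def comp_def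
  by (rule fil.completion_map_nbhd) (simp add: LR.ideal_power_1[OF max_ideal] local_ring_map_max p_carr del: ideal_power.simps)

lemma FN_map_Units: "s \<in> carrier R - p \<Longrightarrow> formal_nbhd_map R p s \<in> Units FN"
  unfolding FN_map_eq formal_nbhd_def comp_def
  by (rule ring_hom_Units[OF LR_cring fil.Compl_cring fil.completion_map_hom local_ring_map_Units])

lemma FN_eval_hom: "(\<lambda>x. x 1) \<in> ring_hom FN (residue_field R p)"
  using fil.proj_hom[of 1] LR.ideal_power_1[OF max_ideal] by (simp add: formal_nbhd_def residue_field_def del: ideal_power.simps)

lemma FN_map_eval: "formal_nbhd_map R p a 1 = residue_map R p a"
  using LR.ideal_power_1[OF max_ideal]
  by (simp add: formal_nbhd_map_def completion_map_def residue_map_def del: ideal_power.simps)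

lemma FN_nbhd_1: "x \<in> carrier FN \<Longrightarrow> x \<in> nbhd FN 1 \<longleftrightarrow> x 1 = \<zero>\<^bsub>residue_field R p\<^esub>"
  using LR.ideal_power_1[OF max_ideal]
  by (simp add: formal_nbhd_def fil.nbhd_Compl residue_field_def FactRing_def del: ideal_power.simps)

text \<open>
  The formal neighborhood is universal among complete rings in which \<open>p\<close> becomes small and its
  complement invertible; continuity is automatic because \<open>nbhd C 1\<close> is topologically nilpotent.
\<close>

lemma FN_extend:
  assumes C: "complete_top_ring C" and f: "f \<in> ring_hom R C"
    and fp: "\<And>a. a \<in> p \<Longrightarrow> f a \<in> nbhd C 1" and U: "\<And>s. s \<in> carrier R - p \<Longrightarrow> f s \<in> Units C"
  shows "\<exists>h\<in>adic_hom FN C. \<forall>a\<in>carrier R. h (formal_nbhd_map R p a) = f a"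
proof -
  interpret C: complete_top_ring C by fact
  obtain g where g: "g \<in> ring_hom LR C"
    "\<forall>a\<in>carrier R. \<forall>s\<in>carrier R - p. g (frac R (carrier R - p) a s) = f a \<otimes>\<^bsub>C\<^esub> inv\<^bsub>C\<^esub> (f s)"
    using loc.localization_extend[OF C.cring_axioms f U] unfolding LR_eq by blast
  have g1: "g (local_ring_map R p a) = f a" if "a \<in> carrier R" for a
    using g(2) that loc.S_one ring_hom_one[OF f] ring_hom_closed[OF f that] by (simp add: local_ring_map_def)
  have gm: "g ` \<mm> \<subseteq> nbhd C 1"
  proof (rule image_subsetI)
    fix x assume "x \<in> \<mm>"
    then obtain a s where a: "x = frac R (carrier R - p) a s" "a \<in> p" "s \<in> carrier R - p"
      unfolding local_max_ideal_def by blast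
    have "g x = f a \<otimes>\<^bsub>C\<^esub> inv\<^bsub>C\<^esub> (f s)" using g(2) a p_carr by simp
    then show "g x \<in> nbhd C 1" using ideal.I_r_closed[OF C.nbhd_ideal fp[OF a(2)] C.Units_inv_closed[OF U[OF a(3)]]] by simp
  qed
  have g2: "g ` ideal_power LR \<mm> 1 \<subseteq> nbhd C 1" using gm LR.ideal_power_1[OF max_ideal] by (simp del: ideal_power.simps)
  have gn: "\<exists>k. g ` ideal_power LR \<mm> k \<subseteq> nbhd C n" for n
  proof -
    obtain k where k: "ideal_power C (nbhd C 1) k \<subseteq> nbhd C n" using C.nilpotent by blast
    show ?thesis
      using subset_trans[OF ideal_power_hom[OF LR.ring_axioms C.ring_axioms g(1) max_ideal C.nbhd_ideal gm] k]
      by (intro exI[of _ k])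
  qed
  obtain h where h: "h \<in> adic_hom FN C" "\<forall>x\<in>carrier LR. h (completion_map LR (ideal_power LR \<mm>) x) = g x"
    using fil.completion_extend[OF C g(1) g2 gn] unfolding formal_nbhd_def by blast
  have "h (formal_nbhd_map R p a) = f a" if "a \<in> carrier R" for a
    unfolding FN_map_eq comp_def using h(2) ring_hom_closed[OF local_ring_map_hom that] g1[OF that] by simp
  then show ?thesis using h(1) by (intro bexI[of _ h] ballI)
qed

lemma FN_hom_ext:
  assumes C: "complete_top_ring C" and h: "h \<in> adic_hom FN C" and h': "h' \<in> adic_hom FN C"
    and e: "\<And>a. a \<in> carrier R \<Longrightarrow> h (formal_nbhd_map R p a) = h' (formal_nbhd_map R p a)"
    and x: "x \<in> carrier FN"
  shows "h x = h' x"
proof (rule fil.completion_hom_ext[OF C, folded formal_nbhd_def, OF h h' _ x])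
  fix y assume y: "y \<in> carrier LR"
  note m = fil.completion_map_hom[folded formal_nbhd_def]
  interpret C: complete_top_ring C by fact
  have "(h \<circ> completion_map LR (ideal_power LR \<mm>)) y = (h' \<circ> completion_map LR (ideal_power LR \<mm>)) y"
  proof (rule loc.localization_hom_ext[OF C.cring_axioms, folded LR_eq,
        OF ring_hom_trans[OF m adic_hom_hom[OF h]] ring_hom_trans[OF m adic_hom_hom[OF h']] _ y])
    show "(h \<circ> completion_map LR (ideal_power LR \<mm>)) (frac R (carrier R - p) a \<one>) =
        (h' \<circ> completion_map LR (ideal_power LR \<mm>)) (frac R (carrier R - p) a \<one>)" if "a \<in> carrier R" for a
      using e[OF that] by (simp add: formal_nbhd_map_def local_ring_map_def)
  qed
  then show "h (completion_map LR (ideal_power LR \<mm>) y) = h' (completion_map LR (ideal_power LR \<mm>) y)" by simp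
qed

end


section \<open>Tensor products\<close>

lemma frag_carrier_induct [consumes 1, case_names zero one diff]:
  assumes c: "Poly_Mapping.keys c \<subseteq> X"
    and 0: "P 0" and sing: "\<And>x. x \<in> X \<Longrightarrow> P (frag_of x)"
    and diff: "\<And>a b. Poly_Mapping.keys a \<subseteq> X \<Longrightarrow> Poly_Mapping.keys b \<subseteq> X \<Longrightarrow> P a \<Longrightarrow> P b \<Longrightarrow> P (a - b)"
  shows "P c"
proof -
  have "Poly_Mapping.keys c \<subseteq> X \<and> P c"
    using c
  proof (induction c rule: frag_induction)
    case (diff a b)
    then show ?case using assms(4)[of a b] keys_diff[of a b] by auto
  qed (use 0 sing in auto)
  then show ?thesis ..
qed

locale tensor_data = K: cring K + R: cring R + S: cring S
  for K :: "('k, 'g) ring_scheme" and R :: "('a, 'e) ring_scheme" and S :: "('b, 'f) ring_scheme" +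
  fixes \<phi> and \<psi>
  assumes \<phi>: "\<phi> \<in> ring_hom K R" and \<psi>: "\<psi> \<in> ring_hom K S"
begin

abbreviation "Fr \<equiv> free_tensor_ring R S"
abbreviation "X \<equiv> carrier R \<times> carrier S"

definition mul :: "('a \<times> 'b, int) poly_mapping \<Rightarrow> ('a \<times> 'b, int) poly_mapping \<Rightarrow> ('a \<times> 'b, int) poly_mapping" where
  "mul x y = frag_extend (\<lambda>(a, b). frag_extend (\<lambda>(c, d). frag_of (a \<otimes>\<^bsub>R\<^esub> c, b \<otimes>\<^bsub>S\<^esub> d)) y) x"

lemma Fr_simps: "carrier Fr = {x. Poly_Mapping.keys x \<subseteq> X}" "x \<otimes>\<^bsub>Fr\<^esub> y = mul x y"
  "\<one>\<^bsub>Fr\<^esub> = frag_of (\<one>\<^bsub>R\<^esub>, \<one>\<^bsub>S\<^esub>)" "\<zero>\<^bsub>Fr\<^esub> = 0" "x \<oplus>\<^bsub>Fr\<^esub> y = x + y"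
  by (simp_all add: free_tensor_ring_def mul_def)

lemma mul_of: "mul (frag_of (a, b)) (frag_of (c, d)) = frag_of (a \<otimes>\<^bsub>R\<^esub> c, b \<otimes>\<^bsub>S\<^esub> d)"
  by (simp add: mul_def)

lemma mul_diff_l: "mul (x - y) z = mul x z - mul y z"
  by (simp add: mul_def frag_extend_diff)

lemma mul_0_l: "mul 0 z = 0"
  by (simp add: mul_def)

lemma mul_0_r: "mul z 0 = 0"
  by (simp add: mul_def frag_extend_eq_0 split: prod.splits)

lemma mul_diff_r: "mul z (x - y) = mul z x - mul z y"
proof (induction z rule: frag_induction[OF subset_UNIV])
  case (2 p)
  then show ?case by (simp add: mul_def frag_extend_diff split: prod.splits)
qed (auto simp: mul_0_l mul_diff_l)

lemma mul_add_l: "mul (x + y) z = mul x z + mul y z"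
  by (simp add: mul_def frag_extend_add)

lemma mul_closed:
  assumes "Poly_Mapping.keys x \<subseteq> X" "Poly_Mapping.keys y \<subseteq> X"
  shows "Poly_Mapping.keys (mul x y) \<subseteq> X"
  using assms(1)
proof (induction x rule: frag_carrier_induct)
  case (one p)
  show ?case using assms(2)
  proof (induction y rule: frag_carrier_induct)
    case (one q)
    then show ?case using \<open>p \<in> X\<close> by (cases p; cases q) (auto simp: mul_of)
  next
    case (diff a b)
    show ?case unfolding mul_diff_r by (rule subset_trans[OF keys_diff Un_least[OF diff.IH]])
  qed (simp add: mul_0_r)
next
  case (diff a b)
  show ?case unfolding mul_diff_l by (rule subset_trans[OF keys_diff Un_least[OF diff.IH]])
qed (simp add: mul_0_l)

lemma mul_comm:
  assumes x: "Poly_Mapping.keys x \<subseteq> X" and y: "Poly_Mapping.keys y \<subseteq> X"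
  shows "mul x y = mul y x"
  using x
proof (induction x rule: frag_carrier_induct)
  case (one p)
  show ?case using y
  proof (induction y rule: frag_carrier_induct)
    case (one q)
    then show ?case using \<open>p \<in> X\<close> by (cases p; cases q) (auto simp: mul_of R.m_comm S.m_comm)
  qed (simp_all add: mul_0_r mul_0_l mul_diff_l mul_diff_r)
qed (simp_all add: mul_0_r mul_0_l mul_diff_l mul_diff_r)

lemma mul_assoc:
  assumes x: "Poly_Mapping.keys x \<subseteq> X" and y: "Poly_Mapping.keys y \<subseteq> X" and z: "Poly_Mapping.keys z \<subseteq> X"
  shows "mul (mul x y) z = mul x (mul y z)"
  using x
proof (induction x rule: frag_carrier_induct)
  case (one p)
  show ?case using y
  proof (induction y rule: frag_carrier_induct)
    case (one q)
    show ?case using z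
    proof (induction z rule: frag_carrier_induct)
      case (one r)
      then show ?case using \<open>p \<in> X\<close> \<open>q \<in> X\<close>
        by (cases p; cases q; cases r) (auto simp: mul_of R.m_assoc S.m_assoc)
    qed (simp_all add: mul_0_r mul_0_l mul_diff_l mul_diff_r)
  qed (simp_all add: mul_0_r mul_0_l mul_diff_l mul_diff_r)
qed (simp_all add: mul_0_r mul_0_l mul_diff_l mul_diff_r)

lemma mul_one:
  assumes x: "Poly_Mapping.keys x \<subseteq> X"
  shows "mul (frag_of (\<one>\<^bsub>R\<^esub>, \<one>\<^bsub>S\<^esub>)) x = x"
  using x
proof (induction x rule: frag_carrier_induct)
  case (one p)
  then show ?case by (cases p) (auto simp: mul_of)
qed (simp_all add: mul_0_r mul_diff_r)

lemma Fr_cring: "cring Fr"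
proof (rule cringI)
  show "abelian_group Fr"
  proof (rule abelian_groupI)
    show "x \<oplus>\<^bsub>Fr\<^esub> y \<in> carrier Fr" if "x \<in> carrier Fr" "y \<in> carrier Fr" for x y
      using that keys_add[of x y] by (auto simp: Fr_simps)
    show "\<exists>y\<in>carrier Fr. y \<oplus>\<^bsub>Fr\<^esub> x = \<zero>\<^bsub>Fr\<^esub>" if "x \<in> carrier Fr" for x
      using that by (intro bexI[of _ "- x"]) (auto simp: Fr_simps)
  qed (auto simp: Fr_simps ac_simps)
  show "Group.comm_monoid Fr"
    by (rule comm_monoidI) (auto simp: Fr_simps mul_closed mul_assoc mul_one intro: mul_comm dest: subsetD[OF mul_closed])
qed (simp add: Fr_simps mul_add_l)

sublocale Fr: cring Fr by (rule Fr_cring)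

lemma Fr_minus:
  assumes "x \<in> carrier Fr" "y \<in> carrier Fr" shows "x \<ominus>\<^bsub>Fr\<^esub> y = x - y"
proof -
  have m: "- y \<in> carrier Fr" using assms by (simp add: Fr_simps)
  have "- y \<oplus>\<^bsub>Fr\<^esub> y = \<zero>\<^bsub>Fr\<^esub>" by (simp add: Fr_simps)
  then have "\<ominus>\<^bsub>Fr\<^esub> y = - y" by (rule Fr.minus_equality[OF _ assms(2) m])
  then show ?thesis by (simp add: a_minus_def Fr_simps)
qed

lemma frag_of_closed: "a \<in> carrier R \<Longrightarrow> b \<in> carrier S \<Longrightarrow> frag_of (a, b) \<in> carrier Fr"
  by (simp add: Fr_simps)

abbreviation "gens \<equiv>
  {frag_of (a \<oplus>\<^bsub>R\<^esub> a', b) - frag_of (a, b) - frag_of (a', b) |a a' b.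
     a \<in> carrier R \<and> a' \<in> carrier R \<and> b \<in> carrier S} \<union>
  {frag_of (a, b \<oplus>\<^bsub>S\<^esub> b') - frag_of (a, b) - frag_of (a, b') |a b b'.
     a \<in> carrier R \<and> b \<in> carrier S \<and> b' \<in> carrier S} \<union>
  {frag_of (\<phi> c \<otimes>\<^bsub>R\<^esub> a, b) - frag_of (a, \<psi> c \<otimes>\<^bsub>S\<^esub> b) |c a b.
     c \<in> carrier K \<and> a \<in> carrier R \<and> b \<in> carrier S}"

abbreviation "I \<equiv> tensor_ideal K R \<phi> S \<psi>"
abbreviation "T \<equiv> tensor_ring K R \<phi> S \<psi>"
abbreviation "pure \<equiv> pure_tensor K R \<phi> S \<psi>"

lemma diff_closed [intro]: "x \<in> carrier Fr \<Longrightarrow> y \<in> carrier Fr \<Longrightarrow> x - y \<in> carrier Fr"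
  using Fr.minus_closed[of x y] Fr_minus[of x y] by simp

lemma \<phi>c: "c \<in> carrier K \<Longrightarrow> \<phi> c \<in> carrier R" and \<psi>c: "c \<in> carrier K \<Longrightarrow> \<psi> c \<in> carrier S"
  using ring_hom_closed[OF \<phi>] ring_hom_closed[OF \<psi>] by auto

lemma gens_closed: "gens \<subseteq> carrier Fr"
  by (auto intro!: diff_closed frag_of_closed \<phi>c \<psi>c simp: R.m_closed S.m_closed)

lemma I_ideal: "ideal I Fr"
  unfolding tensor_ideal_def by (rule Fr.genideal_ideal[OF gens_closed])

lemma gens_I: "gens \<subseteq> I"
  unfolding tensor_ideal_def by (rule Fr.genideal_self[OF gens_closed])

lemma T_cring: "cring T"
  unfolding tensor_ring_def by (rule ideal.quotient_is_cring[OF I_ideal Fr.cring_axioms])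

sublocale T: cring T by (rule T_cring)

abbreviation "q x \<equiv> I +>\<^bsub>Fr\<^esub> x"

lemma q_hom: "(+>\<^bsub>Fr\<^esub>) I \<in> ring_hom Fr T"
  unfolding tensor_ring_def by (rule ideal.rcos_ring_hom[OF I_ideal])

lemma pure_q: "pure a b = q (frag_of (a, b))"
  by (simp add: pure_tensor_def)

lemma q_eqI: "x \<in> carrier Fr \<Longrightarrow> y \<in> carrier Fr \<Longrightarrow> x - y \<in> I \<Longrightarrow> q x = q y"
  using Fr.quotient_eq_iff_same_a_r_cos[OF I_ideal, of x y] by (simp add: Fr_minus)

lemma pure_closed: "a \<in> carrier R \<Longrightarrow> b \<in> carrier S \<Longrightarrow> pure a b \<in> carrier T"
  unfolding pure_q by (rule ring_hom_closed[OF q_hom frag_of_closed])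

lemma pure_mult:
  assumes "a \<in> carrier R" "b \<in> carrier S" "c \<in> carrier R" "d \<in> carrier S"
  shows "pure a b \<otimes>\<^bsub>T\<^esub> pure c d = pure (a \<otimes>\<^bsub>R\<^esub> c) (b \<otimes>\<^bsub>S\<^esub> d)"
  unfolding pure_q ring_hom_mult[OF q_hom frag_of_closed[OF assms(1,2)] frag_of_closed[OF assms(3,4)], symmetric]
  by (simp add: Fr_simps mul_of)

lemma pure_one: "pure \<one>\<^bsub>R\<^esub> \<one>\<^bsub>S\<^esub> = \<one>\<^bsub>T\<^esub>"
  unfolding pure_q ring_hom_one[OF q_hom, symmetric] by (simp add: Fr_simps)

lemma pure_add_l:
  assumes "a \<in> carrier R" "a' \<in> carrier R" "b \<in> carrier S"
  shows "pure (a \<oplus>\<^bsub>R\<^esub> a') b = pure a b \<oplus>\<^bsub>T\<^esub> pure a' b"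
proof -
  note f = frag_of_closed[OF assms(1,3)] frag_of_closed[OF assms(2,3)]
  have "frag_of (a \<oplus>\<^bsub>R\<^esub> a', b) - (frag_of (a, b) + frag_of (a', b)) \<in> I"
    unfolding diff_diff_eq[symmetric] by (rule subsetD[OF gens_I]) (use assms in blast)
  then have "q (frag_of (a \<oplus>\<^bsub>R\<^esub> a', b)) = q (frag_of (a, b) \<oplus>\<^bsub>Fr\<^esub> frag_of (a', b))"
    using assms f by (intro q_eqI) (auto simp: frag_of_closed Fr.a_closed, simp add: Fr_simps)
  then show ?thesis unfolding pure_q by (simp add: ring_hom_add[OF q_hom f])
qed

lemma pure_add_r:
  assumes "a \<in> carrier R" "b \<in> carrier S" "b' \<in> carrier S"
  shows "pure a (b \<oplus>\<^bsub>S\<^esub> b') = pure a b \<oplus>\<^bsub>T\<^esub> pure a b'"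
proof -
  note f = frag_of_closed[OF assms(1,2)] frag_of_closed[OF assms(1,3)]
  have "frag_of (a, b \<oplus>\<^bsub>S\<^esub> b') - (frag_of (a, b) + frag_of (a, b')) \<in> I"
    unfolding diff_diff_eq[symmetric] by (rule subsetD[OF gens_I]) (use assms in blast)
  then have "q (frag_of (a, b \<oplus>\<^bsub>S\<^esub> b')) = q (frag_of (a, b) \<oplus>\<^bsub>Fr\<^esub> frag_of (a, b'))"
    using assms f by (intro q_eqI) (auto simp: frag_of_closed Fr.a_closed, simp add: Fr_simps)
  then show ?thesis unfolding pure_q by (simp add: ring_hom_add[OF q_hom f])
qed

lemma pure_balanced: "c \<in> carrier K \<Longrightarrow> pure (\<phi> c) \<one>\<^bsub>S\<^esub> = pure \<one>\<^bsub>R\<^esub> (\<psi> c)"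
proof -
  assume c: "c \<in> carrier K"
  have "frag_of (\<phi> c \<otimes>\<^bsub>R\<^esub> \<one>\<^bsub>R\<^esub>, \<one>\<^bsub>S\<^esub>) - frag_of (\<one>\<^bsub>R\<^esub>, \<psi> c \<otimes>\<^bsub>S\<^esub> \<one>\<^bsub>S\<^esub>) \<in> I"
    by (rule subsetD[OF gens_I]) (use c in blast)
  then show ?thesis unfolding pure_q using c \<phi>c[OF c] \<psi>c[OF c] by (intro q_eqI) (auto simp: frag_of_closed)
qed

definition "inl a = pure a \<one>\<^bsub>S\<^esub>"
definition "inr b = pure \<one>\<^bsub>R\<^esub> b"

lemma inl_hom: "inl \<in> ring_hom R T"
  by (rule ring_hom_memI) (simp_all add: inl_def pure_closed pure_mult pure_add_l pure_one)

lemma inr_hom: "inr \<in> ring_hom S T"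
  by (rule ring_hom_memI) (simp_all add: inr_def pure_closed pure_mult pure_add_r pure_one)

lemma inl_inr: "a \<in> carrier R \<Longrightarrow> b \<in> carrier S \<Longrightarrow> pure a b = inl a \<otimes>\<^bsub>T\<^esub> inr b"
  by (simp add: inl_def inr_def pure_mult)

lemma tensor_extend:
  assumes D: "cring D" and f: "f \<in> ring_hom R D" and g: "g \<in> ring_hom S D"
    and fg: "\<And>c. c \<in> carrier K \<Longrightarrow> f (\<phi> c) = g (\<psi> c)"
  shows "\<exists>h\<in>ring_hom T D. (\<forall>a\<in>carrier R. h (inl a) = f a) \<and> (\<forall>b\<in>carrier S. h (inr b) = g b)"
proof -
  interpret D: cring D by fact
  note fc = ring_hom_closed[OF f] and gc = ring_hom_closed[OF g]
  have ac: "comm_group (add_monoid D)" by (rule D.a_comm_group)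
  have im: "(\<lambda>p. f (fst p) \<otimes>\<^bsub>D\<^esub> g (snd p)) ` X \<subseteq> carrier (add_monoid D)" using fc gc by auto
  obtain E where E: "E \<in> hom (free_Abelian_group X) (add_monoid D)"
    "\<And>p. p \<in> X \<Longrightarrow> E (frag_of p) = f (fst p) \<otimes>\<^bsub>D\<^esub> g (snd p)"
    using comm_group.free_Abelian_group_universal[OF ac im] by blast
  have Ec: "E x \<in> carrier D" if "x \<in> carrier Fr" for x
    using hom_in_carrier[OF E(1), of x] that by (simp add: free_Abelian_group_def Fr_simps)
  have Ea: "E (x + y) = E x \<oplus>\<^bsub>D\<^esub> E y" if "x \<in> carrier Fr" "y \<in> carrier Fr" for x y
    using hom_mult[OF E(1), of x y] that by (simp add: free_Abelian_group_def Fr_simps)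
  have E0: "E 0 = \<zero>\<^bsub>D\<^esub>"
  proof -
    have z: "0 \<in> carrier Fr" by (simp add: Fr_simps)
    have "E 0 \<oplus>\<^bsub>D\<^esub> E 0 = E 0" using Ea[OF z z] by simp
    then show ?thesis using Ec[OF z] D.add.l_cancel_one by simp
  qed
  have Ed: "E (x - y) = E x \<ominus>\<^bsub>D\<^esub> E y" if xy: "x \<in> carrier Fr" "y \<in> carrier Fr" for x y
  proof -
    have "E x = E (x - y) \<oplus>\<^bsub>D\<^esub> E y" using Ea[OF diff_closed[OF xy] xy(2)] by simp
    then show ?thesis using Ec[OF xy(1)] Ec[OF xy(2)] Ec[OF diff_closed[OF xy]]
      by (simp add: a_minus_def D.a_assoc D.r_neg)
  qed
  have Em: "E (mul x y) = E x \<otimes>\<^bsub>D\<^esub> E y" if x: "Poly_Mapping.keys x \<subseteq> X" and y: "Poly_Mapping.keys y \<subseteq> X" for x y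
    using x
  proof (induction x rule: frag_carrier_induct)
    case zero
    then show ?case using y Ec by (simp add: mul_0_l E0 Fr_simps)
  next
    case (one p)
    show ?case using y
    proof (induction y rule: frag_carrier_induct)
      case zero
      then show ?case using one Ec by (simp add: mul_0_r E0 Fr_simps)
    next
      case (one r)
      obtain a b c d where pr: "p = (a, b)" "r = (c, d)" by (meson surj_pair)
      have ab: "a \<in> carrier R" "b \<in> carrier S" "c \<in> carrier R" "d \<in> carrier S" using one \<open>p \<in> X\<close> pr by auto
      then show ?case unfolding pr mul_of
        using fc gc by (simp add: E(2) ring_hom_mult[OF f] ring_hom_mult[OF g] D.m_ac)
    next
      case (diff u v)
      have k: "frag_of p \<in> carrier Fr" "u \<in> carrier Fr" "v \<in> carrier Fr" using \<open>p \<in> X\<close> diff by (auto simp: Fr_simps)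
      have m: "mul (frag_of p) u \<in> carrier Fr" "mul (frag_of p) v \<in> carrier Fr"
        using k mul_closed by (auto simp: Fr_simps)
      show ?case unfolding mul_diff_r Ed[OF m] Ed[OF k(2,3)] diff.IH
        using Ec k by (simp add: a_minus_def D.r_distr D.r_minus)
    qed
  next
    case (diff u v)
    have k: "y \<in> carrier Fr" "u \<in> carrier Fr" "v \<in> carrier Fr" using y diff by (auto simp: Fr_simps)
    have m: "mul u y \<in> carrier Fr" "mul v y \<in> carrier Fr"
      using k mul_closed by (auto simp: Fr_simps)
    show ?case unfolding mul_diff_l Ed[OF m] Ed[OF k(2,3)] diff.IH
      using Ec k by (simp add: a_minus_def D.l_distr D.l_minus)
  qed
  have Eh: "E \<in> ring_hom Fr D"
  proof (rule ring_hom_memI)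
    show "E \<one>\<^bsub>Fr\<^esub> = \<one>\<^bsub>D\<^esub>"
      using E(2)[of "(\<one>\<^bsub>R\<^esub>, \<one>\<^bsub>S\<^esub>)"] by (simp add: Fr_simps ring_hom_one[OF f] ring_hom_one[OF g])
    show "E x \<in> carrier D" if "x \<in> carrier Fr" for x by (rule Ec[OF that])
    show "E (x \<otimes>\<^bsub>Fr\<^esub> y) = E x \<otimes>\<^bsub>D\<^esub> E y" if "x \<in> carrier Fr" "y \<in> carrier Fr" for x y
      using Em that by (simp add: Fr_simps)
    show "E (x \<oplus>\<^bsub>Fr\<^esub> y) = E x \<oplus>\<^bsub>D\<^esub> E y" if "x \<in> carrier Fr" "y \<in> carrier Fr" for x y
      using Ea that by (simp add: Fr_simps(5))
  qed
  interpret Eh: ring_hom_ring Fr D E by (rule ring_hom_ringI2[OF Fr.ring_axioms D.ring_axioms Eh])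
  have Ep: "E (frag_of (a, b)) = f a \<otimes>\<^bsub>D\<^esub> g b" if "a \<in> carrier R" "b \<in> carrier S" for a b
    using E(2)[of "(a, b)"] that by simp
  have "gens \<subseteq> {x \<in> carrier Fr. E x = \<zero>\<^bsub>D\<^esub>}"
  proof
    fix x assume x: "x \<in> gens"
    have xc: "x \<in> carrier Fr" using subsetD[OF gens_closed x] .
    have z: "(u \<oplus>\<^bsub>D\<^esub> v) \<ominus>\<^bsub>D\<^esub> u \<ominus>\<^bsub>D\<^esub> v = \<zero>\<^bsub>D\<^esub>" if "u \<in> carrier D" "v \<in> carrier D" for u v
      using that by algebra
    from x have "E x = \<zero>\<^bsub>D\<^esub>"
    proof (elim UnE CollectE exE conjE)
      fix a a' b assume c: "x = frag_of (a \<oplus>\<^bsub>R\<^esub> a', b) - frag_of (a, b) - frag_of (a', b)"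
        "a \<in> carrier R" "a' \<in> carrier R" "b \<in> carrier S"
      then have "E x = (f a \<oplus>\<^bsub>D\<^esub> f a') \<otimes>\<^bsub>D\<^esub> g b \<ominus>\<^bsub>D\<^esub> f a \<otimes>\<^bsub>D\<^esub> g b \<ominus>\<^bsub>D\<^esub> f a' \<otimes>\<^bsub>D\<^esub> g b"
        by (simp add: Ed Ep frag_of_closed diff_closed ring_hom_add[OF f])
      then show ?thesis using c fc gc z[of "f a \<otimes>\<^bsub>D\<^esub> g b" "f a' \<otimes>\<^bsub>D\<^esub> g b"] by (simp add: D.l_distr)
    next
      fix a b b' assume c: "x = frag_of (a, b \<oplus>\<^bsub>S\<^esub> b') - frag_of (a, b) - frag_of (a, b')"
        "a \<in> carrier R" "b \<in> carrier S" "b' \<in> carrier S"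
      then have "E x = f a \<otimes>\<^bsub>D\<^esub> (g b \<oplus>\<^bsub>D\<^esub> g b') \<ominus>\<^bsub>D\<^esub> f a \<otimes>\<^bsub>D\<^esub> g b \<ominus>\<^bsub>D\<^esub> f a \<otimes>\<^bsub>D\<^esub> g b'"
        by (simp add: Ed Ep frag_of_closed diff_closed ring_hom_add[OF g])
      then show ?thesis using c fc gc z[of "f a \<otimes>\<^bsub>D\<^esub> g b" "f a \<otimes>\<^bsub>D\<^esub> g b'"] by (simp add: D.r_distr)
    next
      fix c a b assume c: "x = frag_of (\<phi> c \<otimes>\<^bsub>R\<^esub> a, b) - frag_of (a, \<psi> c \<otimes>\<^bsub>S\<^esub> b)"
        "c \<in> carrier K" "a \<in> carrier R" "b \<in> carrier S"
      then have "E x = (g (\<psi> c) \<otimes>\<^bsub>D\<^esub> f a) \<otimes>\<^bsub>D\<^esub> g b \<ominus>\<^bsub>D\<^esub> f a \<otimes>\<^bsub>D\<^esub> (g (\<psi> c) \<otimes>\<^bsub>D\<^esub> g b)"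
        by (simp add: Ed Ep frag_of_closed ring_hom_mult[OF f] ring_hom_mult[OF g] \<phi>c \<psi>c fg)
      then show ?thesis using c fc gc \<psi>c by (simp add: D.m_ac a_minus_def D.r_neg)
    qed
    then show "x \<in> {x \<in> carrier Fr. E x = \<zero>\<^bsub>D\<^esub>}" using xc by simp
  qed
  then have "gens \<subseteq> a_kernel Fr D E" unfolding a_kernel_def' .
  then have "I \<subseteq> a_kernel Fr D E"
    unfolding tensor_ideal_def by (rule Fr.genideal_minimal[OF Eh.kernel_is_ideal])
  then have Iz: "E x = \<zero>\<^bsub>D\<^esub>" if "x \<in> I" for x using that unfolding a_kernel_def' by blast
  obtain h where h: "h \<in> ring_hom T D" "\<forall>x\<in>carrier Fr. h (q x) = E x"
    using Fr.quotient_extend[OF I_ideal D.ring_axioms Eh Iz] unfolding tensor_ring_def by blast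
  show ?thesis
  proof (intro bexI[OF _ h(1)] conjI ballI)
    show "h (inl a) = f a" if "a \<in> carrier R" for a
      using h(2) frag_of_closed[OF that S.one_closed] that Ep[OF that S.one_closed] fc
      by (simp add: inl_def pure_q ring_hom_one[OF g])
    show "h (inr b) = g b" if "b \<in> carrier S" for b
      using h(2) frag_of_closed[OF R.one_closed that] that Ep[OF R.one_closed that] gc
      by (simp add: inr_def pure_q ring_hom_one[OF f])
  qed
qed

lemma tensor_hom_ext:
  assumes D: "cring D" and h: "h \<in> ring_hom T D" and h': "h' \<in> ring_hom T D"
    and l: "\<And>a. a \<in> carrier R \<Longrightarrow> h (inl a) = h' (inl a)"
    and r: "\<And>b. b \<in> carrier S \<Longrightarrow> h (inr b) = h' (inr b)"
    and x: "x \<in> carrier T"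
  shows "h x = h' x"
proof -
  interpret D: cring D by fact
  interpret h: ring_hom_cring Fr D "h \<circ> (+>\<^bsub>Fr\<^esub>) I"
    by (intro ring_hom_cring.intro ring_hom_cring_axioms.intro Fr_cring D ring_hom_trans[OF q_hom h])
  interpret h': ring_hom_cring Fr D "h' \<circ> (+>\<^bsub>Fr\<^esub>) I"
    by (intro ring_hom_cring.intro ring_hom_cring_axioms.intro Fr_cring D ring_hom_trans[OF q_hom h'])
  obtain y where y: "y \<in> carrier Fr" "x = q y" using x unfolding tensor_ring_def quotient_carrier by blast
  have "Poly_Mapping.keys y \<subseteq> X" using y by (simp add: Fr_simps)
  then have "(h \<circ> (+>\<^bsub>Fr\<^esub>) I) y = (h' \<circ> (+>\<^bsub>Fr\<^esub>) I) y"
  proof (induction y rule: frag_carrier_induct)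
    case zero
    then show ?case using h.hom_zero h'.hom_zero by (simp add: Fr_simps)
  next
    case (one p)
    obtain a b where p: "p = (a, b)" "a \<in> carrier R" "b \<in> carrier S" using one by auto
    have e: "k (q (frag_of p)) = k (inl a) \<otimes>\<^bsub>D\<^esub> k (inr b)" if k: "k \<in> ring_hom T D" for k
      unfolding p(1) pure_q[symmetric] inl_inr[OF p(2,3)]
      by (rule ring_hom_mult[OF k ring_hom_closed[OF inl_hom p(2)] ring_hom_closed[OF inr_hom p(3)]])
    show ?case unfolding comp_def e[OF h] e[OF h'] l[OF p(2)] r[OF p(3)] ..
  next
    case (diff u v)
    have k: "u \<in> carrier Fr" "v \<in> carrier Fr" using diff by (auto simp: Fr_simps)
    have d: "u - v = u \<oplus>\<^bsub>Fr\<^esub> (\<ominus>\<^bsub>Fr\<^esub> v)" using Fr_minus[OF k] by (simp add: a_minus_def)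
    show ?case unfolding d using k diff.IH h.hom_a_inv[of v] h'.hom_a_inv[of v] h.hom_add[of u "\<ominus>\<^bsub>Fr\<^esub> v"] h'.hom_add[of u "\<ominus>\<^bsub>Fr\<^esub> v"]
      by simp
  qed
  then show ?thesis by (simp add: y(2))
qed

end


section \<open>Completed tensor products\<close>

lemma (in cring) genideal_mult_in:
  assumes A: "A \<subseteq> carrier R" and B: "B \<subseteq> carrier R" and Q: "ideal Q R"
    and AB: "\<And>a b. a \<in> A \<Longrightarrow> b \<in> B \<Longrightarrow> a \<otimes> b \<in> Q"
    and x: "x \<in> Idl A" and y: "y \<in> Idl B"
  shows "x \<otimes> y \<in> Q"
proof -
  interpret Q: ideal Q R by fact
  have id: "ideal {x \<in> carrier R. \<forall>b\<in>C. x \<otimes> b \<in> Q} R" if C: "C \<subseteq> carrier R" for C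
  proof (rule idealI)
    show "ring R" by (rule ring_axioms)
    show "subgroup {x \<in> carrier R. \<forall>b\<in>C. x \<otimes> b \<in> Q} (add_monoid R)"
    proof (rule add.subgroupI)
      show "{x \<in> carrier R. \<forall>b\<in>C. x \<otimes> b \<in> Q} \<noteq> {}"
        using C Q.zero_closed by (auto intro!: exI[of _ \<zero>] simp: subset_iff)
      show "\<ominus> a \<in> {x \<in> carrier R. \<forall>b\<in>C. x \<otimes> b \<in> Q}" if "a \<in> {x \<in> carrier R. \<forall>b\<in>C. x \<otimes> b \<in> Q}" for a
        using that C Q.a_inv_closed by (auto simp: l_minus subset_iff)
      show "a \<oplus> b \<in> {x \<in> carrier R. \<forall>b\<in>C. x \<otimes> b \<in> Q}"
        if "a \<in> {x \<in> carrier R. \<forall>b\<in>C. x \<otimes> b \<in> Q}" "b \<in> {x \<in> carrier R. \<forall>b\<in>C. x \<otimes> b \<in> Q}" for a b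
        using that C Q.a_closed by (auto simp: l_distr subset_iff)
    qed auto
    show xa: "x \<otimes> a \<in> {x \<in> carrier R. \<forall>b\<in>C. x \<otimes> b \<in> Q}"
      if "a \<in> {x \<in> carrier R. \<forall>b\<in>C. x \<otimes> b \<in> Q}" "x \<in> carrier R" for a x
      using that C Q.I_l_closed by (auto simp: m_assoc subset_iff)
    show "a \<otimes> x \<in> {x \<in> carrier R. \<forall>b\<in>C. x \<otimes> b \<in> Q}"
      if "a \<in> {x \<in> carrier R. \<forall>b\<in>C. x \<otimes> b \<in> Q}" "x \<in> carrier R" for a x
      using xa[OF that] that m_comm[of x a] by simp
  qed
  have "Idl A \<subseteq> {x \<in> carrier R. \<forall>b\<in>B. x \<otimes> b \<in> Q}"
    by (rule genideal_minimal[OF id[OF B]]) (use A AB in auto)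
  then have xB: "x \<in> carrier R" "\<And>b. b \<in> B \<Longrightarrow> x \<otimes> b \<in> Q" using x by auto
  have "Idl B \<subseteq> {y \<in> carrier R. \<forall>a\<in>{x}. y \<otimes> a \<in> Q}"
    by (rule genideal_minimal[OF id]) (use B xB m_comm in \<open>auto simp: subset_iff\<close>)
  then show ?thesis using y xB(1) m_comm[of y x] by auto
qed

lemma (in cring) preimage_ideal:
  assumes "cring T" "h \<in> ring_hom R T" "ideal Q T"
  shows "ideal {x \<in> carrier R. h x \<in> Q} R"
proof -
  interpret T: cring T by fact
  interpret h: ring_hom_ring R T h by (rule ring_hom_ringI2[OF ring_axioms T.ring_axioms assms(2)])
  show ?thesis using h.ideal_vimage[OF assms(3)] .
qed

locale top_tensor_data = tensor_data K R S \<phi> \<psi> + Rt: complete_top_ring R + St: complete_top_ring S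
  for K :: "('k, 'g) ring_scheme" and R :: "('a, 'e) top_ring_scheme" and S :: "('b, 'f) top_ring_scheme"
    and \<phi> and \<psi>
begin

abbreviation "TN \<equiv> tensor_nbhd K R \<phi> S \<psi>"

abbreviation "tgens n \<equiv> {pure a b |a b. a \<in> nbhd R n \<and> b \<in> carrier S} \<union> {pure a b |a b. a \<in> carrier R \<and> b \<in> nbhd S n}"

lemma Rn: "a \<in> nbhd R n \<Longrightarrow> a \<in> carrier R" and Sn: "b \<in> nbhd S n \<Longrightarrow> b \<in> carrier S"
  using ideal.Icarr[OF Rt.nbhd_ideal] ideal.Icarr[OF St.nbhd_ideal] by auto

lemma tgens_closed: "tgens n \<subseteq> carrier T"
  using pure_closed Rn Sn by blast

lemma TN_eq: "TN n = Idl\<^bsub>T\<^esub> (tgens n)"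
  by (simp add: tensor_nbhd_def)

lemma TN_ideal: "ideal (TN n) T"
  unfolding TN_eq by (rule T.genideal_ideal[OF tgens_closed])

lemma inl_TN: "a \<in> nbhd R n \<Longrightarrow> inl a \<in> TN n" and inr_TN: "b \<in> nbhd S n \<Longrightarrow> inr b \<in> TN n"
  unfolding TN_eq inl_def inr_def
  by (rule subsetD[OF T.genideal_self[OF tgens_closed]], use R.one_closed S.one_closed in blast)+

text \<open>
  To map \<open>TN n\<close> into an ideal it suffices to test the two factors, since a pure tensor is a
  product of elements coming from them.
\<close>

lemma TN_minimal:
  assumes Q: "ideal Q T" and l: "\<And>a. a \<in> nbhd R n \<Longrightarrow> inl a \<in> Q" and r: "\<And>b. b \<in> nbhd S n \<Longrightarrow> inr b \<in> Q"
  shows "TN n \<subseteq> Q"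
  unfolding TN_eq
proof (rule T.genideal_minimal[OF Q], intro Un_least subsetI)
  fix x assume "x \<in> {pure a b |a b. a \<in> nbhd R n \<and> b \<in> carrier S}"
  then obtain a b where x: "x = pure a b" "a \<in> nbhd R n" "b \<in> carrier S" by blast
  show "x \<in> Q" unfolding x(1) inl_inr[OF Rn[OF x(2)] x(3)]
    by (rule ideal.I_r_closed[OF Q l[OF x(2)] ring_hom_closed[OF inr_hom x(3)]])
next
  fix x assume "x \<in> {pure a b |a b. a \<in> carrier R \<and> b \<in> nbhd S n}"
  then obtain a b where x: "x = pure a b" "a \<in> carrier R" "b \<in> nbhd S n" by blast
  show "x \<in> Q" unfolding x(1) inl_inr[OF x(2) Sn[OF x(3)]]
    by (rule ideal.I_l_closed[OF Q r[OF x(3)] ring_hom_closed[OF inl_hom x(2)]])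
qed

abbreviation "W a b \<equiv> Idl\<^bsub>T\<^esub> (inl ` ideal_power R (nbhd R 1) a \<union> inr ` ideal_power S (nbhd S 1) b)"

lemma RP_closed: "x \<in> ideal_power R (nbhd R 1) a \<Longrightarrow> x \<in> carrier R"
  and SP_closed: "y \<in> ideal_power S (nbhd S 1) a \<Longrightarrow> y \<in> carrier S"
  using ideal.Icarr[OF R.ideal_power_ideal[OF Rt.nbhd_ideal]] ideal.Icarr[OF S.ideal_power_ideal[OF St.nbhd_ideal]]
  by blast+

lemma Wg_closed: "inl ` ideal_power R (nbhd R 1) a \<union> inr ` ideal_power S (nbhd S 1) b \<subseteq> carrier T"
  using ring_hom_closed[OF inl_hom RP_closed] ring_hom_closed[OF inr_hom SP_closed] by blast

lemma W_ideal: "ideal (W a b) T"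
  by (rule T.genideal_ideal[OF Wg_closed])

lemma inl_W: "x \<in> ideal_power R (nbhd R 1) a \<Longrightarrow> inl x \<in> W a b"
  and inr_W: "y \<in> ideal_power S (nbhd S 1) b \<Longrightarrow> inr y \<in> W a b"
  by (rule subsetD[OF T.genideal_self[OF Wg_closed]], blast)+

lemma ideal_full: "ideal Q T \<Longrightarrow> \<one>\<^bsub>T\<^esub> \<in> Q \<Longrightarrow> Q = carrier T"
  by (rule ideal.one_imp_carrier)

text \<open>
  A product of \<open>a + b\<close> factors, each from one of two ideals, contains at least \<open>a\<close> factors from
  the first or at least \<open>b\<close> from the second.
\<close>

lemma TN_power: "a + b = n \<Longrightarrow> ideal_power T (TN 1) n \<subseteq> W a b"
proof (induction n arbitrary: a b)
  case 0
  then have "\<one>\<^bsub>T\<^esub> \<in> W a b"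
    using inl_W[of "\<one>\<^bsub>R\<^esub>" a b] by (simp add: ring_hom_one[OF inl_hom])
  then show ?case using ideal_full[OF W_ideal] by simp
next
  case (Suc n)
  show ?case
  proof (cases "a = 0 \<or> b = 0")
    case True
    then have "\<one>\<^bsub>T\<^esub> \<in> W a b"
      using inl_W[of "\<one>\<^bsub>R\<^esub>" a b] inr_W[of "\<one>\<^bsub>S\<^esub>" b a]
      by (auto simp: ring_hom_one[OF inl_hom] ring_hom_one[OF inr_hom])
    then have "W a b = carrier T" using ideal_full[OF W_ideal] by simp
    then show ?thesis using ideal.Icarr[OF T.ideal_power_ideal[OF TN_ideal]] by blast
  next
    case False
    then obtain a' b' where ab: "a = Suc a'" "b = Suc b'" by (metis not0_implies_Suc)
    have 1: "ideal_power T (TN 1) n \<subseteq> W a' b" "ideal_power T (TN 1) n \<subseteq> W a b'"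
      using Suc.IH[of a' b] Suc.IH[of a b'] Suc.prems ab by auto
    have l: "inl x \<otimes>\<^bsub>T\<^esub> y \<in> W a b" if x: "x \<in> nbhd R 1" and y: "y \<in> W a' b" for x y
    proof (rule T.genideal_mult_in[OF _ Wg_closed W_ideal _ _ y])
      show "{inl x} \<subseteq> carrier T" using ring_hom_closed[OF inl_hom Rn[OF x]] by simp
      show "inl x \<in> Idl\<^bsub>T\<^esub> {inl x}" by (rule T.genideal_self'[OF ring_hom_closed[OF inl_hom Rn[OF x]]])
      fix u v assume u: "u \<in> {inl x}" and v: "v \<in> inl ` ideal_power R (nbhd R 1) a' \<union> inr ` ideal_power S (nbhd S 1) b"
      then consider z where "z \<in> ideal_power R (nbhd R 1) a'" "v = inl z" | z where "z \<in> ideal_power S (nbhd S 1) b" "v = inr z" by blast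
      then show "u \<otimes>\<^bsub>T\<^esub> v \<in> W a b"
      proof cases
        case 1
        have "u \<otimes>\<^bsub>T\<^esub> v = inl (x \<otimes>\<^bsub>R\<^esub> z)"
          using u 1(2) ring_hom_mult[OF inl_hom Rn[OF x] RP_closed[OF 1(1)]] by simp
        then show ?thesis unfolding ab(1) using inl_W[OF R.ideal_power_Suc_mem[OF x 1(1)]] by simp
      next
        case 2
        then show ?thesis using u ideal.I_l_closed[OF W_ideal inr_W[OF 2(1)] ring_hom_closed[OF inl_hom Rn[OF x]]] by simp
      qed
    qed
    have r: "inr x \<otimes>\<^bsub>T\<^esub> y \<in> W a b" if x: "x \<in> nbhd S 1" and y: "y \<in> W a b'" for x y
    proof (rule T.genideal_mult_in[OF _ Wg_closed W_ideal _ _ y])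
      show "{inr x} \<subseteq> carrier T" using ring_hom_closed[OF inr_hom Sn[OF x]] by simp
      show "inr x \<in> Idl\<^bsub>T\<^esub> {inr x}" by (rule T.genideal_self'[OF ring_hom_closed[OF inr_hom Sn[OF x]]])
      fix u v assume u: "u \<in> {inr x}" and v: "v \<in> inl ` ideal_power R (nbhd R 1) a \<union> inr ` ideal_power S (nbhd S 1) b'"
      then consider z where "z \<in> ideal_power R (nbhd R 1) a" "v = inl z" | z where "z \<in> ideal_power S (nbhd S 1) b'" "v = inr z" by blast
      then show "u \<otimes>\<^bsub>T\<^esub> v \<in> W a b"
      proof cases
        case 2
        have "u \<otimes>\<^bsub>T\<^esub> v = inr (x \<otimes>\<^bsub>S\<^esub> z)"
          using u 2(2) ring_hom_mult[OF inr_hom Sn[OF x] SP_closed[OF 2(1)]] by simp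
        then show ?thesis unfolding ab(2) using inr_W[OF S.ideal_power_Suc_mem[OF x 2(1)]] by simp
      next
        case 1
        then show ?thesis using u ideal.I_l_closed[OF W_ideal inl_W[OF 1(1)] ring_hom_closed[OF inr_hom Sn[OF x]]] by simp
      qed
    qed
    show ?thesis unfolding ideal_power.simps
    proof (rule T.ideal_prod_subset[OF W_ideal])
      fix i y assume i: "i \<in> TN 1" and y: "y \<in> ideal_power T (TN 1) n"
      have yc: "y \<in> carrier T" using ideal.Icarr[OF T.ideal_power_ideal[OF TN_ideal] y] .
      have "TN 1 \<subseteq> {z \<in> carrier T. z \<otimes>\<^bsub>T\<^esub> y \<in> W a b}"
      proof (rule TN_minimal)
        have "ideal {z \<in> carrier T. \<forall>b'\<in>{y}. z \<otimes>\<^bsub>T\<^esub> b' \<in> W a b} T"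
        proof (rule idealI)
          interpret Q: ideal "W a b" T by (rule W_ideal)
          show "ring T" by (rule T.ring_axioms)
          show "subgroup {z \<in> carrier T. \<forall>b'\<in>{y}. z \<otimes>\<^bsub>T\<^esub> b' \<in> W a b} (add_monoid T)"
          proof (rule T.add.subgroupI)
            show "{z \<in> carrier T. \<forall>b'\<in>{y}. z \<otimes>\<^bsub>T\<^esub> b' \<in> W a b} \<noteq> {}"
              using yc Q.zero_closed by (auto intro!: exI[of _ "\<zero>\<^bsub>T\<^esub>"])
          qed (use yc Q.a_inv_closed Q.a_closed in \<open>auto simp: T.l_minus T.l_distr\<close>)
          show xa: "x \<otimes>\<^bsub>T\<^esub> z \<in> {z \<in> carrier T. \<forall>b'\<in>{y}. z \<otimes>\<^bsub>T\<^esub> b' \<in> W a b}"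
            if "z \<in> {z \<in> carrier T. \<forall>b'\<in>{y}. z \<otimes>\<^bsub>T\<^esub> b' \<in> W a b}" "x \<in> carrier T" for z x
            using that yc Q.I_l_closed by (auto simp: T.m_assoc)
          show "z \<otimes>\<^bsub>T\<^esub> x \<in> {z \<in> carrier T. \<forall>b'\<in>{y}. z \<otimes>\<^bsub>T\<^esub> b' \<in> W a b}"
            if "z \<in> {z \<in> carrier T. \<forall>b'\<in>{y}. z \<otimes>\<^bsub>T\<^esub> b' \<in> W a b}" "x \<in> carrier T" for z x
            using xa[OF that] that T.m_comm[of x z] by simp
        qed
        then show "ideal {z \<in> carrier T. z \<otimes>\<^bsub>T\<^esub> y \<in> W a b} T" by simp
        show "inl x \<in> {z \<in> carrier T. z \<otimes>\<^bsub>T\<^esub> y \<in> W a b}" if "x \<in> nbhd R 1" for x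
          using l[OF that subsetD[OF 1(1) y]] ring_hom_closed[OF inl_hom Rn[OF that]] by simp
        show "inr x \<in> {z \<in> carrier T. z \<otimes>\<^bsub>T\<^esub> y \<in> W a b}" if "x \<in> nbhd S 1" for x
          using r[OF that subsetD[OF 1(2) y]] ring_hom_closed[OF inr_hom Sn[OF that]] by simp
      qed
      then show "i \<otimes>\<^bsub>T\<^esub> y \<in> W a b" using i by blast
    qed
  qed
qed

lemma filtered_T: "filtered_ring T TN"
proof (intro filtered_ring.intro filtered_ring_axioms.intro T_cring)
  show "ideal (TN n) T" for n by (rule TN_ideal)
  show "TN (Suc n) \<subseteq> TN n" for n
    by (rule TN_minimal[OF TN_ideal]) (use inl_TN inr_TN Rt.nbhd_decr St.nbhd_decr in blast)+
  show "\<exists>k. ideal_power T (TN 1) k \<subseteq> TN n" for n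
  proof -
    obtain a where a: "ideal_power R (nbhd R 1) a \<subseteq> nbhd R n" using Rt.nilpotent by blast
    obtain b where b: "ideal_power S (nbhd S 1) b \<subseteq> nbhd S n" using St.nilpotent by blast
    have "W a b \<subseteq> TN n"
      by (rule T.genideal_minimal[OF TN_ideal]) (use a b inl_TN inr_TN in blast)
    then show ?thesis using TN_power[OF refl, of a b] by (intro exI[of _ "a + b"]) (rule subset_trans)
  qed
qed

sublocale fT: filtered_ring T TN by (rule filtered_T)

abbreviation "CT \<equiv> completed_tensor K R \<phi> S \<psi>"

definition "cinl = completion_map T TN \<circ> inl"
abbreviation "cinr \<equiv> completed_tensor_inr K R \<phi> S \<psi>"

lemma CT_complete: "complete_top_ring CT"
  unfolding completed_tensor_def by (rule fT.complete_top_ring_Compl)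

lemma cmap_hom: "completion_map T TN \<in> ring_hom T CT"
  unfolding completed_tensor_def by (rule fT.completion_map_hom)

lemma cinr_eq: "cinr = completion_map T TN \<circ> inr"
  by (simp add: completed_tensor_inr_def inr_def fun_eq_iff)

lemma cinl_adic: "cinl \<in> adic_hom R CT"
proof -
  have "cinl ` nbhd R n \<subseteq> nbhd CT n" for n
    unfolding cinl_def completed_tensor_def using fT.completion_map_nbhd[OF inl_TN] by auto
  then show ?thesis unfolding adic_hom_def using ring_hom_trans[OF inl_hom cmap_hom] by (auto simp: cinl_def)
qed

lemma cinr_adic: "cinr \<in> adic_hom S CT"
proof -
  have "cinr ` nbhd S n \<subseteq> nbhd CT n" for n
    unfolding cinr_eq completed_tensor_def using fT.completion_map_nbhd[OF inr_TN] by auto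
  then show ?thesis unfolding adic_hom_def using ring_hom_trans[OF inr_hom cmap_hom] by (auto simp: cinr_eq)
qed

lemma cinl_cinr: "c \<in> carrier K \<Longrightarrow> cinl (\<phi> c) = cinr (\<psi> c)"
  by (simp add: cinl_def cinr_eq inl_def inr_def pure_balanced)

lemma CT_extend:
  assumes C: "complete_top_ring C" and f: "f \<in> adic_hom R C" and g: "g \<in> adic_hom S C"
    and fg: "\<And>c. c \<in> carrier K \<Longrightarrow> f (\<phi> c) = g (\<psi> c)"
  shows "\<exists>h\<in>adic_hom CT C. (\<forall>a\<in>carrier R. h (cinl a) = f a) \<and> (\<forall>b\<in>carrier S. h (cinr b) = g b)"
proof -
  interpret C: complete_top_ring C by fact
  obtain e where e: "e \<in> ring_hom T C" "\<forall>a\<in>carrier R. e (inl a) = f a" "\<forall>b\<in>carrier S. e (inr b) = g b"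
    using tensor_extend[OF C.cring_axioms adic_hom_hom[OF f] adic_hom_hom[OF g] fg] by blast
  have sub: "e ` TN k \<subseteq> nbhd C n" if k: "f ` nbhd R k \<subseteq> nbhd C n" "g ` nbhd S k \<subseteq> nbhd C n" for k n
  proof -
    have "TN k \<subseteq> {x \<in> carrier T. e x \<in> nbhd C n}"
    proof (rule TN_minimal[OF T.preimage_ideal[OF C.cring_axioms e(1) C.nbhd_ideal]])
      show "inl a \<in> {x \<in> carrier T. e x \<in> nbhd C n}" if "a \<in> nbhd R k" for a
        using that k(1) e(2) Rn[OF that] ring_hom_closed[OF inl_hom Rn[OF that]] by auto
      show "inr a \<in> {x \<in> carrier T. e x \<in> nbhd C n}" if "a \<in> nbhd S k" for a
        using that k(2) e(3) Sn[OF that] ring_hom_closed[OF inr_hom Sn[OF that]] by auto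
    qed
    then show ?thesis by blast
  qed
  have 1: "e ` TN 1 \<subseteq> nbhd C 1" by (rule sub) (use adic_hom_1[OF f] adic_hom_1[OF g] in blast)+
  have 2: "\<exists>k. e ` TN k \<subseteq> nbhd C n" for n
  proof -
    obtain k where k: "f ` nbhd R k \<subseteq> nbhd C n" using adic_hom_cont[OF f] by blast
    obtain l where l: "g ` nbhd S l \<subseteq> nbhd C n" using adic_hom_cont[OF g] by blast
    have "nbhd R (max k l) \<subseteq> nbhd R k" "nbhd S (max k l) \<subseteq> nbhd S l"
      by (rule Rt.nbhd_mono, simp) (rule St.nbhd_mono, simp)
    then have "e ` TN (max k l) \<subseteq> nbhd C n"
      using subset_trans[OF image_mono k] subset_trans[OF image_mono l] by (intro sub)
    then show ?thesis ..
  qed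
  obtain h where h: "h \<in> adic_hom CT C" "\<forall>x\<in>carrier T. h (completion_map T TN x) = e x"
    using fT.completion_extend[OF C e(1) 1 2] unfolding completed_tensor_def by blast
  show ?thesis
    using h(2) e(2,3) ring_hom_closed[OF inl_hom] ring_hom_closed[OF inr_hom]
    by (intro bexI[OF _ h(1)]) (simp add: cinl_def cinr_eq)
qed

lemma CT_hom_ext:
  assumes C: "complete_top_ring C" and h: "h \<in> adic_hom CT C" and h': "h' \<in> adic_hom CT C"
    and l: "\<And>a. a \<in> carrier R \<Longrightarrow> h (cinl a) = h' (cinl a)"
    and r: "\<And>b. b \<in> carrier S \<Longrightarrow> h (cinr b) = h' (cinr b)" and x: "x \<in> carrier CT"
  shows "h x = h' x"
proof (rule fT.completion_hom_ext[OF C, folded completed_tensor_def, OF h h' _ x])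
  interpret C: complete_top_ring C by fact
  fix y assume y: "y \<in> carrier T"
  have "(h \<circ> completion_map T TN) y = (h' \<circ> completion_map T TN) y"
    by (rule tensor_hom_ext[OF C.cring_axioms ring_hom_trans[OF cmap_hom adic_hom_hom[OF h]]
          ring_hom_trans[OF cmap_hom adic_hom_hom[OF h']] _ _ y])
      (use l r in \<open>simp_all add: cinl_def cinr_eq\<close>)
  then show "h (completion_map T TN y) = h' (completion_map T TN y)" by simp
qed

end


section \<open>Discrete rings and power series in countably many variables\<close>

lemma discrete_simps [simp]: "carrier (discrete_top_ring R) = carrier R" "x \<otimes>\<^bsub>discrete_top_ring R\<^esub> y = x \<otimes>\<^bsub>R\<^esub> y"
  "\<one>\<^bsub>discrete_top_ring R\<^esub> = \<one>\<^bsub>R\<^esub>" "\<zero>\<^bsub>discrete_top_ring R\<^esub> = \<zero>\<^bsub>R\<^esub>" "x \<oplus>\<^bsub>discrete_top_ring R\<^esub> y = x \<oplus>\<^bsub>R\<^esub> y"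
  "nbhd (discrete_top_ring R) n = {\<zero>\<^bsub>R\<^esub>}"
  by (simp_all add: discrete_top_ring_def)

lemma discrete_hom [simp]: "ring_hom R (discrete_top_ring S) = ring_hom R S"
  "ring_hom (discrete_top_ring R) T = ring_hom R T"
  by (auto simp: ring_hom_def)

lemma (in cring) discrete_complete: "complete_top_ring (discrete_top_ring R)"
proof -
  let ?D = "discrete_top_ring R"
  have D: "cring ?D"
  proof (rule cringI)
    show "abelian_group ?D"
    proof (rule abelian_groupI)
      show "\<exists>y\<in>carrier ?D. y \<oplus>\<^bsub>?D\<^esub> x = \<zero>\<^bsub>?D\<^esub>" if "x \<in> carrier ?D" for x
        using that by (intro bexI[of _ "\<ominus> x"]) (auto simp: l_neg)
    qed (auto simp: a_assoc intro: a_comm)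
    show "Group.comm_monoid ?D" by (rule comm_monoidI) (auto simp: m_assoc intro: m_comm)
  qed (simp add: l_distr)
  interpret D: cring ?D by (rule D)
  have z: "ideal {\<zero>} ?D" using D.zeroideal by simp
  show ?thesis
  proof (intro complete_top_ring.intro complete_top_ring_axioms.intro D)
    show "\<exists>k. ideal_power ?D (nbhd ?D 1) k \<subseteq> nbhd ?D n" for n
      using D.ideal_power_1[OF z] by (intro exI[of _ "Suc 0"]) (simp del: ideal_power.simps)
    fix x assume x: "\<And>n. x n \<in> carrier ?D" "\<And>n. nbhd ?D n +>\<^bsub>?D\<^esub> x (Suc n) = nbhd ?D n +>\<^bsub>?D\<^esub> x n"
    have "nbhd ?D n +>\<^bsub>?D\<^esub> x 0 = nbhd ?D n +>\<^bsub>?D\<^esub> x n" for n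
      by (induction n) (use x(2) in auto)
    then show "\<exists>y\<in>carrier ?D. \<forall>n. nbhd ?D n +>\<^bsub>?D\<^esub> y = nbhd ?D n +>\<^bsub>?D\<^esub> x n"
      using x(1) by (intro bexI[of _ "x 0"] allI)
  qed (use z in simp_all)
qed

lemma discrete_adic:
  assumes "cring R" "complete_top_ring C" "h \<in> ring_hom R C" shows "h \<in> adic_hom (discrete_top_ring R) C"
proof -
  interpret R: cring R by fact
  interpret C: complete_top_ring C by fact
  interpret h: ring_hom_cring R C h by (intro ring_hom_cring.intro ring_hom_cring_axioms.intro assms C.cring_axioms)
  have "h ` {\<zero>\<^bsub>R\<^esub>} \<subseteq> nbhd C n" for n
    using additive_subgroup.zero_closed[OF ideal.axioms(1)[OF C.nbhd_ideal]] by simp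
  then show ?thesis using assms(3) by (simp add: adic_hom_def)
qed

context cring
begin

abbreviation "MP \<equiv> mpoly_ring R (UNIV :: nat set)"
abbreviation "VI \<equiv> countable_var_ideal R"
abbreviation "CPS \<equiv> countable_power_series R"

lemma VI_ideal: "ideal VI MP"
proof -
  interpret M: cring MP by (rule mpoly_ring_cring)
  show ?thesis unfolding countable_var_ideal_def
    by (rule M.genideal_ideal) (auto intro: poly_var_closed)
qed

lemma poly_var_VI: "poly_var R i \<in> VI"
proof -
  interpret M: cring MP by (rule mpoly_ring_cring)
  show ?thesis unfolding countable_var_ideal_def
    by (rule subsetD[OF M.genideal_self]) (auto intro: poly_var_closed)
qed

lemma filtered_MP: "filtered_ring MP (ideal_power MP VI)"
proof (intro filtered_ring.intro filtered_ring_axioms.intro mpoly_ring_cring)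
  interpret M: cring MP by (rule mpoly_ring_cring)
  show "ideal (ideal_power MP VI n) MP" for n by (rule M.ideal_power_ideal[OF VI_ideal])
  show "ideal_power MP VI (Suc n) \<subseteq> ideal_power MP VI n" for n by (rule M.ideal_power_Suc_subset[OF VI_ideal])
  show "\<exists>k. ideal_power MP (ideal_power MP VI 1) k \<subseteq> ideal_power MP VI n" for n
    using M.ideal_power_1[OF VI_ideal] by (intro exI[of _ n]) simp
qed

lemma CPS_complete: "complete_top_ring CPS"
  unfolding countable_power_series_def by (rule filtered_ring.complete_top_ring_Compl[OF filtered_MP])

lemma mpoly_const_hom: "monoid_algebra_const R \<in> ring_hom R (mpoly_ring R V)"
proof (rule ring_hom_memI)
  show "monoid_algebra_const R (x \<otimes> y) = monoid_algebra_const R x \<otimes>\<^bsub>mpoly_ring R V\<^esub> monoid_algebra_const R y"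
    if "x \<in> carrier R" "y \<in> carrier R" for x y
    using that by (simp add: mpoly_ring_def monoid_algebra_const_def monoid_algebra_monom_mult)
  show "monoid_algebra_const R (x \<oplus> y) = monoid_algebra_const R x \<oplus>\<^bsub>mpoly_ring R V\<^esub> monoid_algebra_const R y"
    if "x \<in> carrier R" "y \<in> carrier R" for x y
    using that by (auto simp: mpoly_ring_def monoid_algebra_def monoid_algebra_const_def monoid_algebra_monom_def)
  show "monoid_algebra_const R \<one> = \<one>\<^bsub>mpoly_ring R V\<^esub>"
    by (auto simp: mpoly_ring_def monoid_algebra_def monoid_algebra_const_def monoid_algebra_monom_def)
qed (rule mpoly_const_closed)

abbreviation "cps_map \<equiv> completion_map MP (ideal_power MP VI)"

lemma cps_map_hom: "cps_map \<in> ring_hom MP CPS"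
  unfolding countable_power_series_def by (rule filtered_ring.completion_map_hom[OF filtered_MP])

lemma CPS_const_hom: "countable_power_series_const R \<in> ring_hom R CPS"
proof -
  have "countable_power_series_const R = cps_map \<circ> monoid_algebra_const R"
    by (simp add: countable_power_series_const_def fun_eq_iff)
  then show ?thesis using ring_hom_trans[OF mpoly_const_hom cps_map_hom] by simp
qed

definition "cps_var i = cps_map (poly_var R i)"

lemma cps_var_nbhd: "cps_var i \<in> nbhd CPS 1"
proof -
  interpret M: cring MP by (rule mpoly_ring_cring)
  show ?thesis unfolding countable_power_series_def cps_var_def
    by (rule filtered_ring.completion_map_nbhd[OF filtered_MP])
      (simp add: M.ideal_power_1[OF VI_ideal] poly_var_VI del: ideal_power.simps)
qed

text \<open>
  The variables may be sent to an arbitrary sequence in \<open>nbhd C 1\<close>, without any convergence along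
  the sequence: the completion is along powers of the ideal of all variables, and each truncation
  is a polynomial.
\<close>

lemma CPS_extend:
  assumes C: "complete_top_ring C" and g: "g \<in> ring_hom R C" and t: "\<And>i. t i \<in> nbhd C 1"
  shows "\<exists>h\<in>adic_hom CPS C. (\<forall>c\<in>carrier R. h (countable_power_series_const R c) = g c) \<and> (\<forall>i. h (cps_var i) = t i)"
proof -
  interpret C: complete_top_ring C by fact
  interpret M: cring MP by (rule mpoly_ring_cring)
  have tc: "t i \<in> carrier C" for i using ideal.Icarr[OF C.nbhd_ideal t] .
  obtain E where E: "E \<in> ring_hom MP C" "\<And>c. c \<in> carrier R \<Longrightarrow> E (monoid_algebra_const R c) = g c"
    "\<And>x. x \<in> UNIV \<Longrightarrow> E (poly_var R x) = t x"
    by (rule mpoly_ring_eval[OF C.cring_axioms g, of UNIV t]) (use tc in auto)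
  have "VI \<subseteq> {x \<in> carrier MP. E x \<in> nbhd C 1}"
    unfolding countable_var_ideal_def
    by (rule M.genideal_minimal[OF M.preimage_ideal[OF C.cring_axioms E(1) C.nbhd_ideal]])
      (use E(3) t in \<open>auto intro: poly_var_closed\<close>)
  then have E1: "E ` VI \<subseteq> nbhd C 1" by blast
  have 1: "E ` ideal_power MP VI 1 \<subseteq> nbhd C 1"
    using E1 M.ideal_power_1[OF VI_ideal] by (simp del: ideal_power.simps)
  have 2: "\<exists>k. E ` ideal_power MP VI k \<subseteq> nbhd C n" for n
  proof -
    obtain k where k: "ideal_power C (nbhd C 1) k \<subseteq> nbhd C n" using C.nilpotent by blast
    show ?thesis
      using subset_trans[OF ideal_power_hom[OF M.ring_axioms C.ring_axioms E(1) VI_ideal C.nbhd_ideal E1] k]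
      by (intro exI[of _ k])
  qed
  obtain h where h: "h \<in> adic_hom CPS C" "\<forall>x\<in>carrier MP. h (cps_map x) = E x"
    using filtered_ring.completion_extend[OF filtered_MP C E(1) 1 2] unfolding countable_power_series_def by blast
  have "h (countable_power_series_const R c) = g c" if "c \<in> carrier R" for c
    unfolding countable_power_series_const_def using h(2) E(2)[OF that] mpoly_const_closed[OF that, of "UNIV :: nat set"] by simp
  moreover have "h (cps_var i) = t i" for i
    unfolding cps_var_def using h(2) E(3)[of i] poly_var_closed[of i UNIV] by simp
  ultimately show ?thesis using h(1) by (intro bexI[of _ h] conjI ballI allI)
qed

lemma CPS_hom_ext:
  assumes C: "complete_top_ring C" and h: "h \<in> adic_hom CPS C" and h': "h' \<in> adic_hom CPS C"
    and c: "\<And>c. c \<in> carrier R \<Longrightarrow> h (countable_power_series_const R c) = h' (countable_power_series_const R c)"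
    and v: "\<And>i. h (cps_var i) = h' (cps_var i)" and x: "x \<in> carrier CPS"
  shows "h x = h' x"
proof (rule filtered_ring.completion_hom_ext[OF filtered_MP C, folded countable_power_series_def, OF h h' _ x])
  interpret C: complete_top_ring C by fact
  fix y assume y: "y \<in> carrier MP"
  have "(h \<circ> cps_map) y = (h' \<circ> cps_map) y"
    by (rule mpoly_ring_hom_ext[OF C.cring_axioms ring_hom_trans[OF cps_map_hom adic_hom_hom[OF h]]
          ring_hom_trans[OF cps_map_hom adic_hom_hom[OF h']] _ _ y])
      (use c v in \<open>simp_all add: countable_power_series_const_def cps_var_def\<close>)
  then show "h (cps_map y) = h' (cps_map y)" by simp
qed

end


section \<open>Isomorphisms of formal spectra\<close>

lemma adic_hom_continuous:
  assumes R: "complete_top_ring R" and S: "complete_top_ring S" and h: "h \<in> adic_hom R S"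
  shows "continuous_map (top_ring_topology R) (top_ring_topology S) h"
proof -
  interpret R: complete_top_ring R by fact
  interpret S: complete_top_ring S by fact
  interpret h: ring_hom_cring R S h
    by (intro ring_hom_cring.intro ring_hom_cring_axioms.intro R.cring_axioms S.cring_axioms adic_hom_hom[OF h])
  have op: "openin (top_ring_topology R) (nbhd R n +>\<^bsub>R\<^esub> a)" if "a \<in> carrier R" for n a
    unfolding top_ring_topology_def by (rule topology_generated_by_Basis) (use that in blast)
  have cs: "nbhd Q n +>\<^bsub>Q\<^esub> a \<subseteq> carrier Q" "a \<in> nbhd Q n +>\<^bsub>Q\<^esub> a" if "complete_top_ring Q" "a \<in> carrier Q" for Q a n
  proof -
    interpret Q: complete_top_ring Q by fact
    interpret I: ideal "nbhd Q n" Q by (rule Q.nbhd_ideal)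
    show "nbhd Q n +>\<^bsub>Q\<^esub> a \<subseteq> carrier Q" using I.a_subset that by (intro Q.a_r_coset_subset_G)
    show "a \<in> nbhd Q n +>\<^bsub>Q\<^esub> a" using that by (intro I.a_rcos_self)
  qed
  have tR: "topspace (top_ring_topology R) = carrier R"
    unfolding top_ring_topology_def topology_generated_by_topspace using cs[OF R] by blast
  have tS: "topspace (top_ring_topology S) = carrier S"
    unfolding top_ring_topology_def topology_generated_by_topspace using cs[OF S] by blast
  show ?thesis
    unfolding top_ring_topology_def[of S]
  proof (rule continuous_on_generated_topo)
    fix U assume "U \<in> {nbhd S n +>\<^bsub>S\<^esub> a |n a. a \<in> carrier S}"
    then obtain n b where U: "U = nbhd S n +>\<^bsub>S\<^esub> b" "b \<in> carrier S" by blast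
    obtain k where k: "h ` nbhd R k \<subseteq> nbhd S n" using adic_hom_cont[OF h] by blast
    have "\<exists>V. openin (top_ring_topology R) V \<and> x \<in> V \<and> V \<subseteq> h -` U \<inter> carrier R" if x: "x \<in> h -` U \<inter> carrier R" for x
    proof (intro exI conjI)
      have xc: "x \<in> carrier R" and hx: "h x \<in> nbhd S n +>\<^bsub>S\<^esub> b" using x U by auto
      show "openin (top_ring_topology R) (nbhd R k +>\<^bsub>R\<^esub> x)" by (rule op[OF xc])
      show "x \<in> nbhd R k +>\<^bsub>R\<^esub> x" by (rule cs(2)[OF R xc])
      show "nbhd R k +>\<^bsub>R\<^esub> x \<subseteq> h -` U \<inter> carrier R"
      proof
        fix y assume y: "y \<in> nbhd R k +>\<^bsub>R\<^esub> x"
        then have yc: "y \<in> carrier R" using cs(1)[OF R xc] by blast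
        obtain i where i: "i \<in> nbhd R k" "y = i \<oplus>\<^bsub>R\<^esub> x" using y unfolding a_r_coset_def' by blast
        have ic: "i \<in> carrier R" using ideal.Icarr[OF R.nbhd_ideal i(1)] .
        interpret J: ideal "nbhd S n" S by (rule S.nbhd_ideal)
        obtain j where j: "j \<in> nbhd S n" "h x = j \<oplus>\<^bsub>S\<^esub> b" using hx unfolding a_r_coset_def' by blast
        have "h y = (h i \<oplus>\<^bsub>S\<^esub> j) \<oplus>\<^bsub>S\<^esub> b"
          using i(2) ic xc j(2) J.Icarr[OF j(1)] U(2) by (simp add: S.a_assoc)
        moreover have "h i \<oplus>\<^bsub>S\<^esub> j \<in> nbhd S n" using k i(1) j(1) by (intro J.a_closed) auto
        ultimately show "y \<in> h -` U \<inter> carrier R" using yc unfolding U(1) a_r_coset_def' by blast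
      qed
    qed
    then show "openin (top_ring_topology R) (h -` U \<inter> topspace (top_ring_topology R))"
      unfolding tR by (subst openin_subopen) blast
  next
    show "h ` topspace (top_ring_topology R) \<subseteq> \<Union> {nbhd S n +>\<^bsub>S\<^esub> a |n a. a \<in> carrier S}"
      unfolding tR using h.hom_closed cs(2)[OF S] by blast
  qed
qed

lemma formal_isoI:
  assumes R: "complete_top_ring R" and S: "complete_top_ring S"
    and f: "f \<in> adic_hom R S" and g: "g \<in> adic_hom S R"
    and gf: "\<And>x. x \<in> carrier R \<Longrightarrow> g (f x) = x" and fg: "\<And>y. y \<in> carrier S \<Longrightarrow> f (g y) = y"
    and c: "\<And>c. c \<in> carrier L \<Longrightarrow> f (\<phi> c) = \<psi> c"
  shows "formal_iso L R \<phi> S \<psi>"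
proof -
  have ts: "topspace (top_ring_topology Q) = carrier Q" if "complete_top_ring Q" for Q
  proof -
    interpret Q: complete_top_ring Q by fact
    have "nbhd Q n +>\<^bsub>Q\<^esub> a \<subseteq> carrier Q" "a \<in> nbhd Q n +>\<^bsub>Q\<^esub> a" if "a \<in> carrier Q" for a n
    proof -
      interpret I: ideal "nbhd Q n" Q by (rule Q.nbhd_ideal)
      show "nbhd Q n +>\<^bsub>Q\<^esub> a \<subseteq> carrier Q" using I.a_subset that by (intro Q.a_r_coset_subset_G)
      show "a \<in> nbhd Q n +>\<^bsub>Q\<^esub> a" using that by (intro I.a_rcos_self)
    qed
    then show ?thesis unfolding top_ring_topology_def topology_generated_by_topspace by blast
  qed
  have "bij_betw f (carrier R) (carrier S)"
    by (rule bij_betwI[of _ _ _ g])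
      (use gf fg ring_hom_closed[OF adic_hom_hom[OF f]] ring_hom_closed[OF adic_hom_hom[OF g]] in auto)
  then have "f \<in> ring_iso R S" using adic_hom_hom[OF f] by (simp add: ring_iso_def)
  moreover have "homeomorphic_map (top_ring_topology R) (top_ring_topology S) f"
    unfolding homeomorphic_map_maps homeomorphic_maps_def
    using adic_hom_continuous[OF R S f] adic_hom_continuous[OF S R g] gf fg ts[OF R] ts[OF S]
    by (intro exI[of _ g]) auto
  ultimately show ?thesis unfolding formal_iso_def using c by blast
qed


section \<open>Arcs on monoid algebras\<close>

lemma ps_const_hom:
  assumes K: "cring K" and C: "cring C" and \<tau>: "\<tau> \<in> ring_hom K C"
  shows "(\<lambda>c i::nat. if i = 0 then \<tau> c else \<zero>\<^bsub>C\<^esub>) \<in> ring_hom K (power_series_ring C)"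
proof -
  interpret K: cring K by fact
  interpret C: cring C by fact
  interpret P: cring "power_series_ring C" by (rule C.power_series_cring)
  note tc = ring_hom_closed[OF \<tau>]
  have e: "(\<lambda>i. if i = 0 then x else \<zero>\<^bsub>C\<^esub>) \<otimes>\<^bsub>power_series_ring C\<^esub> g = (\<lambda>i. x \<otimes>\<^bsub>C\<^esub> g i)"
    if "x \<in> carrier C" "g \<in> carrier (power_series_ring C)" for x g
  proof
    fix i
    have "((\<lambda>i. if i = 0 then x else \<zero>\<^bsub>C\<^esub>) \<otimes>\<^bsub>power_series_ring C\<^esub> g) i = (\<Oplus>\<^bsub>C\<^esub>j\<in>{..i}. if 0 = j then x \<otimes>\<^bsub>C\<^esub> g (i - j) else \<zero>\<^bsub>C\<^esub>)"
      unfolding ps_mult using that by (intro C.finsum_cong') (auto simp: ps_carrier)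
    also have "\<dots> = x \<otimes>\<^bsub>C\<^esub> g i" using C.finsum_singleton[of 0 "{..i}" "\<lambda>j. x \<otimes>\<^bsub>C\<^esub> g (i - j)"] that by (auto simp: ps_carrier)
    finally show "((\<lambda>i. if i = 0 then x else \<zero>\<^bsub>C\<^esub>) \<otimes>\<^bsub>power_series_ring C\<^esub> g) i = x \<otimes>\<^bsub>C\<^esub> g i" .
  qed
  show ?thesis
  proof (rule ring_hom_memI)
    fix x y assume xy: "x \<in> carrier K" "y \<in> carrier K"
    show "(\<lambda>i. if i = 0 then \<tau> (x \<otimes>\<^bsub>K\<^esub> y) else \<zero>\<^bsub>C\<^esub>) =
        (\<lambda>i. if i = 0 then \<tau> x else \<zero>\<^bsub>C\<^esub>) \<otimes>\<^bsub>power_series_ring C\<^esub> (\<lambda>i. if i = 0 then \<tau> y else \<zero>\<^bsub>C\<^esub>)"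
      using xy tc by (subst e) (auto simp: ps_carrier ring_hom_mult[OF \<tau>] fun_eq_iff)
    show "(\<lambda>i. if i = 0 then \<tau> (x \<oplus>\<^bsub>K\<^esub> y) else \<zero>\<^bsub>C\<^esub>) =
        (\<lambda>i. if i = 0 then \<tau> x else \<zero>\<^bsub>C\<^esub>) \<oplus>\<^bsub>power_series_ring C\<^esub> (\<lambda>i. if i = 0 then \<tau> y else \<zero>\<^bsub>C\<^esub>)"
      using xy by (auto simp: ps_add fun_eq_iff ring_hom_add[OF \<tau>])
  qed (use tc in \<open>auto simp: ps_carrier ps_one fun_eq_iff ring_hom_one[OF \<tau>]\<close>)
qed

lemma (in cring) ps_const_mult:
  assumes "x \<in> carrier R" "g \<in> carrier (power_series_ring R)"
  shows "((\<lambda>i. if i = 0 then x else \<zero>) \<otimes>\<^bsub>power_series_ring R\<^esub> g) i = x \<otimes> g i"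
proof -
  have "((\<lambda>i. if i = 0 then x else \<zero>) \<otimes>\<^bsub>power_series_ring R\<^esub> g) i = (\<Oplus>j\<in>{..i}. if 0 = j then x \<otimes> g (i - j) else \<zero>)"
    unfolding ps_mult using assms by (intro finsum_cong') (auto simp: ps_carrier)
  also have "\<dots> = x \<otimes> g i" using finsum_singleton[of 0 "{..i}" "\<lambda>j. x \<otimes> g (i - j)"] assms by (auto simp: ps_carrier)
  finally show ?thesis .
qed

locale monoid_arcs = cring K for K :: "('k, 'e) ring_scheme" (structure) +
  fixes S :: "'m::comm_monoid_add set"
  assumes S_zero: "0 \<in> S" and S_add: "\<And>a b. a \<in> S \<Longrightarrow> b \<in> S \<Longrightarrow> a + b \<in> S"
begin

abbreviation "B \<equiv> monoid_algebra K S"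
abbreviation "A \<equiv> arc_ring K B (monoid_algebra_const K)"
abbreviation "\<iota> \<equiv> arc_scalar K B (monoid_algebra_const K)"
abbreviation "ua \<equiv> universal_arc K B (monoid_algebra_const K)"

text \<open>
  The coefficients of the universal arc along the character \<open>m\<close>; these are the functions on the
  arc scheme that generate its coordinate ring.
\<close>

definition D :: "'m \<Rightarrow> nat \<Rightarrow> (((('m \<Rightarrow> 'k) \<times> nat) multiset) \<Rightarrow> 'k) set" where
  "D m = ua (monoid_algebra_monom K \<one> m)"

lemma B_cring: "cring B"
  by (rule monoid_algebra_cring) (use S_zero S_add in auto)

lemma const_hom: "monoid_algebra_const K \<in> ring_hom K B"
proof (rule ring_hom_memI)
  show "monoid_algebra_const K c \<in> carrier B" if "c \<in> carrier K" for c
    unfolding monoid_algebra_const_def using that S_zero by (rule monoid_algebra_monom_closed)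
  show "monoid_algebra_const K (x \<otimes> y) = monoid_algebra_const K x \<otimes>\<^bsub>B\<^esub> monoid_algebra_const K y"
    if "x \<in> carrier K" "y \<in> carrier K" for x y
    using that by (simp add: monoid_algebra_const_def monoid_algebra_monom_mult)
  show "monoid_algebra_const K (x \<oplus> y) = monoid_algebra_const K x \<oplus>\<^bsub>B\<^esub> monoid_algebra_const K y"
    if "x \<in> carrier K" "y \<in> carrier K" for x y
    using that by (auto simp: monoid_algebra_def monoid_algebra_const_def monoid_algebra_monom_def)
  show "monoid_algebra_const K \<one> = \<one>\<^bsub>B\<^esub>"
    by (auto simp: monoid_algebra_def monoid_algebra_const_def monoid_algebra_monom_def)
qed

lemma monom_closed: "c \<in> carrier K \<Longrightarrow> m \<in> S \<Longrightarrow> monoid_algebra_monom K c m \<in> carrier B"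
  by (rule monoid_algebra_monom_closed)

lemma A_cring: "cring A" and \<iota>_hom: "\<iota> \<in> ring_hom K A"
proof -
  note r = arc_ring_represents_arcs[OF cring_axioms B_cring cring_axioms const_hom id_ring_hom]
  show "cring A" "\<iota> \<in> ring_hom K A" by (rule r(1), rule r(2))
qed

lemma arcs_bij:
  assumes "cring C" "\<tau> \<in> ring_hom K C"
  shows "bij_betw (\<lambda>h. \<lambda>f\<in>carrier B. \<lambda>i. h (ua f i))
      {h \<in> ring_hom A C \<inter> extensional (carrier A). \<forall>c\<in>carrier K. h (\<iota> c) = \<tau> c}
      {\<phi> \<in> ring_hom B (power_series_ring C) \<inter> extensional (carrier B).
         \<forall>c\<in>carrier K. \<phi> (monoid_algebra_const K c) = (\<lambda>i. if i = 0 then \<tau> c else \<zero>\<^bsub>C\<^esub>)}"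
  by (rule arc_ring_represents_arcs(3)[OF cring_axioms B_cring assms(1) const_hom assms(2)])

lemma restrict_hom: "cring R \<Longrightarrow> h \<in> ring_hom R C \<Longrightarrow> restrict h (carrier R) \<in> ring_hom R C"
  by (rule ring.ring_hom_restrict[OF cring.axioms(1)]) auto

lemma ua_carrier: "f \<in> carrier B \<Longrightarrow> ua f i \<in> carrier A"
  and ua_const: "c \<in> carrier K \<Longrightarrow> ua (monoid_algebra_const K c) i = (if i = 0 then \<iota> c else \<zero>\<^bsub>A\<^esub>)"
  and ua_hom: "ua \<in> ring_hom B (power_series_ring A)"
proof -
  interpret A: cring A by (rule A_cring)
  interpret B: cring B by (rule B_cring)
  let ?h = "restrict id (carrier A)"
  have "?h \<in> ring_hom A A" by (rule restrict_hom[OF A_cring id_ring_hom])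
  then have h: "?h \<in> {h \<in> ring_hom A A \<inter> extensional (carrier A). \<forall>c\<in>carrier K. h (\<iota> c) = \<iota> c}"
    using ring_hom_closed[OF \<iota>_hom] by simp
  note b = bij_betw_apply[OF arcs_bij[OF A_cring \<iota>_hom] h]
  have uc: "ua f i \<in> carrier A" if f: "f \<in> carrier B" for f i
  proof -
    interpret P: cring "arc_poly_ring K B" unfolding arc_poly_ring_def by (rule mpoly_ring_cring)
    have "poly_var K (f, i) \<in> carrier (arc_poly_ring K B)"
      unfolding arc_poly_ring_def by (rule poly_var_closed) (use f in simp)
    then show ?thesis unfolding universal_arc_def arc_ring_def quotient_carrier by blast
  qed
  then show "f \<in> carrier B \<Longrightarrow> ua f i \<in> carrier A" .
  have e: "(\<lambda>f\<in>carrier B. \<lambda>i. ?h (ua f i)) f = ua f" if "f \<in> carrier B" for f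
    using that uc by (simp add: fun_eq_iff)
  have c: "(\<lambda>f\<in>carrier B. \<lambda>i. ?h (ua f i)) \<in> ring_hom B (power_series_ring A)"
    "\<And>c. c \<in> carrier K \<Longrightarrow> (\<lambda>f\<in>carrier B. \<lambda>i. ?h (ua f i)) (monoid_algebra_const K c) = (\<lambda>i. if i = 0 then \<iota> c else \<zero>\<^bsub>A\<^esub>)"
    using b by auto
  show "ua (monoid_algebra_const K c) i = (if i = 0 then \<iota> c else \<zero>\<^bsub>A\<^esub>)" if "c \<in> carrier K"
    using fun_cong[OF trans[OF e[OF ring_hom_closed[OF const_hom that], symmetric] c(2)[OF that]], of i] .
  show "ua \<in> ring_hom B (power_series_ring A)"
    by (rule B.ring_hom_restrict[OF c(1) e])
qed

lemma D_family: "arc_family S A D"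
proof -
  note h = ua_hom
  have m: "monoid_algebra_monom K \<one> (a + b) = monoid_algebra_monom K \<one> a \<otimes>\<^bsub>B\<^esub> monoid_algebra_monom K \<one> b" for a b :: 'm
    by (simp add: monoid_algebra_monom_mult)
  have z: "monoid_algebra_monom K \<one> 0 = \<one>\<^bsub>B\<^esub>" by (auto simp: monoid_algebra_def monoid_algebra_monom_def)
  have "D 0 = \<one>\<^bsub>power_series_ring A\<^esub>" unfolding D_def z by (rule ring_hom_one[OF h])
  then show ?thesis
    unfolding arc_family_def D_def
    using ring_hom_closed[OF h monom_closed] ring_hom_mult[OF h monom_closed monom_closed] m by auto
qed

lemma D_closed: "m \<in> S \<Longrightarrow> D m i \<in> carrier A"
  using arc_familyD(4)[OF D_family] by blast

text \<open>
  Homomorphisms on the coordinate ring of the arc scheme are the same as arcs, and arcs on the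
  spectrum of a monoid algebra are determined freely by a multiplicative family on the monoid.
\<close>

lemma arc_hom_exists:
  assumes C: "cring C" and \<tau>: "\<tau> \<in> ring_hom K C" and \<phi>: "arc_family S C \<phi>"
  obtains h where "h \<in> ring_hom A C" "\<And>c. c \<in> carrier K \<Longrightarrow> h (\<iota> c) = \<tau> c"
    "\<And>m. m \<in> S \<Longrightarrow> h \<circ> D m = \<phi> m"
proof -
  interpret C: cring C by fact
  interpret P: cring "power_series_ring C" by (rule C.power_series_cring)
  interpret B: cring B by (rule B_cring)
  obtain E where E: "E \<in> ring_hom B (power_series_ring C)"
    "\<And>c m. c \<in> carrier K \<Longrightarrow> m \<in> S \<Longrightarrow> E (monoid_algebra_monom K c m) =
      (\<lambda>i. if i = 0 then \<tau> c else \<zero>\<^bsub>C\<^esub>) \<otimes>\<^bsub>power_series_ring C\<^esub> \<phi> m"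
    by (rule monoid_algebra_eval[OF S_zero S_add P.cring_axioms ps_const_hom[OF cring_axioms C \<tau>], where e = \<phi>])
      (use arc_familyD[OF \<phi>] in auto)
  have ec: "(\<lambda>i. if i = 0 then \<tau> c else \<zero>\<^bsub>C\<^esub>) \<in> carrier (power_series_ring C)" if "c \<in> carrier K" for c
    using ring_hom_closed[OF \<tau> that] by (simp add: ps_carrier)
  have Ec: "E (monoid_algebra_const K c) = (\<lambda>i. if i = 0 then \<tau> c else \<zero>\<^bsub>C\<^esub>)" if "c \<in> carrier K" for c
    unfolding monoid_algebra_const_def E(2)[OF that S_zero] arc_familyD(2)[OF \<phi>] using ec[OF that] by simp
  have "restrict E (carrier B) \<in> ring_hom B (power_series_ring C)" by (rule restrict_hom[OF B_cring E(1)])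
  then have "restrict E (carrier B) \<in> {\<phi> \<in> ring_hom B (power_series_ring C) \<inter> extensional (carrier B).
         \<forall>c\<in>carrier K. \<phi> (monoid_algebra_const K c) = (\<lambda>i. if i = 0 then \<tau> c else \<zero>\<^bsub>C\<^esub>)}"
    using Ec ring_hom_closed[OF const_hom] by auto
  then obtain h where h: "h \<in> ring_hom A C" "\<forall>c\<in>carrier K. h (\<iota> c) = \<tau> c"
    "restrict E (carrier B) = (\<lambda>f\<in>carrier B. \<lambda>i. h (ua f i))"
    using bij_betw_imp_surj_on[OF arcs_bij[OF C \<tau>]] by blast
  show thesis
  proof (rule that[OF h(1)])
    show "h (\<iota> c) = \<tau> c" if "c \<in> carrier K" for c using h(2) that by blast
    show "h \<circ> D m = \<phi> m" if m: "m \<in> S" for m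
    proof -
      note mc = monom_closed[OF one_closed m]
      have "(\<lambda>i. h (D m i)) = E (monoid_algebra_monom K \<one> m)"
        unfolding D_def using fun_cong[OF h(3), of "monoid_algebra_monom K \<one> m"] mc by simp
      also have "\<dots> = \<one>\<^bsub>power_series_ring C\<^esub> \<otimes>\<^bsub>power_series_ring C\<^esub> \<phi> m"
        unfolding E(2)[OF one_closed m] using ring_hom_one[OF ps_const_hom[OF cring_axioms C \<tau>]] by simp
      also have "\<dots> = \<phi> m" using arc_familyD(1)[OF \<phi> m] by simp
      finally show ?thesis by (simp add: comp_def)
    qed
  qed
qed

lemma arc_hom_ext:
  assumes C: "cring C" and h: "h \<in> ring_hom A C" and h': "h' \<in> ring_hom A C"
    and s: "\<And>c. c \<in> carrier K \<Longrightarrow> h (\<iota> c) = h' (\<iota> c)"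
    and e: "\<And>m. m \<in> S \<Longrightarrow> h \<circ> D m = h' \<circ> D m" and a: "a \<in> carrier A"
  shows "h a = h' a"
proof -
  interpret C: cring C by fact
  interpret P: cring "power_series_ring C" by (rule C.power_series_cring)
  interpret A: cring A by (rule A_cring)
  interpret B: cring B by (rule B_cring)
  have \<tau>: "(\<lambda>c. h (\<iota> c)) \<in> ring_hom K C" using ring_hom_trans[OF \<iota>_hom h] by (simp add: comp_def)
  have U: "(\<lambda>f. k \<circ> ua f) \<in> ring_hom B (power_series_ring C)" if "k \<in> ring_hom A C" for k
    using ring_hom_trans[OF ua_hom ps_hom[OF A_cring C that]] unfolding comp_def .
  have eq: "h \<circ> ua f = h' \<circ> ua f" if "f \<in> carrier B" for f
    using that
  proof (induction f rule: monoid_algebra_induct)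
    case zero
    interpret u: ring_hom_cring B "power_series_ring C" "\<lambda>f. h \<circ> ua f"
      by (intro ring_hom_cring.intro ring_hom_cring_axioms.intro B_cring P.cring_axioms U[OF h])
    interpret u': ring_hom_cring B "power_series_ring C" "\<lambda>f. h' \<circ> ua f"
      by (intro ring_hom_cring.intro ring_hom_cring_axioms.intro B_cring P.cring_axioms U[OF h'])
    show ?case using u.hom_zero u'.hom_zero by simp
  next
    case (add c m g)
    have cc: "monoid_algebra_const K c \<in> carrier B" using ring_hom_closed[OF const_hom add(1)] .
    note mc = monom_closed[OF one_closed add(2)]
    have cm: "monoid_algebra_monom K c m = monoid_algebra_const K c \<otimes>\<^bsub>B\<^esub> monoid_algebra_monom K \<one> m"
      using add(1) by (simp add: monoid_algebra_const_def monoid_algebra_monom_mult)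
    have k: "k \<circ> ua (monoid_algebra_monom K c m \<oplus>\<^bsub>B\<^esub> g) =
      ((k \<circ> ua (monoid_algebra_const K c)) \<otimes>\<^bsub>power_series_ring C\<^esub> (k \<circ> D m)) \<oplus>\<^bsub>power_series_ring C\<^esub> (k \<circ> ua g)"
      if "k \<in> ring_hom A C" for k
      unfolding cm ring_hom_add[OF U[OF that] B.m_closed[OF cc mc] add(3)] ring_hom_mult[OF U[OF that] cc mc] D_def ..
    have cc': "h \<circ> ua (monoid_algebra_const K c) = h' \<circ> ua (monoid_algebra_const K c)"
    proof
      fix i
      interpret hh: ring_hom_cring A C h by (intro ring_hom_cring.intro ring_hom_cring_axioms.intro A_cring C h)
      interpret hh': ring_hom_cring A C h' by (intro ring_hom_cring.intro ring_hom_cring_axioms.intro A_cring C h')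
      show "(h \<circ> ua (monoid_algebra_const K c)) i = (h' \<circ> ua (monoid_algebra_const K c)) i"
        using s[OF add(1)] hh.hom_zero hh'.hom_zero by (simp add: ua_const[OF add(1)])
    qed
    show ?case unfolding k[OF h] k[OF h'] cc' e[OF add(2)] add(4) ..
  qed
  have r: "restrict k (carrier A) \<in> {h \<in> ring_hom A C \<inter> extensional (carrier A). \<forall>c\<in>carrier K. h (\<iota> c) = k (\<iota> c)}"
    if "k \<in> ring_hom A C" for k
    using restrict_hom[OF A_cring that] ring_hom_closed[OF \<iota>_hom] by auto
  have "restrict h (carrier A) = restrict h' (carrier A)"
  proof (rule inj_onD[OF bij_betw_imp_inj_on[OF arcs_bij[OF C \<tau>]]])
    show "(\<lambda>f\<in>carrier B. \<lambda>i. restrict h (carrier A) (ua f i)) = (\<lambda>f\<in>carrier B. \<lambda>i. restrict h' (carrier A) (ua f i))"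
      by (rule restrict_ext) (use eq ua_carrier in \<open>auto simp: fun_eq_iff\<close>)
  qed (use r[OF h] r[OF h'] s in auto)
  then show ?thesis using a by (metis restrict_apply')
qed

end


section \<open>Monoid algebras of ordered monoids\<close>

text \<open>
  Order the monoid through \<open>L\<close>. The product of the leading terms of \<open>f\<close> and \<open>g\<close> cannot cancel,
  since no other pair of exponents has the same sum.
\<close>

lemma (in domain) monoid_algebra_integral:
  fixes L :: "'m::comm_monoid_add \<Rightarrow> 'o::linordered_cancel_ab_semigroup_add" and S :: "'m set"
  assumes inj: "inj L" and add: "\<And>a b. L (a + b) = L a + L b"
    and f: "f \<in> carrier (monoid_algebra R S)" and g: "g \<in> carrier (monoid_algebra R S)"
    and f0: "f \<noteq> \<zero>\<^bsub>monoid_algebra R S\<^esub>" and g0: "g \<noteq> \<zero>\<^bsub>monoid_algebra R S\<^esub>"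
  shows "f \<otimes>\<^bsub>monoid_algebra R S\<^esub> g \<noteq> \<zero>\<^bsub>monoid_algebra R S\<^esub>"
proof -
  let ?A = "{m. f m \<noteq> \<zero>}" and ?B = "{m. g m \<noteq> \<zero>}"
  have fc: "\<And>m. f m \<in> carrier R" "finite ?A" and gc: "\<And>m. g m \<in> carrier R" "finite ?B"
    using f g by (auto simp: monoid_algebra_def)
  have ne: "?A \<noteq> {}" "?B \<noteq> {}" using f0 g0 by (auto simp: monoid_algebra_def fun_eq_iff)
  have "Max (L ` ?A) \<in> L ` ?A" using fc(2) ne(1) by (intro Max_in) auto
  then obtain a where a: "a \<in> ?A" "L a = Max (L ` ?A)" by (elim imageE) simp
  have "Max (L ` ?B) \<in> L ` ?B" using gc(2) ne(2) by (intro Max_in) auto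
  then obtain b where b: "b \<in> ?B" "L b = Max (L ` ?B)" by (elim imageE) simp
  note ab = a b
  have mx: "L p \<le> L a" if p: "p \<in> ?A" for p
    unfolding ab(2) using Max_ge[of "L ` ?A" "L p"] fc(2) p by blast
  have my: "L p \<le> L b" if p: "p \<in> ?B" for p
    unfolding ab(4) using Max_ge[of "L ` ?B" "L p"] gc(2) p by blast
  have uniq: "p = (a, b)" if "p \<in> ?A \<times> ?B" "fst p + snd p = a + b" for p
  proof -
    have s: "L (fst p) + L (snd p) = L a + L b" using that(2) add by metis
    have l: "L (fst p) \<le> L a" "L (snd p) \<le> L b" using mx my that(1) by auto
    have "L (fst p) + L (snd p) < L a + L b" if "L (fst p) < L a"
      by (rule add_less_le_mono[OF that l(2)])
    with s l have 1: "L (fst p) = L a" by fastforce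
    with s have 2: "L (snd p) = L b" by simp
    show ?thesis using injD[OF inj 1] injD[OF inj 2] by (simp add: prod_eq_iff)
  qed
  have "(f \<otimes>\<^bsub>monoid_algebra R S\<^esub> g) (a + b) =
    (\<Oplus>p\<in>?A \<times> ?B. if fst p + snd p = a + b then f (fst p) \<otimes> g (snd p) else \<zero>)"
    by (rule monoid_algebra_mult_superset) (use fc gc in auto)
  also have "\<dots> = (\<Oplus>p\<in>?A \<times> ?B. if (a, b) = p then f (fst p) \<otimes> g (snd p) else \<zero>)"
    by (intro finsum_cong') (use fc gc uniq in auto)
  also have "\<dots> = f a \<otimes> g b"
    using finsum_singleton[of "(a, b)" "?A \<times> ?B" "\<lambda>p. f (fst p) \<otimes> g (snd p)"] ab fc gc by auto
  finally have "(f \<otimes>\<^bsub>monoid_algebra R S\<^esub> g) (a + b) \<noteq> \<zero>" using ab(1,3) fc gc integral_iff by auto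
  moreover have "\<zero>\<^bsub>monoid_algebra R S\<^esub> (a + b) = \<zero>" by (simp add: monoid_algebra_def)
  ultimately show ?thesis by metis
qed

lemma (in domain) monoid_algebra_domain:
  fixes L :: "'m::comm_monoid_add \<Rightarrow> 'o::linordered_cancel_ab_semigroup_add" and S :: "'m set"
  assumes "0 \<in> S" "\<And>a b. a \<in> S \<Longrightarrow> b \<in> S \<Longrightarrow> a + b \<in> S"
    and inj: "inj L" and add: "\<And>a b. L (a + b) = L a + L b"
  shows "domain (monoid_algebra R S)"
proof (intro domain.intro domain_axioms.intro)
  show "cring (monoid_algebra R S)" by (rule monoid_algebra_cring) (use assms in auto)
  show "\<one>\<^bsub>monoid_algebra R S\<^esub> \<noteq> \<zero>\<^bsub>monoid_algebra R S\<^esub>"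
    by (auto simp: monoid_algebra_def fun_eq_iff intro!: exI[of _ 0])
  show "a = \<zero>\<^bsub>monoid_algebra R S\<^esub> \<or> b = \<zero>\<^bsub>monoid_algebra R S\<^esub>"
    if "a \<otimes>\<^bsub>monoid_algebra R S\<^esub> b = \<zero>\<^bsub>monoid_algebra R S\<^esub>"
      "a \<in> carrier (monoid_algebra R S)" "b \<in> carrier (monoid_algebra R S)" for a b
    using monoid_algebra_integral[OF inj add that(2,3)] that(1) by blast
qed

text \<open>
  The lexicographic order on finitely supported functions is linear and compatible with addition.
\<close>

lemma lattice_order_embedding:
  obtains L :: "int ^ 'n \<Rightarrow> (nat \<Rightarrow>\<^sub>0 int)" where "inj L" "\<And>a b. L (a + b) = L a + L b"
proof -
  obtain e :: "'n \<Rightarrow> nat" where e: "inj e" using finite_imp_inj_to_nat_seg[of "UNIV :: 'n set"] by auto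
  define L :: "int ^ 'n \<Rightarrow> (nat \<Rightarrow>\<^sub>0 int)" where "L m = (\<Sum>i\<in>UNIV. Poly_Mapping.single (e i) (m $ i))" for m
  have lk: "Poly_Mapping.lookup (L m) (e j) = m $ j" for m j
    unfolding L_def lookup_sum using e by (simp add: lookup_single when_def inj_eq)
  show thesis
  proof
    show "inj L"
    proof (rule injI)
      fix a b assume "L a = L b"
      then have "a $ j = b $ j" for j using lk by metis
      then show "a = b" by (simp add: vec_eq_iff)
    qed
    show "L (a + b) = L a + L b" for a b by (simp add: L_def single_add sum.distrib)
  qed
qed

lemma (in domain) laurent_domain: "domain (monoid_algebra R (UNIV :: (int ^ 'n) set))"
proof -
  obtain L :: "int ^ 'n \<Rightarrow> (nat \<Rightarrow>\<^sub>0 int)" where "inj L" "\<And>a b. L (a + b) = L a + L b"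
    using lattice_order_embedding by blast
  then show ?thesis by (intro monoid_algebra_domain[of UNIV L]) auto
qed

lemma (in domain) mpoly_nat_domain: "domain (mpoly_ring R (UNIV :: nat set))"
  unfolding mpoly_ring_def by (rule monoid_algebra_domain[of _ "\<lambda>m :: nat multiset. m"]) (auto simp: inj_on_def)


section \<open>Zariski topology\<close>

lemma zariski_open: "f \<in> carrier R \<Longrightarrow> openin (zariski R) {p \<in> Spec R. f \<notin> p}"
  unfolding zariski_def by (rule topology_generated_by_Basis) blast

lemma (in cring) zariski_topspace: "topspace (zariski R) = Spec R"
proof -
  have "\<one> \<notin> p" if p: "p \<in> Spec R" for p
  proof -
    interpret p: primeideal p R using p by (simp add: Spec_def)
    show ?thesis using p.I_notcarr p.one_imp_carrier by auto
  qed
  then have "{p \<in> Spec R. \<one> \<notin> p} = Spec R" by auto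
  then have 1: "Spec R \<in> {{p \<in> Spec R. f \<notin> p} |f. f \<in> carrier R}"
    by (intro CollectI exI[of _ \<one>]) simp
  have "\<Union> {{p \<in> Spec R. f \<notin> p} |f. f \<in> carrier R} = Spec R"
  proof
    show "\<Union> {{p \<in> Spec R. f \<notin> p} |f. f \<in> carrier R} \<subseteq> Spec R" by (rule Union_least) auto
    show "Spec R \<subseteq> \<Union> {{p \<in> Spec R. f \<notin> p} |f. f \<in> carrier R}" by (rule Union_upper[OF 1])
  qed
  then show ?thesis unfolding zariski_def topology_generated_by_topspace .
qed

lemma (in cring) closure_member_subset:
  assumes q: "q \<in> zariski R closure_of X" and f: "f \<in> carrier R" and X: "\<And>p. p \<in> X \<Longrightarrow> f \<in> p"
  shows "f \<in> q"
proof (rule ccontr)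
  assume "f \<notin> q"
  moreover have "q \<in> Spec R" using subsetD[OF closure_of_subset_topspace q] zariski_topspace by simp
  ultimately have q1: "q \<in> {p \<in> Spec R. f \<notin> p}" by simp
  have "\<forall>T. q \<in> T \<and> openin (zariski R) T \<longrightarrow> (\<exists>y. y \<in> X \<and> y \<in> T)"
    using q unfolding in_closure_of by (rule conjunct2)
  then obtain p where "p \<in> X" "p \<in> {p \<in> Spec R. f \<notin> p}"
    using q1 zariski_open[OF f] by meson
  then show False using X by simp
qed

lemma (in cring) closure_specializes:
  assumes "q \<in> zariski R closure_of {p}" "p \<in> Spec R" shows "p \<subseteq> q"
proof
  fix f assume f: "f \<in> p"
  then have "f \<in> carrier R"
    using ideal.Icarr[OF primeideal.axioms(1), of p R f] assms(2) by (simp add: Spec_def)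
  then show "f \<in> q" using closure_member_subset[OF assms(1)] f by blast
qed


section \<open>Arcs on toric varieties\<close>

locale toric_setting =
  fixes K :: "'k ring" and \<sigma> :: "(real ^ 'n) set" and n :: "int ^ 'n"
  assumes field_K: "field K"
    and cone: "strongly_convex_rational_cone \<sigma>"
    and valuation: "lattice_vec n \<in> \<sigma>"
begin

abbreviation "S \<equiv> dual_cone_lattice \<sigma>"

lemma K_domain: "domain K"
  by (rule field.axioms(1)[OF field_K])

lemma K_cring: "cring K"
  by (rule domain.axioms(1)[OF K_domain])

sublocale K: domain K by (rule K_domain)

sublocale monoid_arcs K S
  by (intro monoid_arcs.intro monoid_arcs_axioms.intro K_cring dual_cone_zero dual_cone_add)

lemma toric_eqs: "toric_arc_ring K \<sigma> = A" "toric_arc_scalar K \<sigma> = \<iota>"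
  "toric_nash_set K \<sigma> n = nash_set K B (monoid_algebra_const K) (toric_ord K n)"
  by (simp_all add: toric_arc_ring_def toric_arc_scalar_def toric_nash_set_def toric_ring_def)

definition deg :: "int ^ 'n \<Rightarrow> nat" where "deg m = nat (lattice_pairing m n)"

lemma deg_0: "deg 0 = 0"
  by (simp add: deg_def lattice_pairing_0)

lemma deg_add: "a \<in> S \<Longrightarrow> b \<in> S \<Longrightarrow> deg (a + b) = deg a + deg b"
  using dual_cone_pairing[OF _ valuation, of a] dual_cone_pairing[OF _ valuation, of b]
  by (simp add: deg_def lattice_pairing_add nat_add_distrib)

lemma multiple_in_S: "m \<in> S \<Longrightarrow> int k *s m \<in> S"
proof (induction k)
  case 0
  have "int 0 *s m = 0" by (simp add: vec_eq_iff)
  then show ?case using S_zero by simp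
next
  case (Suc k)
  have "int (Suc k) *s m = m + int k *s m" by (simp add: vec_eq_iff algebra_simps)
  then show ?case using S_add Suc by simp
qed

lemma S_generates: "\<exists>a\<in>S. m + a \<in> S"
proof -
  obtain m0 where "m0 \<in> S" "\<And>m. \<exists>k::nat. m + int k *s m0 \<in> S" using dual_cone_interior[OF cone] by blast
  then show ?thesis using multiple_in_S by blast
qed

text \<open>The arcs \<open>t\<^sup>n u\<close> with \<open>u\<close> an arc on the torus with coordinates \<open>c\<close>.\<close>

definition shifted_arc :: "('c, 'f) ring_scheme \<Rightarrow> ('n \<Rightarrow> nat \<Rightarrow> 'c) \<Rightarrow> int ^ 'n \<Rightarrow> nat \<Rightarrow> 'c" where
  "shifted_arc C c m = tpow C (deg m) \<otimes>\<^bsub>power_series_ring C\<^esub> torus_arc C c m"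

lemma tpow_family: "cring C \<Longrightarrow> arc_family S C (\<lambda>m. tpow C (deg m))"
  by (simp add: arc_family_def cring.tpow_closed cring.tpow_0 cring.tpow_add deg_0 deg_add)

lemma shifted_arc_family:
  assumes "cring C" "\<And>i. c i \<in> Units (power_series_ring C)"
  shows "arc_family S C (shifted_arc C c)"
  unfolding shifted_arc_def
  by (rule arc_family_mult[OF assms(1) tpow_family[OF assms(1)] cring.torus_arc_family[OF assms]])

lemma tpow_hom:
  assumes "cring R" "cring C" "h \<in> ring_hom R C" shows "h \<circ> tpow R d = tpow C d"
proof -
  interpret h: ring_hom_cring R C h by (intro ring_hom_cring.intro ring_hom_cring_axioms.intro assms)
  show ?thesis using h.hom_one h.hom_zero by (auto simp: tpow_def fun_eq_iff)
qed

lemma shifted_arc_hom: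
  assumes R: "cring R" and C: "cring C" and h: "h \<in> ring_hom R C" and c: "\<And>i. c i \<in> Units (power_series_ring R)"
  shows "h \<circ> shifted_arc R c m = shifted_arc C (\<lambda>i. h \<circ> c i) m"
proof -
  interpret P: cring "power_series_ring R" by (rule cring.power_series_cring[OF R])
  have tc: "torus_arc R c m \<in> carrier (power_series_ring R)"
    by (rule P.Units_closed[OF cring.torus_arc_Units[OF R c]])
  show ?thesis
    unfolding shifted_arc_def
    using ring_hom_mult[OF ps_hom[OF R C h] cring.tpow_closed[OF R] tc, of "deg m"]
    by (simp add: tpow_hom[OF R C h] torus_arc_hom[OF R C h c])
qed

lemma shifted_arc_coeff:
  assumes C: "cring C" and c: "\<And>i. c i \<in> Units (power_series_ring C)"
  shows "shifted_arc C c m i = (if i < deg m then \<zero>\<^bsub>C\<^esub> else torus_arc C c m (i - deg m))"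
proof -
  interpret P: cring "power_series_ring C" by (rule cring.power_series_cring[OF C])
  show ?thesis unfolding shifted_arc_def
    by (rule cring.tpow_mult[OF C P.Units_closed[OF cring.torus_arc_Units[OF C c]]])
qed


text \<open>A polynomial model of the coordinate ring of the arc scheme of the torus, with its universal arc.\<close>

abbreviation "Lau \<equiv> monoid_algebra K (UNIV :: (int ^ 'n) set)"
abbreviation "Tor \<equiv> mpoly_ring Lau (UNIV :: nat set)"

definition coord_index :: "'n \<times> nat \<Rightarrow> nat" where
  "coord_index = to_nat_on UNIV"

lemma coord_index_bij: "bij coord_index"
proof -
  have "countable (UNIV :: ('n \<times> nat) set)"
    by (metis UNIV_Times_UNIV countable_SIGMA countable_finite finite_class.finite_UNIV countableI_type)
  moreover have "infinite (UNIV :: ('n \<times> nat) set)"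
    using finite_prod[where 'a = 'n and 'b = nat] by simp
  ultimately show ?thesis unfolding coord_index_def by (rule to_nat_on_infinite)
qed

text \<open>
  A unit series has invertible constant coefficient and arbitrary higher coefficients. The former
  are the Laurent variables of \<open>Lau\<close>, the latter the polynomial variables of \<open>Tor\<close>.
\<close>

definition univ_coord :: "'n \<Rightarrow> nat \<Rightarrow> (nat multiset \<Rightarrow> (int ^ 'n \<Rightarrow> 'k))" where
  "univ_coord i j = (if j = 0 then monoid_algebra_const Lau (monoid_algebra_monom K \<one>\<^bsub>K\<^esub> (axis i 1))
     else poly_var Lau (coord_index (i, j)))"

lemma Lau_domain: "domain Lau"
  by (rule K.laurent_domain)

lemma Lau_cring: "cring Lau"
  by (rule domain.axioms(1)[OF Lau_domain])

lemma Tor_domain: "domain Tor"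
  by (rule domain.mpoly_nat_domain[OF Lau_domain])

lemma Tor_cring: "cring Tor"
  by (rule domain.axioms(1)[OF Tor_domain])

lemma Lau_monom_Units: "monoid_algebra_monom K \<one>\<^bsub>K\<^esub> m \<in> Units Lau"
proof -
  interpret L: cring Lau by (rule Lau_cring)
  have c: "monoid_algebra_monom K \<one>\<^bsub>K\<^esub> m \<in> carrier Lau" for m :: "int ^ 'n"
    by (rule K.monoid_algebra_monom_closed) auto
  have "monoid_algebra_monom K \<one>\<^bsub>K\<^esub> m \<otimes>\<^bsub>Lau\<^esub> monoid_algebra_monom K \<one>\<^bsub>K\<^esub> (- m) = \<one>\<^bsub>Lau\<^esub>"
    by (simp add: K.monoid_algebra_monom_mult) (auto simp: monoid_algebra_def monoid_algebra_monom_def)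
  then show ?thesis by (rule L.Units_rightI[OF c c])
qed

lemma univ_coord_Units: "univ_coord i \<in> Units (power_series_ring Tor)"
proof (rule cring.ps_UnitsI[OF Tor_cring])
  interpret L: cring Lau by (rule Lau_cring)
  have m: "monoid_algebra_monom K \<one>\<^bsub>K\<^esub> (axis i 1) \<in> Units Lau" by (rule Lau_monom_Units)
  then have mc: "monoid_algebra_monom K \<one>\<^bsub>K\<^esub> (axis i 1) \<in> carrier Lau" by (rule L.Units_closed)
  show "univ_coord i \<in> carrier (power_series_ring Tor)"
    using L.mpoly_const_closed[OF mc] L.poly_var_closed[OF UNIV_I] by (auto simp: ps_carrier univ_coord_def)
  show "univ_coord i 0 \<in> Units Tor"
    using ring_hom_Units[OF Lau_cring Tor_cring L.mpoly_const_hom m] by (simp add: univ_coord_def)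
qed

abbreviation "scal \<equiv> monoid_algebra_const Lau \<circ> monoid_algebra_const K"

lemma Lau_const_hom: "monoid_algebra_const K \<in> ring_hom K Lau"
  by (rule monoid_arcs.const_hom) (intro monoid_arcs.intro monoid_arcs_axioms.intro K_cring, auto)

lemma scal_hom: "scal \<in> ring_hom K Tor"
  by (rule ring_hom_trans[OF Lau_const_hom cring.mpoly_const_hom[OF Lau_cring]])

lemma Tor_universal:
  assumes C: "cring C" and \<tau>: "\<tau> \<in> ring_hom K C" and c: "\<And>i. c i \<in> Units (power_series_ring C)"
  obtains E where "E \<in> ring_hom Tor C" "\<And>k. k \<in> carrier K \<Longrightarrow> E (scal k) = \<tau> k" "\<And>i. E \<circ> univ_coord i = c i"
proof -
  interpret C: cring C by fact
  interpret U: comm_group "units_of C" by (rule C.units_comm_group)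
  interpret L: cring Lau by (rule Lau_cring)
  have c0: "c i 0 \<in> carrier (units_of C)" for i using C.ps_Units_coeff[OF c] by (simp add: units_of_carrier)
  have cc: "c i j \<in> carrier C" for i j
    using c[of i] cring.power_series_cring[OF C] by (auto simp: ps_carrier Units_def)
  have lc: "lattice_char (units_of C) (\<lambda>i. c i 0) m \<in> carrier C" for m
    using U.lattice_char_closed[of "\<lambda>i. c i 0" m, OF c0] C.Units_closed by (simp add: units_of_carrier)
  obtain E1 where E1: "E1 \<in> ring_hom Lau C"
    "\<And>k m. k \<in> carrier K \<Longrightarrow> m \<in> UNIV \<Longrightarrow> E1 (monoid_algebra_monom K k m) = \<tau> k \<otimes>\<^bsub>C\<^esub> lattice_char (units_of C) (\<lambda>i. c i 0) m"
    by (rule K.monoid_algebra_eval[OF UNIV_I UNIV_I C \<tau>, where e = "lattice_char (units_of C) (\<lambda>i. c i 0)"])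
      (use lc U.lattice_char_0[of "\<lambda>i. c i 0"] U.lattice_char_add[of "\<lambda>i. c i 0", OF c0] in \<open>simp_all add: units_of_one units_of_mult\<close>)
  obtain E where E: "E \<in> ring_hom Tor C" "\<And>x. x \<in> carrier Lau \<Longrightarrow> E (monoid_algebra_const Lau x) = E1 x"
    "\<And>l. l \<in> UNIV \<Longrightarrow> E (poly_var Lau l) = c (fst (inv_into UNIV coord_index l)) (snd (inv_into UNIV coord_index l))"
    by (rule L.mpoly_ring_eval[OF C E1(1), where V = UNIV and u = "\<lambda>l. c (fst (inv_into UNIV coord_index l)) (snd (inv_into UNIV coord_index l))"])
      (use cc in simp_all)
  show thesis
  proof (rule that[OF E(1)])
    fix k assume k: "k \<in> carrier K"
    have "E (scal k) = E1 (monoid_algebra_monom K k 0)"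
      using E(2)[OF ring_hom_closed[OF Lau_const_hom k]] by (simp add: monoid_algebra_const_def)
    also have "\<dots> = \<tau> k" using E1(2)[OF k UNIV_I, of 0] U.lattice_char_0[of "\<lambda>i. c i 0"] ring_hom_closed[OF \<tau> k]
      by (simp add: units_of_one)
    finally show "E (scal k) = \<tau> k" .
  next
    fix i
    show "E \<circ> univ_coord i = c i"
    proof
      fix j show "(E \<circ> univ_coord i) j = c i j"
      proof (cases "j = 0")
        case True
        have mc: "monoid_algebra_monom K \<one>\<^bsub>K\<^esub> (axis i 1) \<in> carrier Lau"
          by (rule L.Units_closed[OF Lau_monom_Units])
        have "(E \<circ> univ_coord i) j = E1 (monoid_algebra_monom K \<one>\<^bsub>K\<^esub> (axis i 1))"
          using True E(2)[OF mc] by (simp add: univ_coord_def)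
        also have "\<dots> = c i 0"
          using E1(2)[OF K.one_closed UNIV_I, of "axis i 1"] U.lattice_char_axis[of "\<lambda>i. c i 0" i, OF c0] cc[of i 0]
          by (simp add: ring_hom_one[OF \<tau>])
        finally show ?thesis using True by simp
      next
        case False
        then show ?thesis using E(3)[of "coord_index (i, j)"] coord_index_bij
          by (simp add: univ_coord_def bij_is_inj inv_f_f)
      qed
    qed
  qed
qed

definition univ_hom :: "(((int ^ 'n \<Rightarrow> 'k) \<times> nat) multiset \<Rightarrow> 'k) set \<Rightarrow> nat multiset \<Rightarrow> int ^ 'n \<Rightarrow> 'k" where
  "univ_hom = (SOME h. h \<in> ring_hom A Tor \<and> (\<forall>k\<in>carrier K. h (\<iota> k) = scal k) \<and>
     (\<forall>m\<in>S. h \<circ> D m = shifted_arc Tor univ_coord m))"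

lemma univ_hom: "univ_hom \<in> ring_hom A Tor" "k \<in> carrier K \<Longrightarrow> univ_hom (\<iota> k) = scal k"
  "m \<in> S \<Longrightarrow> univ_hom \<circ> D m = shifted_arc Tor univ_coord m"
proof -
  obtain h where h: "h \<in> ring_hom A Tor" "\<And>k. k \<in> carrier K \<Longrightarrow> h (\<iota> k) = scal k"
    "\<And>m. m \<in> S \<Longrightarrow> h \<circ> D m = shifted_arc Tor univ_coord m"
    by (rule arc_hom_exists[OF Tor_cring scal_hom shifted_arc_family[OF Tor_cring univ_coord_Units]]) (rule that)
  have "\<exists>h. h \<in> ring_hom A Tor \<and> (\<forall>k\<in>carrier K. h (\<iota> k) = scal k) \<and>
     (\<forall>m\<in>S. h \<circ> D m = shifted_arc Tor univ_coord m)"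
    by (rule exI[of _ h]) (use h in simp)
  note s = someI_ex[OF this, folded univ_hom_def]
  show "univ_hom \<in> ring_hom A Tor" by (rule conjunct1[OF s])
  show "k \<in> carrier K \<Longrightarrow> univ_hom (\<iota> k) = scal k" by (rule bspec[OF conjunct1[OF conjunct2[OF s]]])
  show "m \<in> S \<Longrightarrow> univ_hom \<circ> D m = shifted_arc Tor univ_coord m" by (rule bspec[OF conjunct2[OF conjunct2[OF s]]])
qed

text \<open>
  The point of the arc scheme given by the universal arc \<open>t\<^sup>n u\<close> with \<open>u\<close> on the torus.
\<close>

definition univ_pt where "univ_pt = {a \<in> carrier A. univ_hom a = \<zero>\<^bsub>Tor\<^esub>}"

lemma univ_pt_Spec: "univ_pt \<in> Spec A"
proof -
  interpret A: cring A by (rule A_cring)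
  interpret T: domain Tor by (rule Tor_domain)
  interpret h: ring_hom_ring A Tor univ_hom by (rule ring_hom_ringI2[OF A.ring_axioms T.ring_axioms univ_hom(1)])
  have k: "univ_pt = a_kernel A Tor univ_hom" unfolding univ_pt_def a_kernel_def' ..
  have mem: "a \<in> univ_pt \<longleftrightarrow> a \<in> carrier A \<and> univ_hom a = \<zero>\<^bsub>Tor\<^esub>" for a
    unfolding univ_pt_def by (rule mem_Collect_eq)
  have "primeideal univ_pt A"
  proof (rule primeidealI)
    show "ideal univ_pt A" unfolding k by (rule h.kernel_is_ideal)
    show "cring A" by (rule A_cring)
    show "carrier A \<noteq> univ_pt"
    proof
      assume "carrier A = univ_pt"
      then have "\<one>\<^bsub>A\<^esub> \<in> univ_pt" using A.one_closed by (rule subst)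
      then have "univ_hom \<one>\<^bsub>A\<^esub> = \<zero>\<^bsub>Tor\<^esub>" unfolding mem by (rule conjunct2)
      then show False using h.hom_one T.one_not_zero by metis
    qed
    show "a \<in> univ_pt \<or> b \<in> univ_pt" if "a \<in> carrier A" "b \<in> carrier A" "a \<otimes>\<^bsub>A\<^esub> b \<in> univ_pt" for a b
    proof -
      have "univ_hom a \<otimes>\<^bsub>Tor\<^esub> univ_hom b = \<zero>\<^bsub>Tor\<^esub>"
        using that(3) unfolding mem h.hom_mult[OF that(1,2)] by (rule conjunct2)
      then show ?thesis using T.integral[OF _ h.hom_closed[OF that(1)] h.hom_closed[OF that(2)]] that(1,2) mem by blast
    qed
  qed
  then show ?thesis by (simp add: Spec_def)
qed

lemma arc_ord_prime:
  assumes q: "q \<in> Spec A" and f: "f \<in> carrier B"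
  shows "arc_ord K B (monoid_algebra_const K) q f = (INF i\<in>{i. ua f i \<notin> q}. enat i)"
proof -
  interpret q: prime_point A q by (intro prime_point.intro prime_point_axioms.intro A_cring q)
  have "{i. arc_morphism K B (monoid_algebra_const K) q f i \<noteq> \<zero>\<^bsub>residue_field A q\<^esub>} = {i. ua f i \<notin> q}"
    using q.residue_zero_iff[OF ua_carrier[OF f]] by (simp add: arc_morphism_def)
  then show ?thesis by (simp add: arc_ord_def power_series_ord_def)
qed

text \<open>Setting the higher coordinates to zero reduces the leading coefficients to Laurent monomials.\<close>

lemma univ_leading:
  obtains V where "V \<in> ring_hom Tor Lau"
    "\<And>f i. f \<in> carrier B \<Longrightarrow> V (univ_hom (ua f i)) = (\<lambda>m. if deg m = i then f m else \<zero>\<^bsub>K\<^esub>)"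
proof -
  interpret A: cring A by (rule A_cring)
  interpret B: cring B by (rule B_cring)
  interpret T: cring Tor by (rule Tor_cring)
  interpret L: cring Lau by (rule Lau_cring)
  interpret LP: cring "power_series_ring Lau" by (rule L.power_series_cring)
  interpret U: comm_group "ps_units Lau" by (rule LP.units_comm_group)
  obtain V where V: "V \<in> ring_hom Tor Lau" "\<And>x. x \<in> carrier Lau \<Longrightarrow> V (monoid_algebra_const Lau x) = x"
    "\<And>l. l \<in> UNIV \<Longrightarrow> V (poly_var Lau l) = \<zero>\<^bsub>Lau\<^esub>"
    by (rule L.mpoly_ring_eval[OF Lau_cring id_ring_hom, where V = UNIV and u = "\<lambda>l. \<zero>\<^bsub>Lau\<^esub>"]) auto
  let ?X = "\<lambda>m. monoid_algebra_monom K \<one>\<^bsub>K\<^esub> m :: int ^ 'n \<Rightarrow> 'k"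
  have Xc: "?X m \<in> carrier Lau" for m by (rule L.Units_closed[OF Lau_monom_Units])
  define mono where "mono m = (\<lambda>j::nat. if j = 0 then ?X m else \<zero>\<^bsub>Lau\<^esub>)" for m
  have monoU: "mono m \<in> Units (power_series_ring Lau)" for m
    by (rule L.ps_UnitsI) (use Xc Lau_monom_Units in \<open>auto simp: mono_def ps_carrier\<close>)
  have monoc: "mono m \<in> carrier (power_series_ring Lau)" for m using monoU LP.Units_closed by blast
  have mono_add: "mono (a + b) = mono a \<otimes>\<^bsub>power_series_ring Lau\<^esub> mono b" for a b
  proof
    fix i
    have "(mono a \<otimes>\<^bsub>power_series_ring Lau\<^esub> mono b) i = ?X a \<otimes>\<^bsub>Lau\<^esub> mono b i"
      unfolding mono_def[of a] by (rule L.ps_const_mult[OF Xc monoc])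
    then show "mono (a + b) i = (mono a \<otimes>\<^bsub>power_series_ring Lau\<^esub> mono b) i"
      using Xc by (simp add: mono_def K.monoid_algebra_monom_mult)
  qed
  have Vc: "V \<circ> univ_coord i = mono (axis i 1)" for i
    using V(2)[OF Xc] V(3) by (auto simp: univ_coord_def mono_def fun_eq_iff)
  have lc: "lattice_char (ps_units Lau) (\<lambda>i. mono (axis i 1)) a \<in> Units (power_series_ring Lau)" for a :: "int ^ 'n"
    using U.lattice_char_closed[of "\<lambda>i. mono (axis i 1)" a] monoU by (simp add: units_of_carrier)
  have tm: "torus_arc Lau (\<lambda>i. V \<circ> univ_coord i) m = mono m" for m
    unfolding Vc torus_arc_def
    by (rule U.lattice_hom_ext)
      (simp_all add: U.lattice_char_add lc U.lattice_char_axis units_of_carrier units_of_mult monoU mono_add)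
  have VD: "V (univ_hom (D m i)) = (if i = deg m then ?X m else \<zero>\<^bsub>Lau\<^esub>)" if "m \<in> S" for m i
  proof -
    have "V (univ_hom (D m i)) = (V \<circ> shifted_arc Tor univ_coord m) i"
      using fun_cong[OF univ_hom(3)[OF that], of i] by simp
    also have "V \<circ> shifted_arc Tor univ_coord m = shifted_arc Lau (\<lambda>i. V \<circ> univ_coord i) m"
      by (rule shifted_arc_hom[OF Tor_cring Lau_cring V(1) univ_coord_Units])
    also have "\<dots> i = (if i < deg m then \<zero>\<^bsub>Lau\<^esub> else torus_arc Lau (\<lambda>i. V \<circ> univ_coord i) m (i - deg m))"
      by (rule shifted_arc_coeff[OF Lau_cring ps_hom_Units[OF Tor_cring Lau_cring V(1) univ_coord_Units]])
    finally show ?thesis unfolding tm by (auto simp: mono_def)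
  qed
  define W where "W f = V \<circ> univ_hom \<circ> ua f" for f
  have Wh: "W \<in> ring_hom B (power_series_ring Lau)"
  proof -
    have w: "W = (\<lambda>f. V \<circ> f) \<circ> ((\<lambda>f. univ_hom \<circ> f) \<circ> ua)" by (simp add: W_def fun_eq_iff)
    show ?thesis unfolding w
      by (rule ring_hom_trans[OF ring_hom_trans[OF ua_hom ps_hom[OF A_cring Tor_cring univ_hom(1)]] ps_hom[OF Tor_cring Lau_cring V(1)]])
  qed
  interpret W: ring_hom_cring B "power_series_ring Lau" W
    by (intro ring_hom_cring.intro ring_hom_cring_axioms.intro B_cring LP.cring_axioms Wh)
  have "W f i = (\<lambda>m. if deg m = i then f m else \<zero>\<^bsub>K\<^esub>)" if "f \<in> carrier B" for f i
    using that
  proof (induction f arbitrary: i rule: K.monoid_algebra_induct)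
    case zero
    then show ?case by (simp add: ps_zero) (auto simp: monoid_algebra_def)
  next
    case (add c m g)
    have cc: "monoid_algebra_const K c \<in> carrier B" using ring_hom_closed[OF const_hom add(1)] .
    note mc = monom_closed[OF K.one_closed add(2)]
    have cm: "monoid_algebra_monom K c m = monoid_algebra_const K c \<otimes>\<^bsub>B\<^esub> monoid_algebra_monom K \<one>\<^bsub>K\<^esub> m"
      using add(1) by (simp add: monoid_algebra_const_def K.monoid_algebra_monom_mult)
    have Lc: "monoid_algebra_const K c \<in> carrier Lau" using ring_hom_closed[OF Lau_const_hom add(1)] .
    interpret Vh: ring_hom_cring Tor Lau V by (intro ring_hom_cring.intro ring_hom_cring_axioms.intro Tor_cring Lau_cring V(1))
    interpret uh: ring_hom_cring A Tor univ_hom by (intro ring_hom_cring.intro ring_hom_cring_axioms.intro A_cring Tor_cring univ_hom(1))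
    have Wc: "W (monoid_algebra_const K c) = (\<lambda>i. if i = 0 then monoid_algebra_const K c else \<zero>\<^bsub>Lau\<^esub>)"
    proof (rule ext)
      fix i show "W (monoid_algebra_const K c) i = (if i = 0 then monoid_algebra_const K c else \<zero>\<^bsub>Lau\<^esub>)"
        using univ_hom(2)[OF add(1)] V(2)[OF Lc] uh.hom_zero Vh.hom_zero by (simp add: W_def ua_const[OF add(1)])
    qed
    have Wm: "W (monoid_algebra_monom K \<one>\<^bsub>K\<^esub> m) = (\<lambda>i. if i = deg m then ?X m else \<zero>\<^bsub>Lau\<^esub>)"
    proof (rule ext)
      fix j show "W (monoid_algebra_monom K \<one>\<^bsub>K\<^esub> m) j = (if j = deg m then ?X m else \<zero>\<^bsub>Lau\<^esub>)"
        using VD[OF add(2), of j] by (simp add: W_def D_def)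
    qed
    have Wmc: "W (monoid_algebra_monom K \<one>\<^bsub>K\<^esub> m) \<in> carrier (power_series_ring Lau)" using W.hom_closed[OF mc] .
    have "W (monoid_algebra_monom K c m) i = monoid_algebra_const K c \<otimes>\<^bsub>Lau\<^esub> W (monoid_algebra_monom K \<one>\<^bsub>K\<^esub> m) i"
      unfolding cm W.hom_mult[OF cc mc] Wc by (rule L.ps_const_mult[OF Lc Wmc])
    also have "\<dots> = (if i = deg m then monoid_algebra_monom K c m else \<zero>\<^bsub>Lau\<^esub>)"
      unfolding Wm using Lc add(1) by (simp add: monoid_algebra_const_def K.monoid_algebra_monom_mult)
    finally have e: "W (monoid_algebra_monom K c m) i = (if i = deg m then monoid_algebra_monom K c m else \<zero>\<^bsub>Lau\<^esub>)" .
    have mc': "monoid_algebra_monom K c m \<in> carrier B" by (rule monom_closed[OF add(1,2)])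
    have ad: "(u \<oplus>\<^bsub>monoid_algebra K X\<^esub> v) m' = u m' \<oplus>\<^bsub>K\<^esub> v m'" for u v :: "int ^ 'n \<Rightarrow> 'k" and m' X by (simp add: monoid_algebra_def)
    have z: "\<zero>\<^bsub>Lau\<^esub> m' = \<zero>\<^bsub>K\<^esub>" for m' by (simp add: monoid_algebra_def)
    have gc: "g m' \<in> carrier K" for m' using add(3) by (simp add: monoid_algebra_def)
    show ?case
    proof
      fix m'
      show "W (monoid_algebra_monom K c m \<oplus>\<^bsub>B\<^esub> g) i m' = (if deg m' = i then (monoid_algebra_monom K c m \<oplus>\<^bsub>B\<^esub> g) m' else \<zero>\<^bsub>K\<^esub>)"
        unfolding W.hom_add[OF mc' add(3)] ps_add ad e add(4)
        using add(1) gc[of m'] by (auto simp: z monoid_algebra_monom_def)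
    qed
  qed
  then show thesis using that[OF V(1)] by (simp add: W_def)
qed

text \<open>
  Below the smallest degree \<open>e\<close> of an exponent of \<open>f\<close> the series vanishes, because every monomial
  of \<open>f\<close> is divisible by \<open>t\<^sup>e\<close>. In degree \<open>e\<close> the coefficient specializes, by \<open>univ_leading\<close>, to
  the part of \<open>f\<close> of degree \<open>e\<close>, which is nonzero as a Laurent polynomial.
\<close>

lemma univ_pt_ord:
  assumes f: "f \<in> carrier B"
  shows "arc_ord K B (monoid_algebra_const K) univ_pt f = toric_ord K n f"
proof (cases "f = \<zero>\<^bsub>B\<^esub>")
  case True
  interpret A: cring A by (rule A_cring)
  interpret B: cring B by (rule B_cring)
  interpret P: cring "power_series_ring A" by (rule A.power_series_cring)
  interpret u: ring_hom_cring B "power_series_ring A" ua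
    by (intro ring_hom_cring.intro ring_hom_cring_axioms.intro B_cring P.cring_axioms ua_hom)
  have "ua f i = \<zero>\<^bsub>A\<^esub>" for i using u.hom_zero True by (simp add: ps_zero)
  moreover have "\<zero>\<^bsub>A\<^esub> \<in> univ_pt"
    using univ_pt_Spec additive_subgroup.zero_closed[OF ideal.axioms(1)] primeideal.axioms(1) by (auto simp: Spec_def)
  ultimately have "{i. ua f i \<notin> univ_pt} = {}" by simp
  moreover have "{m. f m \<noteq> \<zero>\<^bsub>K\<^esub>} = {}" using True by (simp add: monoid_algebra_def)
  ultimately show ?thesis unfolding arc_ord_prime[OF univ_pt_Spec f] toric_ord_def by simp
next
  case False
  interpret A: cring A by (rule A_cring)
  interpret T: cring Tor by (rule Tor_cring)
  interpret TP: cring "power_series_ring Tor" by (rule T.power_series_cring)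
  interpret L: cring Lau by (rule Lau_cring)
  let ?s = "{m. f m \<noteq> \<zero>\<^bsub>K\<^esub>}"
  have fs: "?s \<subseteq> S" "?s \<noteq> {}" using f False by (auto simp: monoid_algebra_def)
  define e where "e = (LEAST i. \<exists>m\<in>?s. deg m = i)"
  obtain m1 where m1: "m1 \<in> ?s" "deg m1 = e"
    using LeastI_ex[of "\<lambda>i. \<exists>m\<in>?s. deg m = i"] fs(2) unfolding e_def by blast
  have le: "e \<le> deg m" if "m \<in> ?s" for m unfolding e_def using that by (intro Least_le) blast
  obtain V where V: "V \<in> ring_hom Tor Lau"
    "\<And>f i. f \<in> carrier B \<Longrightarrow> V (univ_hom (ua f i)) = (\<lambda>m. if deg m = i then f m else \<zero>\<^bsub>K\<^esub>)"
    by (rule univ_leading) (rule that)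
  interpret Vh: ring_hom_cring Tor Lau V by (intro ring_hom_cring.intro ring_hom_cring_axioms.intro Tor_cring Lau_cring V(1))
  have ne: "ua f e \<notin> univ_pt"
  proof
    assume "ua f e \<in> univ_pt"
    then have "V (univ_hom (ua f e)) = \<zero>\<^bsub>Lau\<^esub>" by (simp add: univ_pt_def)
    then have "(\<lambda>m. if deg m = e then f m else \<zero>\<^bsub>K\<^esub>) = \<zero>\<^bsub>Lau\<^esub>" unfolding V(2)[OF f, of e] .
    then have "(\<lambda>m. if deg m = e then f m else \<zero>\<^bsub>K\<^esub>) m1 = \<zero>\<^bsub>Lau\<^esub> m1" by (rule fun_cong)
    then show False using m1 by (simp add: monoid_algebra_def)
  qed
  let ?B' = "monoid_algebra K {m \<in> S. e \<le> deg m}"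
  have "f \<in> carrier ?B'" using f le by (auto simp: monoid_algebra_def)
  have zero_coeff: "ua f i \<in> univ_pt" if i: "i < e" for i
  proof -
    define W where "W f = univ_hom \<circ> ua f" for f
    have Wh: "W \<in> ring_hom B (power_series_ring Tor)"
    proof -
      have w: "W = (\<lambda>f. univ_hom \<circ> f) \<circ> ua" by (simp add: W_def fun_eq_iff)
      show ?thesis unfolding w by (rule ring_hom_trans[OF ua_hom ps_hom[OF A_cring Tor_cring univ_hom(1)]])
    qed
    interpret B: cring B by (rule B_cring)
    interpret W: ring_hom_cring B "power_series_ring Tor" W
      by (intro ring_hom_cring.intro ring_hom_cring_axioms.intro B_cring TP.cring_axioms Wh)
    have sub: "g \<in> carrier B" if "g \<in> carrier ?B'" for g using that by (auto simp: monoid_algebra_def)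
    have "W f i = \<zero>\<^bsub>Tor\<^esub>"
      using \<open>f \<in> carrier ?B'\<close>
    proof (induction f rule: K.monoid_algebra_induct)
      case zero
      have "\<zero>\<^bsub>?B'\<^esub> = \<zero>\<^bsub>B\<^esub>" by (simp add: monoid_algebra_def)
      then show ?case using W.hom_zero by (simp add: ps_zero)
    next
      case (add c m g)
      have m: "m \<in> S" "e \<le> deg m" using add(2) by auto
      have cc: "monoid_algebra_const K c \<in> carrier B" using ring_hom_closed[OF const_hom add(1)] .
      note mc = monom_closed[OF K.one_closed m(1)]
      have cm: "monoid_algebra_monom K c m = monoid_algebra_const K c \<otimes>\<^bsub>B\<^esub> monoid_algebra_monom K \<one>\<^bsub>K\<^esub> m"
        using add(1) by (simp add: monoid_algebra_const_def K.monoid_algebra_monom_mult)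
      have pl: "monoid_algebra_monom K c m \<oplus>\<^bsub>?B'\<^esub> g = monoid_algebra_monom K c m \<oplus>\<^bsub>B\<^esub> g" by (simp add: monoid_algebra_def)
      have Wm: "W (monoid_algebra_monom K \<one>\<^bsub>K\<^esub> m) j = \<zero>\<^bsub>Tor\<^esub>" if "j < e" for j
        using fun_cong[OF univ_hom(3)[OF m(1)], of j] shifted_arc_coeff[OF Tor_cring univ_coord_Units, where m = m and i = j] m(2) that
        by (simp add: W_def D_def)
      have "W (monoid_algebra_monom K c m) i = \<zero>\<^bsub>Tor\<^esub>"
        unfolding cm W.hom_mult[OF cc mc] ps_mult
        by (rule T.add.finprod_one_eqI)
          (use Wm i ps_coeff_closed[OF W.hom_closed[OF cc]] in simp)
      then show ?case unfolding pl W.hom_add[OF monom_closed[OF add(1) m(1)] sub[OF add(3)]] ps_add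
        using add(4) by simp
    qed
    then show ?thesis using ua_carrier[OF f] by (simp add: univ_pt_def W_def)
  qed
  have "(INF i\<in>{i. ua f i \<notin> univ_pt}. enat i) = enat e"
  proof (rule antisym)
    show "(INF i\<in>{i. ua f i \<notin> univ_pt}. enat i) \<le> enat e" by (rule INF_lower) (simp add: ne)
    show "enat e \<le> (INF i\<in>{i. ua f i \<notin> univ_pt}. enat i)"
    proof (rule INF_greatest)
      fix i assume "i \<in> {i. ua f i \<notin> univ_pt}"
      then have "\<not> i < e" using zero_coeff[of i] by force
      then show "enat e \<le> enat i" by simp
    qed
  qed
  moreover have "toric_ord K n f = enat e"
    unfolding toric_ord_def deg_def[symmetric]
  proof (rule antisym)
    have "(INF m\<in>?s. enat (deg m)) \<le> enat (deg m1)" by (rule INF_lower[OF m1(1)])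
    then show "(INF m\<in>?s. enat (deg m)) \<le> enat e" unfolding m1(2) .
    show "enat e \<le> (INF m\<in>?s. enat (deg m))" by (rule INF_greatest) (simp only: enat_ord_simps le)
  qed
  ultimately show ?thesis unfolding arc_ord_prime[OF univ_pt_Spec f] by simp
qed

abbreviation "\<N> \<equiv> toric_nash_set K \<sigma> n"

abbreviation "Npts \<equiv> {\<alpha> \<in> Spec A. \<forall>f\<in>carrier B. arc_ord K B (monoid_algebra_const K) \<alpha> f = toric_ord K n f}"

lemma nash_eq: "\<N> = zariski A closure_of Npts"
  unfolding toric_eqs nash_set_def ..

lemma univ_pt_Nash: "univ_pt \<in> \<N>"
proof -
  have 1: "univ_pt \<in> Npts" by (intro CollectI conjI ballI univ_pt_Spec univ_pt_ord)
  have 2: "Npts \<subseteq> topspace (zariski A)" unfolding cring.zariski_topspace[OF A_cring] by (rule Collect_restrict)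
  show ?thesis unfolding nash_eq by (rule subsetD[OF closure_of_subset[OF 2] 1])
qed

lemma toric_ord_monom: "toric_ord K n (monoid_algebra_monom K \<one>\<^bsub>K\<^esub> m) = enat (deg m)"
proof -
  have "{m'. monoid_algebra_monom K \<one>\<^bsub>K\<^esub> m m' \<noteq> \<zero>\<^bsub>K\<^esub>} = {m}" by (auto simp: monoid_algebra_monom_def)
  then show ?thesis by (simp add: toric_ord_def deg_def)
qed

text \<open>
  The vanishing of coefficients is a closed condition, and it holds on the set of points whose
  closure is the Nash set.
\<close>

lemma Nash_low_coeff:
  assumes \<alpha>: "\<alpha> \<in> \<N>" and m: "m \<in> S" and i: "i < deg m"
  shows "D m i \<in> \<alpha>"
proof (rule cring.closure_member_subset[OF A_cring \<alpha>[unfolded nash_eq] D_closed[OF m]])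
  fix p assume p: "p \<in> Npts"
  note mc = monom_closed[OF K.one_closed m]
  have "(INF i\<in>{i. ua (monoid_algebra_monom K \<one>\<^bsub>K\<^esub> m) i \<notin> p}. enat i) = enat (deg m)"
    using p mc arc_ord_prime[OF _ mc] toric_ord_monom by auto
  then have "enat (deg m) \<le> enat i" if "ua (monoid_algebra_monom K \<one>\<^bsub>K\<^esub> m) i \<notin> p"
    using that INF_lower[of i "{i. ua (monoid_algebra_monom K \<one>\<^bsub>K\<^esub> m) i \<notin> p}" enat] by simp
  then show "D m i \<in> p" using i by (auto simp: D_def)
qed

lemma Nash_Spec: "\<alpha> \<in> \<N> \<Longrightarrow> \<alpha> \<in> Spec A"
  unfolding nash_eq cring.zariski_topspace[OF A_cring, symmetric] by (rule subsetD[OF closure_of_subset_topspace])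

text \<open>At these points Weierstrass preparation applies to all characters simultaneously.\<close>

definition generic_orders :: "(((int ^ 'n \<Rightarrow> 'k) \<times> nat) multiset \<Rightarrow> 'k) set set \<Rightarrow> bool" where
  "generic_orders \<alpha> \<longleftrightarrow> \<alpha> \<in> Spec A \<and> (\<forall>m\<in>S. (\<forall>i<deg m. D m i \<in> \<alpha>) \<and> D m (deg m) \<notin> \<alpha>)"

text \<open>
  On the Nash set, modulo \<open>\<alpha>\<close>, the coefficients of degree \<open>deg m\<close> are multiplicative in \<open>m\<close>,
  because the lower ones vanish. Every \<open>m\<close> in \<open>S\<close> divides a multiple of \<open>m0\<close>, and modulo \<open>\<alpha>\<close> the
  leading coefficients of these multiples are powers of one element outside the prime \<open>\<alpha>\<close>.
\<close>

lemma generic_orders_if_interior: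
  assumes \<alpha>: "\<alpha> \<in> \<N>" and m0: "m0 \<in> S" "\<And>m. \<exists>k::nat. m + int k *s m0 \<in> S" and d0: "D m0 (deg m0) \<notin> \<alpha>"
  shows "generic_orders \<alpha>"
  unfolding generic_orders_def
proof (intro conjI ballI allI impI)
  show sp: "\<alpha> \<in> Spec A" by (rule Nash_Spec[OF \<alpha>])
  show low: "D m i \<in> \<alpha>" if "m \<in> S" "i < deg m" for m i by (rule Nash_low_coeff[OF \<alpha> that])
  interpret A: cring A by (rule A_cring)
  have pr: "primeideal \<alpha> A" using sp by (simp add: Spec_def)
  interpret I: primeideal \<alpha> A by (rule pr)
  have lead: "D (a + b) (deg (a + b)) \<in> \<alpha> \<longleftrightarrow> D a (deg a) \<in> \<alpha> \<or> D b (deg b) \<in> \<alpha>" if ab: "a \<in> S" "b \<in> S" for a b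
  proof -
    let ?d = "deg a + deg b"
    have c: "D a j \<in> carrier A" "D b j \<in> carrier A" for j using D_closed ab by auto
    have pc: "D a j \<otimes>\<^bsub>A\<^esub> D b (?d - j) \<in> carrier A" for j by (rule A.m_closed[OF c])
    have low': "D a j \<otimes>\<^bsub>A\<^esub> D b (?d - j) \<in> \<alpha>" if "deg a \<noteq> j" "j \<le> ?d" for j
    proof (cases "j < deg a")
      case True
      show ?thesis by (rule I.I_r_closed[OF low[OF ab(1) True] c(2)])
    next
      case False
      then have "?d - j < deg b" using that by linarith
      then show ?thesis by (rule I.I_l_closed[OF low[OF ab(2)] c(1)])
    qed
    have "\<alpha> +>\<^bsub>A\<^esub> (\<Oplus>\<^bsub>A\<^esub>j\<in>{..?d}. D a j \<otimes>\<^bsub>A\<^esub> D b (?d - j)) =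
        \<alpha> +>\<^bsub>A\<^esub> (\<Oplus>\<^bsub>A\<^esub>j\<in>{..?d}. if deg a = j then D a j \<otimes>\<^bsub>A\<^esub> D b (?d - j) else \<zero>\<^bsub>A\<^esub>)"
    proof (rule A.coset_finsum_cong[OF I.is_ideal])
      fix j assume j: "j \<in> {..?d}"
      show "\<alpha> +>\<^bsub>A\<^esub> (D a j \<otimes>\<^bsub>A\<^esub> D b (?d - j)) = \<alpha> +>\<^bsub>A\<^esub> (if deg a = j then D a j \<otimes>\<^bsub>A\<^esub> D b (?d - j) else \<zero>\<^bsub>A\<^esub>)"
      proof (cases "deg a = j")
        case False
        have "\<alpha> +>\<^bsub>A\<^esub> (D a j \<otimes>\<^bsub>A\<^esub> D b (?d - j)) = \<alpha> +>\<^bsub>A\<^esub> \<zero>\<^bsub>A\<^esub>"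
          by (rule iffD1[OF A.coset_mem_iff[OF I.is_ideal pc] low'[OF False]]) (use j in simp)
        then show ?thesis unfolding if_not_P[OF False] .
      qed simp
      show "D a j \<otimes>\<^bsub>A\<^esub> D b (?d - j) \<in> carrier A" by (rule pc)
      show "(if deg a = j then D a j \<otimes>\<^bsub>A\<^esub> D b (?d - j) else \<zero>\<^bsub>A\<^esub>) \<in> carrier A"
        by (split if_split) (intro conjI impI pc A.zero_closed)
    qed
    also have "(\<Oplus>\<^bsub>A\<^esub>j\<in>{..?d}. if deg a = j then D a j \<otimes>\<^bsub>A\<^esub> D b (?d - j) else \<zero>\<^bsub>A\<^esub>) = D a (deg a) \<otimes>\<^bsub>A\<^esub> D b (deg b)"
      using A.finsum_singleton[of "deg a" "{..?d}" "\<lambda>j. D a j \<otimes>\<^bsub>A\<^esub> D b (?d - j)", OF _ _ Pi_I[OF pc]] by simp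
    finally have e: "\<alpha> +>\<^bsub>A\<^esub> D (a + b) ?d = \<alpha> +>\<^bsub>A\<^esub> (D a (deg a) \<otimes>\<^bsub>A\<^esub> D b (deg b))"
      unfolding arc_familyD(3)[OF D_family ab] ps_mult .
    have "D (a + b) ?d \<in> \<alpha> \<longleftrightarrow> D a (deg a) \<otimes>\<^bsub>A\<^esub> D b (deg b) \<in> \<alpha>"
      by (rule A.coset_mem_cong[OF I.is_ideal D_closed[OF S_add[OF ab]] A.m_closed[OF c] e])
    moreover have "D a (deg a) \<otimes>\<^bsub>A\<^esub> D b (deg b) \<in> \<alpha> \<longleftrightarrow> D a (deg a) \<in> \<alpha> \<or> D b (deg b) \<in> \<alpha>"
    proof
      assume "D a (deg a) \<otimes>\<^bsub>A\<^esub> D b (deg b) \<in> \<alpha>"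
      then show "D a (deg a) \<in> \<alpha> \<or> D b (deg b) \<in> \<alpha>" by (rule I.I_prime[OF c])
    next
      assume "D a (deg a) \<in> \<alpha> \<or> D b (deg b) \<in> \<alpha>"
      then show "D a (deg a) \<otimes>\<^bsub>A\<^esub> D b (deg b) \<in> \<alpha>"
        by (rule disjE) (rule I.I_r_closed[OF _ c(2)], assumption, rule I.I_l_closed[OF _ c(1)], assumption)
    qed
    ultimately show ?thesis unfolding deg_add[OF ab] by (rule trans)
  qed
  have mult: "D (int k *s m0) (deg (int k *s m0)) \<notin> \<alpha>" for k
  proof (induction k)
    case 0
    have z: "int 0 *s m0 = 0" by (simp add: vec_eq_iff)
    have "D 0 0 = \<one>\<^bsub>A\<^esub>" using arc_familyD(2)[OF D_family] by (simp add: ps_one)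
    then show ?case unfolding z deg_0 using I.one_imp_carrier I.I_notcarr by auto
  next
    case (Suc k)
    have "int (Suc k) *s m0 = m0 + int k *s m0" by (simp add: vec_eq_iff algebra_simps)
    then show ?case using lead[OF m0(1) multiple_in_S[OF m0(1), of k]] Suc d0 by simp
  qed
  show "D m (deg m) \<notin> \<alpha>" if m: "m \<in> S" for m
  proof
    assume d: "D m (deg m) \<in> \<alpha>"
    obtain k :: nat where k: "- m + int k *s m0 \<in> S" using m0(2) by blast
    have "D (m + (- m + int k *s m0)) (deg (m + (- m + int k *s m0))) \<in> \<alpha>" using lead[OF m k] d by blast
    then show False using mult[of k] by simp
  qed
qed

lemma generic_point_facts:
  assumes eta: "generic_point A \<N> \<eta>"
  shows "\<eta> \<in> Spec A" "\<eta> \<in> \<N>" "\<eta> \<subseteq> univ_pt"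
proof -
  interpret A: cring A by (rule A_cring)
  show sp: "\<eta> \<in> Spec A" using eta by (simp add: generic_point_def)
  have N: "zariski A closure_of {\<eta>} = \<N>" using eta by (simp add: generic_point_def)
  have sub: "{\<eta>} \<subseteq> topspace (zariski A)" using sp A.zariski_topspace by simp
  show "\<eta> \<in> \<N>" unfolding N[symmetric] by (rule subsetD[OF closure_of_subset[OF sub]]) simp
  have "univ_pt \<in> zariski A closure_of {\<eta>}" unfolding N by (rule univ_pt_Nash)
  then show "\<eta> \<subseteq> univ_pt" by (rule A.closure_specializes[OF _ sp])
qed

text \<open>
  Such an arc factors through the universal one, and \<open>\<eta>\<close> is contained in the kernel of the latter.
\<close>

lemma eta_killed:
  assumes eta: "generic_point A \<N> \<eta>" and C: "cring C" and c: "\<And>i. c i \<in> Units (power_series_ring C)"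
    and h: "h \<in> ring_hom A C" and hD: "\<And>m. m \<in> S \<Longrightarrow> h \<circ> D m = shifted_arc C c m" and a: "a \<in> \<eta>"
  shows "h a = \<zero>\<^bsub>C\<^esub>"
proof -
  interpret C: cring C by fact
  have au: "a \<in> carrier A" "univ_hom a = \<zero>\<^bsub>Tor\<^esub>" using generic_point_facts(3)[OF eta] a by (auto simp: univ_pt_def)
  have \<tau>: "h \<circ> \<iota> \<in> ring_hom K C" by (rule ring_hom_trans[OF \<iota>_hom h])
  obtain E where E: "E \<in> ring_hom Tor C" "\<And>k. k \<in> carrier K \<Longrightarrow> E (scal k) = (h \<circ> \<iota>) k" "\<And>i. E \<circ> univ_coord i = c i"
    by (rule Tor_universal[OF C \<tau> c]) (rule that)
  interpret Eh: ring_hom_cring Tor C E by (intro ring_hom_cring.intro ring_hom_cring_axioms.intro Tor_cring C E(1))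
  have "h a = (E \<circ> univ_hom) a"
  proof (rule arc_hom_ext[OF C h ring_hom_trans[OF univ_hom(1) E(1)] _ _ au(1)])
    show "h (\<iota> k) = (E \<circ> univ_hom) (\<iota> k)" if "k \<in> carrier K" for k
      using E(2)[OF that] univ_hom(2)[OF that] by simp
    show "h \<circ> D m = (E \<circ> univ_hom) \<circ> D m" if "m \<in> S" for m
      unfolding comp_assoc univ_hom(3)[OF that] shifted_arc_hom[OF Tor_cring C E(1) univ_coord_Units] E(3) hD[OF that] ..
  qed
  then show ?thesis using au(2) by simp
qed

lemma generic_orders_open:
  assumes eta: "generic_point A \<N> \<eta>"
  obtains U where "openin (subtopology (zariski A) \<N>) U" "\<eta> \<in> U" "\<And>\<alpha>. \<alpha> \<in> U \<Longrightarrow> generic_orders \<alpha>"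
proof -
  obtain m0 where m0: "m0 \<in> S" "\<And>m. \<exists>k::nat. m + int k *s m0 \<in> S" using dual_cone_interior[OF cone] by blast
  define U where "U = {\<alpha> \<in> \<N>. D m0 (deg m0) \<notin> \<alpha>}"
  have "U = {p \<in> Spec A. D m0 (deg m0) \<notin> p} \<inter> \<N>" using Nash_Spec by (auto simp: U_def)
  then have 1: "openin (subtopology (zariski A) \<N>) U"
    unfolding openin_subtopology by (intro exI[of _ "{p \<in> Spec A. D m0 (deg m0) \<notin> p}"] conjI zariski_open[OF D_closed[OF m0(1)]])
  interpret T: domain Tor by (rule Tor_domain)
  have "torus_arc Tor univ_coord m0 \<in> Units (power_series_ring Tor)"
    by (rule T.torus_arc_Units[OF univ_coord_Units])
  then have "torus_arc Tor univ_coord m0 0 \<in> Units Tor" by (rule T.ps_Units_coeff)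
  then have "torus_arc Tor univ_coord m0 0 \<noteq> \<zero>\<^bsub>Tor\<^esub>" by (auto simp: Units_def)
  moreover have "univ_hom (D m0 (deg m0)) = torus_arc Tor univ_coord m0 0"
    using fun_cong[OF univ_hom(3)[OF m0(1)], of "deg m0"] shifted_arc_coeff[OF Tor_cring univ_coord_Units, where m = m0 and i = "deg m0"] by simp
  ultimately have "D m0 (deg m0) \<notin> univ_pt" by (simp add: univ_pt_def)
  then have "\<eta> \<in> U" using generic_point_facts[OF eta] by (auto simp: U_def)
  then show thesis using that[OF 1] generic_orders_if_interior[OF _ m0] by (auto simp: U_def)
qed

end


section \<open>Weierstrass coordinates on formal neighborhoods\<close>

context toric_setting
begin

text \<open>
  The second Weierstrass factor is a family of units on \<open>S\<close>, and \<open>S\<close> generates the lattice.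
\<close>

lemma arc_factor:
  assumes C: "complete_top_ring C" and \<phi>: "arc_family S C \<phi>"
    and low: "\<And>m i. m \<in> S \<Longrightarrow> i < deg m \<Longrightarrow> \<phi> m i \<in> nbhd C 1"
    and lead: "\<And>m. m \<in> S \<Longrightarrow> \<phi> m (deg m) \<in> Units C"
  obtains p and c :: "'n \<Rightarrow> nat \<Rightarrow> 'c" where "arc_family S C p"
    "\<And>m. m \<in> S \<Longrightarrow> complete_top_ring.distinguished C (deg m) (p m)"
    "\<And>i. c i \<in> Units (power_series_ring C)"
    "\<And>m. m \<in> S \<Longrightarrow> \<phi> m = p m \<otimes>\<^bsub>power_series_ring C\<^esub> torus_arc C c m"
proof -
  interpret C: complete_top_ring C by (rule C)
  obtain p u where p: "arc_family S C p" "\<And>m. m \<in> S \<Longrightarrow> C.distinguished (deg m) (p m)"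
    and u: "arc_family S C u" "\<And>m. m \<in> S \<Longrightarrow> u m \<in> Units (power_series_ring C)"
    and eq: "\<And>m. m \<in> S \<Longrightarrow> \<phi> m = p m \<otimes>\<^bsub>power_series_ring C\<^esub> u m"
    by (rule C.weierstrass_arc_family[where d = deg, OF S_zero S_add deg_0 deg_add \<phi> low lead]) (assumption+, rule that)
  obtain c where c: "\<And>i. c i \<in> Units (power_series_ring C)" "\<And>m. m \<in> S \<Longrightarrow> u m = torus_arc C c m"
    by (rule C.torus_arc_param[OF S_zero S_add S_generates u]) (assumption+, rule that)
  have "\<phi> m = p m \<otimes>\<^bsub>power_series_ring C\<^esub> torus_arc C c m" if "m \<in> S" for m
    using eq[OF that] unfolding c(2)[OF that] .
  from that[OF p c(1) this] show thesis .
qed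

lemma arc_factor_unique:
  assumes C: "complete_top_ring C"
    and p: "\<And>m. m \<in> S \<Longrightarrow> complete_top_ring.distinguished C (deg m) (p m)"
    and p': "\<And>m. m \<in> S \<Longrightarrow> complete_top_ring.distinguished C (deg m) (p' m)"
    and c: "\<And>i. c i \<in> Units (power_series_ring C)" and c': "\<And>i. c' i \<in> Units (power_series_ring C)"
    and eq: "\<And>m. m \<in> S \<Longrightarrow> p m \<otimes>\<^bsub>power_series_ring C\<^esub> torus_arc C c m =
      p' m \<otimes>\<^bsub>power_series_ring C\<^esub> torus_arc C c' m"
  shows "m \<in> S \<Longrightarrow> p m = p' m" "c = c'"
proof -
  interpret C: complete_top_ring C by (rule C)
  note u = C.weierstrass_unique[OF p p' C.torus_arc_Units[OF c] C.torus_arc_Units[OF c'] eq]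
  show "p m = p' m" if m: "m \<in> S" by (rule u(1)[OF m m m])
  show "c = c'" by (rule C.torus_arc_unique[OF S_generates c c' u(2)])
qed

lemma distinguished_reduction:
  assumes C: "complete_top_ring C" and E: "cring E" and h: "h \<in> ring_hom C E"
    and z: "\<And>x. x \<in> nbhd C 1 \<Longrightarrow> h x = \<zero>\<^bsub>E\<^esub>" and p: "complete_top_ring.distinguished C d p"
  shows "h \<circ> p = tpow E d"
proof (rule ext)
  interpret C: complete_top_ring C by (rule C)
  interpret h: ring_hom_cring C E h by (intro ring_hom_cring.intro ring_hom_cring_axioms.intro C.cring_axioms E h)
  have p': "\<forall>i<d. p i \<in> nbhd C 1" "p d = \<one>\<^bsub>C\<^esub>" "\<forall>i>d. p i = \<zero>\<^bsub>C\<^esub>"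
    using p by (simp_all add: C.distinguished_def)
  fix i
  consider "i < d" | "i = d" | "i > d" by linarith
  then show "(h \<circ> p) i = tpow E d i"
    by cases (use p' z h.hom_one h.hom_zero in \<open>auto simp: tpow_def\<close>)
qed

text \<open>
  Modulo \<open>nbhd C 1\<close> a distinguished polynomial of degree \<open>d\<close> becomes \<open>t\<^sup>d\<close>, so only the torus part
  of a factored arc survives.
\<close>

lemma factor_reduction:
  assumes C: "complete_top_ring C" and E: "cring E" and h: "h \<in> ring_hom C E"
    and z: "\<And>x. x \<in> nbhd C 1 \<Longrightarrow> h x = \<zero>\<^bsub>E\<^esub>" and p: "complete_top_ring.distinguished C (deg m) (p m)"
    and c: "\<And>i. c i \<in> Units (power_series_ring C)"
  shows "h \<circ> (p m \<otimes>\<^bsub>power_series_ring C\<^esub> torus_arc C c m) = shifted_arc E (\<lambda>i. h \<circ> c i) m"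
proof -
  interpret C: complete_top_ring C by (rule C)
  interpret P: cring "power_series_ring C" by (rule C.power_series_cring)
  have "h \<circ> (p m \<otimes>\<^bsub>power_series_ring C\<^esub> torus_arc C c m) =
      (h \<circ> p m) \<otimes>\<^bsub>power_series_ring E\<^esub> (h \<circ> torus_arc C c m)"
    by (rule ring_hom_mult[OF ps_hom[OF C.cring_axioms E h] C.distinguished_closed[OF p] P.Units_closed[OF C.torus_arc_Units[OF c]]])
  moreover have "h \<circ> p m = tpow E (deg m)" by (rule distinguished_reduction[OF C E h z p])
  ultimately show ?thesis
    unfolding shifted_arc_def torus_arc_hom[OF C.cring_axioms E h c] by (simp only:)
qed

text \<open>
  Multiplication by a power of \<open>t\<close> is injective.
\<close>

lemma shifted_arc_unique:
  assumes C: "cring C" and c: "\<And>i. c i \<in> Units (power_series_ring C)" and c': "\<And>i. c' i \<in> Units (power_series_ring C)"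
    and eq: "\<And>m. m \<in> S \<Longrightarrow> shifted_arc C c m = shifted_arc C c' m"
  shows "c = c'"
proof (rule cring.torus_arc_unique[OF C S_generates c c'])
  show "torus_arc C c m = torus_arc C c' m" if m: "m \<in> S" for m
  proof (rule ext)
    fix i
    show "torus_arc C c m i = torus_arc C c' m i"
      using fun_cong[OF eq[OF m], of "i + deg m"] by (simp add: shifted_arc_coeff[OF C c] shifted_arc_coeff[OF C c'])
  qed
qed

end

lemma (in complete_top_ring) mod_nbhd_hom: "(+>) (nbhd R 1) \<in> ring_hom R (R Quot nbhd R 1)"
  by (rule ideal.rcos_ring_hom[OF nbhd_ideal])

locale generic_order_point = toric_setting K \<sigma> n
  for K :: "'k ring" and \<sigma> :: "(real ^ 'n) set" and n :: "int ^ 'n" +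
  fixes \<alpha> :: "(((int ^ 'n \<Rightarrow> 'k) \<times> nat) multiset \<Rightarrow> 'k) set set"
  assumes generic_orders: "generic_orders \<alpha>"
begin

sublocale P: prime_point A \<alpha>
  by (intro prime_point.intro prime_point_axioms.intro A_cring) (use generic_orders in \<open>simp add: generic_orders_def\<close>)

(* The index 1 of nbhd F 1 and of the evaluation at 1 must not be rewritten to Suc 0. *)
declare One_nat_def [simp del]

abbreviation "F \<equiv> formal_nbhd A \<alpha>"
abbreviation "fm \<equiv> formal_nbhd_map A \<alpha>"
abbreviation "\<kappa> \<equiv> residue_field A \<alpha>"
abbreviation "res \<equiv> residue_map A \<alpha>"

sublocale F: complete_top_ring F by (rule P.FN_complete)

text \<open>
  The Weierstrass factorization of the canonical arc over the formal neighborhood: distinguished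
  polynomials \<open>wpoly\<close> and torus coordinates \<open>wcoord\<close>, with \<open>rcoord\<close> the residual torus
  coordinates.
\<close>

definition arc_factors where
  "arc_factors = (SOME (p, c :: 'n \<Rightarrow> _). arc_family S F p \<and>
    (\<forall>m\<in>S. F.distinguished (deg m) (p m)) \<and> (\<forall>i. c i \<in> Units (power_series_ring F)) \<and>
    (\<forall>m\<in>S. fm \<circ> D m = p m \<otimes>\<^bsub>power_series_ring F\<^esub> torus_arc F c m))"

definition "wpoly = fst arc_factors"
definition "wcoord = snd arc_factors"
definition "rcoord i j = wcoord i j 1"

lemma D_factor: "arc_family S F wpoly"
  "m \<in> S \<Longrightarrow> F.distinguished (deg m) (wpoly m)" "wcoord i \<in> Units (power_series_ring F)"
  "m \<in> S \<Longrightarrow> fm \<circ> D m = wpoly m \<otimes>\<^bsub>power_series_ring F\<^esub> torus_arc F wcoord m"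
proof -
  have lo: "(fm \<circ> D m) i \<in> nbhd F 1" if "m \<in> S" "i < deg m" for m i
    using P.FN_map_nbhd[of "D m i"] generic_orders that by (simp add: generic_orders_def)
  have le: "(fm \<circ> D m) (deg m) \<in> Units F" if "m \<in> S" for m
    using P.FN_map_Units[of "D m (deg m)"] generic_orders that D_closed[OF that] by (simp add: generic_orders_def)
  obtain p c where pc: "arc_family S F p" "\<And>m. m \<in> S \<Longrightarrow> F.distinguished (deg m) (p m)"
    "\<And>i. c i \<in> Units (power_series_ring F)"
    "\<And>m. m \<in> S \<Longrightarrow> fm \<circ> D m = p m \<otimes>\<^bsub>power_series_ring F\<^esub> torus_arc F c m"
    by (rule arc_factor[OF F.complete_top_ring_axioms arc_family_hom[OF A_cring F.cring_axioms P.FN_map_hom D_family] lo le])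
      (assumption+, rule that)
  have "case arc_factors of (p, c) \<Rightarrow> arc_family S F p \<and>
    (\<forall>m\<in>S. F.distinguished (deg m) (p m)) \<and> (\<forall>i. c i \<in> Units (power_series_ring F)) \<and>
    (\<forall>m\<in>S. fm \<circ> D m = p m \<otimes>\<^bsub>power_series_ring F\<^esub> torus_arc F c m)"
    unfolding arc_factors_def by (rule someI[of _ "(p, c)"]) (use pc in simp)
  then have *: "arc_family S F wpoly \<and>
    (\<forall>m\<in>S. F.distinguished (deg m) (wpoly m)) \<and> (\<forall>i. wcoord i \<in> Units (power_series_ring F)) \<and>
    (\<forall>m\<in>S. fm \<circ> D m = wpoly m \<otimes>\<^bsub>power_series_ring F\<^esub> torus_arc F wcoord m)"
    by (simp add: wpoly_def wcoord_def case_prod_beta)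
  show "arc_family S F wpoly" using * by (rule conjunct1)
  show "F.distinguished (deg m) (wpoly m)" if "m \<in> S" using * that by simp
  show "wcoord i \<in> Units (power_series_ring F)" using * by simp
  show "fm \<circ> D m = wpoly m \<otimes>\<^bsub>power_series_ring F\<^esub> torus_arc F wcoord m" if "m \<in> S" using * that by simp
qed

text \<open>
  Evaluation at index \<open>1\<close> is the projection of the completed local ring to the residue field.
\<close>

lemma diff_in_nbhd:
  assumes x: "x \<in> carrier F" and y: "y \<in> carrier F" and e: "x 1 = y 1"
  shows "x \<ominus>\<^bsub>F\<^esub> y \<in> nbhd F 1"
proof -
  interpret ev: ring_hom_cring F \<kappa> "\<lambda>x. x 1"
    by (intro ring_hom_cring.intro ring_hom_cring_axioms.intro F.cring_axioms P.residue_cring P.FN_eval_hom)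
  have "(x \<ominus>\<^bsub>F\<^esub> y) 1 = x 1 \<oplus>\<^bsub>\<kappa>\<^esub> \<ominus>\<^bsub>\<kappa>\<^esub> y 1"
    using x y by (simp add: a_minus_def)
  also have "\<dots> = \<zero>\<^bsub>\<kappa>\<^esub>" unfolding e by (rule P.res.r_neg[OF ev.hom_closed[OF y]])
  finally show ?thesis using P.FN_nbhd_1[of "x \<ominus>\<^bsub>F\<^esub> y"] x y by simp
qed

lemma wpoly_closed: "m \<in> S \<Longrightarrow> wpoly m i \<in> carrier F"
  by (rule arc_familyD(4)[OF D_factor(1)])

lemma wcoord_closed: "wcoord i j \<in> carrier F"
proof -
  interpret PS: cring "power_series_ring F" by (rule F.power_series_cring)
  show ?thesis by (rule ps_coeff_closed[OF PS.Units_closed[OF D_factor(3)]])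
qed

lemma rcoord_eq: "rcoord i = (\<lambda>x. x 1) \<circ> wcoord i"
  by (simp add: rcoord_def fun_eq_iff)

lemma rcoord_Units: "rcoord i \<in> Units (power_series_ring \<kappa>)"
  unfolding rcoord_eq by (rule ps_hom_Units[OF F.cring_axioms P.residue_cring P.FN_eval_hom D_factor(3)])

lemma rcoord_closed: "rcoord i j \<in> carrier \<kappa>"
  unfolding rcoord_def using ring_hom_closed[OF P.FN_eval_hom wcoord_closed] .

text \<open>
  Over the residue field the distinguished polynomials reduce to powers of \<open>t\<close>.
\<close>

lemma res_D: "m \<in> S \<Longrightarrow> res \<circ> D m = shifted_arc \<kappa> rcoord m"
proof -
  assume m: "m \<in> S"
  have "res \<circ> D m = (\<lambda>x. x 1) \<circ> (fm \<circ> D m)" by (rule ext) (simp add: P.FN_map_eval)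
  also have "\<dots> = shifted_arc \<kappa> (\<lambda>i. (\<lambda>x. x 1) \<circ> wcoord i) m"
    unfolding D_factor(4)[OF m]
  proof (rule factor_reduction[where p = wpoly, OF F.complete_top_ring_axioms P.residue_cring P.FN_eval_hom _ D_factor(2)[OF m] D_factor(3)])
    show "x 1 = \<zero>\<^bsub>\<kappa>\<^esub>" if "x \<in> nbhd F 1" for x
      using P.FN_nbhd_1[OF ideal.Icarr[OF F.nbhd_ideal that]] that by simp
  qed
  finally show ?thesis unfolding rcoord_eq .
qed

text \<open>
  The formal neighborhood represents the pairs \<open>(p, c)\<close> of distinguished polynomials and torus
  coordinates lifting the residual ones. The arc \<open>p \<cdot> c\<close> over \<open>C\<close> defines a homomorphism \<open>g\<close> on
  the coordinate ring that is congruent to the one of \<open>\<alpha>\<close> modulo \<open>nbhd C 1\<close>. So \<open>g\<close> makes \<open>\<alpha>\<close>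
  small and its complement invertible, and it extends to the formal neighborhood; uniqueness of
  the factorization shows that the extension carries \<open>wpoly\<close> and \<open>wcoord\<close> to \<open>p\<close> and \<open>c\<close>.
\<close>

lemma coordinates_extend:
  assumes C: "complete_top_ring C" and \<theta>: "\<theta> \<in> ring_hom \<kappa> C" and p: "arc_family S C p"
    and pd: "\<And>m. m \<in> S \<Longrightarrow> complete_top_ring.distinguished C (deg m) (p m)"
    and c: "\<And>i. c i \<in> Units (power_series_ring C)"
    and lift: "\<And>i j. nbhd C 1 +>\<^bsub>C\<^esub> c i j = nbhd C 1 +>\<^bsub>C\<^esub> \<theta> (rcoord i j)"
  obtains f where "f \<in> adic_hom F C" "\<And>k. k \<in> carrier K \<Longrightarrow> f (fm (\<iota> k)) = \<theta> (res (\<iota> k))"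
    "\<And>m i. m \<in> S \<Longrightarrow> f (wpoly m i) = p m i" "\<And>i j. f (wcoord i j) = c i j"
proof -
  interpret C: complete_top_ring C by (rule C)
  interpret PC: cring "power_series_ring C" by (rule C.power_series_cring)
  let ?Q = "C Quot nbhd C 1" and ?q = "(+>\<^bsub>C\<^esub>) (nbhd C 1)"
  have Q: "cring ?Q" by (rule ideal.quotient_is_cring[OF C.nbhd_ideal C.cring_axioms])
  have q0: "?q x = \<zero>\<^bsub>?Q\<^esub>" if "x \<in> nbhd C 1" for x
    using C.coset_mem_iff[OF C.nbhd_ideal ideal.Icarr[OF C.nbhd_ideal that], of 1] that
      C.coset_zero[OF C.nbhd_ideal] by (simp add: FactRing_def)
  have tr: "\<theta> \<circ> (res \<circ> \<iota>) \<in> ring_hom K C"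
    by (rule ring_hom_trans[OF ring_hom_trans[OF \<iota>_hom P.residue_map_hom] \<theta>])
  have fam: "arc_family S C (\<lambda>m. p m \<otimes>\<^bsub>power_series_ring C\<^esub> torus_arc C c m)"
    by (rule arc_family_mult[OF C.cring_axioms p C.torus_arc_family[OF c]])
  obtain g where g: "g \<in> ring_hom A C" "\<And>k. k \<in> carrier K \<Longrightarrow> g (\<iota> k) = (\<theta> \<circ> (res \<circ> \<iota>)) k"
    "\<And>m. m \<in> S \<Longrightarrow> g \<circ> D m = p m \<otimes>\<^bsub>power_series_ring C\<^esub> torus_arc C c m"
    by (rule arc_hom_exists[OF C.cring_axioms tr fam]) (rule that)
  have red: "?q (g a) = ?q (\<theta> (res a))" if a: "a \<in> carrier A" for a
  proof -
    have "(?q \<circ> g) a = (?q \<circ> (\<theta> \<circ> res)) a"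
    proof (rule arc_hom_ext[OF Q ring_hom_trans[OF g(1) C.mod_nbhd_hom]
          ring_hom_trans[OF ring_hom_trans[OF P.residue_map_hom \<theta>] C.mod_nbhd_hom] _ _ a])
      show "(?q \<circ> g) (\<iota> k) = (?q \<circ> (\<theta> \<circ> res)) (\<iota> k)" if "k \<in> carrier K" for k
        using g(2)[OF that] by simp
      fix m assume m: "m \<in> S"
      have "?q \<circ> (\<theta> \<circ> res) \<circ> D m = (?q \<circ> \<theta>) \<circ> shifted_arc \<kappa> rcoord m"
        unfolding res_D[OF m, symmetric] by (simp only: comp_assoc)
      also have "\<dots> = shifted_arc ?Q (\<lambda>i. (?q \<circ> \<theta>) \<circ> rcoord i) m"
        by (rule shifted_arc_hom[OF P.residue_cring Q ring_hom_trans[OF \<theta> C.mod_nbhd_hom] rcoord_Units])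
      also have "(\<lambda>i. (?q \<circ> \<theta>) \<circ> rcoord i) = (\<lambda>i. ?q \<circ> c i)"
      proof (rule ext, rule ext)
        fix i j show "((?q \<circ> \<theta>) \<circ> rcoord i) j = (?q \<circ> c i) j" using lift[of i j, symmetric] by simp
      qed
      also have "shifted_arc ?Q (\<lambda>i. ?q \<circ> c i) m = ?q \<circ> g \<circ> D m"
        unfolding comp_assoc g(3)[OF m]
        by (rule factor_reduction[where p = p, OF C Q C.mod_nbhd_hom q0 pd[OF m] c, symmetric])
      finally show "?q \<circ> g \<circ> D m = ?q \<circ> (\<theta> \<circ> res) \<circ> D m" by (rule sym)
    qed
    then show ?thesis by simp
  qed
  have gc: "a \<in> carrier A \<Longrightarrow> g a \<in> carrier C" for a by (rule ring_hom_closed[OF g(1)])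
  interpret th: ring_hom_cring \<kappa> C \<theta>
    by (intro ring_hom_cring.intro ring_hom_cring_axioms.intro P.residue_cring C.cring_axioms \<theta>)
  have gN: "g a \<in> nbhd C 1" if "a \<in> \<alpha>" for a
  proof -
    note ac = P.p_carr[OF that]
    have "res a = \<zero>\<^bsub>\<kappa>\<^esub>" using P.residue_zero_iff[OF ac] that by simp
    then have "?q (g a) = ?q \<zero>\<^bsub>C\<^esub>" using red[OF ac] th.hom_zero by simp
    then show ?thesis using C.coset_mem_iff[OF C.nbhd_ideal gc[OF ac], of 1] by simp
  qed
  have gU: "g a \<in> Units C" if "a \<in> carrier A - \<alpha>" for a
  proof -
    have ac: "a \<in> carrier A" using that by simp
    show ?thesis
      by (rule C.Units_if_cong_Units[OF ring_hom_Units[OF P.residue_cring C.cring_axioms \<theta> P.residue_Units[OF that]] gc[OF ac] red[OF ac, symmetric]])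
  qed
  obtain f where f: "f \<in> adic_hom F C" "\<And>a. a \<in> carrier A \<Longrightarrow> f (fm a) = g a"
    using P.FN_extend[OF C g(1) gN gU] by blast
  have fh: "f \<in> ring_hom F C" by (rule adic_hom_hom[OF f(1)])
  have eq: "(f \<circ> wpoly m) \<otimes>\<^bsub>power_series_ring C\<^esub> torus_arc C (\<lambda>i. f \<circ> wcoord i) m =
      p m \<otimes>\<^bsub>power_series_ring C\<^esub> torus_arc C c m" if m: "m \<in> S" for m
  proof -
    interpret PF: cring "power_series_ring F" by (rule F.power_series_cring)
    have "g \<circ> D m = f \<circ> (fm \<circ> D m)" by (rule ext) (simp add: f(2) D_closed[OF m])
    also have "\<dots> = (f \<circ> wpoly m) \<otimes>\<^bsub>power_series_ring C\<^esub> (f \<circ> torus_arc F wcoord m)"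
      unfolding D_factor(4)[OF m]
      by (rule ring_hom_mult[OF ps_hom[OF F.cring_axioms C.cring_axioms fh] F.distinguished_closed[OF D_factor(2)[OF m]]
            PF.Units_closed[OF F.torus_arc_Units[OF D_factor(3)]]])
    also have "f \<circ> torus_arc F wcoord m = torus_arc C (\<lambda>i. f \<circ> wcoord i) m"
      by (rule torus_arc_hom[OF F.cring_axioms C.cring_axioms fh D_factor(3)])
    finally show ?thesis unfolding g(3)[OF m] by (rule sym)
  qed
  have un: "m \<in> S \<Longrightarrow> f \<circ> wpoly m = p m" "(\<lambda>i. f \<circ> wcoord i) = c" for m
    using arc_factor_unique[OF C distinguished_hom[OF F.complete_top_ring_axioms C f(1) D_factor(2)] pd
        ps_hom_Units[OF F.cring_axioms C.cring_axioms fh D_factor(3)] c eq] by blast+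
  show thesis
  proof (rule that[OF f(1)])
    show "f (fm (\<iota> k)) = \<theta> (res (\<iota> k))" if "k \<in> carrier K" for k
      using f(2)[OF ring_hom_closed[OF \<iota>_hom that]] g(2)[OF that] by simp
    show "f (wpoly m i) = p m i" if "m \<in> S" for m i using fun_cong[OF un(1)[OF that], of i] by simp
    show "f (wcoord i j) = c i j" for i j using fun_cong[OF fun_cong[OF un(2), of i], of j] by simp
  qed
qed

lemma coordinates_ext:
  assumes C: "complete_top_ring C" and f: "f \<in> adic_hom F C" and f': "f' \<in> adic_hom F C"
    and k: "\<And>k. k \<in> carrier K \<Longrightarrow> f (fm (\<iota> k)) = f' (fm (\<iota> k))"
    and p: "\<And>m i. m \<in> S \<Longrightarrow> f (wpoly m i) = f' (wpoly m i)" and c: "\<And>i j. f (wcoord i j) = f' (wcoord i j)"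
    and x: "x \<in> carrier F"
  shows "f x = f' x"
proof (rule P.FN_hom_ext[OF C f f' _ x])
  interpret C: complete_top_ring C by (rule C)
  interpret PF: cring "power_series_ring F" by (rule F.power_series_cring)
  have D: "h \<circ> fm \<circ> D m = (h \<circ> wpoly m) \<otimes>\<^bsub>power_series_ring C\<^esub> torus_arc C (\<lambda>i. h \<circ> wcoord i) m"
    if m: "m \<in> S" and h: "h \<in> adic_hom F C" for h m
  proof -
    have hh: "h \<in> ring_hom F C" by (rule adic_hom_hom[OF h])
    have "h \<circ> fm \<circ> D m = (h \<circ> wpoly m) \<otimes>\<^bsub>power_series_ring C\<^esub> (h \<circ> torus_arc F wcoord m)"
      unfolding comp_assoc D_factor(4)[OF m]
      by (rule ring_hom_mult[OF ps_hom[OF F.cring_axioms C.cring_axioms hh] F.distinguished_closed[OF D_factor(2)[OF m]]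
            PF.Units_closed[OF F.torus_arc_Units[OF D_factor(3)]]])
    then show ?thesis unfolding torus_arc_hom[OF F.cring_axioms C.cring_axioms hh D_factor(3)] .
  qed
  fix a assume a: "a \<in> carrier A"
  have "(f \<circ> fm) a = (f' \<circ> fm) a"
  proof (rule arc_hom_ext[OF C.cring_axioms ring_hom_trans[OF P.FN_map_hom adic_hom_hom[OF f]]
        ring_hom_trans[OF P.FN_map_hom adic_hom_hom[OF f']] _ _ a])
    show "(f \<circ> fm) (\<iota> k') = (f' \<circ> fm) (\<iota> k')" if "k' \<in> carrier K" for k' using k[OF that] by simp
    fix m assume m: "m \<in> S"
    have 1: "f \<circ> wpoly m = f' \<circ> wpoly m" by (rule ext) (simp add: p[OF m])
    have 2: "(\<lambda>i. f \<circ> wcoord i) = (\<lambda>i. f' \<circ> wcoord i)" by (rule ext, rule ext) (simp add: c)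
    show "f \<circ> fm \<circ> D m = f' \<circ> fm \<circ> D m" unfolding D[OF m f] D[OF m f'] 1 2 ..
  qed
  then show "f (fm a) = f' (fm a)" by simp
qed

end

section \<open>The coefficient field at the generic point\<close>

locale generic_arc = generic_order_point K \<sigma> n \<eta>
  for K :: "'k ring" and \<sigma> :: "(real ^ 'n) set" and n :: "int ^ 'n"
    and \<eta> :: "(((int ^ 'n \<Rightarrow> 'k) \<times> nat) multiset \<Rightarrow> 'k) set set" +
  assumes generic: "generic_point A \<N> \<eta>"
begin

text \<open>
  Dropping the distinguished polynomials from the canonical arc leaves an arc \<open>\<Psi>\<close> of the form \<open>t\<^sup>d
  u\<close> that reduces to the same point. It kills \<open>\<eta>\<close> by \<open>eta_killed\<close>, and it sends the complement of
  \<open>\<eta>\<close> to units since it agrees with the canonical arc modulo the maximal ideal. Hence it factors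
  through the residue field.
\<close>

lemma section_exists:
  obtains s where "s \<in> ring_hom \<kappa> F" "\<And>x. x \<in> carrier \<kappa> \<Longrightarrow> s x 1 = x"
    "\<And>k. k \<in> carrier K \<Longrightarrow> s (res (\<iota> k)) = fm (\<iota> k)" "\<And>i j. s (rcoord i j) = wcoord i j"
proof -
  have h0: "fm \<circ> \<iota> \<in> ring_hom K F" by (rule ring_hom_trans[OF \<iota>_hom P.FN_map_hom])
  obtain \<Psi> where \<Psi>: "\<Psi> \<in> ring_hom A F" "\<And>k. k \<in> carrier K \<Longrightarrow> \<Psi> (\<iota> k) = (fm \<circ> \<iota>) k"
    "\<And>m. m \<in> S \<Longrightarrow> \<Psi> \<circ> D m = shifted_arc F wcoord m"
    by (rule arc_hom_exists[OF F.cring_axioms h0 shifted_arc_family[OF F.cring_axioms D_factor(3)]]) (rule that)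
  have ev: "\<Psi> a 1 = res a" if a: "a \<in> carrier A" for a
  proof -
    have "((\<lambda>x. x 1) \<circ> \<Psi>) a = res a"
    proof (rule arc_hom_ext[OF P.residue_cring ring_hom_trans[OF \<Psi>(1) P.FN_eval_hom] P.residue_map_hom _ _ a])
      show "((\<lambda>x. x 1) \<circ> \<Psi>) (\<iota> k) = res (\<iota> k)" if "k \<in> carrier K" for k
        using \<Psi>(2)[OF that] by (simp add: P.FN_map_eval)
      show "(\<lambda>x. x 1) \<circ> \<Psi> \<circ> D m = res \<circ> D m" if m: "m \<in> S" for m
        unfolding comp_assoc \<Psi>(3)[OF m] res_D[OF m]
        unfolding shifted_arc_hom[OF F.cring_axioms P.residue_cring P.FN_eval_hom D_factor(3)] rcoord_eq ..
    qed
    then show ?thesis by simp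
  qed
  have \<Psi>U: "\<Psi> a \<in> Units F" if "a \<in> carrier A - \<eta>" for a
  proof (rule F.Units_if_cong_Units[OF P.FN_map_Units[OF that]])
    have ac: "a \<in> carrier A" using that by simp
    show c1: "\<Psi> a \<in> carrier F" by (rule ring_hom_closed[OF \<Psi>(1) ac])
    have c2: "fm a \<in> carrier F" by (rule ring_hom_closed[OF P.FN_map_hom ac])
    have "fm a \<ominus>\<^bsub>F\<^esub> \<Psi> a \<in> nbhd F 1"
      by (rule diff_in_nbhd[OF c2 c1]) (simp add: P.FN_map_eval ev[OF ac])
    then show "nbhd F 1 +>\<^bsub>F\<^esub> fm a = nbhd F 1 +>\<^bsub>F\<^esub> \<Psi> a"
      by (rule iffD1[OF F.quotient_eq_iff_same_a_r_cos[OF F.nbhd_ideal c2 c1]])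
  qed
  obtain s where s: "s \<in> ring_hom \<kappa> F" "\<And>a. a \<in> carrier A \<Longrightarrow> s (res a) = \<Psi> a"
    using P.residue_extend[OF F.cring_axioms \<Psi>(1) eta_killed[OF generic F.cring_axioms D_factor(3) \<Psi>(1,3)] \<Psi>U] by blast
  have sr: "(\<lambda>i. s \<circ> rcoord i) = wcoord"
  proof (rule shifted_arc_unique[OF F.cring_axioms ps_hom_Units[OF P.residue_cring F.cring_axioms s(1) rcoord_Units] D_factor(3)])
    fix m assume m: "m \<in> S"
    have "shifted_arc F (\<lambda>i. s \<circ> rcoord i) m = s \<circ> (res \<circ> D m)"
      unfolding res_D[OF m] by (rule shifted_arc_hom[OF P.residue_cring F.cring_axioms s(1) rcoord_Units, symmetric])
    also have "\<dots> = \<Psi> \<circ> D m" by (rule ext) (simp add: s(2) D_closed[OF m])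
    finally show "shifted_arc F (\<lambda>i. s \<circ> rcoord i) m = shifted_arc F wcoord m" unfolding \<Psi>(3)[OF m] .
  qed
  show thesis
  proof (rule that[OF s(1)])
    fix x assume x: "x \<in> carrier \<kappa>"
    have "((\<lambda>x. x 1) \<circ> s) x = id x"
    proof (rule P.residue_hom_ext[OF P.residue_cring ring_hom_trans[OF s(1) P.FN_eval_hom] _ _ x])
      show "id \<in> ring_hom \<kappa> \<kappa>" by (auto simp: ring_hom_def)
      show "((\<lambda>x. x 1) \<circ> s) (res a) = id (res a)" if "a \<in> carrier A" for a
        using ev[OF that] s(2)[OF that] by simp
    qed
    then show "s x 1 = x" by simp
  next
    show "s (res (\<iota> k)) = fm (\<iota> k)" if "k \<in> carrier K" for k
      using s(2)[OF ring_hom_closed[OF \<iota>_hom that]] \<Psi>(2)[OF that] by simp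
    show "s (rcoord i j) = wcoord i j" for i j using fun_cong[OF fun_cong[OF sr, of i], of j] by simp
  qed
qed

end

text \<open>
  A coefficient field at the generic point that contains the torus coordinates.
\<close>

locale coefficient_section = generic_arc K \<sigma> n \<eta>
  for K :: "'k ring" and \<sigma> :: "(real ^ 'n) set" and n :: "int ^ 'n"
    and \<eta> :: "(((int ^ 'n \<Rightarrow> 'k) \<times> nat) multiset \<Rightarrow> 'k) set set" +
  fixes s
  assumes s_hom: "s \<in> ring_hom \<kappa> F"
    and s_scalar: "\<And>k. k \<in> carrier K \<Longrightarrow> s (res (\<iota> k)) = fm (\<iota> k)"
    and s_coord: "\<And>i j. s (rcoord i j) = wcoord i j"
begin

text \<open>
  Over the coefficient field the torus coordinates are constants, so that only the family of
  distinguished polynomials remains free.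
\<close>

lemma section_extend:
  assumes C: "complete_top_ring C" and \<gamma>: "\<gamma> \<in> ring_hom \<kappa> C" and p: "arc_family S C p"
    and pd: "\<And>m. m \<in> S \<Longrightarrow> complete_top_ring.distinguished C (deg m) (p m)"
  obtains f where "f \<in> adic_hom F C" "\<And>x. x \<in> carrier \<kappa> \<Longrightarrow> f (s x) = \<gamma> x"
    "\<And>m i. m \<in> S \<Longrightarrow> f (wpoly m i) = p m i"
proof -
  interpret C: complete_top_ring C by (rule C)
  have c: "\<gamma> \<circ> rcoord i \<in> Units (power_series_ring C)" for i
    by (rule ps_hom_Units[OF P.residue_cring C.cring_axioms \<gamma> rcoord_Units])
  obtain f where f: "f \<in> adic_hom F C" "\<And>k. k \<in> carrier K \<Longrightarrow> f (fm (\<iota> k)) = \<gamma> (res (\<iota> k))"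
    "\<And>m i. m \<in> S \<Longrightarrow> f (wpoly m i) = p m i" "\<And>i j. f (wcoord i j) = (\<gamma> \<circ> rcoord i) j"
    by (rule coordinates_extend[where c = "\<lambda>i. \<gamma> \<circ> rcoord i", OF C \<gamma> p pd c]) (assumption, simp, rule that)
  have fs: "f \<circ> s \<in> ring_hom \<kappa> C" by (rule ring_hom_trans[OF s_hom adic_hom_hom[OF f(1)]])
  have "(f \<circ> s) x = \<gamma> x" if x: "x \<in> carrier \<kappa>" for x
  proof (rule P.residue_hom_ext[OF C.cring_axioms fs \<gamma> _ x])
    fix a assume a: "a \<in> carrier A"
    have "((f \<circ> s) \<circ> res) a = (\<gamma> \<circ> res) a"
    proof (rule arc_hom_ext[OF C.cring_axioms ring_hom_trans[OF P.residue_map_hom fs] ring_hom_trans[OF P.residue_map_hom \<gamma>] _ _ a])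
      show "((f \<circ> s) \<circ> res) (\<iota> k) = (\<gamma> \<circ> res) (\<iota> k)" if "k \<in> carrier K" for k
        using s_scalar[OF that] f(2)[OF that] by simp
      fix m assume m: "m \<in> S"
      have e: "(\<lambda>i. (f \<circ> s) \<circ> rcoord i) = (\<lambda>i. \<gamma> \<circ> rcoord i)"
        by (rule ext, rule ext) (simp add: s_coord f(4))
      show "(f \<circ> s) \<circ> res \<circ> D m = \<gamma> \<circ> res \<circ> D m"
        unfolding comp_assoc[of _ res] res_D[OF m]
          shifted_arc_hom[OF P.residue_cring C.cring_axioms fs rcoord_Units] e
          shifted_arc_hom[OF P.residue_cring C.cring_axioms \<gamma> rcoord_Units] ..
    qed
    then show "(f \<circ> s) (res a) = \<gamma> (res a)" by simp
  qed
  then have "f (s x) = \<gamma> x" if "x \<in> carrier \<kappa>" for x using that by simp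
  from that[OF f(1) this f(3)] show thesis .
qed

lemma section_ext:
  assumes C: "complete_top_ring C" and f: "f \<in> adic_hom F C" and f': "f' \<in> adic_hom F C"
    and k: "\<And>x. x \<in> carrier \<kappa> \<Longrightarrow> f (s x) = f' (s x)"
    and p: "\<And>m i. m \<in> S \<Longrightarrow> f (wpoly m i) = f' (wpoly m i)" and x: "x \<in> carrier F"
  shows "f x = f' x"
proof (rule coordinates_ext[OF C f f' _ p _ x])
  show "f (fm (\<iota> k')) = f' (fm (\<iota> k'))" if "k' \<in> carrier K" for k'
    using k[OF ring_hom_closed[OF P.residue_map_hom ring_hom_closed[OF \<iota>_hom that]]] s_scalar[OF that] by simp
  show "f (wcoord i j) = f' (wcoord i j)" for i j using k[OF rcoord_closed] unfolding s_coord .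
qed

end

section \<open>Comparison of the formal neighborhoods\<close>

locale comparison = toric_setting K \<sigma> n + e: coefficient_section K \<sigma> n \<eta> s + a: generic_order_point K \<sigma> n \<alpha>
  for K :: "'k ring" and \<sigma> :: "(real ^ 'n) set" and n :: "int ^ 'n"
    and \<eta> \<alpha> :: "(((int ^ 'n \<Rightarrow> 'k) \<times> nat) multiset \<Rightarrow> 'k) set set" and s +
  assumes rational: "rational_point K A \<iota> \<alpha>"
begin


abbreviation "cst \<equiv> countable_power_series_const e.\<kappa>"
abbreviation "dis \<equiv> discrete_top_ring e.\<kappa>"

interpretation X: top_tensor_data e.\<kappa> e.F e.P.res.CPS s cst
  by (intro top_tensor_data.intro tensor_data.intro tensor_data_axioms.intro e.P.res.cring_axioms
      e.F.cring_axioms complete_top_ring.axioms(1)[OF e.P.res.CPS_complete] e.s_hom e.P.res.CPS_const_hom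
      e.F.complete_top_ring_axioms e.P.res.CPS_complete)

lemma res_scalar_hom: "e.res \<circ> \<iota> \<in> ring_hom K e.\<kappa>"
  by (rule ring_hom_trans[OF \<iota>_hom e.P.residue_map_hom])

interpretation Y: top_tensor_data K a.F dis "a.fm \<circ> \<iota>" "e.res \<circ> \<iota>"
  by (intro top_tensor_data.intro tensor_data.intro tensor_data_axioms.intro K_cring
      a.F.cring_axioms complete_top_ring.axioms(1)[OF e.P.res.discrete_complete] ring_hom_trans[OF \<iota>_hom a.P.FN_map_hom]
      a.F.complete_top_ring_axioms e.P.res.discrete_complete) (simp add: res_scalar_hom)

lemma rational_retraction:
  obtains \<delta> where "\<delta> \<in> ring_hom a.\<kappa> K" "\<And>x. x \<in> carrier a.\<kappa> \<Longrightarrow> a.res (\<iota> (\<delta> x)) = x"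
    "\<And>k. k \<in> carrier K \<Longrightarrow> \<delta> (a.res (\<iota> k)) = k"
proof -
  let ?r = "\<lambda>k. a.res (\<iota> k)"
  have bij: "bij_betw ?r (carrier K) (carrier a.\<kappa>)" using rational by (simp add: rational_point_def)
  have rh: "?r \<in> ring_hom K a.\<kappa>" using ring_hom_trans[OF \<iota>_hom a.P.residue_map_hom] by (simp add: comp_def)
  define \<delta> where "\<delta> = the_inv_into (carrier K) ?r"
  have inj: "inj_on ?r (carrier K)" and im: "?r ` carrier K = carrier a.\<kappa>" using bij by (simp_all add: bij_betw_def)
  have 1: "a.res (\<iota> (\<delta> x)) = x" if "x \<in> carrier a.\<kappa>" for x
    unfolding \<delta>_def by (rule f_the_inv_into_f[OF inj]) (simp add: im that)
  have 2: "\<delta> (a.res (\<iota> k)) = k" if "k \<in> carrier K" for k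
    unfolding \<delta>_def by (rule the_inv_into_f_f[OF inj that])
  have "\<delta> \<in> ring_hom a.\<kappa> K"
  proof (rule ring_hom_memI)
    show c: "\<delta> x \<in> carrier K" if "x \<in> carrier a.\<kappa>" for x
      unfolding \<delta>_def by (rule the_inv_into_into[OF inj]) (simp_all add: im that)
    show "\<delta> (x \<otimes>\<^bsub>a.\<kappa>\<^esub> y) = \<delta> x \<otimes>\<^bsub>K\<^esub> \<delta> y" if "x \<in> carrier a.\<kappa>" "y \<in> carrier a.\<kappa>" for x y
      using 2[OF K.m_closed[OF c[OF that(1)] c[OF that(2)]]] ring_hom_mult[OF rh c[OF that(1)] c[OF that(2)]]
      by (simp only: 1[OF that(1)] 1[OF that(2)])
    show "\<delta> (x \<oplus>\<^bsub>a.\<kappa>\<^esub> y) = \<delta> x \<oplus>\<^bsub>K\<^esub> \<delta> y" if "x \<in> carrier a.\<kappa>" "y \<in> carrier a.\<kappa>" for x y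
      using 2[OF K.a_closed[OF c[OF that(1)] c[OF that(2)]]] ring_hom_add[OF rh c[OF that(1)] c[OF that(2)]]
      by (simp only: 1[OF that(1)] 1[OF that(2)])
    show "\<delta> \<one>\<^bsub>a.\<kappa>\<^esub> = \<one>\<^bsub>K\<^esub>" using 2[OF K.one_closed] ring_hom_one[OF rh] by simp
  qed
  from that[OF this 1 2] show thesis .
qed

text \<open>
  Both sides represent, over the residue field of \<open>\<eta>\<close>, a family \<open>p\<close> of distinguished polynomials
  together with countably many topologically nilpotent elements. On the left the latter are the
  variables; on the right they are the deviations of the torus coordinates at \<open>\<alpha>\<close> from the
  constants \<open>b i j\<close>. The two homomorphisms below exchange these data, and they are mutually
  inverse because they are so on the data.
\<close>

lemma formal_nbhds_iso:
  "formal_iso e.\<kappa> X.CT (X.cinr \<circ> cst) Y.CT Y.cinr"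
proof -
  obtain \<delta> where \<delta>: "\<delta> \<in> ring_hom a.\<kappa> K" "\<And>x. x \<in> carrier a.\<kappa> \<Longrightarrow> a.res (\<iota> (\<delta> x)) = x"
    "\<And>k. k \<in> carrier K \<Longrightarrow> \<delta> (a.res (\<iota> k)) = k"
    by (rule rational_retraction) (rule that)
  interpret XC: complete_top_ring X.CT by (rule X.CT_complete)
  interpret YC: complete_top_ring Y.CT by (rule Y.CT_complete)
  define \<gamma>X where "\<gamma>X = X.cinr \<circ> cst"
  define \<gamma>Y where "\<gamma>Y = Y.cinr"
  have \<gamma>Xh: "\<gamma>X \<in> ring_hom e.\<kappa> X.CT"
    unfolding \<gamma>X_def by (rule ring_hom_trans[OF e.P.res.CPS_const_hom adic_hom_hom[OF X.cinr_adic]])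
  have \<gamma>Ya: "\<gamma>Y \<in> adic_hom dis Y.CT" unfolding \<gamma>Y_def by (rule Y.cinr_adic)
  have \<gamma>Yh: "\<gamma>Y \<in> ring_hom e.\<kappa> Y.CT" using adic_hom_hom[OF \<gamma>Ya] by simp
  have Xl: "X.cinl (s x) = \<gamma>X x" if "x \<in> carrier e.\<kappa>" for x using X.cinl_cinr[OF that] by (simp add: \<gamma>X_def)
  have Yl: "Y.cinl (a.fm (\<iota> k)) = \<gamma>Y (e.res (\<iota> k))" if "k \<in> carrier K" for k
    using Y.cinl_cinr[OF that] by (simp add: \<gamma>Y_def)
  define b where "b i j = e.res (\<iota> (\<delta> (a.rcoord i j)))" for i j
  have dc: "\<delta> (a.rcoord i j) \<in> carrier K" for i j by (rule ring_hom_closed[OF \<delta>(1) a.rcoord_closed])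
  have bc: "b i j \<in> carrier e.\<kappa>" for i j
    unfolding b_def using ring_hom_closed[OF res_scalar_hom dc] by simp
  have Yb: "Y.cinl (a.fm (\<iota> (\<delta> (a.rcoord i j)))) = \<gamma>Y (b i j)" for i j unfolding b_def by (rule Yl[OF dc])
  \<comment> \<open>The variables go to the deviations \<open>T\<close>, indexed by pairs through \<open>coord_index\<close>.\<close>
  define T where "T l = (case inv_into UNIV coord_index l of (i, j) \<Rightarrow> Y.cinl (a.wcoord i j) \<ominus>\<^bsub>Y.CT\<^esub> \<gamma>Y (b i j))" for l
  have T_index: "T (coord_index (i, j)) = Y.cinl (a.wcoord i j) \<ominus>\<^bsub>Y.CT\<^esub> \<gamma>Y (b i j)" for i j
    unfolding T_def by (simp add: inv_into_f_f[OF bij_is_inj[OF coord_index_bij]])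
  interpret Yl: ring_hom_cring a.F Y.CT Y.cinl
    by (intro ring_hom_cring.intro ring_hom_cring_axioms.intro a.F.cring_axioms YC.cring_axioms adic_hom_hom[OF Y.cinl_adic])
  have T_N: "T l \<in> nbhd Y.CT 1" for l
  proof -
    obtain i j where l: "l = coord_index (i, j)"
      using bij_is_surj[OF coord_index_bij] by (metis surjE surj_pair)
    let ?y = "a.fm (\<iota> (\<delta> (a.rcoord i j)))"
    have yc: "?y \<in> carrier a.F" by (rule ring_hom_closed[OF a.P.FN_map_hom ring_hom_closed[OF \<iota>_hom dc]])
    have "a.wcoord i j 1 = ?y 1" unfolding a.P.FN_map_eval \<delta>(2)[OF a.rcoord_closed] by (simp add: a.rcoord_def)
    then have "a.wcoord i j \<ominus>\<^bsub>a.F\<^esub> ?y \<in> nbhd a.F 1" by (rule a.diff_in_nbhd[OF a.wcoord_closed yc])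
    then have "Y.cinl (a.wcoord i j \<ominus>\<^bsub>a.F\<^esub> ?y) \<in> nbhd Y.CT 1" by (rule adic_hom_1[OF Y.cinl_adic])
    also have "Y.cinl (a.wcoord i j \<ominus>\<^bsub>a.F\<^esub> ?y) = T l"
      unfolding l T_index Yb[symmetric] using a.wcoord_closed[of i j] yc by (simp add: a_minus_def)
    finally show ?thesis .
  qed
  have pYf: "arc_family S Y.CT (\<lambda>m. Y.cinl \<circ> a.wpoly m)"
    by (rule arc_family_hom[OF a.F.cring_axioms YC.cring_axioms adic_hom_hom[OF Y.cinl_adic] a.D_factor(1)])
  have pYd: "YC.distinguished (deg m) (Y.cinl \<circ> a.wpoly m)" if "m \<in> S" for m
    by (rule distinguished_hom[OF a.F.complete_top_ring_axioms Y.CT_complete Y.cinl_adic a.D_factor(2)[OF that]])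
  obtain F1 where F1: "F1 \<in> adic_hom e.F Y.CT" "\<And>x. x \<in> carrier e.\<kappa> \<Longrightarrow> F1 (s x) = \<gamma>Y x"
    "\<And>m i. m \<in> S \<Longrightarrow> F1 (e.wpoly m i) = (Y.cinl \<circ> a.wpoly m) i"
    by (rule e.section_extend[OF Y.CT_complete \<gamma>Yh pYf pYd]) (assumption, rule that)
  obtain G1 where G1: "G1 \<in> adic_hom e.P.res.CPS Y.CT" "\<And>x. x \<in> carrier e.\<kappa> \<Longrightarrow> G1 (cst x) = \<gamma>Y x"
    "\<And>l. G1 (e.P.res.cps_var l) = T l"
    using e.P.res.CPS_extend[where t = T, OF Y.CT_complete \<gamma>Yh T_N] by blast
  have FG1: "F1 (s x) = G1 (cst x)" if "x \<in> carrier e.\<kappa>" for x using F1(2) G1(2) that by simp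
  obtain f where f: "f \<in> adic_hom X.CT Y.CT" "\<And>x. x \<in> carrier e.F \<Longrightarrow> f (X.cinl x) = F1 x"
    "\<And>y. y \<in> carrier e.P.res.CPS \<Longrightarrow> f (X.cinr y) = G1 y"
    using X.CT_extend[OF Y.CT_complete F1(1) G1(1) FG1] by blast
  \<comment> \<open>In the other direction, the torus coordinates go to the constants \<open>b\<close> deformed by the variables.\<close>
  define c where "c i j = \<gamma>X (b i j) \<oplus>\<^bsub>X.CT\<^esub> X.cinr (e.P.res.cps_var (coord_index (i, j)))" for i j
  define \<theta> where "\<theta> = \<gamma>X \<circ> (e.res \<circ> \<iota>) \<circ> \<delta>"
  have \<theta>h: "\<theta> \<in> ring_hom a.\<kappa> X.CT"
    unfolding \<theta>_def by (rule ring_hom_trans[OF \<delta>(1) ring_hom_trans[OF res_scalar_hom \<gamma>Xh]])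
  have \<theta>b: "\<theta> (a.rcoord i j) = \<gamma>X (b i j)" for i j by (simp add: \<theta>_def b_def)
  have vN: "X.cinr (e.P.res.cps_var l) \<in> nbhd X.CT 1" for l by (rule adic_hom_1[OF X.cinr_adic e.P.res.cps_var_nbhd])
  have vc: "X.cinr (e.P.res.cps_var l) \<in> carrier X.CT" for l by (rule ideal.Icarr[OF XC.nbhd_ideal vN])
  have gc: "\<gamma>X (b i j) \<in> carrier X.CT" for i j by (rule ring_hom_closed[OF \<gamma>Xh bc])
  have lift: "nbhd X.CT 1 +>\<^bsub>X.CT\<^esub> c i j = nbhd X.CT 1 +>\<^bsub>X.CT\<^esub> \<theta> (a.rcoord i j)" for i j
  proof (rule iffD1[OF XC.quotient_eq_iff_same_a_r_cos[OF XC.nbhd_ideal]])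
    show "c i j \<in> carrier X.CT" "\<theta> (a.rcoord i j) \<in> carrier X.CT"
      unfolding c_def \<theta>b using gc vc by auto
    have "c i j \<ominus>\<^bsub>X.CT\<^esub> \<theta> (a.rcoord i j) = X.cinr (e.P.res.cps_var (coord_index (i, j)))"
      unfolding c_def \<theta>b a_minus_def
      using XC.r_neg1[OF gc vc] by (simp add: XC.add.m_ac gc vc XC.r_neg XC.r_neg1 XC.r_neg2)
    then show "c i j \<ominus>\<^bsub>X.CT\<^esub> \<theta> (a.rcoord i j) \<in> nbhd X.CT 1" using vN by simp
  qed
  have cU: "c i \<in> Units (power_series_ring X.CT)" for i
  proof (rule XC.ps_UnitsI)
    show "c i \<in> carrier (power_series_ring X.CT)" unfolding ps_carrier c_def using gc vc by auto
    have "\<theta> (a.rcoord i 0) \<in> Units X.CT"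
      by (rule ring_hom_Units[OF a.P.residue_cring XC.cring_axioms \<theta>h cring.ps_Units_coeff[OF a.P.residue_cring a.rcoord_Units]])
    then show "c i 0 \<in> Units X.CT"
      by (rule XC.Units_if_cong_Units[OF _ _ lift[symmetric]]) (unfold c_def, use gc vc in auto)
  qed
  have pXf: "arc_family S X.CT (\<lambda>m. X.cinl \<circ> e.wpoly m)"
    by (rule arc_family_hom[OF e.F.cring_axioms XC.cring_axioms adic_hom_hom[OF X.cinl_adic] e.D_factor(1)])
  have pXd: "XC.distinguished (deg m) (X.cinl \<circ> e.wpoly m)" if "m \<in> S" for m
    by (rule distinguished_hom[OF e.F.complete_top_ring_axioms X.CT_complete X.cinl_adic e.D_factor(2)[OF that]])
  obtain F2 where F2: "F2 \<in> adic_hom a.F X.CT" "\<And>k. k \<in> carrier K \<Longrightarrow> F2 (a.fm (\<iota> k)) = \<theta> (a.res (\<iota> k))"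
    "\<And>m i. m \<in> S \<Longrightarrow> F2 (a.wpoly m i) = (X.cinl \<circ> e.wpoly m) i" "\<And>i j. F2 (a.wcoord i j) = c i j"
    by (rule a.coordinates_extend[OF X.CT_complete \<theta>h pXf pXd cU lift]) (assumption, rule that)
  have FG2: "F2 ((a.fm \<circ> \<iota>) k) = \<gamma>X ((e.res \<circ> \<iota>) k)" if "k \<in> carrier K" for k
    using F2(2)[OF that] \<delta>(3)[OF that] by (simp add: \<theta>_def)
  have \<gamma>Xa: "\<gamma>X \<in> adic_hom dis X.CT" by (rule discrete_adic[OF e.P.res.cring_axioms X.CT_complete \<gamma>Xh])
  obtain g where g: "g \<in> adic_hom Y.CT X.CT" "\<And>x. x \<in> carrier a.F \<Longrightarrow> g (Y.cinl x) = F2 x"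
    "\<And>y. y \<in> carrier dis \<Longrightarrow> g (Y.cinr y) = \<gamma>X y"
    using Y.CT_extend[OF X.CT_complete F2(1) \<gamma>Xa FG2] by blast
  have g\<gamma>: "g (\<gamma>Y x) = \<gamma>X x" if "x \<in> carrier e.\<kappa>" for x using g(3)[of x] that by (simp add: \<gamma>Y_def)
  have f\<gamma>: "f (\<gamma>X x) = \<gamma>Y x" if "x \<in> carrier e.\<kappa>" for x
    using f(3)[OF ring_hom_closed[OF e.P.res.CPS_const_hom that]] G1(2)[OF that] by (simp add: \<gamma>X_def)
  have gp: "g (Y.cinl (a.wpoly m i)) = X.cinl (e.wpoly m i)" if "m \<in> S" for m i
    using g(2)[OF a.wpoly_closed[OF that]] F2(3)[OF that] by simp
  have fp: "f (X.cinl (e.wpoly m i)) = Y.cinl (a.wpoly m i)" if "m \<in> S" for m i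
    using f(2)[OF e.wpoly_closed[OF that]] F1(3)[OF that] by simp
  have gw: "g (Y.cinl (a.wcoord i j)) = c i j" for i j using g(2)[OF a.wcoord_closed] F2(4) by simp
  interpret g: ring_hom_cring Y.CT X.CT g
    by (intro ring_hom_cring.intro ring_hom_cring_axioms.intro YC.cring_axioms XC.cring_axioms adic_hom_hom[OF g(1)])
  interpret f: ring_hom_cring X.CT Y.CT f
    by (intro ring_hom_cring.intro ring_hom_cring_axioms.intro YC.cring_axioms XC.cring_axioms adic_hom_hom[OF f(1)])
  have wYc: "Y.cinl (a.wcoord i j) \<in> carrier Y.CT" for i j by (rule Yl.hom_closed[OF a.wcoord_closed])
  have gYc: "\<gamma>Y (b i j) \<in> carrier Y.CT" for i j by (rule ring_hom_closed[OF \<gamma>Yh bc])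
  have fv: "f (X.cinr (e.P.res.cps_var (coord_index (i, j)))) = Y.cinl (a.wcoord i j) \<ominus>\<^bsub>Y.CT\<^esub> \<gamma>Y (b i j)" for i j
    using f(3)[OF ideal.Icarr[OF complete_top_ring.nbhd_ideal[OF e.P.res.CPS_complete] e.P.res.cps_var_nbhd]] G1(3) T_index by simp
  have gv: "g (f (X.cinr (e.P.res.cps_var (coord_index (i, j))))) = X.cinr (e.P.res.cps_var (coord_index (i, j)))" for i j
  proof -
    have "g (f (X.cinr (e.P.res.cps_var (coord_index (i, j))))) = c i j \<ominus>\<^bsub>X.CT\<^esub> \<gamma>X (b i j)"
      unfolding fv a_minus_def using wYc gYc by (simp add: gw g\<gamma>[OF bc])
    also have "\<dots> = X.cinr (e.P.res.cps_var (coord_index (i, j)))"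
      unfolding c_def a_minus_def by (simp add: XC.add.m_ac gc vc XC.r_neg XC.r_neg1 XC.r_neg2)
    finally show ?thesis .
  qed
  have fw: "f (g (Y.cinl (a.wcoord i j))) = Y.cinl (a.wcoord i j)" for i j
  proof -
    have "f (g (Y.cinl (a.wcoord i j))) = \<gamma>Y (b i j) \<oplus>\<^bsub>Y.CT\<^esub> (Y.cinl (a.wcoord i j) \<ominus>\<^bsub>Y.CT\<^esub> \<gamma>Y (b i j))"
      unfolding gw c_def f.hom_add[OF gc vc] fv f\<gamma>[OF bc] ..
    also have "\<dots> = Y.cinl (a.wcoord i j)"
      unfolding a_minus_def by (simp add: YC.add.m_ac wYc gYc YC.r_neg YC.r_neg1 YC.r_neg2)
    finally show ?thesis .
  qed
  have gf_adic: "g \<circ> f \<in> adic_hom X.CT X.CT" by (rule adic_hom_trans[OF f(1) g(1)])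
  have fg_adic: "f \<circ> g \<in> adic_hom Y.CT Y.CT" by (rule adic_hom_trans[OF g(1) f(1)])
  have "(g \<circ> f) x = id x" if x: "x \<in> carrier X.CT" for x
  proof (rule X.CT_hom_ext[OF X.CT_complete gf_adic adic_hom_id _ _ x])
    fix y assume y: "y \<in> carrier e.F"
    have "((g \<circ> f) \<circ> X.cinl) y = X.cinl y"
    proof (rule e.section_ext[OF X.CT_complete adic_hom_trans[OF X.cinl_adic gf_adic] X.cinl_adic _ _ y])
      show "((g \<circ> f) \<circ> X.cinl) (s z) = X.cinl (s z)" if "z \<in> carrier e.\<kappa>" for z
        using Xl[OF that] f\<gamma>[OF that] g\<gamma>[OF that] by simp
      show "((g \<circ> f) \<circ> X.cinl) (e.wpoly m i) = X.cinl (e.wpoly m i)" if "m \<in> S" for m i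
        using fp[OF that] gp[OF that] by simp
    qed
    then show "(g \<circ> f) (X.cinl y) = id (X.cinl y)" by simp
  next
    fix y assume y: "y \<in> carrier e.P.res.CPS"
    have "((g \<circ> f) \<circ> X.cinr) y = X.cinr y"
    proof (rule e.P.res.CPS_hom_ext[OF X.CT_complete adic_hom_trans[OF X.cinr_adic gf_adic] X.cinr_adic _ _ y])
      show "((g \<circ> f) \<circ> X.cinr) (cst z) = X.cinr (cst z)" if "z \<in> carrier e.\<kappa>" for z
        using f\<gamma>[OF that] g\<gamma>[OF that] by (simp add: \<gamma>X_def)
      fix l
      obtain i j where l: "l = coord_index (i, j)"
        using bij_is_surj[OF coord_index_bij] by (metis surjE surj_pair)
      show "((g \<circ> f) \<circ> X.cinr) (e.P.res.cps_var l) = X.cinr (e.P.res.cps_var l)"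
        unfolding l comp_apply by (rule gv)
    qed
    then show "(g \<circ> f) (X.cinr y) = id (X.cinr y)" by simp
  qed
  then have gf: "g (f x) = x" if "x \<in> carrier X.CT" for x using that by simp
  have "(f \<circ> g) x = id x" if x: "x \<in> carrier Y.CT" for x
  proof (rule Y.CT_hom_ext[OF Y.CT_complete fg_adic adic_hom_id _ _ x])
    fix y assume y: "y \<in> carrier a.F"
    have "((f \<circ> g) \<circ> Y.cinl) y = Y.cinl y"
    proof (rule a.coordinates_ext[OF Y.CT_complete adic_hom_trans[OF Y.cinl_adic fg_adic] Y.cinl_adic _ _ _ y])
      fix k assume k: "k \<in> carrier K"
      have rk: "e.res (\<iota> k) \<in> carrier e.\<kappa>" using ring_hom_closed[OF res_scalar_hom k] by simp
      show "((f \<circ> g) \<circ> Y.cinl) (a.fm (\<iota> k)) = Y.cinl (a.fm (\<iota> k))"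
        using Yl[OF k] g\<gamma>[OF rk] f\<gamma>[OF rk] by simp
    next
      show "((f \<circ> g) \<circ> Y.cinl) (a.wpoly m i) = Y.cinl (a.wpoly m i)" if "m \<in> S" for m i
        using fp[OF that] gp[OF that] by simp
      show "((f \<circ> g) \<circ> Y.cinl) (a.wcoord i j) = Y.cinl (a.wcoord i j)" for i j using fw by simp
    qed
    then show "(f \<circ> g) (Y.cinl y) = id (Y.cinl y)" by simp
  next
    fix y assume "y \<in> carrier dis"
    then have "y \<in> carrier e.\<kappa>" by simp
    from g\<gamma>[OF this] f\<gamma>[OF this] show "(f \<circ> g) (Y.cinr y) = id (Y.cinr y)" by (simp add: \<gamma>Y_def)
  qed
  then have fg: "f (g x) = x" if "x \<in> carrier Y.CT" for x using that by simp
  show ?thesis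
  proof (rule formal_isoI[OF X.CT_complete Y.CT_complete f(1) g(1)])
    show "g (f x) = x" if "x \<in> carrier X.CT" for x by (rule gf[OF that])
    show "f (g x) = x" if "x \<in> carrier Y.CT" for x by (rule fg[OF that])
    show "f ((X.cinr \<circ> cst) x) = Y.cinr x" if "x \<in> carrier e.\<kappa>" for x
      using f\<gamma>[OF that] unfolding \<gamma>X_def \<gamma>Y_def .
  qed
qed

end

theorem theorem1p6:
  fixes K :: "'k ring" and \<sigma> :: "(real ^ 'n) set" and n :: "int ^ 'n"
    and \<eta> :: "(((int ^ 'n \<Rightarrow> 'k) \<times> nat) multiset \<Rightarrow> 'k) set set"
  defines "A \<equiv> toric_arc_ring K \<sigma>" and "\<iota> \<equiv> toric_arc_scalar K \<sigma>"
    and "\<N> \<equiv> toric_nash_set K \<sigma> n"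
    and "\<kappa> \<equiv> residue_field (toric_arc_ring K \<sigma>) \<eta>"
  assumes field_K: "field K"
    and char_zero: "\<And>m::nat. 0 < m \<Longrightarrow> [m] \<cdot>\<^bsub>K\<^esub> \<one>\<^bsub>K\<^esub> \<noteq> \<zero>\<^bsub>K\<^esub>"
    and cone: "strongly_convex_rational_cone \<sigma>"
    and valuation: "lattice_vec n \<in> \<sigma>"
    and eta: "generic_point A \<N> \<eta>"
  shows "\<exists>s. coefficient_field K A \<iota> \<eta> s \<and>
    (\<exists>U. openin (subtopology (zariski A) \<N>) U \<and> U \<noteq> {} \<and>
      (\<forall>\<alpha>\<in>U. rational_point K A \<iota> \<alpha> \<longrightarrow>
        formal_iso \<kappa>
          (completed_tensor \<kappa> (formal_nbhd A \<eta>) s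
             (countable_power_series \<kappa>) (countable_power_series_const \<kappa>))
          (completed_tensor_inr \<kappa> (formal_nbhd A \<eta>) s
             (countable_power_series \<kappa>) (countable_power_series_const \<kappa>)
             \<circ> countable_power_series_const \<kappa>)
          (completed_tensor K (formal_nbhd A \<alpha>) (formal_nbhd_map A \<alpha> \<circ> \<iota>)
             (discrete_top_ring \<kappa>) (residue_map A \<eta> \<circ> \<iota>))
          (completed_tensor_inr K (formal_nbhd A \<alpha>) (formal_nbhd_map A \<alpha> \<circ> \<iota>)
             (discrete_top_ring \<kappa>) (residue_map A \<eta> \<circ> \<iota>))))"
proof -
  interpret t: toric_setting K \<sigma> n by (intro toric_setting.intro field_K cone valuation)
  note eqs = A_def \<iota>_def \<N>_def \<kappa>_def t.toric_eqs(1,2)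
  have eta': "generic_point t.A (toric_nash_set K \<sigma> n) \<eta>" using eta unfolding eqs .
  obtain U where U: "openin (subtopology (zariski t.A) (toric_nash_set K \<sigma> n)) U" "\<eta> \<in> U" "\<And>\<alpha>. \<alpha> \<in> U \<Longrightarrow> t.generic_orders \<alpha>"
    by (rule t.generic_orders_open[OF eta']) (rule that)
  interpret e: generic_arc K \<sigma> n \<eta>
    by (intro generic_arc.intro generic_order_point.intro generic_order_point_axioms.intro generic_arc_axioms.intro t.toric_setting_axioms U(3)[OF U(2)] eta')
  obtain s where s: "s \<in> ring_hom e.\<kappa> e.F" "\<And>x. x \<in> carrier e.\<kappa> \<Longrightarrow> s x 1 = x"
    "\<And>k. k \<in> carrier K \<Longrightarrow> s (e.res (t.\<iota> k)) = e.fm (t.\<iota> k)" "\<And>i j. s (e.rcoord i j) = e.wcoord i j"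
    by (rule e.section_exists) (rule that)
  interpret s: coefficient_section K \<sigma> n \<eta> s
    by (intro coefficient_section.intro coefficient_section_axioms.intro e.generic_arc_axioms s(1,3,4))
  show ?thesis unfolding eqs
  proof (intro exI conjI ballI impI)
    show "coefficient_field K t.A t.\<iota> \<eta> s" unfolding coefficient_field_def using s by simp
    show "openin (subtopology (zariski t.A) (toric_nash_set K \<sigma> n)) U" by (rule U(1))
    show "U \<noteq> {}" using U(2) by blast
    fix \<alpha> assume "\<alpha> \<in> U" and rat: "rational_point K t.A t.\<iota> \<alpha>"
    then have "comparison K \<sigma> n \<eta> \<alpha> s"
      by (intro comparison.intro comparison_axioms.intro generic_order_point.intro generic_order_point_axioms.intro
          t.toric_setting_axioms s.coefficient_section_axioms U(3))
    then show "formal_iso e.\<kappa>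
          (completed_tensor e.\<kappa> e.F s (countable_power_series e.\<kappa>) (countable_power_series_const e.\<kappa>))
          (completed_tensor_inr e.\<kappa> e.F s (countable_power_series e.\<kappa>) (countable_power_series_const e.\<kappa>)
             \<circ> countable_power_series_const e.\<kappa>)
          (completed_tensor K (formal_nbhd t.A \<alpha>) (formal_nbhd_map t.A \<alpha> \<circ> t.\<iota>)
             (discrete_top_ring e.\<kappa>) (e.res \<circ> t.\<iota>))
          (completed_tensor_inr K (formal_nbhd t.A \<alpha>) (formal_nbhd_map t.A \<alpha> \<circ> t.\<iota>)
             (discrete_top_ring e.\<kappa>) (e.res \<circ> t.\<iota>))"
      by (rule comparison.formal_nbhds_iso)
  qed
qed

end
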